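(* The bar involution $\bar{\ }:\mathcal Z\to\mathcal Z$, $\boldsymbol\upsilon\mapsto\boldsymbol\upsilon^{-1}$, can be extended to a ring homomorphism $\bar{\ }:\mathcal S(m|n,r)\to\mathcal S(m|n,r)$ defined by (semi)linearly extending $$\overline{\varphi_D}=\sum_{C}r_{C,D}\,\varphi_C\qquad(D\in M(m|n,r)).$$ In particular, there is a unique basis $\{\Theta_D\}_{D\in M(m|n,r)}$ of $\mathcal S(m|n,r)$ satisfying $$\overline{\Theta_D}=\Theta_D,\qquad \Theta_D-\varphi_D\in\sum_{C<D}\boldsymbol\upsilon^{-1}\mathbb Z[\boldsymbol\upsilon^{-1}]\,\varphi_C .$$
   Context: Let $m,n\ge0$ be integers, not both zero, $r\ge1$, $\mathcal Z=\mathbb Z[\boldsymbol\upsilon,\boldsymbol\upsilon^{-1}]$, $\boldsymbol q=\boldsymbol\upsilon^2$. $\mathfrak S_r$ has simple reflections $S$, length $l$, Bruhat order $\le$. $\mathcal H$ is its Hecke algebra over $\mathcal Z$: basis $T_w$, $T_s^2=(\boldsymbol q-1)T_s+\boldsymbol q$, $T_yT_w=T_{yw}$ if $l(yw)=l(y)+l(w)$; bar involution $\bar{\boldsymbol\upsilon}=\boldsymbol\upsilon^{-1}$, $\overline{T_w}=T_{w^{-1}}^{-1}$. $\Lambda(m|n,r)$ is the set of pairs $\lambda|\mu$, $\lambda\in\mathbb N^m,\mu\in\mathbb N^n$, $|\lambda|+|\mu|=r$, identified with the concatenation $\lambda\vee\mu$. For a composition $\nu$ of $r$, $R^\nu_k=\{\nu_1+\dots+\nu_{k-1}+1,\dots,\nu_1+\dots+\nu_k\}$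 and $\mathfrak S_\nu$ is the Young subgroup stabilizing all $R^\nu_k$. $\lambda^*=\lambda\vee(1^{r-|\lambda|})$, ${}^*\mu=(1^{r-|\mu|})\vee\mu$, $\mathfrak S_{\lambda|\mu}:=\mathfrak S_{\lambda\vee\mu}=\mathfrak S_{\lambda^*}\mathfrak S_{{}^*\mu}$; $w_{0,\lambda}$ and $w_{0,\mu}$ denote the longest elements of $\mathfrak S_{\lambda^*}$ and $\mathfrak S_{{}^*\mu}$. $x_\lambda=\sum_{w\in\mathfrak S_{\lambda^*}}T_w$, $y_\mu=\sum_{w\in\mathfrak S_{{}^*\mu}}(-\boldsymbol q)^{-l(w)}T_w$. $\mathcal S(m|n,r)=\mathrm{End}_{\mathcal H}\big(\bigoplus_{\lambda|\mu\in\Lambda(m|n,r)}x_\lambda y_\mu\mathcal H\big)$, $\mathbb Z_2$-graded so that $\mathrm{Hom}_{\mathcal H}(x_\xi y_\eta\mathcal H,x_\lambda y_\mu\mathcal H)$ has degree $|\mu|+|\eta|$ mod $2$, with supermultiplication $\phi\psi=(-1)^{\hat\phi\hat\psi}\phi\circ\psi$ for homogeneous elements of degrees $\hat\phi,\hat\psi$. $\hat i=0$ for $i\le m$, $\hat i=1$ for $m<i\le m+n$; $M(m|n,r)$ is the set of $(m+n)\times(m+n)$ matrices $(a_{ij})$ over $\mathbb N$ with entry sum $r$ and $a_{ij}\in\{0,1\}$ whenever $\hat i+\hat j=1$. $M(m|n,r)_{\lambda|\mu,\xi|\eta}$ is the subset of matrices with row sums $\lambda|\mu$ and column sums $\mathrm{co}=\xi|\eta$;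 such a matrix $D=(a_{ij})$ is identified with the double coset $D=\{w:|R_i^{\lambda\vee\mu}\cap wR_j^{\xi\vee\eta}|=a_{ij}\ \forall i,j\}\in\mathfrak S_{\lambda|\mu}\backslash\mathfrak S_r/\mathfrak S_{\xi|\eta}$. For $C,D\in M(m|n,r)_{\lambda|\mu,\xi|\eta}$, $C\le D$ means that the longest element of $C$ is $\le$ that of $D$ in Bruhat order (only matrices with equal row sums and equal column sums are compared). For $D\in M(m|n,r)_{\lambda|\mu,\xi|\eta}$ let $d$ be the shortest element of $D$, $d^*$ the longest element of $\mathfrak S_{\lambda^*}d\,\mathfrak S_{\xi^*}$, ${}^*d$ the longest element of $\mathfrak S_{{}^*\mu}d\,\mathfrak S_{{}^*\eta}$, and define $\alpha,\beta$ by $\mathfrak S_{\alpha^*}=d^{-1}\mathfrak S_{\lambda^*}d\cap\mathfrak S_{\xi^*}$, $\mathfrak S_{{}^*\beta}=d^{-1}\mathfrak S_{{}^*\mu}d\cap\mathfrak S_{{}^*\eta}$. Put $T_D=\sum_{u,v}(-\boldsymbol q)^{-l(v)}x_\lambda y_\mu T_dT_uT_v$, summed over $u\in\mathfrak S_{\xi^*}$, $v\in\mathfrak S_{{}^*\eta}$ of minimal length in $\mathfrak S_{\alpha^*}u$, $\mathfrak S_{{}^*\beta}v$ respectively, and $$\mathcal T_D=\boldsymbol\upsilon^{-l(d^* )}\boldsymbol\upsilon^{l({}^*d)-l(d)}T_D .$$ In particular $\mathcal T_{\mathfrak S_{\lambda|\mu}}=\boldsymbol\upsilon^{-l(w_{0,\lambda})+l(w_{0,\mu})}x_\lambda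 y_\mu$. The $\mathcal T_D$, $D\in M(m|n,r)_{\lambda|\mu,\xi|\eta}$, form a $\mathcal Z$-basis of $x_\lambda y_\mu\mathcal H\cap\mathcal Hx_\xi y_\eta$, which is stable under the bar involution of $\mathcal H$, and $r_{C,D}\in\mathcal Z$ are defined by $\overline{\mathcal T_D}=\sum_{C\le D}r_{C,D}\mathcal T_C$ ($r_{D,D}=1$). The element $\varphi_D\in\mathcal S(m|n,r)$ is the $\mathcal H$-homomorphism determined by $\varphi_D(\mathcal T_{\mathfrak S_{\alpha'|\beta'}})=\delta_{\mathrm{co}(D),\alpha'|\beta'}\mathcal T_D$ for all $\alpha'|\beta'\in\Lambda(m|n,r)$; the $\varphi_D$ form a $\mathcal Z$-basis of $\mathcal S(m|n,r)$. *)

theory Defs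
  imports
    Complex_Main
    "HOL-Library.Poly_Mapping"
    "HOL-Library.FuncSet"
    "HOL-Combinatorics.Permutations"
    "HOL-Algebra.Module"
begin

section \<open>Laurent polynomials\<close>

text \<open>The convolution ring of finitely supported functions from the additive group of
  integers to the integers is the ring of Laurent polynomials in one variable over the
  integers; \<^term>\<open>Poly_Mapping.single k c\<close> is the monomial with exponent k and
  coefficient c.\<close>

type_synonym laurent = "int \<Rightarrow>\<^sub>0 int"

definition vpow :: "int \<Rightarrow> laurent" where
  "vpow k = Poly_Mapping.single k 1"

definition q_param :: laurent where
  "q_param = vpow 2"

text \<open>The power of -q with exponent -k.\<close>
definition neg_q_inv_pow :: "nat \<Rightarrow> laurent" where
  "neg_q_inv_pow k = (- 1) ^ k * vpow (- 2 * int k)"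

definition laurent_bar :: "laurent \<Rightarrow> laurent" where
  "laurent_bar p = Poly_Mapping.map_key uminus p"

text \<open>Polynomials in the inverse of the variable, without constant term.\<close>
definition neg_laurent :: "laurent set" where
  "neg_laurent = {p. Poly_Mapping.keys p \<subseteq> {..<0}}"


section \<open>The symmetric group\<close>

type_synonym perm = "nat \<Rightarrow> nat"

definition sym :: "nat \<Rightarrow> perm set" where
  "sym r = {w. w permutes {1..r}}"

definition simple_refl :: "nat \<Rightarrow> perm" where
  "simple_refl i = Transposition.transpose i (Suc i)"

definition word_prod :: "nat list \<Rightarrow> perm" where
  "word_prod is = foldr (\<lambda>i w. simple_refl i \<circ> w) is id"

definition len :: "nat \<Rightarrow> perm \<Rightarrow> nat" where
  "len r w = (LEAST k. \<exists>is. length is = k \<and> set is \<subseteq> {1..<r} \<and> word_prod is = w)"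

definition bruhat_le :: "nat \<Rightarrow> perm \<Rightarrow> perm \<Rightarrow> bool" where
  "bruhat_le r = (\<lambda>y w. y \<in> sym r \<and> len r y < len r w \<and>
     (\<exists>i j. 1 \<le> i \<and> i < j \<and> j \<le> r \<and> w = y \<circ> Transposition.transpose i j))\<^sup>*\<^sup>*"

text \<open>The element of minimal, resp. maximal, length; only used for double cosets of parabolic
  subgroups, in which it is unique.\<close>
definition shortest :: "nat \<Rightarrow> perm set \<Rightarrow> perm" where
  "shortest r X = arg_min (len r) (\<lambda>w. w \<in> X)"

definition longest :: "nat \<Rightarrow> perm set \<Rightarrow> perm" where
  "longest r X = arg_max (len r) (\<lambda>w. w \<in> X)"

text \<open>Compositions are lists; parts, rows and columns are numbered from 0, while the symmetric
  group acts on 1, ..., r.\<close>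
definition block :: "nat list \<Rightarrow> nat \<Rightarrow> nat set" where
  "block \<nu> k = {sum_list (take k \<nu>) + 1 .. sum_list (take (Suc k) \<nu>)}"

definition young :: "nat \<Rightarrow> nat list \<Rightarrow> perm set" where
  "young r \<nu> = {w \<in> sym r. \<forall>k<length \<nu>. w ` block \<nu> k = block \<nu> k}"


section \<open>Bicompositions and matrices\<close>

text \<open>A bicomposition is given by its concatenation \<nu>, a list of length m + n; its two
  components are \<^term>\<open>take m \<nu>\<close> and \<^term>\<open>drop m \<nu>\<close>.\<close>
definition bicomps :: "nat \<Rightarrow> nat \<Rightarrow> nat \<Rightarrow> nat list set" where
  "bicomps m n r = {\<nu>. length \<nu> = m + n \<and> sum_list \<nu> = r}"

definition even_young :: "nat \<Rightarrow> nat \<Rightarrow> nat list \<Rightarrow> perm set" where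
  "even_young r m \<nu> = young r (take m \<nu> @ replicate (r - sum_list (take m \<nu>)) 1)"

definition odd_young :: "nat \<Rightarrow> nat \<Rightarrow> nat list \<Rightarrow> perm set" where
  "odd_young r m \<nu> = young r (replicate (r - sum_list (drop m \<nu>)) 1 @ drop m \<nu>)"

definition odd_size :: "nat \<Rightarrow> nat list \<Rightarrow> nat" where
  "odd_size m \<nu> = sum_list (drop m \<nu>)"

type_synonym nmat = "nat \<Rightarrow> nat \<Rightarrow> nat"

text \<open>Matrices of size m + n are functions that vanish outside the index range.\<close>
definition mats :: "nat \<Rightarrow> nat \<Rightarrow> nat \<Rightarrow> nmat set" where
  "mats m n r = {A.
     (\<forall>i j. m + n \<le> i \<or> m + n \<le> j \<longrightarrow> A i j = 0) \<and>
     (\<Sum>i<m + n. \<Sum>j<m + n. A i j) = r \<and>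
     (\<forall>i<m + n. \<forall>j<m + n. (i < m) \<noteq> (j < m) \<longrightarrow> A i j \<in> {0, 1})}"

definition row_sums :: "nat \<Rightarrow> nat \<Rightarrow> nmat \<Rightarrow> nat list" where
  "row_sums m n A = map (\<lambda>i. \<Sum>j<m + n. A i j) [0..<m + n]"

definition col_sums :: "nat \<Rightarrow> nat \<Rightarrow> nmat \<Rightarrow> nat list" where
  "col_sums m n A = map (\<lambda>j. \<Sum>i<m + n. A i j) [0..<m + n]"

definition dcoset :: "nat \<Rightarrow> nat \<Rightarrow> nat \<Rightarrow> nmat \<Rightarrow> perm set" where
  "dcoset m n r A = {w \<in> sym r. \<forall>i<m + n. \<forall>j<m + n.
     card (block (row_sums m n A) i \<inter> w ` block (col_sums m n A) j) = A i j}"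

definition mat_le :: "nat \<Rightarrow> nat \<Rightarrow> nat \<Rightarrow> nmat \<Rightarrow> nmat \<Rightarrow> bool" where
  "mat_le m n r C D \<longleftrightarrow> row_sums m n C = row_sums m n D \<and> col_sums m n C = col_sums m n D \<and>
     bruhat_le r (longest r (dcoset m n r C)) (longest r (dcoset m n r D))"

text \<open>The diagonal matrix with diagonal \<nu> corresponds to the Young subgroup of \<nu>, as a
  double coset.\<close>
definition diag_mat :: "nat list \<Rightarrow> nmat" where
  "diag_mat \<nu> i j = (if i = j \<and> i < length \<nu> then \<nu> ! i else 0)"

definition dmin :: "nat \<Rightarrow> nat \<Rightarrow> nat \<Rightarrow> nmat \<Rightarrow> perm" where
  "dmin m n r D = shortest r (dcoset m n r D)"

definition even_dmax :: "nat \<Rightarrow> nat \<Rightarrow> nat \<Rightarrow> nmat \<Rightarrow> perm" where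
  "even_dmax m n r D = longest r {a \<circ> dmin m n r D \<circ> b | a b.
     a \<in> even_young r m (row_sums m n D) \<and> b \<in> even_young r m (col_sums m n D)}"

definition odd_dmax :: "nat \<Rightarrow> nat \<Rightarrow> nat \<Rightarrow> nmat \<Rightarrow> perm" where
  "odd_dmax m n r D = longest r {a \<circ> dmin m n r D \<circ> b | a b.
     a \<in> odd_young r m (row_sums m n D) \<and> b \<in> odd_young r m (col_sums m n D)}"

definition conj_inter :: "perm \<Rightarrow> perm set \<Rightarrow> perm set \<Rightarrow> perm set" where
  "conj_inter d X Y = {inv_into UNIV d \<circ> w \<circ> d | w. w \<in> X} \<inter> Y"

text \<open>The elements u of Y that are of minimal length in their coset Pu.\<close>
definition min_right_reps :: "nat \<Rightarrow> perm set \<Rightarrow> perm set \<Rightarrow> perm set" where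
  "min_right_reps r P Y = {u \<in> Y. \<forall>p\<in>P. len r u \<le> len r (p \<circ> u)}"

definition even_reps :: "nat \<Rightarrow> nat \<Rightarrow> nat \<Rightarrow> nmat \<Rightarrow> perm set" where
  "even_reps m n r D = min_right_reps r
     (conj_inter (dmin m n r D) (even_young r m (row_sums m n D)) (even_young r m (col_sums m n D)))
     (even_young r m (col_sums m n D))"

definition odd_reps :: "nat \<Rightarrow> nat \<Rightarrow> nat \<Rightarrow> nmat \<Rightarrow> perm set" where
  "odd_reps m n r D = min_right_reps r
     (conj_inter (dmin m n r D) (odd_young r m (row_sums m n D)) (odd_young r m (col_sums m n D)))
     (odd_young r m (col_sums m n D))"


section \<open>Bases of free modules\<close>

text \<open>The family b, indexed by the finite set I, is a basis of the module S.\<close>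
definition is_basis :: "('z::zero, 'e) module \<Rightarrow> 'i set \<Rightarrow> ('i \<Rightarrow> 'e) \<Rightarrow> bool" where
  "is_basis S I b \<longleftrightarrow> (\<forall>i\<in>I. b i \<in> carrier S) \<and>
     (\<forall>x\<in>carrier S. \<exists>!c. (\<forall>i. i \<notin> I \<longrightarrow> c i = 0) \<and> x = (\<Oplus>\<^bsub>S\<^esub>i\<in>I. c i \<odot>\<^bsub>S\<^esub> b i))"


section \<open>The Hecke algebra and the quantum Schur superalgebra\<close>

text \<open>The ring \<open>'h\<close>, with scalar multiplication scl and basis T, is the Hecke algebra of the
  symmetric group on r letters. The relations and the basis determine it up to a unique
  isomorphism preserving T; T_id = 1 is a consequence.\<close>
locale hecke_algebra = Modules.module scl
  for scl :: "laurent \<Rightarrow> 'h::ring_1 \<Rightarrow> 'h" +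
  fixes r :: nat and T :: "perm \<Rightarrow> 'h"
  assumes scl_mult_left: "scl c (a * b) = scl c a * b"
    and scl_mult_right: "scl c (a * b) = a * scl c b"
    and T_basis: "\<exists>!c. (\<forall>w. w \<notin> sym r \<longrightarrow> c w = 0) \<and> h = (\<Sum>w\<in>sym r. scl (c w) (T w))"
    and T_quadratic: "i \<in> {1..<r} \<Longrightarrow> T (simple_refl i) * T (simple_refl i) =
      scl (q_param - 1) (T (simple_refl i)) + scl q_param 1"
    and T_mult: "y \<in> sym r \<Longrightarrow> w \<in> sym r \<Longrightarrow> len r (y \<circ> w) = len r y + len r w \<Longrightarrow>
      T y * T w = T (y \<circ> w)"
begin

definition T_coeff :: "'h \<Rightarrow> perm \<Rightarrow> laurent" where
  "T_coeff h = (THE c. (\<forall>w. w \<notin> sym r \<longrightarrow> c w = 0) \<and> h = (\<Sum>w\<in>sym r. scl (c w) (T w)))"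

definition hecke_inv :: "'h \<Rightarrow> 'h" where
  "hecke_inv a = (THE b. a * b = 1 \<and> b * a = 1)"

definition hecke_bar :: "'h \<Rightarrow> 'h" where
  "hecke_bar h = (\<Sum>w\<in>sym r. scl (laurent_bar (T_coeff h w)) (hecke_inv (T (inv_into UNIV w))))"

definition x_elt :: "nat \<Rightarrow> nat list \<Rightarrow> 'h" where
  "x_elt m \<nu> = (\<Sum>w\<in>even_young r m \<nu>. T w)"

definition y_elt :: "nat \<Rightarrow> nat list \<Rightarrow> 'h" where
  "y_elt m \<nu> = (\<Sum>w\<in>odd_young r m \<nu>. scl (neg_q_inv_pow (len r w)) (T w))"

definition T_mat :: "nat \<Rightarrow> nat \<Rightarrow> nmat \<Rightarrow> 'h" where
  "T_mat m n D = (\<Sum>u\<in>even_reps m n r D. \<Sum>v\<in>odd_reps m n r D.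
     scl (neg_q_inv_pow (len r v))
       (x_elt m (row_sums m n D) * y_elt m (row_sums m n D) * T (dmin m n r D) * T u * T v))"

definition T_cal :: "nat \<Rightarrow> nat \<Rightarrow> nmat \<Rightarrow> 'h" where
  "T_cal m n D =
     scl (vpow (- int (len r (even_dmax m n r D))) *
          vpow (int (len r (odd_dmax m n r D)) - int (len r (dmin m n r D))))
       (T_mat m n D)"

definition bar_row :: "nat \<Rightarrow> nat \<Rightarrow> nmat \<Rightarrow> nmat \<Rightarrow> laurent" where
  "bar_row m n D = (THE c.
     (\<forall>C. \<not> (C \<in> mats m n r \<and> mat_le m n r C D) \<longrightarrow> c C = 0) \<and>
     hecke_bar (T_cal m n D) =
       (\<Sum>C | C \<in> mats m n r \<and> mat_le m n r C D. scl (c C) (T_cal m n C)))"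

text \<open>The coefficient of C in the bar of D; it is 0 unless C is below D.\<close>
definition bar_coeff :: "nat \<Rightarrow> nat \<Rightarrow> nmat \<Rightarrow> nmat \<Rightarrow> laurent" where
  "bar_coeff m n C D = bar_row m n D C"

text \<open>The direct sum of the right modules x y H, as families indexed by the bicompositions and
  extended by 0.\<close>
definition dsum :: "nat \<Rightarrow> nat \<Rightarrow> (nat list \<Rightarrow> 'h) set" where
  "dsum m n = {f.
     (\<forall>\<nu>\<in>bicomps m n r. f \<nu> \<in> {x_elt m \<nu> * y_elt m \<nu> * h | h. True}) \<and>
     (\<forall>\<nu>. \<nu> \<notin> bicomps m n r \<longrightarrow> f \<nu> = 0)}"

definition incl :: "nat list \<Rightarrow> 'h \<Rightarrow> nat list \<Rightarrow> 'h" where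
  "incl \<nu> h = (\<lambda>\<xi>. if \<xi> = \<nu> then h else 0)"

text \<open>Right H-linear endomorphisms of the direct sum, \<^term>\<open>undefined\<close> outside of it.
  Linearity over the Laurent polynomials follows, as these are central in H.\<close>
definition endos :: "nat \<Rightarrow> nat \<Rightarrow> ((nat list \<Rightarrow> 'h) \<Rightarrow> (nat list \<Rightarrow> 'h)) set" where
  "endos m n = {\<phi> \<in> dsum m n \<rightarrow>\<^sub>E dsum m n.
     (\<forall>f\<in>dsum m n. \<forall>g\<in>dsum m n. \<phi> (\<lambda>\<nu>. f \<nu> + g \<nu>) = (\<lambda>\<nu>. \<phi> f \<nu> + \<phi> g \<nu>)) \<and>
     (\<forall>f\<in>dsum m n. \<forall>h. \<phi> (\<lambda>\<nu>. f \<nu> * h) = (\<lambda>\<nu>. \<phi> f \<nu> * h))}"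

text \<open>The homogeneous component of degree a: the sum of those blocks of \<phi>, from the summand of
  index \<xi> to the one of index \<nu>, for which the odd sizes of \<xi> and \<nu> add up to a modulo 2.\<close>
definition hom_part ::
  "nat \<Rightarrow> nat \<Rightarrow> nat \<Rightarrow> ((nat list \<Rightarrow> 'h) \<Rightarrow> (nat list \<Rightarrow> 'h)) \<Rightarrow>
    (nat list \<Rightarrow> 'h) \<Rightarrow> (nat list \<Rightarrow> 'h)" where
  "hom_part m n a \<phi> = (\<lambda>f\<in>dsum m n. \<lambda>\<nu>.
     \<phi> (\<lambda>\<xi>. if (odd_size m \<nu> + odd_size m \<xi>) mod 2 = a then f \<xi> else 0) \<nu>)"

text \<open>The supermultiplication is the biadditive extension of its values on homogeneous
  elements.\<close>
definition schur_superalgebra ::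
  "nat \<Rightarrow> nat \<Rightarrow> (laurent, (nat list \<Rightarrow> 'h) \<Rightarrow> (nat list \<Rightarrow> 'h)) module" where
  "schur_superalgebra m n = \<lparr>
     carrier = endos m n,
     mult = (\<lambda>\<phi> \<psi>. \<lambda>f\<in>dsum m n. \<lambda>\<nu>.
       \<Sum>a<2. \<Sum>b<2. (- 1) ^ (a * b) * hom_part m n a \<phi> (hom_part m n b \<psi> f) \<nu>),
     one = (\<lambda>f\<in>dsum m n. f),
     zero = (\<lambda>f\<in>dsum m n. \<lambda>\<nu>. 0),
     add = (\<lambda>\<phi> \<psi>. \<lambda>f\<in>dsum m n. \<lambda>\<nu>. \<phi> f \<nu> + \<psi> f \<nu>),
     smult = (\<lambda>c \<phi>. \<lambda>f\<in>dsum m n. \<lambda>\<nu>. scl c (\<phi> f \<nu>))\<rparr>"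

definition phi :: "nat \<Rightarrow> nat \<Rightarrow> nmat \<Rightarrow> (nat list \<Rightarrow> 'h) \<Rightarrow> (nat list \<Rightarrow> 'h)" where
  "phi m n D = (THE \<phi>. \<phi> \<in> carrier (schur_superalgebra m n) \<and>
     (\<forall>\<nu>\<in>bicomps m n r. \<phi> (incl \<nu> (T_cal m n (diag_mat \<nu>))) =
       (if col_sums m n D = \<nu> then incl (row_sums m n D) (T_cal m n D) else (\<lambda>_. 0))))"

end

end

theory Submission
  imports Defs
begin

text \<open>The length of a permutation is its number of inversions, so that everything about double cosets
  can be read off from inversions. An element of \<open>x y H \<inter> H x' y'\<close> is the same as an
  element of H that is an eigenvector of the even generators (eigenvalue q) and of the odd ones
  (eigenvalue -1) on both sides; its coefficients on a double coset are determined by one of them,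
  and vanish if the matrix has a mixed entry above 1. Hence \<open>T_D\<close> is the sum over w in D of
  \<open>(-1/q)^o(w) T_w\<close>, where o(w) counts the inversions of w within a common odd block of rows or columns,
  and the \<open>T_D\<close> form a basis of these eigenspaces. The eigenspaces are stable under the bar involution
  of H, and the triangularity of the latter for the Bruhat order, applied at the longest element of D,
  gives the triangularity of the matrix r with diagonal 1.

  An endomorphism \<phi> has a bar conjugate, mapping f to the bar of \<open>\<phi>(bar f)\<close>. This is a
  semilinear ring homomorphism; since the bar involution fixes the generators \<open>v^k x y\<close> of the summands,
  it sends \<open>\<phi>_D\<close> to the element prescribed. The canonical basis exists by the usual argument: a vector
  antisymmetric under a unitriangular semilinear involution J is \<open>y - J y\<close> for a unique y with
  coefficients in negative powers.\<close>

section \<open>Length and Bruhat order of the symmetric group\<close>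

text \<open>The defining sum of T_D shows neither why its span is stable under bar nor why r_{D,D} =
  1. The eigenvector description answers the former: bar turns T_s z = c z into T_s^{-1} bar(z) =
  bar(c) bar(z), and both eigenvalues c = q and c = -1 satisfy bar(c) = c^{-1}. The latter rests on
  the normalising power of v. Let z be the longest element of D, l its length and o = o(z). The
  power turns out to be v^(2o - l), and T_D has the coefficient (-1/q)^o at T_z; so the normalised
  T_D has the coefficient (-1)^o v^(-l) there. Bar preserves this value, because the coefficient of
  T_z in bar(T_z) is v^(-2l). The same unit serves as the leading coefficient from which coordinates
  are read off. The obstacle is to evaluate the power: the lengths of three different extremal
  elements must be expressed by the numbers of even and of odd block inversions of z. These two
  numbers add up correctly only because a mixed cell contains at most one point, so that two points
  in a common cell have a row and a column of the same parity.\<close>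

abbreviation pinv :: "perm \<Rightarrow> perm" where "pinv w \<equiv> inv_into UNIV w"

section \<open>Permutations of 1, ..., r and simple reflections\<close>

lemma sym_comp [intro]: "u \<in> sym r \<Longrightarrow> w \<in> sym r \<Longrightarrow> u \<circ> w \<in> sym r"
  by (simp add: sym_def permutes_compose)

lemma sym_pinv [intro]: "w \<in> sym r \<Longrightarrow> pinv w \<in> sym r"
  by (simp add: sym_def permutes_inv)

lemma sym_id [simp, intro]: "id \<in> sym r"
  by (simp add: sym_def permutes_id)

lemma finite_sym [simp, intro]: "finite (sym r)"
  by (simp add: sym_def finite_permutations)

lemma sym_pinv_apply [simp]: "w \<in> sym r \<Longrightarrow> pinv w (w x) = x"
  by (simp add: sym_def permutes_inverses)

lemma sym_apply_pinv [simp]: "w \<in> sym r \<Longrightarrow> w (pinv w x) = x"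
  by (simp add: sym_def permutes_inverses)

lemma sym_pinv_pinv [simp]: "w \<in> sym r \<Longrightarrow> pinv (pinv w) = w"
  by (simp add: sym_def permutes_inv_inv)

lemma sym_pinv_comp [simp]: "w \<in> sym r \<Longrightarrow> pinv w \<circ> w = id" "w \<in> sym r \<Longrightarrow> w \<circ> pinv w = id"
  by (auto simp: fun_eq_iff)

lemma sym_comp_pinv: "u \<in> sym r \<Longrightarrow> w \<in> sym r \<Longrightarrow> pinv (u \<circ> w) = pinv w \<circ> pinv u"
  by (metis permutes_bij o_inv_distrib sym_def mem_Collect_eq)

lemma sym_mem [simp]: "w \<in> sym r \<Longrightarrow> w x \<in> {Suc 0..r} \<longleftrightarrow> x \<in> {Suc 0..r}"
  by (metis One_nat_def permutes_in_image sym_def mem_Collect_eq)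

lemma sym_mem' [simp]: "w \<in> sym r \<Longrightarrow> (Suc 0 \<le> w x \<and> w x \<le> r) \<longleftrightarrow> Suc 0 \<le> x \<and> x \<le> r"
  using sym_mem by auto

lemma sym_inj [simp]: "w \<in> sym r \<Longrightarrow> w x = w y \<longleftrightarrow> x = y"
  by (metis sym_pinv_apply)

lemma sym_outside: "w \<in> sym r \<Longrightarrow> x \<notin> {1..r} \<Longrightarrow> w x = x"
  by (auto simp: sym_def permutes_def)

lemma sym_eqI: "u \<in> sym r \<Longrightarrow> w \<in> sym r \<Longrightarrow> (\<And>x. x \<in> {1..r} \<Longrightarrow> u x = w x) \<Longrightarrow> u = w"
  by (metis ext sym_outside)

lemma transpose_sym [intro]: "i \<in> {1..r} \<Longrightarrow> j \<in> {1..r} \<Longrightarrow> Transposition.transpose i j \<in> sym r"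
  by (simp add: sym_def permutes_swap_id)

lemma simple_refl_sym [simp, intro]: "k \<in> {1..<r} \<Longrightarrow> simple_refl k \<in> sym r"
  unfolding simple_refl_def by (rule transpose_sym) auto

lemma simple_refl_simps [simp]:
  "simple_refl k k = Suc k" "simple_refl k (Suc k) = k"
  "x \<noteq> k \<Longrightarrow> x \<noteq> Suc k \<Longrightarrow> simple_refl k x = x"
  "simple_refl k (simple_refl k x) = x"
  "pinv (simple_refl k) = simple_refl k"
  "simple_refl k \<circ> (simple_refl k \<circ> w) = w"
  "simple_refl k \<circ> simple_refl k = id"
  "w \<circ> simple_refl k \<circ> simple_refl k = w"
  by (simp_all add: simple_refl_def fun_eq_iff)

text \<open>\<open>k\<close> and \<open>Suc k\<close> are neighbours, so exchanging them leaves the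
  order of every other pair intact.\<close>

lemma simple_refl_less:
  "i < j \<Longrightarrow> (i, j) \<noteq> (k, Suc k) \<Longrightarrow> simple_refl k i < simple_refl k j"
  by (cases "i = k \<or> i = Suc k"; cases "j = k \<or> j = Suc k") auto

lemma pinv_simple_left: "w \<in> sym r \<Longrightarrow> k \<in> {1..<r} \<Longrightarrow> pinv (simple_refl k \<circ> w) = pinv w \<circ> simple_refl k"
  by (simp add: sym_comp_pinv[of _ r])

lemma simple_left_sym [intro]: "w \<in> sym r \<Longrightarrow> k \<in> {1..<r} \<Longrightarrow> simple_refl k \<circ> w \<in> sym r"
  by (intro sym_comp) auto

lemma simple_right_sym [intro]: "w \<in> sym r \<Longrightarrow> k \<in> {1..<r} \<Longrightarrow> w \<circ> simple_refl k \<in> sym r"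
  by (intro sym_comp) auto

section \<open>Inversions\<close>

definition inversions :: "nat \<Rightarrow> perm \<Rightarrow> (nat \<times> nat) set" where
  "inversions r w = {(i, j). 1 \<le> i \<and> i < j \<and> j \<le> r \<and> w j < w i}"

lemma finite_inversions [simp, intro]: "finite (inversions r w)"
  by (rule finite_subset[of _ "{1..r} \<times> {1..r}"]) (auto simp: inversions_def)

lemma inversions_id [simp]: "inversions r id = {}" "inversions r (\<lambda>a. a) = {}"
  by (auto simp: inversions_def)

text \<open>Applying the reflection to both positions carries inversions of w to inversions of the
  product, because only the pair \<open>(k, Suc k)\<close> has its order reversed, and this pair is
  an ascent of w. The pair itself is the single new inversion.\<close>

lemma inversions_simple_right:
  assumes "w \<in> sym r" "k \<in> {1..<r}" "w k < w (Suc k)"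
  shows "inversions r (w \<circ> simple_refl k) =
    insert (k, Suc k) (map_prod (simple_refl k) (simple_refl k) ` inversions r w)" (is "?L = ?R")
proof (intro equalityI subsetI)
  have s: "simple_refl k \<in> sym r" using assms by auto
  fix x assume "x \<in> ?L"
  then obtain i j where x: "x = (i, j)" "1 \<le> i" "i < j" "j \<le> r"
      "w (simple_refl k j) < w (simple_refl k i)"
    by (auto simp: inversions_def)
  show "x \<in> ?R"
  proof (cases "(i, j) = (k, Suc k)")
    case False
    have "simple_refl k i < simple_refl k j" using x False by (intro simple_refl_less)
    moreover have "simple_refl k i \<in> {Suc 0..r}" "simple_refl k j \<in> {Suc 0..r}"
      using s x by (subst sym_mem, auto)+
    ultimately have "(simple_refl k i, simple_refl k j) \<in> inversions r w"
      using x by (auto simp: inversions_def)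
    then have "map_prod (simple_refl k) (simple_refl k) (simple_refl k i, simple_refl k j) \<in> ?R"
      by blast
    then show ?thesis using x by simp
  qed (use x in auto)
next
  have s: "simple_refl k \<in> sym r" using assms by auto
  fix x assume "x \<in> ?R"
  then consider "x = (k, Suc k)" | i j where "x = (simple_refl k i, simple_refl k j)" "(i, j) \<in> inversions r w"
    by auto
  then show "x \<in> ?L"
  proof cases
    case 1
    then show ?thesis using assms by (auto simp: inversions_def)
  next
    case 2
    have ij: "1 \<le> i" "i < j" "j \<le> r" "w j < w i" using 2 by (auto simp: inversions_def)
    have "simple_refl k i < simple_refl k j"
      using ij assms by (intro simple_refl_less) auto
    moreover have "simple_refl k i \<in> {Suc 0..r}" "simple_refl k j \<in> {Suc 0..r}"
      using s ij by (subst sym_mem, auto)+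
    ultimately show ?thesis using 2 ij by (auto simp: inversions_def)
  qed
qed

lemma card_inversions_simple_right:
  assumes "w \<in> sym r" "k \<in> {1..<r}" "w k < w (Suc k)"
  shows "card (inversions r (w \<circ> simple_refl k)) = Suc (card (inversions r w))"
proof -
  have "inj (simple_refl k)" by (metis injI simple_refl_simps(4))
  then have inj: "inj (map_prod (simple_refl k) (simple_refl k))" by (simp add: prod.inj_map)
  have "(k, Suc k) \<notin> map_prod (simple_refl k) (simple_refl k) ` inversions r w"
  proof
    assume "(k, Suc k) \<in> map_prod (simple_refl k) (simple_refl k) ` inversions r w"
    then obtain i j where "k = simple_refl k i" "Suc k = simple_refl k j" "i < j"
      by (auto simp: inversions_def)
    then show False by (metis simple_refl_simps(1,2,4) not_less_iff_gr_or_eq lessI)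
  qed
  then show ?thesis
    by (simp add: inversions_simple_right[OF assms] card_image[OF inj_on_subset[OF inj]])
qed

text \<open>An inversion \<open>(i, j)\<close> of w becomes the inversion \<open>(w j, w i)\<close>
  of the inverse; the exchange of the two entries restores increasing order. Right-hand statements
  on lengths thus yield left-hand ones.\<close>

lemma card_inversions_pinv:
  assumes "w \<in> sym r" shows "card (inversions r (pinv w)) = card (inversions r w)"
proof (rule bij_betw_same_card)
  have r: "v i \<in> {1..r} \<longleftrightarrow> i \<in> {1..r}" if "v \<in> sym r" for v i
    using sym_mem[OF that, of i] by simp
  have sub: "(\<lambda>(i, j). (v j, v i)) ` inversions r v \<subseteq> inversions r (pinv v)" if v: "v \<in> sym r" for v
  proof (rule image_subsetI, simp only: split_paired_all)
    fix i j assume "(i, j) \<in> inversions r v"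
    then have ij: "i \<in> {1..r}" "j \<in> {1..r}" "i < j" "v j < v i" by (auto simp: inversions_def)
    then have "v i \<in> {1..r}" "v j \<in> {1..r}" using r[OF v] by blast+
    then show "(case (i, j) of (i, j) \<Rightarrow> (v j, v i)) \<in> inversions r (pinv v)"
      using ij v by (simp add: inversions_def)
  qed
  show "bij_betw (\<lambda>(i, j). (pinv w j, pinv w i)) (inversions r (pinv w)) (inversions r w)"
    using sub[OF assms] sub[OF sym_pinv[OF assms]] assms
    by (intro bij_betw_byWitness[where f' = "\<lambda>(i, j). (w j, w i)"]) auto
qed

lemma card_inversions_simple_left:
  assumes "w \<in> sym r" "k \<in> {1..<r}" "pinv w k < pinv w (Suc k)"
  shows "card (inversions r (simple_refl k \<circ> w)) = Suc (card (inversions r w))"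
proof -
  have "card (inversions r (simple_refl k \<circ> w)) = card (inversions r (pinv w \<circ> simple_refl k))"
    using card_inversions_pinv[OF simple_left_sym[OF assms(1,2)]] pinv_simple_left[OF assms(1,2)] by simp
  also have "\<dots> = Suc (card (inversions r (pinv w)))"
    using assms by (intro card_inversions_simple_right) auto
  finally show ?thesis using card_inversions_pinv assms by simp
qed

text \<open>The codomain is an arbitrary order, so that decreasing sequences are covered as well,
  after negation in the integers.\<close>

lemma less_by_steps:
  fixes h :: "nat \<Rightarrow> 'a::order"
  assumes "a < b" "\<And>k. a \<le> k \<Longrightarrow> k < b \<Longrightarrow> h k < h (Suc k)"
  shows "h a < h b"
  using assms
proof (induction "b - a" arbitrary: b)
  case (Suc d)
  show ?case
  proof (cases "b = Suc a")
    case False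
    then obtain b' where b': "b = Suc b'" "a < b'" using Suc by (cases b) auto
    then have "h a < h b'" using Suc by (intro Suc(1)) auto
    also have "\<dots> < h b" using Suc b' by auto
    finally show ?thesis .
  qed (use Suc in auto)
qed auto

text \<open>An everywhere ascending w satisfies \<open>k \<le> w k\<close> by induction from the
  left end, and \<open>w k \<le> k\<close> by induction from the right end.\<close>

lemma sym_ascending_id:
  assumes "w \<in> sym r" "\<And>k. k \<in> {1..<r} \<Longrightarrow> w k < w (Suc k)"
  shows "w = id"
proof (rule sym_eqI[OF assms(1) sym_id])
  have ge: "k \<le> w k" if "k \<in> {1..r}" for k
    using that
  proof (induction k)
    case (Suc k)
    show ?case
    proof (cases "k = 0")
      case True
      then show ?thesis using sym_mem[OF assms(1), of 1] Suc by auto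
    next
      case False
      then have "k \<le> w k" using Suc by auto
      also have "w k < w (Suc k)" using assms(2) False Suc by auto
      finally show ?thesis by simp
    qed
  qed auto
  have le: "w k \<le> k" if "k \<in> {1..r}" for k
    using that
  proof (induction "r - k" arbitrary: k)
    case 0
    then show ?case using sym_mem[OF assms(1), of k] by auto
  next
    case (Suc d)
    then have "w (Suc k) \<le> Suc k" by auto
    moreover have "w k < w (Suc k)" using Suc assms(2) by auto
    ultimately show ?case by simp
  qed
  show "w x = id x" if "x \<in> {1..r}" for x using ge[OF that] le[OF that] by simp
qed

lemma sym_descent:
  assumes "w \<in> sym r" "w \<noteq> id"
  obtains k where "k \<in> {1..<r}" "w (Suc k) < w k"
proof -
  obtain k where "k \<in> {1..<r}" "\<not> w k < w (Suc k)" using sym_ascending_id assms by blast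
  then show ?thesis using that assms by (metis linorder_neqE_nat sym_inj n_not_Suc_n)
qed

lemma pinv_id [simp]: "pinv id = id"
  by (metis inv_id)

lemma sym_left_descent:
  assumes "w \<in> sym r" "w \<noteq> id"
  obtains k where "k \<in> {1..<r}" "pinv w (Suc k) < pinv w k"
proof -
  have "pinv w \<noteq> id" using assms by (metis sym_pinv_pinv pinv_id)
  then show ?thesis using sym_descent[OF sym_pinv[OF assms(1)]] that by blast
qed

text \<open>Left descents are peeled off until none is left, the number of inversions being the
  measure. Each step of the rule is lengthening, which is the situation in which T is
  multiplicative.\<close>

lemma sym_simple_induct [consumes 1, case_names id step]:
  assumes "w \<in> sym r" "Q id"
    and step: "\<And>w k. w \<in> sym r \<Longrightarrow> k \<in> {1..<r} \<Longrightarrow> pinv w k < pinv w (Suc k) \<Longrightarrow> Q w \<Longrightarrow> Q (simple_refl k \<circ> w)"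
  shows "Q w"
  using assms(1)
proof (induction "card (inversions r w)" arbitrary: w rule: less_induct)
  case less
  show ?case
  proof (cases "w = id")
    case False
    then obtain k where k: "k \<in> {1..<r}" "pinv w (Suc k) < pinv w k"
      using sym_left_descent less by blast
    define w' where "w' = simple_refl k \<circ> w"
    have w': "w' \<in> sym r" "pinv w' k < pinv w' (Suc k)" "w = simple_refl k \<circ> w'"
      using k less by (auto simp: w'_def pinv_simple_left)
    then have "card (inversions r w) = Suc (card (inversions r w'))"
      using card_inversions_simple_left k by auto
    then have "Q w'" using less w' by auto
    then show ?thesis using step w' k by auto
  qed (use assms in auto)
qed

section \<open>Words in simple reflections and the length\<close>

lemma word_prod_Cons: "word_prod (k # ks) = simple_refl k \<circ> word_prod ks"
  by (simp add: word_prod_def)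

lemma word_prod_Nil: "word_prod [] = id"
  by (simp add: word_prod_def)

lemma word_prod_sym: "set ks \<subseteq> {1..<r} \<Longrightarrow> word_prod ks \<in> sym r"
  by (induction ks) (auto simp: word_prod_Nil word_prod_Cons)

text \<open>Each letter changes the number of inversions by exactly one, upwards or
  downwards.\<close>

lemma card_inversions_word: "set ks \<subseteq> {1..<r} \<Longrightarrow> card (inversions r (word_prod ks)) \<le> length ks"
proof (induction ks)
  case Nil
  show ?case unfolding word_prod_Nil by simp
next
  case (Cons k ks)
  define w where "w = word_prod ks"
  have w: "w \<in> sym r" "k \<in> {1..<r}" using Cons word_prod_sym[of ks r] by (auto simp: w_def)
  have *: "word_prod (k # ks) = simple_refl k \<circ> w" by (simp only: word_prod_Cons w_def)
  have IH: "card (inversions r w) \<le> length ks" using Cons by (simp add: w_def)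
  have "card (inversions r (simple_refl k \<circ> w)) \<le> Suc (length ks)"
  proof (cases "pinv w k < pinv w (Suc k)")
    case True
    then show ?thesis using card_inversions_simple_left[OF w True] IH by simp
  next
    case False
    then have "pinv w (Suc k) < pinv w k"
      using sym_inj[OF sym_pinv[OF w(1)], of k "Suc k"] by linarith
    then have "card (inversions r w) = Suc (card (inversions r (simple_refl k \<circ> w)))"
      using card_inversions_simple_left[OF simple_left_sym[OF w] w(2)] w by (simp add: pinv_simple_left)
    then show ?thesis using IH by simp
  qed
  then show ?case by (simp only: * length_Cons)
qed

text \<open>No word can be shorter, by \<open>card_inversions_word\<close>, and the induction that
  only lengthens produces a word with exactly this number of letters.\<close>

lemma len_eq_card_inversions:
  assumes "w \<in> sym r" shows "len r w = card (inversions r w)"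
  unfolding len_def
proof (rule Least_equality)
  show "\<exists>ks. length ks = card (inversions r w) \<and> set ks \<subseteq> {1..<r} \<and> word_prod ks = w"
    using assms
  proof (induction rule: sym_simple_induct)
    case id
    show ?case by (intro exI[of _ "[]"]) (simp add: word_prod_Nil)
  next
    case (step w k)
    then obtain ks where ks: "length ks = card (inversions r w)" "set ks \<subseteq> {1..<r}" "word_prod ks = w" by blast
    moreover have "card (inversions r (simple_refl k \<circ> w)) = Suc (card (inversions r w))"
      using step by (intro card_inversions_simple_left)
    moreover have "word_prod (k # ks) = simple_refl k \<circ> w" by (simp only: word_prod_Cons ks)
    moreover have "set (k # ks) \<subseteq> {1..<r}" "length (k # ks) = Suc (card (inversions r w))"
      using step ks by auto
    ultimately have "length (k # ks) = card (inversions r (simple_refl k \<circ> w)) \<and>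
        set (k # ks) \<subseteq> {1..<r} \<and> word_prod (k # ks) = simple_refl k \<circ> w"
      by (simp only:)
    then show ?case by (rule exI)
  qed
qed (use card_inversions_word in blast)

lemma len_simple_left:
  assumes "w \<in> sym r" "k \<in> {1..<r}" "pinv w k < pinv w (Suc k)"
  shows "len r (simple_refl k \<circ> w) = Suc (len r w)"
  using card_inversions_simple_left[OF assms] assms
  by (simp add: len_eq_card_inversions simple_left_sym)

lemma len_simple_right:
  assumes "w \<in> sym r" "k \<in> {1..<r}" "w k < w (Suc k)"
  shows "len r (w \<circ> simple_refl k) = Suc (len r w)"
  using card_inversions_simple_right[OF assms] assms
  by (simp add: len_eq_card_inversions simple_right_sym)

lemma len_pinv: "w \<in> sym r \<Longrightarrow> len r (pinv w) = len r w"
  by (simp add: len_eq_card_inversions sym_pinv card_inversions_pinv)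

lemma len_id [simp]: "len r id = 0"
  by (simp add: len_eq_card_inversions)

lemma len_simple [simp]: "k \<in> {1..<r} \<Longrightarrow> len r (simple_refl k) = 1"
  using len_simple_right[of id r k] by auto

lemma sym_neq_Suc: "w \<in> sym r \<Longrightarrow> \<not> w k < w (Suc k) \<longleftrightarrow> w (Suc k) < w k"
  by (metis linorder_neqE_nat not_less_iff_gr_or_eq sym_inj n_not_Suc_n)

lemma pinv_neq_Suc: "w \<in> sym r \<Longrightarrow> \<not> pinv w k < pinv w (Suc k) \<longleftrightarrow> pinv w (Suc k) < pinv w k"
  by (meson sym_neq_Suc sym_pinv)

section \<open>Transpositions and the Bruhat order\<close>

lemma len_transpose_less:
  assumes w: "w \<in> sym r" and ij: "1 \<le> i" "i < j" "j \<le> r" "w i < w j"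
  shows "len r w < len r (w \<circ> Transposition.transpose i j)"
proof -
  let ?t = "Transposition.transpose i j"
  have t: "?t \<in> sym r" using ij by (intro transpose_sym) auto
  \<comment> \<open>F embeds the inversions of w into those of the product: a pair is moved by the
    transposition when its order survives, and is kept otherwise. A kept pair has i or j as one
    entry and a position between them as the other, and remains an inversion because
    \<open>w i < w j\<close>. The pair \<open>(i, j)\<close> is never hit.\<close>
  define F where "F = (\<lambda>(a, b). if ?t a < ?t b then (?t a, ?t b) else (a, b))"
  have inj: "inj_on F (inversions r w)"
  proof (rule inj_onI, clarify)
    fix a b c d assume "(a, b) \<in> inversions r w" "(c, d) \<in> inversions r w" "F (a, b) = F (c, d)"
    moreover have "?t x = ?t y \<longleftrightarrow> x = y" for x y by (rule sym_inj[OF t])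
    ultimately show "a = c \<and> b = d"
      unfolding F_def inversions_def by (auto split: if_splits)
  qed
  have sub: "F ` inversions r w \<subseteq> inversions r (w \<circ> ?t) - {(i, j)}"
  proof (rule image_subsetI, simp only: split_paired_all)
    fix a b assume ab: "(a, b) \<in> inversions r w"
    have r: "1 \<le> ?t a" "?t a \<le> r" "1 \<le> ?t b" "?t b \<le> r"
      using ab sym_mem[OF t, of a] sym_mem[OF t, of b] by (auto simp: inversions_def)
    show "F (a, b) \<in> inversions r (w \<circ> ?t) - {(i, j)}"
    proof (cases "?t a < ?t b")
      case True
      then show ?thesis using ab r ij
        by (auto simp: F_def inversions_def Transposition.transpose_def split: if_splits)
    next
      case False
      then show ?thesis using ab r ij
        by (auto simp: F_def inversions_def Transposition.transpose_def split: if_splits)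
    qed
  qed
  have mem: "(i, j) \<in> inversions r (w \<circ> ?t)" using ij by (auto simp: inversions_def)
  have "card (inversions r w) = card (F ` inversions r w)" by (simp add: card_image inj)
  also have "\<dots> \<le> card (inversions r (w \<circ> ?t) - {(i, j)})" by (intro card_mono sub) auto
  also have "\<dots> < card (inversions r (w \<circ> ?t))" using mem by (intro psubset_card_mono) auto
  finally show ?thesis using w t by (simp add: len_eq_card_inversions sym_comp)
qed

lemma transpose_involutory: "w \<circ> Transposition.transpose i j \<circ> Transposition.transpose i j = w"
  by (simp add: fun_eq_iff)

text \<open>If \<open>w j < w i\<close>, the strict inequality applied to the product runs the other
  way. Length conditions can thereby be replaced by comparisons of two values.\<close>

lemma len_transpose_less_iff:
  assumes w: "w \<in> sym r" and ij: "1 \<le> i" "i < j" "j \<le> r"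
  shows "len r w < len r (w \<circ> Transposition.transpose i j) \<longleftrightarrow> w i < w j"
proof (cases "w i < w j")
  case False
  let ?w = "w \<circ> Transposition.transpose i j"
  have "w i \<noteq> w j" using w ij by simp
  with False have "?w i < ?w j" using ij by simp
  moreover have "?w \<in> sym r" using w ij by (intro sym_comp transpose_sym) auto
  ultimately have "len r ?w < len r w"
    using len_transpose_less[of ?w r i j] ij by (simp add: transpose_involutory)
  then show ?thesis using False by simp
qed (use len_transpose_less assms in auto)

lemma bruhat_refl [simp]: "bruhat_le r w w"
  by (simp add: bruhat_le_def)

lemma bruhat_trans: "bruhat_le r x y \<Longrightarrow> bruhat_le r y z \<Longrightarrow> bruhat_le r x z"
  unfolding bruhat_le_def by (rule rtranclp_trans)

lemma bruhat_transpose: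
  assumes "w \<in> sym r" "1 \<le> i" "i < j" "j \<le> r" "w i < w j"
  shows "bruhat_le r w (w \<circ> Transposition.transpose i j)"
  unfolding bruhat_le_def using assms len_transpose_less[OF assms]
  by (intro r_into_rtranclp) blast

lemma bruhat_simple_right:
  assumes "w \<in> sym r" "k \<in> {1..<r}" "w k < w (Suc k)"
  shows "bruhat_le r w (w \<circ> simple_refl k)"
  unfolding simple_refl_def using assms by (intro bruhat_transpose) auto

lemma comp_transpose_conj:
  "w \<in> sym r \<Longrightarrow> Transposition.transpose (w i) (w j) \<circ> w = w \<circ> Transposition.transpose i j"
  by (auto simp: fun_eq_iff Transposition.transpose_def)

lemma bruhat_simple_left:
  assumes "w \<in> sym r" "k \<in> {1..<r}" "pinv w k < pinv w (Suc k)"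
  shows "bruhat_le r w (simple_refl k \<circ> w)"
proof -
  have "bruhat_le r w (w \<circ> Transposition.transpose (pinv w k) (pinv w (Suc k)))"
    using assms sym_mem[OF sym_pinv[OF assms(1)], of k] sym_mem[OF sym_pinv[OF assms(1)], of "Suc k"]
    by (intro bruhat_transpose) auto
  also have "w \<circ> Transposition.transpose (pinv w k) (pinv w (Suc k)) = simple_refl k \<circ> w"
    using comp_transpose_conj[OF assms(1), of "pinv w k" "pinv w (Suc k)"] assms by (simp add: simple_refl_def)
  finally show ?thesis .
qed

text \<open>Descends along a chain from the fixed upper element w; the length condition of a Bruhat
  step appears as the comparison \<open>y i < y j\<close>.\<close>

lemma bruhat_induct [consumes 1, case_names refl step]:
  assumes "bruhat_le r y w" "Q w"
    "\<And>y i j. y \<in> sym r \<Longrightarrow> 1 \<le> i \<Longrightarrow> i < j \<Longrightarrow> j \<le> r \<Longrightarrow> y i < y j \<Longrightarrow>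
       bruhat_le r (y \<circ> Transposition.transpose i j) w \<Longrightarrow> Q (y \<circ> Transposition.transpose i j) \<Longrightarrow> Q y"
  shows "Q y"
  using assms(1) unfolding bruhat_le_def
proof (induction rule: converse_rtranclp_induct)
  case (step y z)
  then obtain i j where ij: "y \<in> sym r" "len r y < len r z" "1 \<le> i" "i < j" "j \<le> r"
     "z = y \<circ> Transposition.transpose i j" by blast
  then have "y i < y j" using len_transpose_less_iff[of y r i j] by blast
  moreover have "bruhat_le r z w" using step(2) unfolding bruhat_le_def .
  ultimately show ?case using assms(3)[of y i j] ij step(3) by blast
qed (use assms in auto)

lemma bruhat_len: "bruhat_le r y w \<Longrightarrow> y = w \<or> len r y < len r w"
proof (induction rule: bruhat_induct)
  case (step y i j)
  then show ?case using len_transpose_less[of y r i j] by fastforce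
qed auto

lemma bruhat_antisym: "bruhat_le r y w \<Longrightarrow> bruhat_le r w y \<Longrightarrow> y = w"
  using bruhat_len by (metis less_asym)

text \<open>The lifting property, by induction along a chain from y up to w. A chain step by the
  transposition of i and j survives multiplication by s unless s exchanges the two values
  \<open>y i\<close> and \<open>y j\<close>; in that case s y is the next element of the chain,
  which lies below w and hence below s w.\<close>

lemma bruhat_lift:
  assumes "bruhat_le r y w" and w: "w \<in> sym r" and k: "k \<in> {1..<r}" "pinv w k < pinv w (Suc k)"
  shows "bruhat_le r (simple_refl k \<circ> y) (simple_refl k \<circ> w)"
proof -
  let ?s = "simple_refl k"
  have up: "bruhat_le r w (?s \<circ> w)" by (rule bruhat_simple_left[OF w k])
  show ?thesis using assms(1)
  proof (induction rule: bruhat_induct)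
    case (step y i j)
    let ?t = "Transposition.transpose i j"
    have sy: "?s \<circ> y \<in> sym r" using step k by auto
    show ?case
    proof (cases "(?s \<circ> y) i < (?s \<circ> y) j")
      case True
      then have "bruhat_le r (?s \<circ> y) (?s \<circ> y \<circ> ?t)" using step sy by (intro bruhat_transpose) auto
      then show ?thesis using step(7) bruhat_trans by (metis comp_assoc)
    next
      case False
      then have "y i = k" "y j = Suc k"
        using simple_refl_less[of "y i" "y j" k] step by auto
      then have "?s \<circ> y = y \<circ> ?t"
        using comp_transpose_conj[OF step(1), of i j] by (simp add: simple_refl_def)
      then show ?thesis using step(6) up bruhat_trans by metis
    qed
  qed auto
qed

section \<open>Block permutations and double cosets\<close>

text \<open>Parabolic subgroups in functional form: f sends a position to the number of its block,
  and P selects the blocks that may be permuted. The full, the even and the odd Young subgroups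
  differ only in P.\<close>

definition block_perms :: "nat \<Rightarrow> (nat \<Rightarrow> nat) \<Rightarrow> (nat \<Rightarrow> bool) \<Rightarrow> perm set" where
  "block_perms r f P = {w \<in> sym r. \<forall>p\<in>{1..r}. f (w p) = f p \<and> (\<not> P (f p) \<longrightarrow> w p = p)}"

definition gens :: "nat \<Rightarrow> (nat \<Rightarrow> nat) \<Rightarrow> (nat \<Rightarrow> bool) \<Rightarrow> nat set" where
  "gens r f P = {k \<in> {1..<r}. f k = f (Suc k) \<and> P (f k)}"

text \<open>For monotone f this says that v is the shortest element of its coset v W, where W is
  \<open>block_perms r f P\<close>; applied to \<open>pinv v\<close> it concerns the coset W
  v.\<close>

definition asc :: "nat \<Rightarrow> (nat \<Rightarrow> nat) \<Rightarrow> (nat \<Rightarrow> bool) \<Rightarrow> perm \<Rightarrow> bool" where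
  "asc r f P v \<longleftrightarrow> (\<forall>k\<in>gens r f P. v k < v (Suc k))"

text \<open>The signs 1 and -1 cover the shortest and the longest elements of double cosets in one
  argument; the integers make the reversal of order a multiplication.\<close>

definition ordered :: "int \<Rightarrow> nat \<Rightarrow> (nat \<Rightarrow> nat) \<Rightarrow> perm \<Rightarrow> bool" where
  "ordered \<sigma> r g w \<longleftrightarrow> (\<forall>p\<in>{1..r}. \<forall>q\<in>{1..r}. p < q \<longrightarrow> g p = g q \<longrightarrow> \<sigma> * int (w p) < \<sigma> * int (w q))"

text \<open>f and g are arbitrary functions instead of block numberings, since the uniqueness of
  extremal elements uses the matrix also for \<open>f = id\<close>.\<close>

definition mat_of :: "nat \<Rightarrow> (nat \<Rightarrow> nat) \<Rightarrow> (nat \<Rightarrow> nat) \<Rightarrow> perm \<Rightarrow> nmat" where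
  "mat_of r f g w i j = card {p \<in> {1..r}. f (w p) = i \<and> g p = j}"

abbreviation (input) any_type :: "nat \<Rightarrow> bool" where "any_type \<equiv> \<lambda>_. True"

text \<open>Blocks of index below m are even, the others odd.\<close>
definition parity_type :: "nat \<Rightarrow> bool \<Rightarrow> nat \<Rightarrow> bool" where
  "parity_type m e i \<longleftrightarrow> (i < m) = e"

lemma len_id' [simp]: "len r (\<lambda>a. a) = 0"
  using len_id[of r] by (simp add: id_def)

lemma sym_range: "w \<in> sym r \<Longrightarrow> p \<in> {1..r} \<Longrightarrow> w p \<in> {1..r}"
  using sym_mem[of w r p] by simp

lemma pinv_range: "w \<in> sym r \<Longrightarrow> p \<in> {1..r} \<Longrightarrow> pinv w p \<in> {1..r}"
  by (rule sym_range[OF sym_pinv])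

lemma gensD: "k \<in> gens r f P \<Longrightarrow> k \<in> {1..<r}" "k \<in> gens r f P \<Longrightarrow> f k = f (Suc k)"
  "k \<in> gens r f P \<Longrightarrow> P (f k)"
  by (auto simp: gens_def)

lemma gens_any: "k \<in> gens r f P \<Longrightarrow> k \<in> gens r f any_type"
  by (auto simp: gens_def)

text \<open>The blocks of a monotone f are intervals, so f is constant between p and q.\<close>

lemma gens_interval:
  assumes "mono_on {1..r} f" "p \<in> {1..r}" "q \<in> {1..r}" "f p = f q" "P (f p)" "p \<le> k" "k < q"
  shows "k \<in> gens r f P" "f k = f p"
proof -
  have "f p \<le> f k" "f k \<le> f (Suc k)" "f (Suc k) \<le> f q"
    using assms mono_onD[OF assms(1), of p k] mono_onD[OF assms(1), of k "Suc k"] mono_onD[OF assms(1), of "Suc k" q]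
    by auto
  then have "f k = f p" "f k = f (Suc k)" using assms(4) by linarith+
  then show "f k = f p" "k \<in> gens r f P" using assms unfolding gens_def by auto
qed

lemma ascD: "asc r f P v \<Longrightarrow> k \<in> gens r f P \<Longrightarrow> v k < v (Suc k)"
  by (simp add: asc_def)

lemma asc_less:
  assumes "mono_on {1..r} f" "asc r f P v" "p \<in> {1..r}" "q \<in> {1..r}" "p < q" "f p = f q" "P (f p)"
  shows "v p < v q"
proof (rule less_by_steps[OF assms(5)])
  fix k assume "p \<le> k" "k < q"
  then show "v k < v (Suc k)" using gens_interval[of r f p q P k] assms ascD by blast
qed

lemma desc_less:
  fixes v :: "nat \<Rightarrow> nat"
  assumes "mono_on {1..r} f" "\<forall>k\<in>gens r f P. v (Suc k) < v k" "p \<in> {1..r}" "q \<in> {1..r}" "p < q" "f p = f q" "P (f p)"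
  shows "v q < v p"
proof -
  have "- int (v p) < - int (v q)"
  proof (rule less_by_steps[OF assms(5)])
    fix k assume "p \<le> k" "k < q"
    then show "- int (v k) < - int (v (Suc k))" using gens_interval[of r f p q P k] assms by auto
  qed
  then show ?thesis by simp
qed

lemma asc_ordered: "mono_on {1..r} f \<Longrightarrow> asc r f any_type v \<Longrightarrow> ordered 1 r f v"
  using asc_less[of r f any_type v] by (auto simp: ordered_def)

lemma desc_ordered: "mono_on {1..r} f \<Longrightarrow> \<forall>k\<in>gens r f any_type. v (Suc k) < v k \<Longrightarrow> ordered (- 1) r f v"
  using desc_less[of r f any_type v] by (auto simp: ordered_def)

section \<open>Parabolic subgroups and shortest coset representatives\<close>

lemma block_perms_sym: "w \<in> block_perms r f P \<Longrightarrow> w \<in> sym r"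
  by (simp add: block_perms_def)

lemma block_permsD:
  "w \<in> block_perms r f P \<Longrightarrow> p \<in> {1..r} \<Longrightarrow> f (w p) = f p"
  "w \<in> block_perms r f P \<Longrightarrow> p \<in> {1..r} \<Longrightarrow> \<not> P (f p) \<Longrightarrow> w p = p"
  by (auto simp: block_perms_def)

lemma block_perms_id [simp, intro]: "id \<in> block_perms r f P"
  by (auto simp: block_perms_def)

lemma block_perms_comp [intro]:
  assumes "u \<in> block_perms r f P" "w \<in> block_perms r f P"
  shows "u \<circ> w \<in> block_perms r f P"
proof -
  have "f ((u \<circ> w) p) = f p" "\<not> P (f p) \<Longrightarrow> (u \<circ> w) p = p" if "p \<in> {1..r}" for p
    using block_permsD[OF assms(1) sym_range[OF block_perms_sym[OF assms(2)] that]]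
      block_permsD[OF assms(2) that] by auto
  moreover have "u \<circ> w \<in> sym r" using assms block_perms_sym by blast
  ultimately show ?thesis unfolding block_perms_def by blast
qed

lemma block_perms_pinv [intro]:
  assumes "u \<in> block_perms r f P" shows "pinv u \<in> block_perms r f P"
proof -
  have u: "u \<in> sym r" by (rule block_perms_sym[OF assms])
  have "f (pinv u p) = f p" "\<not> P (f p) \<Longrightarrow> pinv u p = p" if "p \<in> {1..r}" for p
    using block_permsD[OF assms pinv_range[OF u that]] block_permsD[OF assms that] u sym_apply_pinv[OF u, of p]
    by (metis sym_pinv_apply)+
  then show ?thesis using u unfolding block_perms_def by blast
qed

lemma block_perms_simple [intro]:
  assumes "k \<in> gens r f P" shows "simple_refl k \<in> block_perms r f P"
proof -
  have "f (simple_refl k p) = f p \<and> (\<not> P (f p) \<longrightarrow> simple_refl k p = p)" for p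
    using assms gensD[OF assms] by (cases "p = k \<or> p = Suc k") auto
  then show ?thesis using gensD(1)[OF assms] unfolding block_perms_def by blast
qed

lemma block_perms_mono: "(\<And>i. P i \<Longrightarrow> Q i) \<Longrightarrow> block_perms r f P \<subseteq> block_perms r f Q"
  by (auto simp: block_perms_def)

lemma finite_block_perms [simp, intro]: "finite (block_perms r f P)"
  by (rule finite_subset[OF _ finite_sym[of r]]) (auto simp: block_perms_def)

text \<open>The remaining ascents are automatic: blocks are preserved, so values increase across a
  border of two blocks, and in a block outside P all points are fixed. Hence w ascends
  everywhere.\<close>

lemma block_perms_asc_id:
  assumes f: "mono_on {1..r} f" and w: "w \<in> block_perms r f P" and asc: "asc r f P w"
  shows "w = id"
proof (rule sym_ascending_id[OF block_perms_sym[OF w]])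
  fix k assume k: "k \<in> {1..<r}"
  then have k': "k \<in> {1..r}" "Suc k \<in> {1..r}" by auto
  note D = block_permsD[OF w k'(1)] block_permsD[OF w k'(2)]
  have r: "w k \<in> {1..r}" "w (Suc k) \<in> {1..r}" using k' sym_range[OF block_perms_sym[OF w]] by blast+
  consider "k \<in> gens r f P" | "f k < f (Suc k)" | "f k = f (Suc k)" "\<not> P (f k)"
    using mono_onD[OF f k'] k by (fastforce simp: gens_def)
  then show "w k < w (Suc k)"
  proof cases
    case 1
    then show ?thesis using asc ascD by blast
  next
    case 2
    then show ?thesis using D(1,3) mono_onD[OF f r(2,1)] by (metis not_less linorder_not_less)
  next
    case 3
    then show ?thesis using D(2,4) by simp
  qed
qed

lemma block_perms_asc_pinv_id:
  assumes "mono_on {1..r} f" "w \<in> block_perms r f P" "asc r f P (pinv w)"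
  shows "w = id"
  using block_perms_asc_id[OF assms(1) block_perms_pinv[OF assms(2)] assms(3)]
  by (metis assms(2) block_perms_sym pinv_id sym_pinv_pinv)

lemma block_perms_induct [consumes 2, case_names id step]:
  assumes f: "mono_on {1..r} f" and w: "w \<in> block_perms r f P" and "Q id"
    and step: "\<And>w k. w \<in> block_perms r f P \<Longrightarrow> k \<in> gens r f P \<Longrightarrow> pinv w k < pinv w (Suc k) \<Longrightarrow> Q w \<Longrightarrow> Q (simple_refl k \<circ> w)"
  shows "Q w"
  using w
proof (induction "len r w" arbitrary: w rule: less_induct)
  case less
  note w = block_perms_sym[OF less(2)]
  show ?case
  proof (cases "asc r f P (pinv w)")
    case True
    then show ?thesis using block_perms_asc_pinv_id[OF f less(2)] assms(3) by simp
  next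
    case False
    then obtain k where k: "k \<in> gens r f P" "pinv w (Suc k) < pinv w k"
      using pinv_neq_Suc[OF w] by (auto simp: asc_def)
    define w' where "w' = simple_refl k \<circ> w"
    have w': "w' \<in> block_perms r f P" "pinv w' k < pinv w' (Suc k)" "w = simple_refl k \<circ> w'"
      using k less w gensD(1)[OF k(1)] by (auto simp: w'_def pinv_simple_left)
    then have "len r w = Suc (len r w')"
      using len_simple_left[OF block_perms_sym gensD(1)] k by metis
    then have "Q w'" using less w' by simp
    then show ?thesis using step w' k by metis
  qed
qed

text \<open>\<open>pinv v\<close> increases on each block that u may permute, so it does not change
  the order of \<open>pinv u k\<close> and \<open>pinv u (Suc k)\<close>. Both the uniqueness of the
  factorisation and the additivity of lengths rest on this.\<close>

lemma pinv_comp_block: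
  assumes f: "mono_on {1..r} f" and u: "u \<in> block_perms r f P" and v: "v \<in> sym r" "asc r f P (pinv v)"
    and k: "k \<in> gens r f P" 
  shows "pinv u k < pinv u (Suc k) \<Longrightarrow> pinv (u \<circ> v) k < pinv (u \<circ> v) (Suc k)"
    "pinv u (Suc k) < pinv u k \<Longrightarrow> pinv (u \<circ> v) (Suc k) < pinv (u \<circ> v) k"
proof -
  have k': "k \<in> {1..r}" "Suc k \<in> {1..r}" using gensD(1)[OF k] by auto
  note u' = block_perms_pinv[OF u]
  have *: "pinv (u \<circ> v) = pinv v \<circ> pinv u" by (rule sym_comp_pinv[OF block_perms_sym[OF u] v(1)])
  have r: "pinv u k \<in> {1..r}" "pinv u (Suc k) \<in> {1..r}"
    using k' pinv_range[OF block_perms_sym[OF u]] by blast+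
  have "f (pinv u k) = f k" "f (pinv u (Suc k)) = f k" "P (f k)"
    using block_permsD(1)[OF u'] k' gensD[OF k] by auto
  then show "pinv u k < pinv u (Suc k) \<Longrightarrow> pinv (u \<circ> v) k < pinv (u \<circ> v) (Suc k)"
    "pinv u (Suc k) < pinv u k \<Longrightarrow> pinv (u \<circ> v) (Suc k) < pinv (u \<circ> v) k"
    using asc_less[OF f v(2) r] asc_less[OF f v(2) r(2,1)] unfolding * by auto
qed

lemma block_perms_comp_asc_id:
  assumes f: "mono_on {1..r} f" and u: "u \<in> block_perms r f P" and v: "v \<in> sym r" "asc r f P (pinv v)"
    and uv: "asc r f P (pinv (u \<circ> v))"
  shows "u = id"
proof (rule block_perms_asc_pinv_id[OF f u], unfold asc_def, intro ballI)
  fix k assume k: "k \<in> gens r f P"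
  show "pinv u k < pinv u (Suc k)"
    using pinv_comp_block(2)[OF f u v k] ascD[OF uv k] pinv_neq_Suc[OF block_perms_sym[OF u], of k] by linarith
qed

lemma len_block_comp:
  assumes f: "mono_on {1..r} f" and u: "u \<in> block_perms r f P" and v: "v \<in> sym r" "asc r f P (pinv v)"
  shows "len r (u \<circ> v) = len r u + len r v"
  using f u
proof (induction rule: block_perms_induct)
  case (step u k)
  have uv: "u \<circ> v \<in> sym r" using step v block_perms_sym by blast
  have "len r (simple_refl k \<circ> (u \<circ> v)) = Suc (len r (u \<circ> v))"
    using pinv_comp_block(1)[OF f step(1) v step(2,3)] by (intro len_simple_left uv gensD(1)[OF step(2)])
  moreover have "len r (simple_refl k \<circ> u) = Suc (len r u)"
    using step by (intro len_simple_left block_perms_sym gensD(1)[OF step(2)])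
  ultimately show ?case using step by (metis add_Suc comp_assoc)
qed simp

lemma len_comp_block:
  assumes f: "mono_on {1..r} f" and u: "u \<in> block_perms r f P" and v: "v \<in> sym r" "asc r f P v"
  shows "len r (v \<circ> u) = len r v + len r u"
proof -
  have u': "u \<in> sym r" by (rule block_perms_sym[OF u])
  have "len r (pinv u \<circ> pinv v) = len r (pinv u) + len r (pinv v)"
    using v by (intro len_block_comp[OF f block_perms_pinv[OF u]]) auto
  moreover have "len r (v \<circ> u) = len r (pinv u \<circ> pinv v)"
    using len_pinv[OF sym_comp[OF v(1) u']] sym_comp_pinv[OF v(1) u'] by simp
  ultimately show ?thesis using len_pinv u' v by simp
qed

section \<open>Induction inside double cosets\<close>

lemma len_bound: "w \<in> sym r \<Longrightarrow> len r w \<le> r * r"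
proof -
  assume w: "w \<in> sym r"
  have "card (inversions r w) \<le> card ({1..r} \<times> {1..r})" by (rule card_mono) (auto simp: inversions_def)
  then show ?thesis using w by (simp add: len_eq_card_inversions)
qed

text \<open>Climbs from an element that is minimal on both sides by lengthening steps within the
  double coset. With an empty selection of blocks on one side it becomes an induction over one-sided
  cosets.\<close>

lemma double_coset_induct [consumes 1, case_names min left right]:
  assumes "w \<in> sym r"
    and min: "\<And>w. w \<in> sym r \<Longrightarrow> asc r f P (pinv w) \<Longrightarrow> asc r g P' w \<Longrightarrow> Q w"
    and left: "\<And>w k. w \<in> sym r \<Longrightarrow> k \<in> gens r f P \<Longrightarrow> pinv w k < pinv w (Suc k) \<Longrightarrow> Q w \<Longrightarrow> Q (simple_refl k \<circ> w)"
    and right: "\<And>w k. w \<in> sym r \<Longrightarrow> k \<in> gens r g P' \<Longrightarrow> w k < w (Suc k) \<Longrightarrow> Q w \<Longrightarrow> Q (w \<circ> simple_refl k)"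
  shows "Q w"
  using assms(1)
proof (induction "len r w" arbitrary: w rule: less_induct)
  case less
  note w = less(2)
  consider "asc r f P (pinv w)" "asc r g P' w" | k where "k \<in> gens r f P" "pinv w (Suc k) < pinv w k"
    | k where "k \<in> gens r g P'" "w (Suc k) < w k"
    using pinv_neq_Suc[OF w] sym_neq_Suc[OF w] by (auto simp: asc_def)
  then show ?case
  proof cases
    case 1
    then show ?thesis using min w by blast
  next
    case (2 k)
    define w' where "w' = simple_refl k \<circ> w"
    have w': "w' \<in> sym r" unfolding w'_def using gensD(1)[OF 2(1)] w by blast
    have *: "pinv w' k < pinv w' (Suc k)" "w = simple_refl k \<circ> w'"
      using 2 w gensD(1)[OF 2(1)] by (auto simp: w'_def pinv_simple_left)
    then have "len r w = Suc (len r w')"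
      using len_simple_left[OF w' gensD(1)[OF 2(1)]] by metis
    then have "Q w'" using less w' by simp
    then show ?thesis using left w' * 2 by metis
  next
    case (3 k)
    define w' where "w' = w \<circ> simple_refl k"
    have w': "w' \<in> sym r" unfolding w'_def using gensD(1)[OF 3(1)] w by blast
    have *: "w' k < w' (Suc k)" "w = w' \<circ> simple_refl k"
      using 3 w by (auto simp: w'_def)
    then have "len r w = Suc (len r w')"
      using len_simple_right[OF w' gensD(1)[OF 3(1)]] by metis
    then have "Q w'" using less w' by simp
    then show ?thesis using right w' * 3 by metis
  qed
qed

text \<open>The opposite direction: the property spreads downwards from elements that descend at all
  generators. The climb to such an element ends because lengths are at most
  \<open>r * r\<close>.\<close>

lemma double_coset_induct_up [consumes 1, case_names max left right]:
  assumes "w \<in> sym r"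
    and max: "\<And>w. w \<in> sym r \<Longrightarrow> \<forall>k\<in>gens r f P. pinv w (Suc k) < pinv w k \<Longrightarrow> \<forall>k\<in>gens r g P'. w (Suc k) < w k \<Longrightarrow> Q w"
    and left: "\<And>w k. w \<in> sym r \<Longrightarrow> k \<in> gens r f P \<Longrightarrow> pinv w k < pinv w (Suc k) \<Longrightarrow> Q (simple_refl k \<circ> w) \<Longrightarrow> Q w"
    and right: "\<And>w k. w \<in> sym r \<Longrightarrow> k \<in> gens r g P' \<Longrightarrow> w k < w (Suc k) \<Longrightarrow> Q (w \<circ> simple_refl k) \<Longrightarrow> Q w"
  shows "Q w"
  using assms(1)
proof (induction "r * r - len r w" arbitrary: w rule: less_induct)
  case less
  note w = less(2)
  consider "\<forall>k\<in>gens r f P. pinv w (Suc k) < pinv w k" "\<forall>k\<in>gens r g P'. w (Suc k) < w k"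
    | k where "k \<in> gens r f P" "pinv w k < pinv w (Suc k)" | k where "k \<in> gens r g P'" "w k < w (Suc k)"
    using pinv_neq_Suc[OF w] sym_neq_Suc[OF w] by blast
  then show ?case
  proof cases
    case 1
    then show ?thesis using max w by blast
  next
    case (2 k)
    have w': "simple_refl k \<circ> w \<in> sym r" using gensD(1)[OF 2(1)] w by blast
    have "r * r - len r (simple_refl k \<circ> w) < r * r - len r w"
      using len_simple_left[OF w gensD(1)[OF 2(1)] 2(2)] len_bound[OF w'] by linarith
    then show ?thesis using less w' left 2 by blast
  next
    case (3 k)
    have w': "w \<circ> simple_refl k \<in> sym r" using gensD(1)[OF 3(1)] w by blast
    have "r * r - len r (w \<circ> simple_refl k) < r * r - len r w"
      using len_simple_right[OF w gensD(1)[OF 3(1)] 3(2)] len_bound[OF w'] by linarith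
    then show ?thesis using less w' right 3 by blast
  qed
qed

text \<open>If \<open>G x < F x\<close>, then all y with \<open>F y \<le> G x\<close> lie strictly
  to the left of x, while all \<open>y \<le> x\<close> satisfy \<open>G y \<le> G x\<close>; equal
  fibre sizes exclude this.\<close>

lemma mono_fibres_le:
  fixes F G :: "nat \<Rightarrow> int"
  assumes "finite A" "mono_on A F" "mono_on A G" "\<And>t. card {x \<in> A. F x = t} = card {x \<in> A. G x = t}" "x \<in> A"
  shows "F x \<le> G x"
proof (rule ccontr)
  assume "\<not> F x \<le> G x"
  then have less: "G x < F x" by simp
  let ?S = "{t \<in> F ` A \<union> G ` A. t \<le> G x}"
  have fin: "finite ?S" using assms(1) by auto
  have c: "card {y \<in> A. H y \<le> G x} = (\<Sum>t\<in>?S. card {y \<in> A. H y = t})" if "H = F \<or> H = G" for H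
  proof -
    have "{y \<in> A. H y \<le> G x} = (\<Union>t\<in>?S. {y \<in> A. H y = t})" using that by auto
    also have "card \<dots> = (\<Sum>t\<in>?S. card {y \<in> A. H y = t})"
      by (rule card_UN_disjoint) (use fin assms(1) in auto)
    finally show ?thesis .
  qed
  have "card {y \<in> A. F y \<le> G x} = card {y \<in> A. G y \<le> G x}" using c[of F] c[of G] assms(4) by simp
  moreover have "{y \<in> A. F y \<le> G x} \<subseteq> {y \<in> A. y < x}"
  proof clarify
    fix y assume y: "y \<in> A" "F y \<le> G x"
    then show "y < x" using mono_onD[OF assms(2) assms(5) y(1)] less by (metis leD le_less_trans linorder_not_less)
  qed
  then have "card {y \<in> A. F y \<le> G x} \<le> card {y \<in> A. y < x}" using assms(1) by (intro card_mono) auto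
  moreover have "{y \<in> A. y < x} \<subset> {y \<in> A. y \<le> x}" using assms(5) by auto
  then have "card {y \<in> A. y < x} < card {y \<in> A. y \<le> x}" using assms(1) by (intro psubset_card_mono) auto
  moreover have "card {y \<in> A. y \<le> x} \<le> card {y \<in> A. G y \<le> G x}"
    using assms(1,5) mono_onD[OF assms(3)] by (intro card_mono) auto
  ultimately show False by linarith
qed

lemma mono_fibres_eq:
  fixes F G :: "nat \<Rightarrow> int"
  assumes "finite A" "mono_on A F" "mono_on A G" "\<And>t. card {x \<in> A. F x = t} = card {x \<in> A. G x = t}" "x \<in> A"
  shows "F x = G x"
  using mono_fibres_le[of A F G x] mono_fibres_le[of A G F x] assms by (simp add: antisym)

text \<open>Within one column block, the row index of \<open>w p\<close>, multiplied by \<sigma>, is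
  monotone in p, and its fibres are counted by one column of the matrix. Two monotone functions with
  equal fibre sizes coincide.\<close>

lemma ordered_block_eq:
  assumes f: "mono_on {1..r} f" and w: "w \<in> sym r" "w' \<in> sym r" and o: "ordered \<sigma> r g w" "ordered \<sigma> r g w'"
    and mat: "mat_of r f g w = mat_of r f g w'" and \<sigma>: "\<sigma> \<in> {1, -1}" and p: "p \<in> {1..r}"
  shows "f (w p) = f (w' p)"
proof -
  define A where "A = {x \<in> {1..r}. g x = g p}"
  have mono: "mono_on A (\<lambda>x. \<sigma> * int (f (v x)))" if v: "v \<in> sym r" "ordered \<sigma> r g v" for v
  proof (rule mono_onI)
    fix x y assume xy: "x \<in> A" "y \<in> A" "x \<le> y"
    have vr: "v x \<in> {1..r}" "v y \<in> {1..r}" using xy sym_range[OF v(1)] by (auto simp: A_def)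
    show "\<sigma> * int (f (v x)) \<le> \<sigma> * int (f (v y))"
    proof (cases "x = y")
      case False
      then have "\<sigma> * int (v x) < \<sigma> * int (v y)" using xy v by (auto simp: ordered_def A_def)
      then show ?thesis using \<sigma> mono_onD[OF f vr] mono_onD[OF f vr(2,1)] by auto
    qed simp
  qed
  \<comment> \<open>As \<sigma> is its own inverse, the value t arises from the row index
    \<open>\<sigma> * t\<close>; a negative product corresponds to no row.\<close>
  have fib: "card {x \<in> A. \<sigma> * int (f (v x)) = t} = (if 0 \<le> \<sigma> * t then mat_of r f g v (nat (\<sigma> * t)) (g p) else 0)" for v t
  proof -
    have "{x \<in> A. \<sigma> * int (f (v x)) = t} = (if 0 \<le> \<sigma> * t then {x \<in> {1..r}. f (v x) = nat (\<sigma> * t) \<and> g x = g p} else {})"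
      using \<sigma> by (auto simp: A_def)
    then show ?thesis by (simp add: mat_of_def)
  qed
  have "\<sigma> * int (f (w p)) = \<sigma> * int (f (w' p))"
    using mono_fibres_eq[OF _ mono[OF w(1) o(1)] mono[OF w(2) o(2)]] p fib mat by (auto simp: A_def)
  then show ?thesis using \<sigma> by auto
qed

text \<open>The comparison of monotone functions is used twice. The matrix determines the row block
  of each \<open>w p\<close>; this says that the inverses have equal matrices when single values
  take the place of row blocks, and the same argument then determines the inverses
  pointwise.\<close>

lemma ordered_unique:
  assumes f: "mono_on {1..r} f" and w: "w \<in> sym r" "w' \<in> sym r" and o: "ordered \<sigma> r g w" "ordered \<sigma> r g w'"
    "ordered \<sigma> r f (pinv w)" "ordered \<sigma> r f (pinv w')"
    and mat: "mat_of r f g w = mat_of r f g w'" and \<sigma>: "\<sigma> \<in> {1, -1}"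
  shows "w = w'"
proof -
  note eq = ordered_block_eq[OF f w o(1,2) mat \<sigma>]
  have m: "mat_of r id f (pinv v) i j = (if i \<in> {1..r} \<and> f (v i) = j then 1 else 0)" if "v \<in> sym r" for v i j
  proof -
    have "pinv v p = i \<longleftrightarrow> p = v i" for p using sym_apply_pinv[OF that] sym_pinv_apply[OF that] by metis
    then have "{p \<in> {1..r}. id (pinv v p) = i \<and> f p = j} = (if v i \<in> {1..r} \<and> f (v i) = j then {v i} else {})"
      by auto
    moreover have "v i \<in> {1..r} \<longleftrightarrow> i \<in> {1..r}" using sym_mem[OF that, of i] by simp
    ultimately show ?thesis unfolding mat_of_def by auto
  qed
  have "pinv w p = pinv w' p" if "p \<in> {1..r}" for p
    using ordered_block_eq[OF _ sym_pinv[OF w(1)] sym_pinv[OF w(2)] o(3,4) _ \<sigma> that, of id] m[OF w(1)] m[OF w(2)] eq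
    by (auto simp: fun_eq_iff mono_on_def)
  then have "pinv w = pinv w'" using sym_eqI w by blast
  then show ?thesis by (metis w sym_pinv_pinv)
qed

lemma bimin_unique:
  assumes "mono_on {1..r} f" "mono_on {1..r} g" "w \<in> sym r" "w' \<in> sym r" "mat_of r f g w = mat_of r f g w'"
   "asc r f any_type (pinv w)" "asc r g any_type w" "asc r f any_type (pinv w')" "asc r g any_type w'"
  shows "w = w'"
  using ordered_unique[of r f w w' 1 g] assms by (simp add: asc_ordered)

lemma mat_of_comp:
  assumes u: "u \<in> block_perms r f P" and w: "w \<in> sym r" and v: "v \<in> block_perms r g P'"
  shows "mat_of r f g (u \<circ> w \<circ> v) = mat_of r f g w"
proof (intro ext)
  fix i j
  have v': "v \<in> sym r" by (rule block_perms_sym[OF v])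
  have "bij_betw v {p \<in> {1..r}. f ((u \<circ> w \<circ> v) p) = i \<and> g p = j} {p \<in> {1..r}. f (w p) = i \<and> g p = j}"
  proof (rule bij_betw_byWitness[where f' = "pinv v"])
    show "v ` {p \<in> {1..r}. f ((u \<circ> w \<circ> v) p) = i \<and> g p = j} \<subseteq> {p \<in> {1..r}. f (w p) = i \<and> g p = j}"
    proof (rule image_subsetI)
      fix p assume p: "p \<in> {p \<in> {1..r}. f ((u \<circ> w \<circ> v) p) = i \<and> g p = j}"
      then have r: "v p \<in> {1..r}" "w (v p) \<in> {1..r}" using sym_range v' w by blast+
      then show "v p \<in> {p \<in> {1..r}. f (w p) = i \<and> g p = j}"
        using block_permsD(1)[OF u r(2)] block_permsD(1)[OF v, of p] p by auto
    qed
    show "pinv v ` {p \<in> {1..r}. f (w p) = i \<and> g p = j} \<subseteq> {p \<in> {1..r}. f ((u \<circ> w \<circ> v) p) = i \<and> g p = j}"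
    proof (rule image_subsetI)
      fix p assume p: "p \<in> {p \<in> {1..r}. f (w p) = i \<and> g p = j}"
      then have r: "pinv v p \<in> {1..r}" "w p \<in> {1..r}" using pinv_range[OF v'] sym_range[OF w] by blast+
      then show "pinv v p \<in> {p \<in> {1..r}. f ((u \<circ> w \<circ> v) p) = i \<and> g p = j}"
        using block_permsD(1)[OF u r(2)] block_permsD(1)[OF block_perms_pinv[OF v], of p] p v' by auto
    qed
  qed (use v' in auto)
  then show "mat_of r f g (u \<circ> w \<circ> v) i j = mat_of r f g w i j"
    unfolding mat_of_def by (rule bij_betw_same_card)
qed

lemma mat_of_comp_left: "u \<in> block_perms r f P \<Longrightarrow> w \<in> sym r \<Longrightarrow> mat_of r f g (u \<circ> w) = mat_of r f g w"
  using mat_of_comp[of u r f P w id g any_type] by auto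

lemma mat_of_comp_right: "v \<in> block_perms r g P' \<Longrightarrow> w \<in> sym r \<Longrightarrow> mat_of r f g (w \<circ> v) = mat_of r f g w"
  using mat_of_comp[of id r f any_type w v g] by auto

text \<open>The matrix determines the double coset: the descent from w keeps the matrix and ends at
  an element minimal on both sides, which must be d.\<close>

lemma double_coset_decomp:
  assumes f: "mono_on {1..r} f" and g: "mono_on {1..r} g" and d: "d \<in> sym r" "asc r f any_type (pinv d)" "asc r g any_type d"
    and w: "w \<in> sym r" "mat_of r f g w = mat_of r f g d"
  shows "\<exists>a\<in>block_perms r f any_type. \<exists>b\<in>block_perms r g any_type. w = a \<circ> d \<circ> b"
  using w
proof (induction rule: double_coset_induct[where f = f and g = g and P = any_type and P' = any_type])
  case (min w)
  then have "w = d" using bimin_unique f g d by blast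
  then have "w = id \<circ> d \<circ> id" by simp
  then show ?case by blast
next
  case (left w k)
  then obtain a b where "a \<in> block_perms r f any_type" "b \<in> block_perms r g any_type" "w = a \<circ> d \<circ> b"
    using mat_of_comp_left[OF block_perms_simple] by metis
  then have "simple_refl k \<circ> a \<in> block_perms r f any_type" "simple_refl k \<circ> w = simple_refl k \<circ> a \<circ> d \<circ> b"
    using left by (auto simp: comp_assoc)
  then show ?case using \<open>b \<in> _\<close> by blast
next
  case (right w k)
  then obtain a b where "a \<in> block_perms r f any_type" "b \<in> block_perms r g any_type" "w = a \<circ> d \<circ> b"
    using mat_of_comp_right[OF block_perms_simple] by metis
  then have "b \<circ> simple_refl k \<in> block_perms r g any_type" "w \<circ> simple_refl k = a \<circ> d \<circ> (b \<circ> simple_refl k)"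
    using right by (auto simp: comp_assoc)
  then show ?case using \<open>a \<in> _\<close> by blast
qed

section \<open>Even and odd parts of a Young subgroup\<close>

lemma block_perms_commute:
  assumes u: "u \<in> block_perms r g (parity_type m e)" and v: "v \<in> block_perms r g (parity_type m (\<not> e))"
  shows "u \<circ> v = v \<circ> u"
proof (rule sym_eqI)
  show "u \<circ> v \<in> sym r" "v \<circ> u \<in> sym r" using u v block_perms_sym by blast+
  fix p assume p: "p \<in> {1..r}"
  have r: "u p \<in> {1..r}" "v p \<in> {1..r}" using p sym_range u v block_perms_sym by blast+
  show "(u \<circ> v) p = (v \<circ> u) p"
    using block_permsD[OF u p] block_permsD[OF v p] block_permsD[OF u r(2)] block_permsD[OF v r(1)]
    by (cases "(g p < m) = e") (auto simp: parity_type_def)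
qed

text \<open>\<open>u e\<close> agrees with b on the blocks of parity e and fixes the rest; it is a
  permutation since b preserves the union of these blocks.\<close>

lemma block_perms_split:
  assumes b: "b \<in> block_perms r g any_type"
  shows "\<exists>u\<in>block_perms r g (parity_type m e). \<exists>v\<in>block_perms r g (parity_type m (\<not> e)). b = u \<circ> v"
proof -
  have b': "b \<in> sym r" by (rule block_perms_sym[OF b])
  define u where "u = (\<lambda>e p. if p \<in> {1..r} \<and> parity_type m e (g p) then b p else p)"
  have uS: "u e \<in> sym r" for e
  proof -
    define A where "A = {p \<in> {1..r}. parity_type m e (g p)}"
    have A: "b p \<in> A \<longleftrightarrow> p \<in> A" for p
    proof -
      have "b p \<in> {1..r} \<longleftrightarrow> p \<in> {1..r}" using sym_mem[OF b', of p] by simp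
      then show ?thesis using block_permsD(1)[OF b, of p] by (auto simp: A_def)
    qed
    have A': "pinv b p \<in> A \<longleftrightarrow> p \<in> A" for p using A[of "pinv b p"] b' by simp
    have "bij_betw b A A" by (rule bij_betw_byWitness[where f' = "pinv b"]) (use A A' b' in auto)
    moreover have "bij_betw (u e) A A \<longleftrightarrow> bij_betw b A A" by (rule bij_betw_cong) (simp add: u_def A_def)
    ultimately have "u e permutes A" by (intro bij_imp_permutes) (auto simp: u_def A_def)
    then show ?thesis unfolding sym_def A_def by (auto intro: permutes_subset)
  qed
  have u: "u e \<in> block_perms r g (parity_type m e)" for e
    using uS block_permsD(1)[OF b] unfolding block_perms_def by (auto simp: u_def)
  moreover have "b = u e \<circ> u (\<not> e)"
  proof (rule sym_eqI[OF b'])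
    show "u e \<circ> u (\<not> e) \<in> sym r" using uS by blast
    fix p assume p: "p \<in> {1..r}"
    then show "b p = (u e \<circ> u (\<not> e)) p"
      using block_permsD(1)[OF b p] by (auto simp: u_def parity_type_def)
  qed
  ultimately show ?thesis by blast
qed

section \<open>Block inversions and extremal elements of double cosets\<close>

text \<open>For P the odd type, this is the exponent of the factor -1/q with which w enters \<open>T_D\<close>.\<close>
definition bindex :: "nat \<Rightarrow> (nat \<Rightarrow> nat) \<Rightarrow> (nat \<Rightarrow> nat) \<Rightarrow> (nat \<Rightarrow> bool) \<Rightarrow> perm \<Rightarrow> nat" where
  "bindex r f g P w = card {(i, j) \<in> inversions r w. g i = g j \<and> P (g i) \<or> f (w i) = f (w j) \<and> P (f (w i))}"

text \<open>The condition on mixed entries of matrices, read off from a permutation. It is constant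
  on double cosets, and it makes the inversions within blocks split into even and odd ones without
  overlap.\<close>

definition parity_ok :: "nat \<Rightarrow> nat \<Rightarrow> (nat \<Rightarrow> nat) \<Rightarrow> (nat \<Rightarrow> nat) \<Rightarrow> perm \<Rightarrow> bool" where
  "parity_ok r m f g w \<longleftrightarrow> (\<forall>i j. (i < m) \<noteq> (j < m) \<longrightarrow> mat_of r f g w i j \<le> 1)"

lemma parity_ok_cell:
  assumes "parity_ok r m f g w" "p \<in> {1..r}" "q \<in> {1..r}" "p \<noteq> q" "g p = g q" "f (w p) = f (w q)"
  shows "f (w p) < m \<longleftrightarrow> g p < m"
proof (rule ccontr)
  assume "\<not> ?thesis"
  then have "card {x \<in> {1..r}. f (w x) = f (w p) \<and> g x = g p} \<le> 1"
    using assms(1) unfolding parity_ok_def mat_of_def by blast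
  moreover have "card {p, q} \<le> card {x \<in> {1..r}. f (w x) = f (w p) \<and> g x = g p}"
    using assms by (intro card_mono) auto
  ultimately show False using assms(4) by simp
qed

lemma parity_ok_cong: "mat_of r f g w = mat_of r f g w' \<Longrightarrow> parity_ok r m f g w = parity_ok r m f g w'"
  by (simp add: parity_ok_def)

lemma mat_of_pinv: "w \<in> sym r \<Longrightarrow> mat_of r g f (pinv w) j i = mat_of r f g w i j"
proof -
  assume w: "w \<in> sym r"
  have sub: "v ` {p \<in> {1..r}. f (v p) = i \<and> g p = j} \<subseteq> {p \<in> {1..r}. g (pinv v p) = j \<and> f p = i}"
    if v: "v \<in> sym r" for v f g i j
  proof (rule image_subsetI)
    fix p assume p: "p \<in> {p \<in> {1..r}. f (v p) = i \<and> g p = j}"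
    then have "v p \<in> {1..r}" using sym_range[OF v] by blast
    then show "v p \<in> {p \<in> {1..r}. g (pinv v p) = j \<and> f p = i}" using p v by simp
  qed
  have "bij_betw w {p \<in> {1..r}. f (w p) = i \<and> g p = j} {p \<in> {1..r}. g (pinv w p) = j \<and> f p = i}"
    by (rule bij_betw_byWitness[where f' = "pinv w"])
       (use w sub[OF w, of f i g j] sub[OF sym_pinv[OF w], of g j f i] in auto)
  then show ?thesis unfolding mat_of_def by (simp add: bij_betw_same_card)
qed

lemma parity_ok_pinv: "w \<in> sym r \<Longrightarrow> parity_ok r m g f (pinv w) = parity_ok r m f g w"
  unfolding parity_ok_def by (metis mat_of_pinv)

text \<open>Rows and columns enter the definition symmetrically and are exchanged by passing to the
  inverse.\<close>

lemma bindex_pinv: 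
  assumes w: "w \<in> sym r" shows "bindex r g f P (pinv w) = bindex r f g P w"
proof -
  let ?A = "\<lambda>f g w. {(i, j) \<in> inversions r w. g i = g j \<and> P (g i) \<or> f (w i) = f (w j) \<and> P (f (w i))}"
  have r: "v i \<in> {1..r} \<longleftrightarrow> i \<in> {1..r}" if "v \<in> sym r" for v i
    using sym_mem[OF that, of i] by simp
  have sub: "(\<lambda>(i, j). (v j, v i)) ` ?A f g v \<subseteq> ?A g f (pinv v)" if v: "v \<in> sym r" for v f g
  proof (rule image_subsetI, simp only: split_paired_all)
    fix i j assume ij: "(i, j) \<in> ?A f g v"
    then have "i \<in> {1..r}" "j \<in> {1..r}" by (auto simp: inversions_def)
    then have "v i \<in> {1..r}" "v j \<in> {1..r}" using r[OF v] by blast+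
    then show "(case (i, j) of (i, j) \<Rightarrow> (v j, v i)) \<in> ?A g f (pinv v)"
      using ij v by (auto simp: inversions_def simp del: sym_mem sym_mem')
  qed
  have "bij_betw (\<lambda>(i, j). (w j, w i)) (?A f g w) (?A g f (pinv w))"
    using sub[OF w, where f = f and g = g] sub[OF sym_pinv[OF w], where f = g and g = f] w
    by (intro bij_betw_byWitness[where f' = "\<lambda>(i, j). (pinv w j, pinv w i)"]) auto
  then show ?thesis unfolding bindex_def by (simp add: bij_betw_same_card)
qed

text \<open>The reflection carries the old inversions along without changing their row and column
  blocks, as \<open>k\<close> and \<open>Suc k\<close> share a column; only the new inversion
  \<open>(k, Suc k)\<close> has to be tested.\<close>

lemma bindex_simple_right_gen:
  assumes w: "w \<in> sym r" and k: "k \<in> gens r g any_type" and up: "w k < w (Suc k)"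
  shows "bindex r f g P (w \<circ> simple_refl k) = 
    bindex r f g P w + (if P (g k) \<or> f (w k) = f (w (Suc k)) \<and> P (f (w k)) then 1 else 0)"
proof -
  let ?s = "simple_refl k"
  define C where "C = (\<lambda>w (i, j). g i = g j \<and> P (g i) \<or> f (w i) = f (w j) \<and> P (f (w i)))"
  have b: "bindex r f g P v = card {x \<in> inversions r v. C v x}" for v
    unfolding bindex_def C_def by (rule arg_cong[of _ _ card]) auto
  have gs: "g (?s i) = g i" for i using gensD(2)[OF k] by (cases "i = k \<or> i = Suc k") auto
  have C: "C (w \<circ> ?s) (map_prod ?s ?s x) = C w x" for x by (cases x) (simp add: C_def gs)
  have inj: "inj (map_prod ?s ?s)"
    by (metis injI simple_refl_simps(4) prod.inj_map)
  have nmem: "(k, Suc k) \<notin> map_prod ?s ?s ` inversions r w"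
  proof
    assume "(k, Suc k) \<in> map_prod ?s ?s ` inversions r w"
    then obtain i j where "k = ?s i" "Suc k = ?s j" "i < j" by (auto simp: inversions_def)
    then show False by (metis simple_refl_simps(1,2,4) not_less_iff_gr_or_eq lessI)
  qed
  define B where "B = map_prod ?s ?s ` {x \<in> inversions r w. C w x}"
  have iff: "C (w \<circ> ?s) (k, Suc k) \<longleftrightarrow> P (g k) \<or> f (w k) = f (w (Suc k)) \<and> P (f (w k))"
    using gensD(2)[OF k] by (auto simp: C_def)
  have eq: "{x \<in> inversions r (w \<circ> ?s). C (w \<circ> ?s) x} =
    (if C (w \<circ> ?s) (k, Suc k) then insert (k, Suc k) B else B)"
    unfolding inversions_simple_right[OF w gensD(1)[OF k] up] B_def using C by auto
  have "(k, Suc k) \<notin> B" unfolding B_def by (rule contra_subsetD[OF image_mono nmem]) auto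
  moreover have "finite B" by (simp add: B_def)
  moreover have "card B = card {x \<in> inversions r w. C w x}"
    unfolding B_def by (rule card_image[OF inj_on_subset[OF inj]]) simp
  ultimately show ?thesis unfolding b eq iff by auto
qed

text \<open>If the two values share a row block, the positions \<open>k\<close> and
  \<open>Suc k\<close> lie in one cell, which is not mixed. Row and column then have the same
  parity, and the column alone decides whether the new inversion counts.\<close>

lemma bindex_simple_right:
  assumes w: "w \<in> sym r" and k: "k \<in> gens r g any_type" and up: "w k < w (Suc k)" and ok: "parity_ok r m f g w"
  shows "bindex r f g (parity_type m e) (w \<circ> simple_refl k) = 
    bindex r f g (parity_type m e) w + (if parity_type m e (g k) then 1 else 0)"
proof -
  have "k \<in> {1..r}" "Suc k \<in> {1..r}" using gensD(1)[OF k] by auto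
  then have "f (w k) = f (w (Suc k)) \<Longrightarrow> f (w k) < m \<longleftrightarrow> g k < m"
    using parity_ok_cell[OF ok _ _ _ gensD(2)[OF k]] by simp
  then show ?thesis unfolding bindex_simple_right_gen[OF w k up] by (auto simp: parity_type_def)
qed

lemma bindex_simple_left:
  assumes w: "w \<in> sym r" and k: "k \<in> gens r f any_type" and up: "pinv w k < pinv w (Suc k)" and ok: "parity_ok r m f g w"
  shows "bindex r f g (parity_type m e) (simple_refl k \<circ> w) = 
    bindex r f g (parity_type m e) w + (if parity_type m e (f k) then 1 else 0)"
proof -
  have "bindex r f g (parity_type m e) (simple_refl k \<circ> w) = bindex r g f (parity_type m e) (pinv w \<circ> simple_refl k)"
    using bindex_pinv[OF simple_left_sym[OF w gensD(1)[OF k]]] pinv_simple_left[OF w gensD(1)[OF k]] by metis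
  also have "\<dots> = bindex r g f (parity_type m e) (pinv w) + (if parity_type m e (f k) then 1 else 0)"
    by (rule bindex_simple_right) (use w k up ok parity_ok_pinv in auto)
  finally show ?thesis using bindex_pinv[OF w] by simp
qed

lemma mat_of_simple_left: "w \<in> sym r \<Longrightarrow> k \<in> gens r f P \<Longrightarrow> mat_of r f g (simple_refl k \<circ> w) = mat_of r f g w"
  by (rule mat_of_comp_left[OF block_perms_simple])

lemma mat_of_simple_right: "w \<in> sym r \<Longrightarrow> k \<in> gens r g P \<Longrightarrow> mat_of r f g (w \<circ> simple_refl k) = mat_of r f g w"
  by (rule mat_of_comp_right[OF block_perms_simple])

text \<open>Generators of the parity opposite to e never change the index of type e, whether they
  lengthen or shorten.\<close>

lemma bindex_block_left:
  assumes f: "mono_on {1..r} f" and w: "w \<in> sym r" "parity_ok r m f g w" 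
    and a: "a \<in> block_perms r f (parity_type m (\<not> e))"
  shows "bindex r f g (parity_type m e) (a \<circ> w) = bindex r f g (parity_type m e) w"
  using f a
proof (induction rule: block_perms_induct)
  case (step a k)
  have aw: "a \<circ> w \<in> sym r" using step w block_perms_sym by blast
  have ok: "parity_ok r m f g (a \<circ> w)"
    using parity_ok_cong[OF mat_of_comp_left[OF step(1) w(1)]] w(2) by blast
  note k = gens_any[OF step(2)]
  have nt: "\<not> parity_type m e (f k)" using gensD(3)[OF step(2)] by (auto simp: parity_type_def)
  have "bindex r f g (parity_type m e) (simple_refl k \<circ> (a \<circ> w)) = bindex r f g (parity_type m e) (a \<circ> w)"
  proof (cases "pinv (a \<circ> w) k < pinv (a \<circ> w) (Suc k)")
    case True
    show ?thesis using bindex_simple_left[OF aw k True ok, of e] nt by simp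
  next
    case False
    define v where "v = simple_refl k \<circ> (a \<circ> w)"
    have v: "v \<in> sym r" unfolding v_def using aw gensD(1)[OF k] by blast
    have up: "pinv v k < pinv v (Suc k)" and awv: "a \<circ> w = simple_refl k \<circ> v"
      using False pinv_neq_Suc[OF aw, of k] pinv_simple_left[OF aw gensD(1)[OF k]] unfolding v_def by simp_all
    have "mat_of r f g v = mat_of r f g (a \<circ> w)" unfolding v_def by (rule mat_of_simple_left[OF aw k])
    then have "parity_ok r m f g v" using ok parity_ok_cong by blast
    then have "bindex r f g (parity_type m e) (simple_refl k \<circ> v) = bindex r f g (parity_type m e) v"
      using bindex_simple_left[OF v k up, of m g e] nt by simp
    then show ?thesis unfolding awv[symmetric] v_def by simp
  qed
  then show ?case using step(4) by (simp add: comp_def)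
qed simp

lemma bindex_block_right:
  assumes g: "mono_on {1..r} g" and w: "w \<in> sym r" "parity_ok r m f g w" 
    and a: "a \<in> block_perms r g (parity_type m (\<not> e))"
  shows "bindex r f g (parity_type m e) (w \<circ> a) = bindex r f g (parity_type m e) w"
proof -
  have "bindex r f g (parity_type m e) (w \<circ> a) = bindex r g f (parity_type m e) (pinv a \<circ> pinv w)"
    using bindex_pinv[OF sym_comp[OF w(1) block_perms_sym[OF a]]] sym_comp_pinv[OF w(1) block_perms_sym[OF a]] by metis
  also have "\<dots> = bindex r g f (parity_type m e) (pinv w)"
    by (rule bindex_block_left[OF g]) (use w a parity_ok_pinv in auto)
  finally show ?thesis using bindex_pinv[OF w(1)] by simp
qed

text \<open>d increases on column blocks and its inverse on row blocks, so no inversion stays inside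
  a block.\<close>

lemma bindex_min:
  assumes f: "mono_on {1..r} f" and g: "mono_on {1..r} g" and d: "d \<in> sym r" "asc r f any_type (pinv d)" "asc r g any_type d"
  shows "bindex r f g P d = 0"
proof -
  have "False" if ij: "1 \<le> i" "i < j" "j \<le> r" "d j < d i" "g i = g j \<or> f (d i) = f (d j)" for i j
  proof -
    have r: "i \<in> {1..r}" "j \<in> {1..r}" using ij by auto
    show False using ij(5)
    proof
      assume "g i = g j"
      then show False using asc_less[OF g d(3) r ij(2)] ij(4) by simp
    next
      assume "f (d i) = f (d j)"
      then show False
        using asc_less[OF f d(2) sym_range[OF d(1) r(2)] sym_range[OF d(1) r(1)] ij(4)] ij(2) d(1) by simp
    qed
  qed
  then have "{(i, j) \<in> inversions r d. g i = g j \<and> P (g i) \<or> f (d i) = f (d j) \<and> P (f (d i))} = {}"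
    by (auto simp: inversions_def)
  then show ?thesis unfolding bindex_def by (simp only: card.empty)
qed

text \<open>Each lengthening step inside the double coset raises exactly one of the two indices, by
  one, and both vanish at d.\<close>

lemma len_bindex:
  assumes f: "mono_on {1..r} f" and g: "mono_on {1..r} g" and d: "d \<in> sym r" "asc r f any_type (pinv d)" "asc r g any_type d"
    and ok: "parity_ok r m f g d" and w: "w \<in> sym r" "mat_of r f g w = mat_of r f g d"
  shows "len r w = len r d + bindex r f g (parity_type m True) w + bindex r f g (parity_type m False) w"
  using w
proof (induction rule: double_coset_induct[where f = f and g = g and P = any_type and P' = any_type])
  case (min w)
  then have "w = d" using bimin_unique f g d by blast
  then show ?case using bindex_min[OF f g d] by simp
next
  case (left w k)
  have m: "mat_of r f g w = mat_of r f g d" using left mat_of_simple_left by metis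
  then have "parity_ok r m f g w" using ok parity_ok_cong by blast
  note bi = bindex_simple_left[OF left(1-3) this]
  have "len r (simple_refl k \<circ> w) = len r d + bindex r f g (parity_type m True) (simple_refl k \<circ> w)
      + bindex r f g (parity_type m False) (simple_refl k \<circ> w)"
    using left(4)[OF m] len_simple_left[OF left(1) gensD(1)[OF left(2)] left(3)]
    unfolding bi by (simp add: parity_type_def[of _ _ "f k"])
  then show ?case by (simp add: comp_def)
next
  case (right w k)
  have m: "mat_of r f g w = mat_of r f g d" using right mat_of_simple_right by metis
  then have "parity_ok r m f g w" using ok parity_ok_cong by blast
  note bi = bindex_simple_right[OF right(1-3) this]
  have "len r (w \<circ> simple_refl k) = len r d + bindex r f g (parity_type m True) (w \<circ> simple_refl k)
      + bindex r f g (parity_type m False) (w \<circ> simple_refl k)"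
    using right(4)[OF m] len_simple_right[OF right(1) gensD(1)[OF right(2)] right(3)]
    unfolding bi by (simp add: parity_type_def[of _ _ "g k"])
  then show ?case by (simp add: comp_def)
qed

section \<open>Longest and shortest elements of double cosets\<close>

lemma longest:
  assumes "X \<subseteq> sym r" "X \<noteq> {}"
  shows "longest r X \<in> X" "w \<in> X \<Longrightarrow> len r w \<le> len r (longest r X)"
proof -
  obtain x where "x \<in> X" using assms by blast
  moreover have "\<forall>y. y \<in> X \<longrightarrow> len r y \<le> r * r" using assms(1) len_bound by blast
  ultimately have "arg_max (len r) (\<lambda>w. w \<in> X) \<in> X \<and> (\<forall>y. y \<in> X \<longrightarrow> len r y \<le> len r (arg_max (len r) (\<lambda>w. w \<in> X)))"
    by (intro arg_max_nat_lemma[of _ x _ "Suc (r * r)"]) (auto simp: less_Suc_eq_le)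
  then show "longest r X \<in> X" "w \<in> X \<Longrightarrow> len r w \<le> len r (longest r X)" by (auto simp: longest_def)
qed

lemma shortest:
  assumes "X \<noteq> {}"
  shows "shortest r X \<in> X" "w \<in> X \<Longrightarrow> len r (shortest r X) \<le> len r w"
proof -
  obtain x where "x \<in> X" using assms by blast
  then show "shortest r X \<in> X" "w \<in> X \<Longrightarrow> len r (shortest r X) \<le> len r w"
    using arg_min_nat_lemma[of "\<lambda>w. w \<in> X" x "len r"] by (auto simp: shortest_def)
qed

definition mat_perms :: "nat \<Rightarrow> (nat \<Rightarrow> nat) \<Rightarrow> (nat \<Rightarrow> nat) \<Rightarrow> nmat \<Rightarrow> perm set" where
  "mat_perms r f g A = {w \<in> sym r. mat_of r f g w = A}"

lemma shortest_asc:
  assumes "mat_perms r f g A \<noteq> {}" 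
  shows "shortest r (mat_perms r f g A) \<in> sym r" "mat_of r f g (shortest r (mat_perms r f g A)) = A"
    "asc r f any_type (pinv (shortest r (mat_perms r f g A)))" "asc r g any_type (shortest r (mat_perms r f g A))"
proof -
  define d where "d = shortest r (mat_perms r f g A)"
  have dA: "d \<in> mat_perms r f g A" and min: "\<And>w. w \<in> mat_perms r f g A \<Longrightarrow> len r d \<le> len r w"
    using shortest[OF assms] by (auto simp: d_def)
  then have d: "d \<in> sym r" "mat_of r f g d = A" by (auto simp: mat_perms_def)
  show "shortest r (mat_perms r f g A) \<in> sym r" "mat_of r f g (shortest r (mat_perms r f g A)) = A"
    using d by (auto simp: d_def)
  have "pinv d k < pinv d (Suc k)" if k: "k \<in> gens r f any_type" for k
  proof (rule ccontr)
    assume n: "\<not> ?thesis"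
    have v: "simple_refl k \<circ> d \<in> sym r" using gensD(1)[OF k] d(1) by blast
    have "pinv (simple_refl k \<circ> d) k < pinv (simple_refl k \<circ> d) (Suc k)"
      using n pinv_neq_Suc[OF d(1)] pinv_simple_left[OF d(1) gensD(1)[OF k]] by simp
    then have "len r d = Suc (len r (simple_refl k \<circ> d))"
      using len_simple_left[OF v gensD(1)[OF k]] by simp
    moreover have "simple_refl k \<circ> d \<in> mat_perms r f g A"
      using v mat_of_simple_left[OF d(1) k] d(2) by (simp add: mat_perms_def)
    ultimately show False using min by fastforce
  qed
  then show "asc r f any_type (pinv (shortest r (mat_perms r f g A)))" by (simp add: asc_def d_def)
  have "d k < d (Suc k)" if k: "k \<in> gens r g any_type" for k
  proof (rule ccontr)
    assume n: "\<not> ?thesis"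
    have v: "d \<circ> simple_refl k \<in> sym r" using gensD(1)[OF k] d(1) by blast
    have "(d \<circ> simple_refl k) k < (d \<circ> simple_refl k) (Suc k)"
      using n sym_neq_Suc[OF d(1)] by simp
    then have "len r d = Suc (len r (d \<circ> simple_refl k))"
      using len_simple_right[OF v gensD(1)[OF k]] by simp
    moreover have "d \<circ> simple_refl k \<in> mat_perms r f g A"
      using v mat_of_simple_right[OF d(1) k] d(2) by (simp add: mat_perms_def)
    ultimately show False using min by fastforce
  qed
  then show "asc r g any_type (shortest r (mat_perms r f g A))" by (simp add: asc_def d_def)
qed

lemma mat_perms_sub: "mat_perms r f g A \<subseteq> sym r" by (auto simp: mat_perms_def)

text \<open>z descends at all generators on both sides, and by uniqueness with sign -1 no other
  element of the double coset does. Climbing from w by lengthening steps, each of them upward in the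
  Bruhat order, must therefore end at z.\<close>

lemma bruhat_longest:
  assumes f: "mono_on {1..r} f" and g: "mono_on {1..r} g" and w: "w \<in> mat_perms r f g A"
  shows "bruhat_le r w (longest r (mat_perms r f g A))"
proof -
  define z where "z = longest r (mat_perms r f g A)"
  have ne: "mat_perms r f g A \<noteq> {}" using w by blast
  have zA: "z \<in> mat_perms r f g A" and max: "\<And>w. w \<in> mat_perms r f g A \<Longrightarrow> len r w \<le> len r z"
    using longest[OF mat_perms_sub ne] by (auto simp: z_def)
  then have z: "z \<in> sym r" "mat_of r f g z = A" by (auto simp: mat_perms_def)
  have zl: "pinv z (Suc k) < pinv z k" if k: "k \<in> gens r f any_type" for k
  proof (rule ccontr)
    assume "\<not> ?thesis"
    then have "pinv z k < pinv z (Suc k)" using pinv_neq_Suc[OF z(1), of k] by blast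
    then have "len r (simple_refl k \<circ> z) = Suc (len r z)" by (rule len_simple_left[OF z(1) gensD(1)[OF k]])
    moreover have "simple_refl k \<circ> z \<in> mat_perms r f g A"
      using gensD(1)[OF k] mat_of_simple_left[OF z(1) k] z unfolding mat_perms_def by blast
    ultimately show False using max by fastforce
  qed
  have zr: "z (Suc k) < z k" if k: "k \<in> gens r g any_type" for k
  proof (rule ccontr)
    assume "\<not> ?thesis"
    then have "z k < z (Suc k)" using sym_neq_Suc[OF z(1), of k] by blast
    then have "len r (z \<circ> simple_refl k) = Suc (len r z)" by (rule len_simple_right[OF z(1) gensD(1)[OF k]])
    moreover have "z \<circ> simple_refl k \<in> mat_perms r f g A"
      using gensD(1)[OF k] mat_of_simple_right[OF z(1) k] z unfolding mat_perms_def by blast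
    ultimately show False using max by fastforce
  qed
  have "w \<in> sym r" "mat_of r f g w = A" using w by (auto simp: mat_perms_def)
  then have "bruhat_le r w z"
  proof (induction rule: double_coset_induct_up[where f = f and g = g and P = any_type and P' = any_type])
    case (max w)
    have "w = z"
      using ordered_unique[OF f max(1) z(1), of "- 1" g] desc_ordered[OF g max(3)] desc_ordered[OF f max(2)]
        desc_ordered[OF g, of z] desc_ordered[OF f, of "pinv z"] zl zr max(4) z(2) by simp
    then show ?case by simp
  next
    case (left w k)
    then show ?case using mat_of_simple_left bruhat_simple_left[OF left(1) gensD(1)[OF left(2)] left(3)] bruhat_trans by metis
  next
    case (right w k)
    then show ?case using mat_of_simple_right bruhat_simple_right[OF right(1) gensD(1)[OF right(2)] right(3)] bruhat_trans by metis
  qed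
  then show ?thesis by (simp add: z_def)
qed

text \<open>For the shortest element d of a double coset, its longest element is
  \<open>even_dmax\<close> for e true and \<open>odd_dmax\<close> for e false.\<close>

definition part_coset :: "nat \<Rightarrow> nat \<Rightarrow> (nat \<Rightarrow> nat) \<Rightarrow> (nat \<Rightarrow> nat) \<Rightarrow> perm \<Rightarrow> bool \<Rightarrow> perm set" where
  "part_coset r m f g d e = {a \<circ> d \<circ> b | a b. a \<in> block_perms r f (parity_type m e) \<and> b \<in> block_perms r g (parity_type m e)}"

text \<open>On a part coset only the index of its own parity varies, so its longest element
  maximises that index. Multiplication by elements of the other parity does not affect it, so this
  is the maximum over the whole double coset as well. It remains to see that z, which maximises the
  sum of both indices, attains both maxima at once.\<close>

lemma len_longest_part:
  assumes f: "mono_on {1..r} f" and g: "mono_on {1..r} g" and d: "d \<in> sym r" "asc r f any_type (pinv d)" "asc r g any_type d"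
    and ok: "parity_ok r m f g d"
  defines "z \<equiv> longest r (mat_perms r f g (mat_of r f g d))"
  shows "len r (longest r (part_coset r m f g d e)) = len r d + bindex r f g (parity_type m e) z"
proof -
  let ?i = "\<lambda>e. bindex r f g (parity_type m e)"
  let ?D = "mat_perms r f g (mat_of r f g d)"
  have okw: "parity_ok r m f g w" if "w \<in> ?D" for w
    using that ok parity_ok_cong unfolding mat_perms_def by blast
  have len: "len r w = len r d + ?i True w + ?i False w" if "w \<in> ?D" for w
    using len_bindex[OF f g d ok] that by (simp add: mat_perms_def)
  have dD: "d \<in> ?D" using d by (simp add: mat_perms_def)
  have zD: "z \<in> ?D" and zmax: "\<And>w. w \<in> ?D \<Longrightarrow> len r w \<le> len r z"
    using longest[OF mat_perms_sub, of r f g "mat_of r f g d"] dD unfolding z_def by blast+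
  define y where "y = (\<lambda>e. longest r (part_coset r m f g d e))"
  have abD: "a \<circ> d \<circ> b \<in> ?D" if "a \<in> block_perms r f P" "b \<in> block_perms r g P'" for a b P P'
  proof -
    have "a \<circ> d \<circ> b \<in> sym r" using that d block_perms_sym by blast
    then show ?thesis using mat_of_comp[OF that(1) d(1) that(2)] by (simp add: mat_perms_def)
  qed
  have sub: "part_coset r m f g d e \<subseteq> ?D" for e unfolding part_coset_def using abD by blast
  have ne: "part_coset r m f g d e \<noteq> {}" for e unfolding part_coset_def by blast
  have yD: "y e \<in> part_coset r m f g d e" and ymax: "\<And>w. w \<in> part_coset r m f g d e \<Longrightarrow> len r w \<le> len r (y e)" for e
    using longest[OF subset_trans[OF sub mat_perms_sub] ne] unfolding y_def by blast+
  have inv: "?i e (a \<circ> w \<circ> b) = ?i e w" if "a \<in> block_perms r f (parity_type m (\<not> e))" "b \<in> block_perms r g (parity_type m (\<not> e))"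
    "w \<in> ?D" for a b w e
  proof -
    have w: "w \<in> sym r" "parity_ok r m f g w" using that okw by (auto simp: mat_perms_def)
    have aw: "a \<circ> w \<in> sym r" "parity_ok r m f g (a \<circ> w)"
      using w that(1) block_perms_sym parity_ok_cong[OF mat_of_comp_left[OF that(1) w(1)]] by blast+
    show ?thesis using bindex_block_right[OF g aw that(2)] bindex_block_left[OF f w that(1)] by simp
  qed
  have i0: "?i (\<not> e) w = 0" if "w \<in> part_coset r m f g d e" for w e
    using that inv[of _ "\<not> e" _ d] dD bindex_min[OF f g d] unfolding part_coset_def by auto
  have leny: "len r w = len r d + ?i e w" if "w \<in> part_coset r m f g d e" for w e
    using len[of w] i0[OF that] sub that by (cases e) auto
  have decomp: "\<exists>a b a' b'. a \<in> block_perms r f (parity_type m e) \<and> b \<in> block_perms r g (parity_type m e) \<and>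
      a' \<in> block_perms r f (parity_type m (\<not> e)) \<and> b' \<in> block_perms r g (parity_type m (\<not> e)) \<and>
      w = a' \<circ> (a \<circ> d \<circ> b) \<circ> b'" if wD: "w \<in> ?D" for w e
  proof -
    obtain A B where AB: "A \<in> block_perms r f any_type" "B \<in> block_perms r g any_type" "w = A \<circ> d \<circ> B"
      using double_coset_decomp[OF f g d, of w] wD unfolding mat_perms_def by blast
    obtain a a' where a: "a \<in> block_perms r f (parity_type m e)" "a' \<in> block_perms r f (parity_type m (\<not> e))" "A = a \<circ> a'"
      using block_perms_split[OF AB(1)] by blast
    obtain b b' where b: "b \<in> block_perms r g (parity_type m e)" "b' \<in> block_perms r g (parity_type m (\<not> e))" "B = b \<circ> b'"
      using block_perms_split[OF AB(2)] by blast
    have "w = a' \<circ> (a \<circ> d \<circ> b) \<circ> b'" using AB(3) a(3) b(3) block_perms_commute[OF a(1,2)] by (simp add: comp_assoc)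
    then show ?thesis using a b by blast
  qed
  have le: "?i e w \<le> ?i e (y e)" if wD: "w \<in> ?D" for w e
  proof -
    obtain a b a' b' where ab: "a \<in> block_perms r f (parity_type m e)" "b \<in> block_perms r g (parity_type m e)"
      "a' \<in> block_perms r f (parity_type m (\<not> e))" "b' \<in> block_perms r g (parity_type m (\<not> e))"
      "w = a' \<circ> (a \<circ> d \<circ> b) \<circ> b'" using decomp[OF wD] by blast
    have "a \<circ> d \<circ> b \<in> part_coset r m f g d e" using ab unfolding part_coset_def by blast
    then have "?i e (a \<circ> d \<circ> b) \<le> ?i e (y e)" using ymax[of "a \<circ> d \<circ> b" e] leny[of _ e] yD[of e] by simp
    moreover have "?i e w = ?i e (a \<circ> d \<circ> b)" unfolding ab(5) by (rule inv[OF ab(3,4) abD[OF ab(1,2)]])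
    ultimately show ?thesis by simp
  qed
  obtain a b where ab: "a \<in> block_perms r f (parity_type m True)" "b \<in> block_perms r g (parity_type m True)" "y True = a \<circ> d \<circ> b"
    using yD[of True] unfolding part_coset_def by blast
  obtain a' b' where ab': "a' \<in> block_perms r f (parity_type m False)" "b' \<in> block_perms r g (parity_type m False)" "y False = a' \<circ> d \<circ> b'"
    using yD[of False] unfolding part_coset_def by blast
  \<comment> \<open>Glues the two maximisers together. Since even and odd factors commute, w is a
    two-sided multiple of each of them by elements of the other parity, and so inherits both maximal
    indices.\<close>
  define w where "w = a' \<circ> y True \<circ> b'"
  have w': "w = a \<circ> y False \<circ> b"
    using block_perms_commute[OF ab(1), of a'] block_perms_commute[OF ab(2), of b'] ab' ab(3) ab'(3)
    unfolding w_def by (simp add: comp_assoc) (metis comp_assoc)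
  have yD': "y e \<in> ?D" for e using yD sub by blast
  have wD: "w \<in> ?D"
  proof -
    have "y True \<in> sym r" "mat_of r f g (y True) = mat_of r f g d" using yD'[of True] by (auto simp: mat_perms_def)
    then have "w \<in> sym r" "mat_of r f g w = mat_of r f g d"
      unfolding w_def using ab' block_perms_sym mat_of_comp[OF ab'(1) _ ab'(2)] by (blast, metis)
    then show ?thesis by (simp add: mat_perms_def)
  qed
  have "?i True w = ?i True (y True)" unfolding w_def by (rule inv) (use ab' yD' in auto)
  moreover have "?i False w = ?i False (y False)" unfolding w' by (rule inv) (use ab yD' in auto)
  ultimately have "len r w = len r d + ?i True (y True) + ?i False (y False)" using len[OF wD] by simp
  then have "?i True (y True) + ?i False (y False) \<le> ?i True z + ?i False z"
    using zmax[OF wD] len[OF zD] by simp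
  then have "?i e (y e) = ?i e z" using le[OF zD, of True] le[OF zD, of False] by (cases e) auto
  then show ?thesis using leny[OF yD] by (simp add: y_def)
qed

text \<open>A vector that is an eigenvector on both sides has coefficient 0 at such a d, since it would be
  scaled there by two different factors. This is why mixed entries above 1 do not occur.\<close>
lemma mixed_cell:
  assumes f: "mono_on {1..r} f" and g: "mono_on {1..r} g" and d: "d \<in> sym r" "asc r f any_type (pinv d)" "asc r g any_type d"
    and "\<not> parity_ok r m f g d"
  obtains k l where "k \<in> gens r g any_type" "l \<in> gens r f any_type" "pinv d l < pinv d (Suc l)" "d k < d (Suc k)"
    "d \<circ> simple_refl k = simple_refl l \<circ> d" "(f l < m) \<noteq> (g k < m)"
proof -
  obtain i j where ij: "(i < m) \<noteq> (j < m)" "1 < card {p \<in> {1..r}. f (d p) = i \<and> g p = j}"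
    using assms(6) unfolding parity_ok_def mat_of_def by (meson not_le)
  then obtain p q where pq: "p \<in> {1..r}" "q \<in> {1..r}" "p < q" "f (d p) = i" "g p = j" "f (d q) = i" "g q = j"
  proof -
    define X where "X = {p \<in> {1..r}. f (d p) = i \<and> g p = j}"
    have "finite X" by (simp add: X_def)
    then have "\<not> (\<forall>x\<in>X. \<forall>y\<in>X. x = y)" using ij(2) card_le_Suc0_iff_eq[of X] unfolding X_def by linarith
    then obtain x y where xy: "x \<in> X" "y \<in> X" "x < y" by (metis nat_neq_iff)
    then show ?thesis using that[of x y] by (simp add: X_def)
  qed
  have k: "p \<in> gens r g any_type" using gens_interval[OF g pq(1,2), of any_type p] pq by simp
  have Sp: "Suc p \<in> {1..r}" using gensD(1)[OF k] by simp
  have dr: "d p \<in> {1..r}" "d (Suc p) \<in> {1..r}" "d q \<in> {1..r}" using sym_range[OF d(1)] pq Sp by blast+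
  have up: "d p < d (Suc p)" using ascD[OF d(3) k] .
  have "d (Suc p) \<le> d q"
  proof (cases "Suc p = q")
    case False
    then have "d (Suc p) < d q" using asc_less[OF g d(3) Sp pq(2)] pq gensD(2)[OF k] by simp
    then show ?thesis by simp
  qed simp
  then have "f (d p) \<le> f (d (Suc p))" "f (d (Suc p)) \<le> f (d q)" using mono_onD[OF f] dr up by simp_all
  then have fe: "f (d (Suc p)) = f (d p)" using pq by simp
  \<comment> \<open>A value strictly between would, by the increase of \<open>pinv d\<close> on the
    row block, sit at a position strictly between \<open>p\<close> and \<open>Suc p\<close>.\<close>
  have "d (Suc p) = Suc (d p)"
  proof (rule ccontr)
    assume "d (Suc p) \<noteq> Suc (d p)"
    then have x: "Suc (d p) < d (Suc p)" using up by simp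
    then have xr: "Suc (d p) \<in> {1..r}" using dr by auto
    have "f (d p) \<le> f (Suc (d p))" "f (Suc (d p)) \<le> f (d (Suc p))" using mono_onD[OF f] dr xr x by simp_all
    then have fx: "f (Suc (d p)) = f (d p)" using fe by simp
    have "pinv d (d p) < pinv d (Suc (d p))" "pinv d (Suc (d p)) < pinv d (d (Suc p))"
      using asc_less[OF f d(2) dr(1) xr] asc_less[OF f d(2) xr dr(2)] fx fe x by simp_all
    then show False using d(1) by simp
  qed
  then have l: "d p \<in> gens r f any_type" "d \<circ> simple_refl p = simple_refl (d p) \<circ> d"
    using dr fe comp_transpose_conj[OF d(1), of p "Suc p"] by (auto simp: gens_def simple_refl_def)
  show ?thesis
    using that[OF k l(1) ascD[OF d(2) l(1)] up l(2)] pq ij(1) by auto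
qed

section \<open>Coset representatives occurring in T_D\<close>

definition cell_reps :: "nat \<Rightarrow> nat \<Rightarrow> (nat \<Rightarrow> nat) \<Rightarrow> (nat \<Rightarrow> nat) \<Rightarrow> perm \<Rightarrow> bool \<Rightarrow> perm set" where
  "cell_reps r m f g d e = {u \<in> block_perms r g (parity_type m e).
    \<forall>p\<in>{1..r}. \<forall>q\<in>{1..r}. p < q \<longrightarrow> g p = g q \<longrightarrow> f (d p) = f (d q) \<longrightarrow> parity_type m e (g p) \<longrightarrow> pinv u p < pinv u q}"

text \<open>\<open>conj_inter\<close> is in effect the parabolic subgroup whose blocks are the cells
  of d in columns of parity e, and the shortest elements of its cosets P u are those whose inverse
  increases on these cells. The absence of mixed cells guarantees that a cell with several points in
  a column of parity e also lies in a row of parity e.\<close>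

lemma min_right_reps_eq:
  assumes f: "mono_on {1..r} f" and g: "mono_on {1..r} g" and d: "d \<in> sym r" "asc r g any_type d"
    and ok: "parity_ok r m f g d"
  shows "min_right_reps r (conj_inter d (block_perms r f (parity_type m e)) (block_perms r g (parity_type m e)))
    (block_perms r g (parity_type m e)) = cell_reps r m f g d e"
proof -
  let ?X = "block_perms r f (parity_type m e)" and ?Y = "block_perms r g (parity_type m e)"
  \<comment> \<open>The function h refines the column blocks by the cells of d; thus u is minimal for its parabolic
    subgroup, and the additivity of the length applies.\<close>
  define N where "N = Suc (f r)"
  define h where "h = (\<lambda>p. g p * N + f (d p))"
  define P where "P = (\<lambda>i. parity_type m e (i div N))"
  have fN: "f (d p) < N" if "p \<in> {1..r}" for p
  proof -
    have dp: "d p \<in> {1..r}" using sym_range[OF d(1) that] .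
    then have "f (d p) \<le> f r" by (intro mono_onD[OF f]) auto
    then show ?thesis by (simp add: N_def)
  qed
  have hdiv: "h p div N = g p" "h p mod N = f (d p)" if "p \<in> {1..r}" for p using fN[OF that] by (simp_all add: h_def)
  have heq: "h p = h q \<longleftrightarrow> g p = g q \<and> f (d p) = f (d q)" if "p \<in> {1..r}" "q \<in> {1..r}" for p q
    using hdiv[OF that(1)] hdiv[OF that(2)] by (auto simp: h_def)
  have Ph: "P (h p) = parity_type m e (g p)" if "p \<in> {1..r}" for p using hdiv[OF that] by (simp add: P_def)
  have h: "mono_on {1..r} h"
  proof (rule mono_onI)
    fix p q assume pq: "p \<in> {1..r}" "q \<in> {1..r}" "p \<le> q"
    have "g p \<le> g q" using mono_onD[OF g pq] .
    show "h p \<le> h q"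
    proof (cases "g p = g q")
      case True
      have "d p \<le> d q" using asc_less[OF g d(2) pq(1,2)] True pq(3) by (cases "p = q") auto
      then have "f (d p) \<le> f (d q)" by (intro mono_onD[OF f] sym_range[OF d(1)] pq)
      then show ?thesis using True by (simp add: h_def)
    next
      case False
      then have "Suc (g p) * N \<le> g q * N" using \<open>g p \<le> g q\<close> by (intro mult_right_mono) auto
      then show ?thesis using fN[OF pq(1)] by (simp add: h_def)
    qed
  qed
  have reps: "cell_reps r m f g d e = {u \<in> ?Y. asc r h P (pinv u)}"
  proof (intro equalityI subsetI)
    fix u assume u: "u \<in> cell_reps r m f g d e"
    have "pinv u k < pinv u (Suc k)" if k: "k \<in> gens r h P" for k
    proof -
      have "k \<in> {1..r}" "Suc k \<in> {1..r}" using gensD(1)[OF k] by auto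
      then show ?thesis using u gensD(2,3)[OF k] heq[of k "Suc k"] Ph[of k] unfolding cell_reps_def by simp
    qed
    then show "u \<in> {u \<in> ?Y. asc r h P (pinv u)}" using u by (auto simp: asc_def cell_reps_def)
  next
    fix u assume u: "u \<in> {u \<in> ?Y. asc r h P (pinv u)}"
    then show "u \<in> cell_reps r m f g d e"
      using asc_less[OF h, of P "pinv u"] heq Ph unfolding cell_reps_def by auto
  qed
  have sub: "conj_inter d ?X ?Y \<subseteq> block_perms r h P"
  proof
    fix p assume "p \<in> conj_inter d ?X ?Y"
    then obtain w where w: "w \<in> ?X" "p = pinv d \<circ> w \<circ> d" and p: "p \<in> ?Y" by (auto simp: conj_inter_def)
    note ps = block_perms_sym[OF p]
    have "h (p x) = h x" "\<not> P (h x) \<Longrightarrow> p x = x" if x: "x \<in> {1..r}" for x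
    proof -
      have "f (d (p x)) = f (d x)" using w d(1) block_permsD(1)[OF w(1) sym_range[OF d(1) x]] by simp
      then show "h (p x) = h x" using heq[OF sym_range[OF ps x] x] block_permsD(1)[OF p x] by simp
      show "\<not> P (h x) \<Longrightarrow> p x = x" using Ph[OF x] block_permsD(2)[OF p x] by simp
    qed
    then show "p \<in> block_perms r h P" using ps unfolding block_perms_def by blast
  qed
  show ?thesis unfolding reps
  proof (intro equalityI subsetI)
    fix u assume u: "u \<in> {u \<in> ?Y. asc r h P (pinv u)}"
    then have us: "u \<in> sym r" using block_perms_sym by blast
    have "len r u \<le> len r (p \<circ> u)" if "p \<in> conj_inter d ?X ?Y" for p
    proof -
      have "p \<in> block_perms r h P" using that sub by blast
      then show ?thesis using len_block_comp[OF h _ us] u by simp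
    qed
    then show "u \<in> min_right_reps r (conj_inter d ?X ?Y) ?Y" using u by (auto simp: min_right_reps_def)
  next
    fix u assume u: "u \<in> min_right_reps r (conj_inter d ?X ?Y) ?Y"
    then have uY: "u \<in> ?Y" and min: "\<And>p. p \<in> conj_inter d ?X ?Y \<Longrightarrow> len r u \<le> len r (p \<circ> u)"
      by (auto simp: min_right_reps_def)
    note us = block_perms_sym[OF uY]
    have "pinv u k < pinv u (Suc k)" if k: "k \<in> gens r h P" for k
    proof (rule ccontr)
      assume n: "\<not> ?thesis"
      let ?s = "simple_refl k"
      have kr: "k \<in> {1..r}" "Suc k \<in> {1..r}" "k \<in> {1..<r}" using gensD(1)[OF k] by auto
      have e: "g k = g (Suc k)" "f (d k) = f (d (Suc k))" "parity_type m e (g k)"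
        using heq[OF kr(1,2)] gensD(2,3)[OF k] Ph[OF kr(1)] by auto
      have sY: "?s \<in> ?Y" using e kr(3) by (intro block_perms_simple) (simp add: gens_def)
      have fd: "f (d (?s y)) = f (d y)" for y using e by (cases "y = k \<or> y = Suc k") auto
      have pe: "parity_type m e (f (d k))"
        using parity_ok_cell[OF ok kr(1,2)] e by (simp add: parity_type_def)
      \<comment> \<open>The conjugate of the reflection by d. As the row block of \<open>d k\<close>
        has parity e, it belongs to the row subgroup, so that the reflection itself lies in
        \<open>conj_inter\<close>.\<close>
      define w where "w = d \<circ> ?s \<circ> pinv d"
      have "f (w x) = f x \<and> (\<not> parity_type m e (f x) \<longrightarrow> w x = x)" for x
      proof -
        have "?s (pinv d x) = pinv d x" if "\<not> parity_type m e (f x)"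
        proof -
          have "pinv d x \<noteq> k" "pinv d x \<noteq> Suc k" using that pe e(2) d(1) sym_apply_pinv[OF d(1), of x] by metis+
          then show ?thesis by simp
        qed
        then show ?thesis using fd[of "pinv d x"] d(1) by (auto simp: w_def)
      qed
      moreover have "w \<in> sym r" unfolding w_def using d(1) kr(3) by blast
      ultimately have "w \<in> ?X" unfolding block_perms_def by blast
      moreover have "?s = pinv d \<circ> w \<circ> d" using d(1) by (auto simp: w_def fun_eq_iff)
      ultimately have "?s \<in> conj_inter d ?X ?Y" using sY unfolding conj_inter_def by blast
      then have "len r u \<le> len r (?s \<circ> u)" by (rule min)
      moreover have "len r u = Suc (len r (?s \<circ> u))"
        using n len_simple_left[OF simple_left_sym[OF us kr(3)] kr(3)] pinv_simple_left[OF us kr(3)] pinv_neq_Suc[OF us, of k]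
        by simp
      ultimately show False by simp
    qed
    then show "u \<in> {u \<in> ?Y. asc r h P (pinv u)}" using uY by (auto simp: asc_def)
  qed
qed

lemma block_perms_parity_disjoint:
  assumes "u \<in> block_perms r g (parity_type m True)" "u \<in> block_perms r g (parity_type m False)"
  shows "u = id"
proof (rule sym_eqI[OF block_perms_sym[OF assms(1)] sym_id])
  fix x assume "x \<in> {1..r}"
  then show "u x = id x"
    using block_permsD(2)[OF assms(1), of x] block_permsD(2)[OF assms(2), of x] by (auto simp: parity_type_def)
qed

text \<open>An element of the double coset that is minimal for the row subgroup differs from d by a
  column permutation b, which splits as u v. Its inverse must increase on each row block; between
  different columns this is automatic, and within a cell it is the condition on u or on v, according
  to the parity of the column.\<close>

lemma left_min_decomp:
  assumes f: "mono_on {1..r} f" and g: "mono_on {1..r} g" and d: "d \<in> sym r" "asc r f any_type (pinv d)" "asc r g any_type d"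
  shows "bij_betw (\<lambda>(u, v). d \<circ> u \<circ> v) (cell_reps r m f g d True \<times> cell_reps r m f g d False)
    {w \<in> mat_perms r f g (mat_of r f g d). asc r f any_type (pinv w)}" (is "bij_betw ?F ?A ?B")
proof (rule bij_betw_imageI)
  let ?E = "block_perms r g (parity_type m True)" and ?O = "block_perms r g (parity_type m False)"
  have any: "u \<in> block_perms r g any_type" if "u \<in> block_perms r g Q" for u Q
    using that block_perms_mono[of Q any_type r g] by blast
  show "inj_on ?F ?A"
  proof (rule inj_onI, clarify)
    fix u v u' v' assume "u \<in> cell_reps r m f g d True" "v \<in> cell_reps r m f g d False"
      "u' \<in> cell_reps r m f g d True" "v' \<in> cell_reps r m f g d False" and eq: "d \<circ> u \<circ> v = d \<circ> u' \<circ> v'"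
    then have m: "u \<in> ?E" "v \<in> ?O" "u' \<in> ?E" "v' \<in> ?O" by (auto simp: cell_reps_def)
    note s = m[THEN block_perms_sym]
    have uv: "u (v x) = u' (v' x)" for x using fun_cong[OF eq, of x] d(1) by simp
    have "pinv u' \<circ> u = v' \<circ> pinv v"
    proof
      fix x show "(pinv u' \<circ> u) x = (v' \<circ> pinv v) x" using uv[of "pinv v x"] s by simp
    qed
    moreover have "pinv u' \<circ> u \<in> ?E" "v' \<circ> pinv v \<in> ?O" using m by blast+
    ultimately have id: "pinv u' \<circ> u = id" "v' \<circ> pinv v = id" using block_perms_parity_disjoint by metis+
    show "u = u' \<and> v = v'"
    proof (intro conjI ext)
      fix x
      show "u x = u' x" using fun_cong[OF id(1), of x] s sym_apply_pinv[OF s(3), of "u x"] by simp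
      show "v x = v' x" using fun_cong[OF id(2), of "v x"] s by simp
    qed
  qed
  have key: "asc r f any_type (pinv (d \<circ> u \<circ> v)) \<longleftrightarrow> u \<in> cell_reps r m f g d True \<and> v \<in> cell_reps r m f g d False"
    if u: "u \<in> ?E" and v: "v \<in> ?O" for u v
  proof -
    note us = block_perms_sym[OF u] and vs = block_perms_sym[OF v]
    have pinv: "pinv (d \<circ> u \<circ> v) = pinv v \<circ> pinv u \<circ> pinv d"
    proof -
      have "d \<circ> u \<in> sym r" using d us by blast
      then show ?thesis using sym_comp_pinv[OF _ vs, of "d \<circ> u"] sym_comp_pinv[OF d(1) us] by (simp add: comp_assoc)
    qed
    have pv: "pinv v (pinv u x) = pinv u x" if "x \<in> {1..r}" "g x < m" for x
    proof -
      have "pinv u x \<in> {1..r}" "g (pinv u x) = g x"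
        using pinv_range[OF us that(1)] block_permsD(1)[OF block_perms_pinv[OF u] that(1)] by auto
      then show ?thesis using block_permsD(2)[OF block_perms_pinv[OF v]] that by (simp add: parity_type_def)
    qed
    have pu: "pinv u x = x" if "x \<in> {1..r}" "\<not> g x < m" for x
      using block_permsD(2)[OF block_perms_pinv[OF u]] that by (simp add: parity_type_def)
    have gp: "g (pinv v (pinv u x)) = g x" if x: "x \<in> {1..r}" for x
      using block_permsD(1)[OF block_perms_pinv[OF u] x] block_permsD(1)[OF block_perms_pinv[OF v] pinv_range[OF us x]] by simp
    show ?thesis
    proof
      assume asc: "asc r f any_type (pinv (d \<circ> u \<circ> v))"
      have *: "pinv v (pinv u p) < pinv v (pinv u q)" if pq: "p \<in> {1..r}" "q \<in> {1..r}" "p < q" "g p = g q" "f (d p) = f (d q)" for p q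
      proof -
        have "d p < d q" using asc_less[OF g d(3)] pq by simp
        then have "pinv (d \<circ> u \<circ> v) (d p) < pinv (d \<circ> u \<circ> v) (d q)"
          by (intro asc_less[OF f asc] sym_range[OF d(1)] pq) auto
        then show ?thesis using d(1) by (simp add: pinv)
      qed
      show "u \<in> cell_reps r m f g d True \<and> v \<in> cell_reps r m f g d False"
      proof
        show "u \<in> cell_reps r m f g d True" unfolding cell_reps_def
        proof (intro CollectI conjI ballI impI u)
          fix p q assume "p \<in> {1..r}" "q \<in> {1..r}" "p < q" "g p = g q" "f (d p) = f (d q)" "parity_type m True (g p)"
          then show "pinv u p < pinv u q" using *[of p q] pv[of p] pv[of q] by (simp add: parity_type_def)
        qed
        show "v \<in> cell_reps r m f g d False" unfolding cell_reps_def
        proof (intro CollectI conjI ballI impI v)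
          fix p q assume "p \<in> {1..r}" "q \<in> {1..r}" "p < q" "g p = g q" "f (d p) = f (d q)" "parity_type m False (g p)"
          then show "pinv v p < pinv v q" using *[of p q] pu[of p] pu[of q] by (simp add: parity_type_def)
        qed
      qed
    next
      assume c: "u \<in> cell_reps r m f g d True \<and> v \<in> cell_reps r m f g d False"
      show "asc r f any_type (pinv (d \<circ> u \<circ> v))" unfolding asc_def
      proof
        fix k assume k: "k \<in> gens r f any_type"
        define p q where "p = pinv d k" and "q = pinv d (Suc k)"
        have "p < q" using ascD[OF d(2) k] by (simp add: p_def q_def)
        have kr: "k \<in> {1..r}" "Suc k \<in> {1..r}" using gensD(1)[OF k] by auto
        have r: "p \<in> {1..r}" "q \<in> {1..r}" unfolding p_def q_def using pinv_range[OF d(1)] kr by blast+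
        have fe: "f (d p) = f (d q)" using gensD(2)[OF k] d(1) by (simp add: p_def q_def)
        have "pinv v (pinv u p) < pinv v (pinv u q)"
        proof (cases "g p = g q")
          case True
          show ?thesis
          proof (cases "g p < m")
            case T: True
            then have "pinv u p < pinv u q" using c r \<open>p < q\<close> True fe unfolding cell_reps_def by (simp add: parity_type_def)
            then show ?thesis using pv[of p] pv[of q] T True r by simp
          next
            case F: False
            then have "pinv v p < pinv v q" using c r \<open>p < q\<close> True fe unfolding cell_reps_def by (simp add: parity_type_def)
            then show ?thesis using pu[of p] pu[of q] F True r by simp
          qed
        next
          case False
          have rr: "pinv v (pinv u p) \<in> {1..r}" "pinv v (pinv u q) \<in> {1..r}"
            using r pinv_range[OF us] pinv_range[OF vs] by blast+
          have "g p \<le> g q" using mono_onD[OF g r] \<open>p < q\<close> by simp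
          then have "\<not> g (pinv v (pinv u q)) \<le> g (pinv v (pinv u p))" using False gp r by simp
          then show ?thesis using mono_onD[OF g rr(2,1)] by linarith
        qed
        then show "pinv (d \<circ> u \<circ> v) k < pinv (d \<circ> u \<circ> v) (Suc k)" by (simp add: pinv p_def q_def)
      qed
    qed
  qed
  show "?F ` ?A = ?B"
  proof (intro equalityI subsetI)
    fix w assume "w \<in> ?F ` ?A"
    then obtain u v where uv: "u \<in> cell_reps r m f g d True" "v \<in> cell_reps r m f g d False" "w = d \<circ> u \<circ> v" by auto
    then have m: "u \<in> ?E" "v \<in> ?O" by (auto simp: cell_reps_def)
    have b: "u \<circ> v \<in> block_perms r g any_type" using any m by blast
    have "w \<in> sym r" "mat_of r f g w = mat_of r f g d"
      using mat_of_comp_right[OF b d(1)] sym_comp[OF d(1) block_perms_sym[OF b]] unfolding uv(3) by (simp_all add: comp_assoc)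
    then show "w \<in> ?B" using key[OF m] uv by (simp add: mat_perms_def)
  next
    fix w assume w: "w \<in> ?B"
    then have ws: "w \<in> sym r" "mat_of r f g w = mat_of r f g d" "asc r f any_type (pinv w)" by (auto simp: mat_perms_def)
    define b where "b = pinv d \<circ> w"
    have bs: "b \<in> sym r" unfolding b_def using d ws by blast
    have wdb: "w = d \<circ> b" using d(1) by (simp add: b_def fun_eq_iff)
    have "mat_of r g f (pinv w) = mat_of r g f (pinv d)"
      using mat_of_pinv[OF ws(1)] mat_of_pinv[OF d(1)] ws(2) by (simp add: fun_eq_iff)
    \<comment> \<open>Both inverses increase on row blocks and have the same matrix, so they place
      each value in the same column. Hence b preserves the columns.\<close>
    then have ge: "g (pinv w p) = g (pinv d p)" if "p \<in> {1..r}" for p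
      using ordered_block_eq[OF g sym_pinv[OF ws(1)] sym_pinv[OF d(1)] asc_ordered[OF f ws(3)] asc_ordered[OF f d(2)] _ _ that]
      by simp
    have "g (b x) = g x" if "x \<in> {1..r}" for x
      using ge[OF sym_range[OF ws(1) that]] ws(1) by (simp add: b_def)
    then have b: "b \<in> block_perms r g any_type" using bs unfolding block_perms_def by simp
    obtain u v where uv: "u \<in> ?E" "v \<in> ?O" "b = u \<circ> v" using block_perms_split[OF b, of m True] by auto
    have "w = d \<circ> u \<circ> v" using wdb uv(3) by (simp add: comp_assoc)
    then have "(u, v) \<in> ?A" using key[OF uv(1,2)] ws(3) by simp
    then show "w \<in> ?F ` ?A" using \<open>w = d \<circ> u \<circ> v\<close> by force
  qed
qed

text \<open>Additive lengths turn \<open>T d * T u * T v\<close> into a single basis element. Its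
  odd index is the length of v because u is even and can be moved to the right end, and because d v
  has even index 0.\<close>

lemma cell_reps_len:
  assumes f: "mono_on {1..r} f" and g: "mono_on {1..r} g" and d: "d \<in> sym r" "asc r f any_type (pinv d)" "asc r g any_type d"
    and ok: "parity_ok r m f g d" and u: "u \<in> cell_reps r m f g d True" and v: "v \<in> cell_reps r m f g d False"
  shows "len r (d \<circ> u) = len r d + len r u" "len r (d \<circ> u \<circ> v) = len r d + len r u + len r v"
    "bindex r f g (parity_type m False) (d \<circ> u \<circ> v) = len r v"
proof -
  have uE: "u \<in> block_perms r g (parity_type m True)" and vO: "v \<in> block_perms r g (parity_type m False)"
    using u v by (auto simp: cell_reps_def)
  note us = block_perms_sym[OF uE] and vs = block_perms_sym[OF vO]
  have any: "x \<in> block_perms r g any_type" if "x \<in> block_perms r g Q" for x Q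
    using that block_perms_mono[of Q any_type r g] by blast
  show du: "len r (d \<circ> u) = len r d + len r u" by (rule len_comp_block[OF g any[OF uE] d(1,3)])
  have "asc r g (parity_type m False) u" unfolding asc_def
  proof
    fix k assume k: "k \<in> gens r g (parity_type m False)"
    have "k \<in> {1..r}" "Suc k \<in> {1..r}" using gensD(1)[OF k] by auto
    then show "u k < u (Suc k)" using block_permsD(2)[OF uE, of k] block_permsD(2)[OF uE, of "Suc k"] gensD(2,3)[OF k]
      by (simp add: parity_type_def)
  qed
  then have uv: "len r (u \<circ> v) = len r u + len r v" by (rule len_comp_block[OF g vO us])
  have "len r (d \<circ> (u \<circ> v)) = len r d + len r (u \<circ> v)"
    by (rule len_comp_block[OF g _ d(1,3)]) (use any uE vO in blast)
  then show "len r (d \<circ> u \<circ> v) = len r d + len r u + len r v" using uv by (simp add: comp_assoc)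
  have dv: "d \<circ> v \<in> sym r" "mat_of r f g (d \<circ> v) = mat_of r f g d"
    using d(1) vs mat_of_comp_right[OF vO d(1)] by blast+
  then have okv: "parity_ok r m f g (d \<circ> v)" using ok parity_ok_cong by blast
  have "bindex r f g (parity_type m False) (d \<circ> u \<circ> v) = bindex r f g (parity_type m False) (d \<circ> v \<circ> u)"
    using block_perms_commute[OF uE, of v] vO by (simp add: comp_assoc)
  also have "\<dots> = bindex r f g (parity_type m False) (d \<circ> v)"
    by (rule bindex_block_right[OF g dv(1) okv]) (use uE in simp)
  also have "\<dots> = len r v"
  proof -
    have "bindex r f g (parity_type m True) (d \<circ> v) = 0"
      using bindex_block_right[OF g d(1) ok, of v True] vO bindex_min[OF f g d] by simp
    then show ?thesis using len_bindex[OF f g d ok dv] len_comp_block[OF g any[OF vO] d(1,3)] by simp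
  qed
  finally show "bindex r f g (parity_type m False) (d \<circ> u \<circ> v) = len r v" .
qed

section \<open>Compositions and their block functions\<close>

text \<open>The number of the block that contains p, for p from 1 to the sum. Empty blocks are
  skipped by the least choice.\<close>

definition blk :: "nat list \<Rightarrow> nat \<Rightarrow> nat" where
  "blk \<nu> p = (LEAST k. p \<le> sum_list (take (Suc k) \<nu>))"

lemma sum_list_take_mono: "i \<le> j \<Longrightarrow> sum_list (take i \<nu>) \<le> sum_list (take j (\<nu> :: nat list))"
proof -
  assume "i \<le> j"
  then have "take j \<nu> = take i \<nu> @ take (j - i) (drop i \<nu>)" by (metis le_add_diff_inverse take_add)
  then show ?thesis by simp
qed

lemma blk_iff:
  assumes "p \<in> {1..sum_list \<nu>}"
  shows "p \<in> block \<nu> k \<longleftrightarrow> blk \<nu> p = k" "blk \<nu> p < length \<nu>"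
proof -
  have ex: "p \<le> sum_list (take (Suc (length \<nu>)) \<nu>)" using assms by simp
  have le: "p \<le> sum_list (take (Suc (blk \<nu> p)) \<nu>)"
    unfolding blk_def by (rule LeastI[where P = "\<lambda>k. p \<le> sum_list (take (Suc k) \<nu>)", OF ex])
  have lt: "sum_list (take (Suc j) \<nu>) < p" if "j < blk \<nu> p" for j
    using not_less_Least[OF that[unfolded blk_def]] by simp
  have lt': "sum_list (take (blk \<nu> p) \<nu>) < p" using lt[of "blk \<nu> p - 1"] assms by (cases "blk \<nu> p") auto
  show "blk \<nu> p < length \<nu>"
  proof (rule ccontr)
    assume "\<not> ?thesis"
    then show False using lt' assms by simp
  qed
  show "p \<in> block \<nu> k \<longleftrightarrow> blk \<nu> p = k"
  proof
    assume k: "p \<in> block \<nu> k"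
    show "blk \<nu> p = k"
    proof (rule antisym)
      show "blk \<nu> p \<le> k" unfolding blk_def using k by (intro Least_le) (simp add: block_def)
      show "k \<le> blk \<nu> p"
      proof (rule ccontr)
        assume "\<not> ?thesis"
        then have "sum_list (take (Suc (blk \<nu> p)) \<nu>) \<le> sum_list (take k \<nu>)" by (intro sum_list_take_mono) simp
        then show False using le k by (simp add: block_def)
      qed
    qed
  next
    assume "blk \<nu> p = k"
    then show "p \<in> block \<nu> k" using le lt' by (auto simp: block_def)
  qed
qed

lemma block_sub: "block \<nu> k \<subseteq> {1..sum_list \<nu>}"
proof -
  have "sum_list (take (Suc k) \<nu>) \<le> sum_list \<nu>" using sum_list_take_mono[of "Suc k" "max (Suc k) (length \<nu>)" \<nu>] by simp
  then show ?thesis by (auto simp: block_def)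
qed

lemma block_eq: "block \<nu> k = {p \<in> {1..sum_list \<nu>}. blk \<nu> p = k}"
  using blk_iff(1) block_sub by blast

lemma blk_mono: "mono_on {1..sum_list \<nu>} (blk \<nu>)"
proof (rule mono_onI)
  fix p q assume pq: "p \<in> {1..sum_list \<nu>}" "q \<in> {1..sum_list \<nu>}" "p \<le> q"
  have "q \<in> block \<nu> (blk \<nu> q)" using blk_iff(1)[OF pq(2)] by blast
  then have "p \<le> sum_list (take (Suc (blk \<nu> q)) \<nu>)" using pq by (simp add: block_def)
  then show "blk \<nu> p \<le> blk \<nu> q" unfolding blk_def[of \<nu> p] by (rule Least_le)
qed

lemma card_block: "k < length \<nu> \<Longrightarrow> card (block \<nu> k) = \<nu> ! k"
  by (simp add: block_def take_Suc_conv_app_nth)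

lemma sym_image_eq_iff:
  assumes "w \<in> sym r" "finite B"
  shows "w ` B = B \<longleftrightarrow> (\<forall>p\<in>B. w p \<in> B)"
proof
  assume "\<forall>p\<in>B. w p \<in> B"
  then have "w ` B \<subseteq> B" by blast
  moreover have "inj_on w B" using assms(1) by (auto simp: inj_on_def)
  ultimately show "w ` B = B" using assms(2) endo_inj_surj by blast
qed blast

lemma young_eq: 
  assumes "sum_list \<nu> = r" shows "young r \<nu> = block_perms r (blk \<nu>) any_type"
proof -
  have "(\<forall>k<length \<nu>. w ` block \<nu> k = block \<nu> k) \<longleftrightarrow> (\<forall>p\<in>{1..r}. blk \<nu> (w p) = blk \<nu> p)" if w: "w \<in> sym r" for w
  proof -
    have "(\<forall>k<length \<nu>. w ` block \<nu> k = block \<nu> k) \<longleftrightarrow> (\<forall>k<length \<nu>. \<forall>p\<in>block \<nu> k. w p \<in> block \<nu> k)"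
      using sym_image_eq_iff[OF w] by (simp add: block_def)
    also have "\<dots> \<longleftrightarrow> (\<forall>p\<in>{1..r}. blk \<nu> (w p) = blk \<nu> p)"
      unfolding block_eq assms using sym_range[OF w] blk_iff(2)[of _ \<nu>] assms by blast
    finally show ?thesis .
  qed
  then show ?thesis by (auto simp: young_def block_perms_def)
qed

lemma sum_list_replicate_1 [simp]: "sum_list (replicate k (Suc 0)) = k"
  by (simp add: sum_list_replicate)

text \<open>Up to position a the padded composition has the same blocks as \<nu>; beyond it all
  blocks are singletons, and preserving a singleton means fixing its point. Thus exactly the odd
  blocks are forced to be fixed pointwise.\<close>

lemma even_young_eq:
  assumes "sum_list \<nu> = r" "m \<le> length \<nu>"
  shows "even_young r m \<nu> = block_perms r (blk \<nu>) (parity_type m True)"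
proof -
  define a where "a = sum_list (take m \<nu>)"
  define \<nu>' where "\<nu>' = take m \<nu> @ replicate (r - a) 1"
  have ar: "a \<le> r" using sum_list_take_mono[of m "length \<nu>" \<nu>] assms by (simp add: a_def)
  have sum': "sum_list \<nu>' = r" using ar by (simp add: \<nu>'_def a_def[symmetric])
  have b1: "block \<nu>' k = block \<nu> k" if "k < m" for k
    using that assms by (simp add: block_def \<nu>'_def)
  have b2: "block \<nu>' (m + j) = {a + j + 1}" if "j < r - a" for j
    using that assms by (cases "length \<nu> = m") (auto simp: block_def \<nu>'_def a_def sum_list_replicate min_def)
  have le: "blk \<nu> p < m \<longleftrightarrow> p \<le> a" if "p \<in> {1..r}" for p
  proof
    assume "blk \<nu> p < m"
    then have "sum_list (take (Suc (blk \<nu> p)) \<nu>) \<le> a" unfolding a_def by (intro sum_list_take_mono) simp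
    then show "p \<le> a" using blk_iff(1)[of p \<nu> "blk \<nu> p"] that assms by (simp add: block_def)
  next
    assume "p \<le> a"
    show "blk \<nu> p < m"
    proof (rule ccontr)
      assume "\<not> ?thesis"
      then have "a \<le> sum_list (take (blk \<nu> p) \<nu>)" unfolding a_def by (intro sum_list_take_mono) simp
      then show False using blk_iff(1)[of p \<nu> "blk \<nu> p"] that assms \<open>p \<le> a\<close> by (simp add: block_def)
    qed
  qed
  have b1': "blk \<nu>' p = blk \<nu> p" if "p \<in> {1..r}" "p \<le> a" for p
    using blk_iff(1)[of p \<nu>' "blk \<nu> p"] blk_iff(1)[of p \<nu> "blk \<nu> p"] b1[of "blk \<nu> p"] le that sum' assms by simp
  have b2': "blk \<nu>' p = m + (p - a - 1)" if "p \<in> {1..r}" "a < p" for p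
  proof -
    have "p - a - 1 < r - a" using that by auto
    then show ?thesis using blk_iff(1)[of p \<nu>' "m + (p - a - 1)"] b2[of "p - a - 1"] that sum' by simp
  qed
  have "(\<forall>p\<in>{1..r}. blk \<nu>' (w p) = blk \<nu>' p) \<longleftrightarrow> 
      (\<forall>p\<in>{1..r}. blk \<nu> (w p) = blk \<nu> p \<and> (\<not> parity_type m True (blk \<nu> p) \<longrightarrow> w p = p))" if w: "w \<in> sym r" for w
  proof (rule ball_cong[OF refl])
    fix p assume p: "p \<in> {1..r}"
    note wp = sym_range[OF w p]
    have lt: "blk \<nu>' q < m \<longleftrightarrow> q \<le> a" if "q \<in> {1..r}" for q
      using b1'[OF that] b2'[OF that] le[OF that] by (cases "q \<le> a") auto
    have inj: "a < x \<Longrightarrow> a < y \<Longrightarrow> x - a - 1 = y - a - 1 \<longleftrightarrow> x = y" for x y by auto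
    show "blk \<nu>' (w p) = blk \<nu>' p \<longleftrightarrow> blk \<nu> (w p) = blk \<nu> p \<and> (\<not> parity_type m True (blk \<nu> p) \<longrightarrow> w p = p)"
    proof (cases "p \<le> a")
      case True
      then show ?thesis using b1'[OF p True] le[OF p] le[OF wp] lt[OF p] lt[OF wp] b1'[OF wp]
        by (auto simp: parity_type_def)
    next
      case F: False
      then have odd: "\<not> parity_type m True (blk \<nu> p)" using le[OF p] by (simp add: parity_type_def)
      show ?thesis
      proof (cases "w p \<le> a")
        case True
        then show ?thesis using F lt[OF p] lt[OF wp] le[OF p] le[OF wp] by metis
      next
        case False
        have "a < p" "a < w p" using False F by simp_all
        then have "blk \<nu>' (w p) = blk \<nu>' p \<longleftrightarrow> w p - a - 1 = p - a - 1"
          by (simp only: b2'[OF p] b2'[OF wp] add_left_cancel)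
        also have "\<dots> \<longleftrightarrow> w p = p" using False F by (intro inj) simp_all
        finally show ?thesis using odd by auto
      qed
    qed
  qed
  then show ?thesis unfolding even_young_def a_def[symmetric] \<nu>'_def[symmetric] young_eq[OF sum']
    unfolding block_perms_def by blast
qed

text \<open>Here the singletons come first and shift the numbering: block \<open>m + j\<close> of
  \<nu> is block \<open>a + j\<close> of the padded composition. Only the partition into blocks
  matters for the subgroup.\<close>

lemma odd_young_eq:
  assumes "sum_list \<nu> = r" "m \<le> length \<nu>"
  shows "odd_young r m \<nu> = block_perms r (blk \<nu>) (parity_type m False)"
proof -
  define a where "a = sum_list (take m \<nu>)"
  have split: "a + sum_list (drop m \<nu>) = r" using assms unfolding a_def by (metis append_take_drop_id sum_list_append)
  define \<nu>' where "\<nu>' = replicate a 1 @ drop m \<nu>"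
  have \<nu>': "replicate (r - sum_list (drop m \<nu>)) 1 @ drop m \<nu> = \<nu>'" using split by (simp add: \<nu>'_def flip: split)
  have sum': "sum_list \<nu>' = r" using split by (simp add: \<nu>'_def)
  have b1: "block \<nu>' k = {k + 1}" if "k < a" for k
    using that by (simp add: block_def \<nu>'_def sum_list_replicate min_def)
  have b2: "block \<nu>' (a + j) = block \<nu> (m + j)" for j
  proof -
    have "sum_list (take (a + i) \<nu>') = sum_list (take (m + i) \<nu>)" for i
      by (simp add: \<nu>'_def take_add a_def)
    from this[of j] this[of "Suc j"] show ?thesis by (simp add: block_def)
  qed
  have le: "blk \<nu> p < m \<longleftrightarrow> p \<le> a" if "p \<in> {1..r}" for p
  proof
    assume "blk \<nu> p < m"
    then have "sum_list (take (Suc (blk \<nu> p)) \<nu>) \<le> a" unfolding a_def by (intro sum_list_take_mono) simp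
    then show "p \<le> a" using blk_iff(1)[of p \<nu> "blk \<nu> p"] that assms by (simp add: block_def)
  next
    assume "p \<le> a"
    show "blk \<nu> p < m"
    proof (rule ccontr)
      assume "\<not> ?thesis"
      then have "a \<le> sum_list (take (blk \<nu> p) \<nu>)" unfolding a_def by (intro sum_list_take_mono) simp
      then show False using blk_iff(1)[of p \<nu> "blk \<nu> p"] that assms \<open>p \<le> a\<close> by (simp add: block_def)
    qed
  qed
  have b1': "blk \<nu>' p = p - 1" if "p \<in> {1..r}" "p \<le> a" for p
    using blk_iff(1)[of p \<nu>' "p - 1"] b1[of "p - 1"] that sum' by auto
  have b2': "blk \<nu>' p = a + (blk \<nu> p - m)" if "p \<in> {1..r}" "a < p" for p
  proof -
    have "m + (blk \<nu> p - m) = blk \<nu> p" using le[OF that(1)] that(2) by simp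
    then show ?thesis
      using blk_iff(1)[of p \<nu>' "a + (blk \<nu> p - m)"] blk_iff(1)[of p \<nu> "blk \<nu> p"] b2[of "blk \<nu> p - m"] that sum' assms by simp
  qed
  have "(\<forall>p\<in>{1..r}. blk \<nu>' (w p) = blk \<nu>' p) \<longleftrightarrow> 
      (\<forall>p\<in>{1..r}. blk \<nu> (w p) = blk \<nu> p \<and> (\<not> parity_type m False (blk \<nu> p) \<longrightarrow> w p = p))" if w: "w \<in> sym r" for w
  proof (rule ball_cong[OF refl])
    fix p assume p: "p \<in> {1..r}"
    note wp = sym_range[OF w p]
    have lt: "blk \<nu>' q < a \<longleftrightarrow> q \<le> a" if "q \<in> {1..r}" for q
      using b1'[OF that] b2'[OF that] le[OF that] that by (cases "q \<le> a") auto
    show "blk \<nu>' (w p) = blk \<nu>' p \<longleftrightarrow> blk \<nu> (w p) = blk \<nu> p \<and> (\<not> parity_type m False (blk \<nu> p) \<longrightarrow> w p = p)"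
    proof (cases "p \<le> a")
      case True
      have "x - 1 = y - 1 \<longleftrightarrow> x = y" if "x \<in> {1..r}" "y \<in> {1..r}" for x y using that by auto
      note inj = this[OF wp p]
      show ?thesis using True b1'[OF p True] le[OF p] le[OF wp] lt[OF p] lt[OF wp] b1'[OF wp] inj
        by (auto simp: parity_type_def)
    next
      case False
      then show ?thesis using b2'[OF p] le[OF p] le[OF wp] lt[OF p] lt[OF wp] b2'[OF wp]
        by (auto simp: parity_type_def)
    qed
  qed
  then show ?thesis unfolding odd_young_def \<nu>' young_eq[OF sum']
    unfolding block_perms_def by blast
qed

section \<open>Matrices and double cosets\<close>

lemma length_row_sums [simp]: "length (row_sums m n A) = m + n" by (simp add: row_sums_def)
lemma length_col_sums [simp]: "length (col_sums m n A) = m + n" by (simp add: col_sums_def)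

lemma sum_list_row_sums: "A \<in> mats m n r \<Longrightarrow> sum_list (row_sums m n A) = r"
  by (simp add: row_sums_def mats_def sum_list_sum_nth atLeast0LessThan)

lemma sum_list_col_sums: "A \<in> mats m n r \<Longrightarrow> sum_list (col_sums m n A) = r"
proof -
  assume "A \<in> mats m n r"
  then have "(\<Sum>j<m+n. \<Sum>i<m+n. A i j) = r" using sum.swap[of "\<lambda>i j. A i j"] by (simp add: mats_def)
  then show ?thesis by (simp add: col_sums_def sum_list_sum_nth atLeast0LessThan)
qed

lemma row_sums_bicomps: "A \<in> mats m n r \<Longrightarrow> row_sums m n A \<in> bicomps m n r"
  by (simp add: bicomps_def sum_list_row_sums)

lemma col_sums_bicomps: "A \<in> mats m n r \<Longrightarrow> col_sums m n A \<in> bicomps m n r"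
  by (simp add: bicomps_def sum_list_col_sums)

lemma card_block_inter:
  assumes "sum_list \<nu> = r" "sum_list \<xi> = r" "w \<in> sym r"
  shows "card (block \<nu> i \<inter> w ` block \<xi> j) = mat_of r (blk \<nu>) (blk \<xi>) w i j"
proof -
  have "block \<nu> i \<inter> w ` block \<xi> j = w ` {p \<in> {1..r}. blk \<nu> (w p) = i \<and> blk \<xi> p = j}"
    unfolding block_eq using assms sym_range[OF assms(3)] by (auto simp del: atLeastAtMost_iff)
  moreover have "inj_on w {p \<in> {1..r}. blk \<nu> (w p) = i \<and> blk \<xi> p = j}" using assms(3) by (auto simp: inj_on_def)
  ultimately show ?thesis by (simp add: mat_of_def card_image)
qed

lemma mat_of_outside:
  assumes "length \<nu> = N" "length \<xi> = N" "sum_list \<nu> = r" "sum_list \<xi> = r" "w \<in> sym r" "N \<le> i \<or> N \<le> j"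
  shows "mat_of r (blk \<nu>) (blk \<xi>) w i j = 0"
proof -
  have "blk \<nu> (w p) < N" "blk \<xi> p < N" if "p \<in> {1..r}" for p
    using blk_iff(2)[of p \<xi>] blk_iff(2)[of "w p" \<nu>] sym_range[OF assms(5) that] that assms by simp_all
  then have "{p \<in> {1..r}. blk \<nu> (w p) = i \<and> blk \<xi> p = j} = {}" using assms(6) by fastforce
  then show ?thesis unfolding mat_of_def by (simp only: card.empty)
qed

text \<open>The definition of \<open>dcoset\<close> speaks of indices below \<open>m + n\<close>;
  outside this range both sides are 0, so the matrices can be compared as functions.\<close>

lemma dcoset_eq:
  assumes "A \<in> mats m n r"
  shows "dcoset m n r A = mat_perms r (blk (row_sums m n A)) (blk (col_sums m n A)) A"
proof -
  let ?\<nu> = "row_sums m n A" and ?\<xi> = "col_sums m n A"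
  have "(\<forall>i<m + n. \<forall>j<m + n. card (block ?\<nu> i \<inter> w ` block ?\<xi> j) = A i j) \<longleftrightarrow> mat_of r (blk ?\<nu>) (blk ?\<xi>) w = A"
    if w: "w \<in> sym r" for w
  proof -
    have out: "mat_of r (blk ?\<nu>) (blk ?\<xi>) w i j = A i j" if "\<not> (i < m + n \<and> j < m + n)" for i j
      using mat_of_outside[of ?\<nu> "m + n" ?\<xi> r w i j] that w sum_list_row_sums[OF assms] sum_list_col_sums[OF assms] assms
      by (auto simp: mats_def not_less)
    have "mat_of r (blk ?\<nu>) (blk ?\<xi>) w = A \<longleftrightarrow>
        (\<forall>i<m + n. \<forall>j<m + n. mat_of r (blk ?\<nu>) (blk ?\<xi>) w i j = A i j)"
      using out unfolding fun_eq_iff by blast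
    then show ?thesis
      using card_block_inter[OF sum_list_row_sums[OF assms] sum_list_col_sums[OF assms] w] by simp
  qed
  then show ?thesis by (auto simp: dcoset_def mat_perms_def)
qed

lemma mat_of_mats:
  assumes \<nu>: "\<nu> \<in> bicomps m n r" and \<xi>: "\<xi> \<in> bicomps m n r" and w: "w \<in> sym r"
  shows "row_sums m n (mat_of r (blk \<nu>) (blk \<xi>) w) = \<nu>" "col_sums m n (mat_of r (blk \<nu>) (blk \<xi>) w) = \<xi>"
    "parity_ok r m (blk \<nu>) (blk \<xi>) w \<Longrightarrow> mat_of r (blk \<nu>) (blk \<xi>) w \<in> mats m n r"
proof -
  let ?A = "mat_of r (blk \<nu>) (blk \<xi>) w"
  have l: "length \<nu> = m + n" "length \<xi> = m + n" "sum_list \<nu> = r" "sum_list \<xi> = r" using \<nu> \<xi> by (auto simp: bicomps_def)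
  have bl: "blk \<nu> (w p) < m + n" "blk \<xi> p < m + n" if "p \<in> {1..r}" for p
    using blk_iff(2)[of p \<xi>] blk_iff(2)[of "w p" \<nu>] sym_range[OF w that] that l by simp_all
  have row: "(\<Sum>j<m+n. ?A i j) = \<nu> ! i" if "i < m + n" for i
  proof -
    have "(\<Sum>j<m+n. ?A i j) = card (\<Union>j\<in>{..<m+n}. {p \<in> {1..r}. blk \<nu> (w p) = i \<and> blk \<xi> p = j})"
      unfolding mat_of_def by (rule card_UN_disjoint[symmetric]) auto
    also have "(\<Union>j\<in>{..<m+n}. {p \<in> {1..r}. blk \<nu> (w p) = i \<and> blk \<xi> p = j}) = pinv w ` block \<nu> i"
    proof (intro equalityI subsetI)
      fix p assume "p \<in> (\<Union>j\<in>{..<m+n}. {p \<in> {1..r}. blk \<nu> (w p) = i \<and> blk \<xi> p = j})"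
      then have "p \<in> {1..r}" "blk \<nu> (w p) = i" by auto
      then have "w p \<in> block \<nu> i" using sym_range[OF w] l by (auto simp: block_eq)
      then show "p \<in> pinv w ` block \<nu> i" using w by (metis imageI sym_pinv_apply)
    next
      fix p assume "p \<in> pinv w ` block \<nu> i"
      then obtain v where v: "v \<in> {1..r}" "blk \<nu> v = i" "p = pinv w v" using l by (auto simp: block_eq)
      then have "p \<in> {1..r}" using pinv_range[OF w] by blast
      then show "p \<in> (\<Union>j\<in>{..<m+n}. {p \<in> {1..r}. blk \<nu> (w p) = i \<and> blk \<xi> p = j})" using bl(2) v w by auto
    qed
    also have "card \<dots> = card (block \<nu> i)" using sym_pinv[OF w] by (intro card_image) (auto simp: inj_on_def)
    finally show ?thesis using card_block that l by simp
  qed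
  then show r: "row_sums m n ?A = \<nu>" using l by (intro nth_equalityI) (auto simp: row_sums_def)
  have col: "(\<Sum>i<m+n. ?A i j) = \<xi> ! j" if "j < m + n" for j
  proof -
    have "(\<Sum>i<m+n. ?A i j) = card (\<Union>i\<in>{..<m+n}. {p \<in> {1..r}. blk \<nu> (w p) = i \<and> blk \<xi> p = j})"
      unfolding mat_of_def by (rule card_UN_disjoint[symmetric]) auto
    also have "(\<Union>i\<in>{..<m+n}. {p \<in> {1..r}. blk \<nu> (w p) = i \<and> blk \<xi> p = j}) = block \<xi> j"
      using bl(1) l by (auto simp: block_eq)
    finally show ?thesis using card_block that l by simp
  qed
  then show "col_sums m n ?A = \<xi>" using l by (intro nth_equalityI) (auto simp: col_sums_def)
  assume ok: "parity_ok r m (blk \<nu>) (blk \<xi>) w"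
  have "(\<Sum>i<m+n. \<Sum>j<m+n. ?A i j) = r"
    using row l by (simp add: sum_list_sum_nth atLeast0LessThan)
  moreover have "?A i j \<in> {0, 1}" if "(i < m) \<noteq> (j < m)" for i j
  proof -
    have "?A i j \<le> 1" using ok that unfolding parity_ok_def by blast
    then show ?thesis by auto
  qed
  ultimately show "?A \<in> mats m n r"
    unfolding mats_def using mat_of_outside[OF l(1,2,3,4) w] by blast
qed

lemma mats_parity_ok:
  assumes A: "A \<in> mats m n r" and w: "w \<in> dcoset m n r A"
  shows "w \<in> sym r" "mat_of r (blk (row_sums m n A)) (blk (col_sums m n A)) w = A"
    "parity_ok r m (blk (row_sums m n A)) (blk (col_sums m n A)) w"
proof -
  show "w \<in> sym r" and e: "mat_of r (blk (row_sums m n A)) (blk (col_sums m n A)) w = A"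
    using w unfolding dcoset_eq[OF A] mat_perms_def by auto
  have "A i j \<le> 1" if "(i < m) \<noteq> (j < m)" for i j
  proof (cases "i < m + n \<and> j < m + n")
    case True
    then have "A i j \<in> {0, 1}" using A that unfolding mats_def by blast
    then show ?thesis by auto
  qed (use A in \<open>auto simp: mats_def not_less\<close>)
  then show "parity_ok r m (blk (row_sums m n A)) (blk (col_sums m n A)) w" unfolding parity_ok_def e by blast
qed

section \<open>Realisation of matrices by permutations\<close>

lemma exists_fibres:
  fixes N :: nat
  assumes "finite X" "card X = (\<Sum>i<N. c i)"
  shows "\<exists>F. (\<forall>x\<in>X. F x < N) \<and> (\<forall>i<N. card {x \<in> X. F x = i} = c i)"
  using assms
proof (induction N arbitrary: X)
  case (Suc N)
  then have "(\<Sum>i<N. c i) \<le> card X" by simp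
  then obtain Y where Y: "Y \<subseteq> X" "card Y = (\<Sum>i<N. c i)" using obtain_subset_with_card_n by metis
  then have fin: "finite Y" using Suc(2) finite_subset by blast
  obtain F where F: "\<forall>x\<in>Y. F x < N" "\<forall>i<N. card {x \<in> Y. F x = i} = c i" using Suc(1)[OF fin Y(2)] by blast
  define G where "G = (\<lambda>x. if x \<in> Y then F x else N)"
  have "{x \<in> X. G x = i} = (if i < N then {x \<in> Y. F x = i} else X - Y)" if "i < Suc N" for i
    using F(1) Y(1) that by (auto simp: G_def)
  moreover have "card (X - Y) = c N" using Suc(2,3) Y fin by (simp add: card_Diff_subset)
  ultimately have "\<forall>i<Suc N. card {x \<in> X. G x = i} = c i" using F(2) by (auto simp: less_Suc_eq)
  moreover have "\<forall>x\<in>X. G x < Suc N" using F(1) by (auto simp: G_def less_Suc_eq)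
  ultimately show ?case by blast
qed auto

text \<open>Positions are labelled by P and values by Q with cells (i, j), such that each label is
  used \<open>A i j\<close> times on either side, positions staying in column j and values in row i.
  Equal multisets of labels are matched by a permutation, and this permutation has the matrix
  A.\<close>

lemma dcoset_nonempty:
  assumes A: "A \<in> mats m n r" shows "dcoset m n r A \<noteq> {}"
proof -
  let ?N = "m + n" and ?\<nu> = "row_sums m n A" and ?\<xi> = "col_sums m n A"
  have sums: "sum_list ?\<nu> = r" "sum_list ?\<xi> = r" using A by (auto simp: sum_list_row_sums sum_list_col_sums)
  have A0: "A i j = 0" if "\<not> (i < ?N \<and> j < ?N)" for i j using A that by (auto simp: mats_def not_less)
  have "\<exists>F. (\<forall>x\<in>block ?\<xi> j. F x < ?N) \<and> (\<forall>i<?N. card {x \<in> block ?\<xi> j. F x = i} = A i j)" if "j < ?N" for j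
    by (rule exists_fibres) (use that card_block[of j ?\<xi>] in \<open>auto simp: block_def col_sums_def\<close>)
  then obtain F where F: "\<And>j. j < ?N \<Longrightarrow> (\<forall>x\<in>block ?\<xi> j. F j x < ?N) \<and> (\<forall>i<?N. card {x \<in> block ?\<xi> j. F j x = i} = A i j)"
    by metis
  have "\<exists>G. (\<forall>x\<in>block ?\<nu> i. G x < ?N) \<and> (\<forall>j<?N. card {x \<in> block ?\<nu> i. G x = j} = A i j)" if "i < ?N" for i
    by (rule exists_fibres) (use that card_block[of i ?\<nu>] in \<open>auto simp: block_def row_sums_def\<close>)
  then obtain G where G: "\<And>i. i < ?N \<Longrightarrow> (\<forall>x\<in>block ?\<nu> i. G i x < ?N) \<and> (\<forall>j<?N. card {x \<in> block ?\<nu> i. G i x = j} = A i j)"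
    by metis
  define P where "P = (\<lambda>p. (F (blk ?\<xi> p) p, blk ?\<xi> p))"
  define Q where "Q = (\<lambda>p. (blk ?\<nu> p, G (blk ?\<nu> p) p))"
  have bl: "blk ?\<nu> p < ?N" "blk ?\<xi> p < ?N" "p \<in> block ?\<nu> (blk ?\<nu> p)" "p \<in> block ?\<xi> (blk ?\<xi> p)" if "p \<in> {1..r}" for p
    using blk_iff(2)[of p ?\<xi>] blk_iff(2)[of p ?\<nu>] that sums by (auto simp: block_eq)
  have cP: "card {p \<in> {1..r}. P p = (i, j)} = A i j" for i j
  proof (cases "i < ?N \<and> j < ?N")
    case True
    have "{p \<in> {1..r}. P p = (i, j)} = {x \<in> block ?\<xi> j. F j x = i}" using sums by (auto simp: P_def block_eq)
    then show ?thesis using F True by simp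
  next
    case False
    have "{p \<in> {1..r}. P p = (i, j)} = {}" using F bl False by (auto simp: P_def)
    then show ?thesis using A0[OF False] by (metis card.empty)
  qed
  have cQ: "card {p \<in> {1..r}. Q p = (i, j)} = A i j" for i j
  proof (cases "i < ?N \<and> j < ?N")
    case True
    have "{p \<in> {1..r}. Q p = (i, j)} = {x \<in> block ?\<nu> i. G i x = j}" using sums by (auto simp: Q_def block_eq)
    then show ?thesis using G True by simp
  next
    case False
    have "{p \<in> {1..r}. Q p = (i, j)} = {}" using G bl False by (auto simp: Q_def)
    then show ?thesis using A0[OF False] by (metis card.empty)
  qed
  have "image_mset P (mset_set {1..r}) = image_mset Q (mset_set {1..r})"
  proof (rule multiset_eqI)
    fix x :: "nat \<times> nat"
    have *: "count (image_mset H (mset_set {1..r})) x = card {p \<in> {1..r}. H p = x}" for H :: "nat \<Rightarrow> nat \<times> nat"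
      by (subst count_image_mset) (auto simp: vimage_def Int_def intro!: arg_cong[of _ _ card])
    show "count (image_mset P (mset_set {1..r})) x = count (image_mset Q (mset_set {1..r})) x"
      unfolding * using cP cQ by (cases x) simp
  qed
  then obtain w where w: "w permutes {1..r}" "\<forall>x\<in>{1..r}. P x = Q (w x)"
    using image_mset_eq_implies_permutes[of "{1..r}" P Q] by blast
  have ws: "w \<in> sym r" using w by (simp add: sym_def)
  have "mat_of r (blk ?\<nu>) (blk ?\<xi>) w i j = A i j" for i j
  proof -
    have "P p = (blk ?\<nu> (w p), blk ?\<xi> p)" if "p \<in> {1..r}" for p
    proof -
      have "fst (P p) = blk ?\<nu> (w p)" using bspec[OF w(2) that] by (simp add: Q_def)
      moreover have "snd (P p) = blk ?\<xi> p" by (simp add: P_def)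
      ultimately show ?thesis by (metis prod.collapse)
    qed
    then have "{p \<in> {1..r}. blk ?\<nu> (w p) = i \<and> blk ?\<xi> p = j} = {p \<in> {1..r}. P p = (i, j)}"
      by (intro Collect_cong conj_cong) auto
    then show ?thesis using cP by (simp add: mat_of_def)
  qed
  then have "w \<in> dcoset m n r A" unfolding dcoset_eq[OF A] using ws by (auto simp: mat_perms_def)
  then show ?thesis by blast
qed

lemma mat_of_id: 
  assumes "\<nu> \<in> bicomps m n r" shows "mat_of r (blk \<nu>) (blk \<nu>) id = diag_mat \<nu>"
proof (intro ext)
  fix i j
  have s: "sum_list \<nu> = r" using assms by (simp add: bicomps_def)
  have "{p \<in> {1..r}. blk \<nu> (id p) = i \<and> blk \<nu> p = j} = (if i = j then block \<nu> i else {})"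
    using s by (auto simp: block_eq)
  moreover have "block \<nu> i = {}" if "\<not> i < length \<nu>" using that by (simp add: block_def)
  ultimately show "mat_of r (blk \<nu>) (blk \<nu>) id i j = diag_mat \<nu> i j"
    using card_block[of i \<nu>] by (auto simp: mat_of_def diag_mat_def)
qed

lemma diag_mat:
  assumes "\<nu> \<in> bicomps m n r"
  shows "diag_mat \<nu> \<in> mats m n r" "row_sums m n (diag_mat \<nu>) = \<nu>" "col_sums m n (diag_mat \<nu>) = \<nu>"
proof -
  have "parity_ok r m (blk \<nu>) (blk \<nu>) id"
    unfolding parity_ok_def mat_of_id[OF assms] by (auto simp: diag_mat_def)
  then show "diag_mat \<nu> \<in> mats m n r" "row_sums m n (diag_mat \<nu>) = \<nu>" "col_sums m n (diag_mat \<nu>) = \<nu>"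
    using mat_of_mats[OF assms assms sym_id] unfolding mat_of_id[OF assms] by auto
qed

text \<open>A zero entry off the diagonal forbids any point to leave its block.\<close>

lemma mat_of_diag_iff:
  assumes "\<nu> \<in> bicomps m n r" "w \<in> sym r"
  shows "mat_of r (blk \<nu>) (blk \<nu>) w = diag_mat \<nu> \<longleftrightarrow> w \<in> block_perms r (blk \<nu>) any_type"
proof
  assume m: "mat_of r (blk \<nu>) (blk \<nu>) w = diag_mat \<nu>"
  have "blk \<nu> (w p) = blk \<nu> p" if p: "p \<in> {1..r}" for p
  proof (rule ccontr)
    assume "blk \<nu> (w p) \<noteq> blk \<nu> p"
    then have "mat_of r (blk \<nu>) (blk \<nu>) w (blk \<nu> (w p)) (blk \<nu> p) = 0"
      unfolding m by (simp add: diag_mat_def)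
    then have "{q \<in> {1..r}. blk \<nu> (w q) = blk \<nu> (w p) \<and> blk \<nu> q = blk \<nu> p} = {}"
      unfolding mat_of_def by (subst (asm) card_0_eq) simp_all
    then show False using p by blast
  qed
  then show "w \<in> block_perms r (blk \<nu>) any_type" using assms by (simp add: block_perms_def)
next
  assume "w \<in> block_perms r (blk \<nu>) any_type"
  then show "mat_of r (blk \<nu>) (blk \<nu>) w = diag_mat \<nu>" 
    using mat_of_comp_left[of w r "blk \<nu>" any_type id "blk \<nu>"] mat_of_id[OF assms(1)] by simp
qed

lemma finite_bicomps [simp, intro]: "finite (bicomps m n r)"
proof (rule finite_subset)
  show "bicomps m n r \<subseteq> {\<nu>. set \<nu> \<subseteq> {..r} \<and> length \<nu> = m + n}"
    by (auto simp: bicomps_def intro: member_le_sum_list)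
  show "finite {\<nu>. set \<nu> \<subseteq> {..r} \<and> length \<nu> = m + n}" by (rule finite_lists_length_eq) simp
qed

text \<open>Each matrix is determined by a permutation that realises it together with its row and
  column sums, and there are finitely many such triples.\<close>

lemma finite_mats [simp, intro]: "finite (mats m n r)"
proof (rule finite_surj)
  show "mats m n r \<subseteq> (\<lambda>(\<nu>, \<xi>, w). mat_of r (blk \<nu>) (blk \<xi>) w) ` (bicomps m n r \<times> bicomps m n r \<times> sym r)"
  proof
    fix A assume A: "A \<in> mats m n r"
    then obtain w where "w \<in> dcoset m n r A" using dcoset_nonempty by blast
    then show "A \<in> (\<lambda>(\<nu>, \<xi>, w). mat_of r (blk \<nu>) (blk \<xi>) w) ` (bicomps m n r \<times> bicomps m n r \<times> sym r)"
      using mats_parity_ok[OF A] row_sums_bicomps[OF A] col_sums_bicomps[OF A] by force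
  qed
qed auto

section \<open>Laurent polynomials\<close>

lemma vpow_add: "vpow a * vpow b = vpow (a + b)"
  by (simp add: vpow_def mult_single)

lemma vpow_0 [simp]: "vpow 0 = 1"
  by (simp add: vpow_def)

lemma vpow_nonzero [simp]: "vpow a \<noteq> 0"
proof
  assume "vpow a = 0"
  then have "vpow a * vpow (- a) = 0" by simp
  then show False by (simp add: vpow_add)
qed

lemma lookup_laurent_bar [simp]: "Poly_Mapping.lookup (laurent_bar p) k = Poly_Mapping.lookup p (- k)"
  by (simp add: laurent_bar_def map_key.rep_eq)

lemma laurent_bar_add [simp]: "laurent_bar (p + q) = laurent_bar p + laurent_bar q"
  by (rule poly_mapping_eqI) (simp add: lookup_add)

lemma laurent_bar_0 [simp]: "laurent_bar 0 = 0"
  by (rule poly_mapping_eqI) simp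

lemma laurent_bar_uminus [simp]: "laurent_bar (- p) = - laurent_bar p"
  by (rule poly_mapping_eqI) simp

lemma laurent_bar_diff [simp]: "laurent_bar (p - q) = laurent_bar p - laurent_bar q"
  by (rule poly_mapping_eqI) (simp add: lookup_minus)

lemma laurent_bar_bar [simp]: "laurent_bar (laurent_bar p) = p"
  by (rule poly_mapping_eqI) simp

lemma laurent_bar_single: "laurent_bar (Poly_Mapping.single k c) = Poly_Mapping.single (- k) c"
  by (rule poly_mapping_eqI) (auto simp: lookup_single when_def)

lemma laurent_bar_vpow [simp]: "laurent_bar (vpow k) = vpow (- k)"
  by (simp add: vpow_def laurent_bar_single)

lemma laurent_bar_1 [simp]: "laurent_bar 1 = 1"
  using laurent_bar_vpow[of 0] by simp

lemma laurent_bar_sum: "laurent_bar (\<Sum>x\<in>A. f x) = (\<Sum>x\<in>A. laurent_bar (f x))"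
  by (induction A rule: infinite_finite_induct) auto

lemma laurent_bar_mult [simp]: "laurent_bar (p * q) = laurent_bar p * laurent_bar q"
proof -
  have 1: "laurent_bar (Poly_Mapping.single k c * q) = laurent_bar (Poly_Mapping.single k c) * laurent_bar q" for k c
  proof -
    have "q = (\<Sum>l\<in>Poly_Mapping.keys q. Poly_Mapping.single l (Poly_Mapping.lookup q l))"
      by (rule poly_mapping_eqI) (simp add: lookup_sum lookup_single when_def sum.delta in_keys_iff)
    moreover have "laurent_bar (Poly_Mapping.single k c * (\<Sum>l\<in>X. Poly_Mapping.single l (h l))) =
      laurent_bar (Poly_Mapping.single k c) * laurent_bar (\<Sum>l\<in>X. Poly_Mapping.single l (h l))" for X h
      by (simp add: sum_distrib_left laurent_bar_sum mult_single laurent_bar_single add.commute)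
    ultimately show ?thesis by metis
  qed
  have "p = (\<Sum>l\<in>Poly_Mapping.keys p. Poly_Mapping.single l (Poly_Mapping.lookup p l))"
    by (rule poly_mapping_eqI) (simp add: lookup_sum lookup_single when_def sum.delta in_keys_iff)
  moreover have "laurent_bar ((\<Sum>l\<in>X. Poly_Mapping.single l (h l)) * q) =
      laurent_bar (\<Sum>l\<in>X. Poly_Mapping.single l (h l)) * laurent_bar q" for X h
    by (simp add: sum_distrib_right laurent_bar_sum 1)
  ultimately show ?thesis by metis
qed

lemma laurent_bar_power [simp]: "laurent_bar (p ^ k) = laurent_bar p ^ k"
  by (induction k) auto

lemma laurent_bar_eq_0 [simp]: "laurent_bar p = 0 \<longleftrightarrow> p = 0"
  by (metis laurent_bar_0 laurent_bar_bar)

lemma vpow_power: "vpow a ^ k = vpow (a * int k)"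
  by (induction k) (auto simp: vpow_add algebra_simps)

lemma neg_laurent_iff: "p \<in> neg_laurent \<longleftrightarrow> (\<forall>k\<ge>0. Poly_Mapping.lookup p k = 0)"
  unfolding neg_laurent_def mem_Collect_eq subset_iff in_keys_iff lessThan_iff by (meson not_le)

lemma neg_laurent_0 [simp]: "0 \<in> neg_laurent" 
  by (simp add: neg_laurent_iff)

lemma neg_laurent_diff: "p \<in> neg_laurent \<Longrightarrow> q \<in> neg_laurent \<Longrightarrow> p - q \<in> neg_laurent"
  by (simp add: neg_laurent_iff lookup_minus)

lemma neg_laurent_bar_eq_0:
  assumes "p \<in> neg_laurent" "laurent_bar p = p" shows "p = 0"
proof (rule poly_mapping_eqI)
  fix k
  have "Poly_Mapping.lookup p k = Poly_Mapping.lookup p (- k)" by (metis assms(2) lookup_laurent_bar)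
  then show "Poly_Mapping.lookup p k = Poly_Mapping.lookup 0 k"
    using assms(1) by (cases "k \<ge> 0") (auto simp: neg_laurent_iff)
qed

text \<open>The constant coefficient equals its own negative, hence is 0; a is the part of p with
  negative exponents.\<close>

lemma antisymmetric_laurent:
  assumes "laurent_bar p = - p"
  obtains a where "a \<in> neg_laurent" "p = a - laurent_bar a"
proof -
  define h where "h = (\<lambda>k. if k < 0 then Poly_Mapping.lookup p k else 0)"
  define a where "a = Abs_poly_mapping h"
  have "finite {k. h k \<noteq> 0}"
    by (rule finite_subset[OF _ finite_keys[of p]]) (auto simp: h_def in_keys_iff)
  then have a: "Poly_Mapping.lookup a = h" unfolding a_def by (rule lookup_Abs_poly_mapping)
  have s: "Poly_Mapping.lookup p (- k) = - Poly_Mapping.lookup p k" for k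
    by (metis assms lookup_laurent_bar lookup_uminus)
  have "Poly_Mapping.lookup p 0 = 0" using s[of 0] by simp
  then have "p = a - laurent_bar a" 
    by (intro poly_mapping_eqI) (auto simp: lookup_minus a h_def s not_less_iff_gr_or_eq)
  moreover have "a \<in> neg_laurent" by (simp add: neg_laurent_iff a h_def)
  ultimately show ?thesis using that by blast
qed

text \<open>The factor by which the coefficients of an eigenvector change along a simple reflection of even
  or odd type; the eigenvalue itself is q times this factor.\<close>
definition kappa :: "bool \<Rightarrow> laurent" where
  "kappa e = (if e then 1 else - vpow (- 2))"

lemma q_inv: "q_param * vpow (- 2) = 1" "vpow (- 2) * q_param = 1"
  by (simp_all add: q_param_def vpow_add)

text \<open>The quadratic relation x^2 = (q - 1) x + q for the eigenvalue x = q
  \<open>kappa e\<close>, divided by q.\<close>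

lemma kappa_eq: "1 + (q_param - 1) * kappa e = q_param * (kappa e * kappa e)"
proof (cases e)
  case False
  have "q_param * (kappa e * kappa e) = (q_param * vpow (- 2)) * vpow (- 2)" using False by (simp add: kappa_def)
  then show ?thesis using False by (simp add: kappa_def q_inv algebra_simps)
qed (simp add: kappa_def)

lemma kappa_neq: "kappa True \<noteq> kappa False"
proof
  assume "kappa True = kappa False"
  then have "Poly_Mapping.lookup (1 :: laurent) 0 = Poly_Mapping.lookup (- vpow (- 2)) 0" by (simp add: kappa_def)
  then show False by (simp add: vpow_def lookup_single lookup_one)
qed

text \<open>The source of the stability of the eigenspaces: bar inverts the eigenvalues just as it
  inverts the generators.\<close>

lemma kappa_bar_q: "laurent_bar (q_param * kappa e) * (q_param * kappa e) = 1"
  by (simp add: kappa_def q_param_def vpow_add)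

lemma neg_q_inv_pow_eq: "neg_q_inv_pow k = kappa False ^ k"
proof -
  have "kappa False ^ k = (- 1) ^ k * vpow (- 2) ^ k" unfolding kappa_def by (simp add: power_minus[of "vpow (-2)"])
  then show ?thesis by (simp add: neg_q_inv_pow_def vpow_power)
qed

lemma kappa_True [simp]: "kappa True = 1" by (simp add: kappa_def)

lemma kappa_nonzero [simp]: "kappa e \<noteq> 0" by (simp add: kappa_def)

section \<open>The Hecke algebra\<close>

context hecke_algebra
begin

section \<open>Coefficients with respect to the basis T\<close>

lemma T_coeff_spec:
  "(\<forall>w. w \<notin> sym r \<longrightarrow> T_coeff h w = 0) \<and> h = (\<Sum>w\<in>sym r. scl (T_coeff h w) (T w))"
  unfolding T_coeff_def using theI'[OF T_basis[of h]] .

lemma T_coeff_outside: "w \<notin> sym r \<Longrightarrow> T_coeff h w = 0"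
  using T_coeff_spec by blast

lemma T_expand: "h = (\<Sum>w\<in>sym r. scl (T_coeff h w) (T w))"
  using T_coeff_spec by blast

lemma T_coeff_sum_T: "T_coeff (\<Sum>w\<in>sym r. scl (c w) (T w)) w = (if w \<in> sym r then c w else 0)"
proof -
  let ?c = "\<lambda>w. if w \<in> sym r then c w else 0" and ?h = "\<Sum>w\<in>sym r. scl (c w) (T w)"
  have "?h = (\<Sum>w\<in>sym r. scl (?c w) (T w))" by (intro sum.cong) auto
  then have "T_coeff ?h = ?c" unfolding T_coeff_def by (intro the1_equality[OF T_basis]) auto
  then show ?thesis by simp
qed

lemma T_coeff_eqI: "(\<And>w. w \<in> sym r \<Longrightarrow> T_coeff a w = T_coeff b w) \<Longrightarrow> a = b"
proof -
  assume c: "\<And>w. w \<in> sym r \<Longrightarrow> T_coeff a w = T_coeff b w"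
  have "a = (\<Sum>w\<in>sym r. scl (T_coeff b w) (T w))"
    by (subst T_expand[of a]) (intro sum.cong refl, simp add: c)
  then show "a = b" by (simp flip: T_expand)
qed

lemma T_coeff_add: "T_coeff (a + b) w = T_coeff a w + T_coeff b w"
proof -
  have "a + b = (\<Sum>w\<in>sym r. scl (T_coeff a w + T_coeff b w) (T w))"
    using T_expand[of a] T_expand[of b] by (simp add: scale_left_distrib sum.distrib)
  then show ?thesis using T_coeff_sum_T[of "\<lambda>w. T_coeff a w + T_coeff b w" w] T_coeff_outside[of w] by auto
qed

lemma T_coeff_scl: "T_coeff (scl c a) w = c * T_coeff a w"
proof -
  have "scl c a = (\<Sum>w\<in>sym r. scl (c * T_coeff a w) (T w))"
    by (subst T_expand[of a]) (simp add: scale_sum_right)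
  then show ?thesis using T_coeff_sum_T[of "\<lambda>w. c * T_coeff a w" w] T_coeff_outside[of w] by auto
qed

lemma T_coeff_0 [simp]: "T_coeff 0 w = 0"
  using T_coeff_add[of 0 0 w] by simp

lemma T_coeff_sum: "T_coeff (\<Sum>x\<in>A. f x) w = (\<Sum>x\<in>A. T_coeff (f x) w)"
  by (induction A rule: infinite_finite_induct) (auto simp: T_coeff_add)

lemma T_coeff_T: "v \<in> sym r \<Longrightarrow> T_coeff (T v) w = (if w = v then 1 else 0)"
proof -
  assume v: "v \<in> sym r"
  have "T v = (\<Sum>w\<in>sym r. if w = v then T w else 0)" using v by (simp add: sum.delta)
  also have "\<dots> = (\<Sum>w\<in>sym r. scl (if w = v then 1 else 0) (T w))" by (intro sum.cong) auto
  finally show ?thesis using T_coeff_sum_T[of "\<lambda>w. if w = v then 1 else 0" w] v by auto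
qed

text \<open>Multiplication by \<open>T id\<close> fixes each \<open>T w\<close>, since lengths add;
  as a left unit, \<open>T id\<close> equals 1.\<close>

lemma T_id: "T id = 1"
proof -
  have "T id * h = h" for h
  proof -
    have "T id * h = (\<Sum>w\<in>sym r. scl (T_coeff h w) (T id * T w))"
      by (subst T_expand[of h]) (simp add: sum_distrib_left scl_mult_right)
    also have "\<dots> = (\<Sum>w\<in>sym r. scl (T_coeff h w) (T w))"
      by (intro sum.cong refl) (simp add: T_mult)
    finally show ?thesis using T_expand[of h] by simp
  qed
  from this[of 1] show ?thesis by simp
qed

lemma T_mult_simple_left_up:
  assumes w: "w \<in> sym r" and k: "k \<in> {1..<r}" and up: "pinv w k < pinv w (Suc k)"
  shows "T (simple_refl k) * T w = T (simple_refl k \<circ> w)"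
proof -
  have "len r (simple_refl k \<circ> w) = len r (simple_refl k) + len r w"
    unfolding len_simple_left[OF w k up] len_simple[OF k] by simp
  then show ?thesis by (rule T_mult[OF simple_refl_sym[OF k] w])
qed

lemma T_mult_simple_right_up:
  assumes w: "w \<in> sym r" and k: "k \<in> {1..<r}" and up: "w k < w (Suc k)"
  shows "T w * T (simple_refl k) = T (w \<circ> simple_refl k)"
proof -
  have "len r (w \<circ> simple_refl k) = len r w + len r (simple_refl k)"
    unfolding len_simple_right[OF w k up] len_simple[OF k] by simp
  then show ?thesis by (rule T_mult[OF w simple_refl_sym[OF k]])
qed

lemma T_mult_simple_left:
  assumes w: "w \<in> sym r" and k: "k \<in> {1..<r}"
  shows "T (simple_refl k) * T w = (if pinv w k < pinv w (Suc k) then T (simple_refl k \<circ> w)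
     else scl (q_param - 1) (T w) + scl q_param (T (simple_refl k \<circ> w)))"
proof (cases "pinv w k < pinv w (Suc k)")
  case True
  then show ?thesis using T_mult_simple_left_up[OF w k True] by simp
next
  case False
  define v where "v = simple_refl k \<circ> w"
  have v: "v \<in> sym r" "pinv v k < pinv v (Suc k)" and wv: "simple_refl k \<circ> v = w"
    unfolding v_def using w k False pinv_neq_Suc[OF w, of k] by (auto simp: pinv_simple_left)
  have "T w = T (simple_refl k) * T v"
    using T_mult_simple_left_up[OF v(1) k v(2)] unfolding wv by simp
  then have "T (simple_refl k) * T w = (T (simple_refl k) * T (simple_refl k)) * T v" by (simp add: mult.assoc)
  also have "\<dots> = scl (q_param - 1) (T (simple_refl k) * T v) + scl q_param (T v)"
    using T_quadratic[OF k] by (simp add: distrib_right scl_mult_left[symmetric])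
  also have "T (simple_refl k) * T v = T w" using \<open>T w = _\<close> by simp
  finally show ?thesis using False unfolding v_def by (simp add: comp_def)
qed

lemma T_mult_simple_right:
  assumes w: "w \<in> sym r" and k: "k \<in> {1..<r}"
  shows "T w * T (simple_refl k) = (if w k < w (Suc k) then T (w \<circ> simple_refl k)
     else scl (q_param - 1) (T w) + scl q_param (T (w \<circ> simple_refl k)))"
proof (cases "w k < w (Suc k)")
  case True
  then show ?thesis using T_mult_simple_right_up[OF w k True] by simp
next
  case False
  define v where "v = w \<circ> simple_refl k"
  have v: "v \<in> sym r" "v k < v (Suc k)" and wv: "v \<circ> simple_refl k = w"
    unfolding v_def using w k False sym_neq_Suc[OF w, of k] by auto
  have "T w = T v * T (simple_refl k)"
    using T_mult_simple_right_up[OF v(1) k v(2)] unfolding wv by simp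
  then have "T w * T (simple_refl k) = T v * (T (simple_refl k) * T (simple_refl k))" by (simp add: mult.assoc)
  also have "\<dots> = scl (q_param - 1) (T v * T (simple_refl k)) + scl q_param (T v)"
    using T_quadratic[OF k] by (simp add: distrib_left scl_mult_right[symmetric])
  also have "T v * T (simple_refl k) = T w" using \<open>T w = _\<close> by simp
  finally show ?thesis using False unfolding v_def by (simp add: comp_def)
qed

lemma bij_simple_left: "k \<in> {1..<r} \<Longrightarrow> bij_betw (\<lambda>w. simple_refl k \<circ> w) (sym r) (sym r)"
  by (rule bij_betw_byWitness[where f' = "\<lambda>w. simple_refl k \<circ> w"]) auto

lemma bij_simple_right: "k \<in> {1..<r} \<Longrightarrow> bij_betw (\<lambda>w. w \<circ> simple_refl k) (sym r) (sym r)"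
  by (rule bij_betw_byWitness[where f' = "\<lambda>w. w \<circ> simple_refl k"]) auto

text \<open>The coefficient at w collects the contributions of w and of the reflected element;
  reindexing by the reflection brings the latter to w.\<close>

lemma T_coeff_simple_left:
  assumes w: "w \<in> sym r" and k: "k \<in> {1..<r}"
  shows "T_coeff (T (simple_refl k) * z) w = (if pinv w k < pinv w (Suc k) then q_param * T_coeff z (simple_refl k \<circ> w)
    else T_coeff z (simple_refl k \<circ> w) + (q_param - 1) * T_coeff z w)"
proof -
  let ?s = "simple_refl k" and ?c = "T_coeff z"
  let ?A = "\<lambda>w. if pinv w k < pinv w (Suc k) then 1 else q_param" and
    ?B = "\<lambda>w. if pinv w k < pinv w (Suc k) then 0 else q_param - 1"
  have "T ?s * z = (\<Sum>w\<in>sym r. scl (?c w) (T ?s * T w))"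
    by (subst T_expand[of z]) (simp add: sum_distrib_left scl_mult_right)
  also have "\<dots> = (\<Sum>w\<in>sym r. scl (?c w * ?A w) (T (?s \<circ> w)) + scl (?c w * ?B w) (T w))"
    by (intro sum.cong refl) (auto simp: T_mult_simple_left[OF _ k] scale_right_distrib add.commute)
  also have "\<dots> = (\<Sum>w\<in>sym r. scl (?c w * ?A w) (T (?s \<circ> w))) + (\<Sum>w\<in>sym r. scl (?c w * ?B w) (T w))"
    by (rule sum.distrib)
  also have "(\<Sum>w\<in>sym r. scl (?c w * ?A w) (T (?s \<circ> w))) = (\<Sum>w\<in>sym r. scl (?c (?s \<circ> w) * ?A (?s \<circ> w)) (T w))"
    by (subst sum.reindex_bij_betw[OF bij_simple_left[OF k], symmetric]) simp
  finally have *: "T ?s * z = (\<Sum>w\<in>sym r. scl (?c (?s \<circ> w) * ?A (?s \<circ> w) + ?c w * ?B w) (T w))"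
    by (simp only: sum.distrib scale_left_distrib)
  have "?A (?s \<circ> w) = (if pinv w k < pinv w (Suc k) then q_param else 1)"
    using pinv_neq_Suc[OF w, of k] pinv_simple_left[OF w k] by auto
  then show ?thesis unfolding * T_coeff_sum_T using w by (auto simp: mult.commute)
qed

lemma T_coeff_simple_right:
  assumes w: "w \<in> sym r" and k: "k \<in> {1..<r}"
  shows "T_coeff (z * T (simple_refl k)) w = (if w k < w (Suc k) then q_param * T_coeff z (w \<circ> simple_refl k)
    else T_coeff z (w \<circ> simple_refl k) + (q_param - 1) * T_coeff z w)"
proof -
  let ?s = "simple_refl k" and ?c = "T_coeff z"
  let ?A = "\<lambda>w. if w k < w (Suc k) then 1 else q_param" and
    ?B = "\<lambda>w. if w k < w (Suc k) then 0 else q_param - 1"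
  have "z * T ?s = (\<Sum>w\<in>sym r. scl (?c w) (T w * T ?s))"
    by (subst T_expand[of z]) (simp add: sum_distrib_right scl_mult_left)
  also have "\<dots> = (\<Sum>w\<in>sym r. scl (?c w * ?A w) (T (w \<circ> ?s)) + scl (?c w * ?B w) (T w))"
    by (intro sum.cong refl) (auto simp: T_mult_simple_right[OF _ k] scale_right_distrib add.commute)
  also have "\<dots> = (\<Sum>w\<in>sym r. scl (?c w * ?A w) (T (w \<circ> ?s))) + (\<Sum>w\<in>sym r. scl (?c w * ?B w) (T w))"
    by (rule sum.distrib)
  also have "(\<Sum>w\<in>sym r. scl (?c w * ?A w) (T (w \<circ> ?s))) = (\<Sum>w\<in>sym r. scl (?c (w \<circ> ?s) * ?A (w \<circ> ?s)) (T w))"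
    by (subst sum.reindex_bij_betw[OF bij_simple_right[OF k], symmetric]) simp
  finally have *: "z * T ?s = (\<Sum>w\<in>sym r. scl (?c (w \<circ> ?s) * ?A (w \<circ> ?s) + ?c w * ?B w) (T w))"
    by (simp only: sum.distrib scale_left_distrib)
  have "?A (w \<circ> ?s) = (if w k < w (Suc k) then q_param else 1)"
    using sym_neq_Suc[OF w, of k] by auto
  then show ?thesis unfolding * T_coeff_sum_T using w by (auto simp: mult.commute)
qed

text \<open>Coefficients are compared on the pairs formed by a shorter w and the longer s w. The
  equation at the shorter element is the asserted relation times q; the equation at the longer one
  follows from it by the quadratic relation \<open>kappa_eq\<close>.\<close>

lemma left_eigen_iff:
  assumes k: "k \<in> {1..<r}"
  shows "T (simple_refl k) * z = scl (q_param * kappa e) z \<longleftrightarrow>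
    (\<forall>w\<in>sym r. pinv w k < pinv w (Suc k) \<longrightarrow> T_coeff z (simple_refl k \<circ> w) = kappa e * T_coeff z w)"
proof
  assume eq: "T (simple_refl k) * z = scl (q_param * kappa e) z"
  show "\<forall>w\<in>sym r. pinv w k < pinv w (Suc k) \<longrightarrow> T_coeff z (simple_refl k \<circ> w) = kappa e * T_coeff z w"
  proof (intro ballI impI)
    fix w assume w: "w \<in> sym r" "pinv w k < pinv w (Suc k)"
    have "q_param * T_coeff z (simple_refl k \<circ> w) = q_param * (kappa e * T_coeff z w)"
      using T_coeff_simple_left[OF w(1) k, of z] w(2) eq by (auto simp: T_coeff_scl mult.assoc)
    then show "T_coeff z (simple_refl k \<circ> w) = kappa e * T_coeff z w"
      by (simp add: q_param_def)
  qed
next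
  assume c: "\<forall>w\<in>sym r. pinv w k < pinv w (Suc k) \<longrightarrow> T_coeff z (simple_refl k \<circ> w) = kappa e * T_coeff z w"
  show "T (simple_refl k) * z = scl (q_param * kappa e) z"
  proof (rule T_coeff_eqI)
    fix w assume w: "w \<in> sym r"
    show "T_coeff (T (simple_refl k) * z) w = T_coeff (scl (q_param * kappa e) z) w"
    proof (cases "pinv w k < pinv w (Suc k)")
      case True
      then show ?thesis using T_coeff_simple_left[OF w k, of z] c w by (simp add: T_coeff_scl mult.assoc)
    next
      case False
      define v where "v = simple_refl k \<circ> w"
      have v: "v \<in> sym r" "pinv v k < pinv v (Suc k)" "w = simple_refl k \<circ> v"
        unfolding v_def using w k False pinv_neq_Suc[OF w, of k] by (auto simp: pinv_simple_left)
      then have cw: "T_coeff z w = kappa e * T_coeff z v" using c by metis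
      have "T_coeff (T (simple_refl k) * z) w = T_coeff z v + (q_param - 1) * T_coeff z w"
        using T_coeff_simple_left[OF w k, of z] False by (simp add: v_def)
      also have "\<dots> = (1 + (q_param - 1) * kappa e) * T_coeff z v" by (simp add: cw algebra_simps)
      also have "\<dots> = q_param * kappa e * T_coeff z w" unfolding kappa_eq cw by (simp add: mult.assoc)
      finally show ?thesis by (simp add: T_coeff_scl)
    qed
  qed
qed

lemma right_eigen_iff:
  assumes k: "k \<in> {1..<r}"
  shows "z * T (simple_refl k) = scl (q_param * kappa e) z \<longleftrightarrow>
    (\<forall>w\<in>sym r. w k < w (Suc k) \<longrightarrow> T_coeff z (w \<circ> simple_refl k) = kappa e * T_coeff z w)"
proof
  assume eq: "z * T (simple_refl k) = scl (q_param * kappa e) z"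
  show "\<forall>w\<in>sym r. w k < w (Suc k) \<longrightarrow> T_coeff z (w \<circ> simple_refl k) = kappa e * T_coeff z w"
  proof (intro ballI impI)
    fix w assume w: "w \<in> sym r" "w k < w (Suc k)"
    have "q_param * T_coeff z (w \<circ> simple_refl k) = q_param * (kappa e * T_coeff z w)"
      using T_coeff_simple_right[OF w(1) k, of z] w(2) eq by (auto simp: T_coeff_scl mult.assoc)
    then show "T_coeff z (w \<circ> simple_refl k) = kappa e * T_coeff z w"
      by (simp add: q_param_def)
  qed
next
  assume c: "\<forall>w\<in>sym r. w k < w (Suc k) \<longrightarrow> T_coeff z (w \<circ> simple_refl k) = kappa e * T_coeff z w"
  show "z * T (simple_refl k) = scl (q_param * kappa e) z"
  proof (rule T_coeff_eqI)
    fix w assume w: "w \<in> sym r"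
    show "T_coeff (z * T (simple_refl k)) w = T_coeff (scl (q_param * kappa e) z) w"
    proof (cases "w k < w (Suc k)")
      case True
      then show ?thesis using T_coeff_simple_right[OF w k, of z] c w by (simp add: T_coeff_scl mult.assoc)
    next
      case False
      define v where "v = w \<circ> simple_refl k"
      have v: "v \<in> sym r" "v k < v (Suc k)" "w = v \<circ> simple_refl k"
        unfolding v_def using w k False sym_neq_Suc[OF w, of k] by auto
      then have cw: "T_coeff z w = kappa e * T_coeff z v" using c by metis
      have "T_coeff (z * T (simple_refl k)) w = T_coeff z v + (q_param - 1) * T_coeff z w"
        using T_coeff_simple_right[OF w k, of z] False by (simp add: v_def)
      also have "\<dots> = (1 + (q_param - 1) * kappa e) * T_coeff z v" by (simp add: cw algebra_simps)
      also have "\<dots> = q_param * kappa e * T_coeff z w" unfolding kappa_eq cw by (simp add: mult.assoc)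
      finally show ?thesis by (simp add: T_coeff_scl)
    qed
  qed
qed

subsection \<open>The bar involution\<close>

text \<open>Obtained by solving the quadratic relation for the inverse of the generator.\<close>

definition T_simple_inv :: "nat \<Rightarrow> 'h" where
  "T_simple_inv k = scl (vpow (- 2)) (T (simple_refl k)) + scl (vpow (- 2) - 1) 1"

lemma T_simple_inv:
  assumes k: "k \<in> {1..<r}"
  shows "T (simple_refl k) * T_simple_inv k = 1" "T_simple_inv k * T (simple_refl k) = 1"
proof -
  have *: "scl (vpow (- 2)) (T (simple_refl k) * T (simple_refl k)) + scl (vpow (- 2) - 1) (T (simple_refl k)) = 1"
    using T_quadratic[OF k]
    by (simp add: scale_right_distrib q_inv ring_distribs scale_left_diff_distrib scale_right_diff_distrib)
  show "T (simple_refl k) * T_simple_inv k = 1"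
    using * by (simp add: T_simple_inv_def distrib_left scl_mult_right[symmetric])
  show "T_simple_inv k * T (simple_refl k) = 1"
    using * by (simp add: T_simple_inv_def distrib_right scl_mult_left[symmetric])
qed

lemma hecke_inv_eq: "a * b = 1 \<Longrightarrow> b * a = 1 \<Longrightarrow> hecke_inv a = b"
  unfolding hecke_inv_def by (rule the_equality) (auto, metis mult.assoc mult_1_left mult_1_right)

lemma T_inverse:
  assumes "w \<in> sym r" shows "T w * hecke_inv (T w) = 1" "hecke_inv (T w) * T w = 1"
proof -
  have "\<exists>b. T w * b = 1 \<and> b * T w = 1" using assms
  proof (induction rule: sym_simple_induct)
    case id
    have "T id * 1 = 1 \<and> 1 * T id = 1" by (simp only: T_id mult_1)
    then show ?case by (simp only: id_def) (rule exI)
  next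
    case (step w k)
    then obtain b where b: "T w * b = 1" "b * T w = 1" by blast
    note s = T_simple_inv[OF step(2)]
    have T: "T (simple_refl k \<circ> w) = T (simple_refl k) * T w" using T_mult_simple_left[OF step(1,2)] step(3) by simp
    have "T (simple_refl k) * T w * (b * T_simple_inv k) = 1" "b * T_simple_inv k * (T (simple_refl k) * T w) = 1"
      using b s by (metis mult.assoc mult_1_right)+
    then show ?case using T by metis
  qed
  then obtain b where b: "T w * b = 1" "b * T w = 1" by blast
  then show "T w * hecke_inv (T w) = 1" "hecke_inv (T w) * T w = 1" using hecke_inv_eq by auto
qed

definition T_bar :: "perm \<Rightarrow> 'h" where
  "T_bar w = hecke_inv (T (pinv w))"

lemma T_bar_id [simp]: "T_bar id = 1"
  unfolding T_bar_def by (rule hecke_inv_eq) (simp_all add: T_id)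

lemma T_bar_simple_left:
  assumes w: "w \<in> sym r" and k: "k \<in> {1..<r}" and up: "pinv w k < pinv w (Suc k)"
  shows "T_bar (simple_refl k \<circ> w) = T_simple_inv k * T_bar w"
  unfolding T_bar_def
proof (rule hecke_inv_eq)
  note i = T_inverse[OF sym_pinv[OF w]] and s = T_simple_inv[OF k]
  have T: "T (pinv (simple_refl k \<circ> w)) = T (pinv w) * T (simple_refl k)"
    using T_mult_simple_right[OF sym_pinv[OF w] k] up pinv_simple_left[OF w k] by simp
  show "T (pinv (simple_refl k \<circ> w)) * (T_simple_inv k * hecke_inv (T (pinv w))) = 1"
    unfolding T using i s by (metis mult.assoc mult_1_right)
  show "T_simple_inv k * hecke_inv (T (pinv w)) * T (pinv (simple_refl k \<circ> w)) = 1"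
    unfolding T using i s by (metis mult.assoc mult_1_right)
qed

lemma hecke_bar_eq: "hecke_bar h = (\<Sum>w\<in>sym r. scl (laurent_bar (T_coeff h w)) (T_bar w))"
  by (simp add: hecke_bar_def T_bar_def)

lemma hecke_bar_add: "hecke_bar (a + b) = hecke_bar a + hecke_bar b"
  by (simp add: hecke_bar_eq T_coeff_add scale_left_distrib sum.distrib)

lemma hecke_bar_scl: "hecke_bar (scl c a) = scl (laurent_bar c) (hecke_bar a)"
  by (simp add: hecke_bar_eq T_coeff_scl scale_sum_right)

lemma hecke_bar_0 [simp]: "hecke_bar 0 = 0"
  by (simp add: hecke_bar_eq)

lemma hecke_bar_sum: "hecke_bar (\<Sum>x\<in>A. f x) = (\<Sum>x\<in>A. hecke_bar (f x))"
  by (induction A rule: infinite_finite_induct) (auto simp: hecke_bar_add)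

lemma hecke_bar_T: "v \<in> sym r \<Longrightarrow> hecke_bar (T v) = T_bar v"
proof -
  assume v: "v \<in> sym r"
  have "hecke_bar (T v) = (\<Sum>w\<in>sym r. if w = v then T_bar w else 0)"
    unfolding hecke_bar_eq by (intro sum.cong refl) (simp add: T_coeff_T[OF v])
  then show ?thesis using v by (simp add: sum.delta)
qed

lemma hecke_bar_1 [simp]: "hecke_bar 1 = 1"
  using hecke_bar_T[of id] by (simp add: T_id)

text \<open>\<open>hecke_bar\<close> is given by its values on the basis, so its multiplicativity
  needs proof. When the reflection shortens w, the product expands by the quadratic relation, and
  the inverse generator satisfies the bar conjugate of that relation, which is
  \<open>sq\<close>.\<close>

lemma hecke_bar_simple_mult_T:
  assumes w: "w \<in> sym r" and k: "k \<in> {1..<r}"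
  shows "hecke_bar (T (simple_refl k) * T w) = T_simple_inv k * T_bar w"
proof (cases "pinv w k < pinv w (Suc k)")
  case True
  then show ?thesis
    using T_mult_simple_left[OF w k] T_bar_simple_left[OF w k True] hecke_bar_T[OF simple_left_sym[OF w k]] by simp
next
  case False
  define v where "v = simple_refl k \<circ> w"
  have v: "v \<in> sym r" "pinv v k < pinv v (Suc k)" "w = simple_refl k \<circ> v"
    unfolding v_def using w k False pinv_neq_Suc[OF w, of k] by (auto simp: pinv_simple_left)
  have Tw: "T_bar w = T_simple_inv k * T_bar v" using T_bar_simple_left[OF v(1) k v(2)] v(3) by simp
  have sq: "T_simple_inv k * T_simple_inv k = scl (vpow (- 2) - 1) (T_simple_inv k) + scl (vpow (- 2)) 1"
  proof -
    have "T_simple_inv k * T_simple_inv k = T_simple_inv k * (scl (vpow (- 2)) (T (simple_refl k)) + scl (vpow (- 2) - 1) 1)"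
      by (simp add: T_simple_inv_def)
    also have "\<dots> = scl (vpow (- 2)) (T_simple_inv k * T (simple_refl k)) + scl (vpow (- 2) - 1) (T_simple_inv k)"
      by (simp add: distrib_left scl_mult_right[symmetric])
    finally show ?thesis using T_simple_inv[OF k] by (simp add: add.commute)
  qed
  have "hecke_bar (T (simple_refl k) * T w) = hecke_bar (scl (q_param - 1) (T w) + scl q_param (T v))"
    using T_mult_simple_left[OF w k] False by (simp add: v_def)
  also have "\<dots> = scl (vpow (- 2) - 1) (T_bar w) + scl (vpow (- 2)) (T_bar v)"
    using w v(1) by (simp add: hecke_bar_add hecke_bar_scl hecke_bar_T q_param_def)
  also have "\<dots> = T_simple_inv k * T_simple_inv k * T_bar v"
    unfolding sq Tw by (simp add: distrib_right scl_mult_left[symmetric])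
  finally show ?thesis by (simp add: Tw mult.assoc)
qed

lemma hecke_bar_simple_mult:
  assumes k: "k \<in> {1..<r}"
  shows "hecke_bar (T (simple_refl k) * z) = T_simple_inv k * hecke_bar z"
proof -
  have "hecke_bar (T (simple_refl k) * z) = hecke_bar (\<Sum>w\<in>sym r. scl (T_coeff z w) (T (simple_refl k) * T w))"
    by (subst T_expand[of z]) (simp add: sum_distrib_left scl_mult_right)
  also have "\<dots> = (\<Sum>w\<in>sym r. scl (laurent_bar (T_coeff z w)) (T_simple_inv k * T_bar w))"
    unfolding hecke_bar_sum hecke_bar_scl by (intro sum.cong refl) (simp add: hecke_bar_simple_mult_T[OF _ k])
  also have "\<dots> = T_simple_inv k * hecke_bar z"
    by (simp add: hecke_bar_eq sum_distrib_left scl_mult_right)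
  finally show ?thesis .
qed

lemma hecke_bar_T_mult:
  assumes "w \<in> sym r" shows "hecke_bar (T w * z) = T_bar w * hecke_bar z"
  using assms
proof (induction rule: sym_simple_induct)
  case id
  have "hecke_bar (T id * z) = T_bar id * hecke_bar z" by (simp only: T_bar_id T_id mult_1)
  then show ?case by (simp only: id_def)
next
  case (step w k)
  have "T (simple_refl k \<circ> w) = T (simple_refl k) * T w" using T_mult_simple_left[OF step(1,2)] step(3) by simp
  then have "hecke_bar (T (simple_refl k \<circ> w) * z) = hecke_bar (T (simple_refl k) * (T w * z))" by (simp add: mult.assoc)
  also have "\<dots> = T_simple_inv k * (T_bar w * hecke_bar z)" using hecke_bar_simple_mult[OF step(2)] step(4) by simp
  also have "\<dots> = T_bar (simple_refl k \<circ> w) * hecke_bar z" using T_bar_simple_left[OF step(1-3)] by (simp add: mult.assoc)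
  finally show ?case by (simp only: comp_def)
qed

lemma hecke_bar_mult: "hecke_bar (x * z) = hecke_bar x * hecke_bar z"
proof -
  have "hecke_bar (x * z) = hecke_bar (\<Sum>w\<in>sym r. scl (T_coeff x w) (T w * z))"
    by (subst T_expand[of x]) (simp add: sum_distrib_right scl_mult_left)
  also have "\<dots> = (\<Sum>w\<in>sym r. scl (laurent_bar (T_coeff x w)) (T_bar w * hecke_bar z))"
    unfolding hecke_bar_sum hecke_bar_scl by (intro sum.cong refl) (simp add: hecke_bar_T_mult)
  also have "\<dots> = hecke_bar x * hecke_bar z"
    by (simp add: hecke_bar_eq[of x] sum_distrib_right scl_mult_left)
  finally show ?thesis .
qed

lemma hecke_bar_T_simple: "k \<in> {1..<r} \<Longrightarrow> hecke_bar (T (simple_refl k)) = T_simple_inv k"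
  using hecke_bar_simple_mult[of k 1] by simp

lemma hecke_bar_bar [simp]: "hecke_bar (hecke_bar z) = z"
proof -
  have s: "hecke_bar (T_simple_inv k) = T (simple_refl k)" if k: "k \<in> {1..<r}" for k
  proof -
    have "hecke_bar (T_simple_inv k) = scl q_param (T_simple_inv k) + scl (q_param - 1) 1"
      using hecke_bar_T_simple[OF k] unfolding T_simple_inv_def[of k] hecke_bar_add hecke_bar_scl
      by (simp add: q_param_def T_simple_inv_def)
    also have "\<dots> = T (simple_refl k)"
      by (simp add: T_simple_inv_def scale_right_distrib q_inv ring_distribs scale_left_diff_distrib scale_right_diff_distrib)
    finally show ?thesis .
  qed
  have T: "hecke_bar (T_bar w) = T w" if "w \<in> sym r" for w
    using that
  proof (induction rule: sym_simple_induct)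
    case id
    have "hecke_bar (T_bar id) = T id" by (simp only: T_bar_id T_id hecke_bar_1)
    then show ?case by (simp only: id_def)
  next
    case (step w k)
    have "hecke_bar (T_bar (simple_refl k \<circ> w)) = T (simple_refl k) * T w"
      unfolding T_bar_simple_left[OF step(1-3)] hecke_bar_mult s[OF step(2)] step(4) ..
    also have "\<dots> = T (simple_refl k \<circ> w)" using T_mult_simple_left[OF step(1,2)] step(3) by simp
    finally show ?case by (simp only: comp_def)
  qed
  have "hecke_bar (hecke_bar z) = (\<Sum>w\<in>sym r. scl (T_coeff z w) (T w))"
    unfolding hecke_bar_eq[of z] hecke_bar_sum hecke_bar_scl by (intro sum.cong refl) (simp add: T)
  then show ?thesis using T_expand[of z] by simp
qed

lemma T_coeff_simple_inv:
  assumes w: "w \<in> sym r" and k: "k \<in> {1..<r}"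
  shows "T_coeff (T_simple_inv k * z) w = (if pinv w k < pinv w (Suc k)
    then T_coeff z (simple_refl k \<circ> w) + (vpow (- 2) - 1) * T_coeff z w
    else vpow (- 2) * T_coeff z (simple_refl k \<circ> w))"
proof -
  have "T_simple_inv k * z = scl (vpow (- 2)) (T (simple_refl k) * z) + scl (vpow (- 2) - 1) z"
    by (simp add: T_simple_inv_def distrib_right scl_mult_left[symmetric])
  then have "T_coeff (T_simple_inv k * z) w =
      vpow (- 2) * T_coeff (T (simple_refl k) * z) w + (vpow (- 2) - 1) * T_coeff z w"
    by (simp add: T_coeff_add T_coeff_scl)
  moreover have 1: "vpow (- 2) * (q_param * x) = x" for x by (simp only: q_inv mult_1 flip: mult.assoc)
  moreover have "vpow (- 2) * (x + (q_param - 1) * y) + (vpow (- 2) - 1) * y = vpow (- 2) * x" for x y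
    using 1[of y] by (simp add: algebra_simps)
  ultimately show ?thesis unfolding T_coeff_simple_left[OF w k] by simp
qed

text \<open>In the step, y can only occur if y or s y occurs for w. If y does, the upward step from
  w to s w suffices; if s y does, the lifting property applies. The coefficient at the top element
  picks up a factor 1/q with each letter.\<close>

lemma T_coeff_T_bar:
  assumes "w \<in> sym r"
  shows "(\<forall>y. T_coeff (T_bar w) y \<noteq> 0 \<longrightarrow> bruhat_le r y w) \<and> T_coeff (T_bar w) w = vpow (- 2 * int (len r w))"
  using assms
proof (induction rule: sym_simple_induct)
  case id
  have *: "T_coeff (T_bar id) y = (if y = id then 1 else 0)" for y
    using T_coeff_T[of id y] by (simp only: T_bar_id T_id sym_id)
  then have "(\<forall>y. T_coeff (T_bar id) y \<noteq> 0 \<longrightarrow> bruhat_le r y id) \<and> T_coeff (T_bar id) id = vpow (- 2 * int (len r id))"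
    unfolding * by simp
  then show ?case by (simp add: id_def)
next
  case (step w k)
  let ?s = "simple_refl k"
  note w = step(1) and k = step(2) and up = step(3)
  have bound: "bruhat_le r y (?s \<circ> w)" if "T_coeff (T_bar (?s \<circ> w)) y \<noteq> 0" for y
  proof -
    have y: "y \<in> sym r" using that T_coeff_outside by blast
    have "T_coeff (T_bar w) (?s \<circ> y) \<noteq> 0 \<or> T_coeff (T_bar w) y \<noteq> 0"
      using that unfolding T_bar_simple_left[OF w k up] T_coeff_simple_inv[OF y k] by (auto split: if_splits)
    then show ?thesis
    proof
      assume "T_coeff (T_bar w) (?s \<circ> y) \<noteq> 0"
      then have "bruhat_le r (?s \<circ> y) w" using step(4) by blast
      then have "bruhat_le r (?s \<circ> (?s \<circ> y)) (?s \<circ> w)" by (rule bruhat_lift[OF _ w k up])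
      then show ?thesis by simp
    next
      assume "T_coeff (T_bar w) y \<noteq> 0"
      then have "bruhat_le r y w" using step(4) by blast
      then show ?thesis using bruhat_simple_left[OF w k up] bruhat_trans by blast
    qed
  qed
  have "\<not> pinv (?s \<circ> w) k < pinv (?s \<circ> w) (Suc k)" using up pinv_simple_left[OF w k] by simp
  then have "T_coeff (T_bar (?s \<circ> w)) (?s \<circ> w) = vpow (- 2) * T_coeff (T_bar w) w"
    unfolding T_bar_simple_left[OF w k up] T_coeff_simple_inv[OF simple_left_sym[OF w k] k] by simp
  also have "\<dots> = vpow (- 2 * int (len r (?s \<circ> w)))"
    unfolding len_simple_left[OF w k up] using step(4) by (simp add: vpow_add)
  finally have "(\<forall>y. T_coeff (T_bar (?s \<circ> w)) y \<noteq> 0 \<longrightarrow> bruhat_le r y (?s \<circ> w)) \<and>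
      T_coeff (T_bar (?s \<circ> w)) (?s \<circ> w) = vpow (- 2 * int (len r (?s \<circ> w)))" using bound by blast
  then show ?case by (simp add: comp_def)
qed

end

section \<open>Eigenspaces of parabolic subalgebras\<close>

lemma block_covariant:
  assumes f: "mono_on {1..r} f" and g: "g \<in> sym r" "asc r f P (pinv g)"
    and c: "\<And>w k. w \<in> sym r \<Longrightarrow> k \<in> gens r f P \<Longrightarrow> pinv w k < pinv w (Suc k) \<Longrightarrow> c (simple_refl k \<circ> w) = \<kappa> * (c w :: laurent)"
    and a: "a \<in> block_perms r f P"
  shows "c (a \<circ> g) = \<kappa> ^ len r a * c g"
  using f a
proof (induction rule: block_perms_induct)
  case id
  have "c (id \<circ> g) = \<kappa> ^ len r id * c g" by simp
  then show ?case by (simp add: comp_def)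
next
  case (step a k)
  note as = block_perms_sym[OF step(1)]
  have ag: "a \<circ> g \<in> sym r" using as g by blast
  have "c (simple_refl k \<circ> (a \<circ> g)) = \<kappa> * c (a \<circ> g)"
    by (rule c[OF ag step(2) pinv_comp_block(1)[OF f step(1) g step(2,3)]])
  moreover have "len r (simple_refl k \<circ> a) = Suc (len r a)" by (rule len_simple_left[OF as gensD(1)[OF step(2)] step(3)])
  ultimately have "c (simple_refl k \<circ> (a \<circ> g)) = \<kappa> ^ len r (simple_refl k \<circ> a) * c g"
    using step(4) by (simp add: mult.assoc)
  then show ?case by (simp add: comp_def)
qed

lemma block_factor:
  assumes f: "mono_on {1..r} f"
  shows "bij_betw (\<lambda>(a, g). a \<circ> g) (block_perms r f P \<times> {g \<in> sym r. asc r f P (pinv g)}) (sym r)"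
proof (rule bij_betw_imageI)
  show "inj_on (\<lambda>(a, g). a \<circ> g) (block_perms r f P \<times> {g \<in> sym r. asc r f P (pinv g)})"
  proof (rule inj_onI, clarify)
    fix a g a' g' assume m: "a \<in> block_perms r f P" "a' \<in> block_perms r f P" "g \<in> sym r" "asc r f P (pinv g)"
      "g' \<in> sym r" "asc r f P (pinv g')" and eq: "a \<circ> g = a' \<circ> g'"
    note s = m(1,2)[THEN block_perms_sym]
    have g: "g = (pinv a \<circ> a') \<circ> g'"
    proof
      fix x show "g x = ((pinv a \<circ> a') \<circ> g') x" using fun_cong[OF eq, of x] s by (simp, metis sym_pinv_apply)
    qed
    then have "pinv a \<circ> a' = id"
      using block_perms_comp_asc_id[OF f, of "pinv a \<circ> a'" P g'] m block_perms_comp[OF block_perms_pinv[OF m(1)] m(2)]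
      by metis
    then have "g = g'" "a' = a"
      using g by (simp, metis comp_assoc comp_id id_comp s(1) sym_pinv_comp(2))
    then show "a = a' \<and> g = g'" by simp
  qed
  show "(\<lambda>(a, g). a \<circ> g) ` (block_perms r f P \<times> {g \<in> sym r. asc r f P (pinv g)}) = sym r"
  proof (intro equalityI subsetI)
    fix w assume "w \<in> (\<lambda>(a, g). a \<circ> g) ` (block_perms r f P \<times> {g \<in> sym r. asc r f P (pinv g)})"
    then show "w \<in> sym r" using block_perms_sym by force
  next
    fix w assume "w \<in> sym r"
    then have "\<exists>a\<in>block_perms r f P. \<exists>g\<in>sym r. asc r f P (pinv g) \<and> w = a \<circ> g"
    \<comment> \<open>An empty selection on the right leaves only the steps on the left.\<close>
    proof (induction rule: double_coset_induct[where f = f and g = f and P = P and P' = "\<lambda>_. False"])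
      case (min w)
      have "w = id \<circ> w" by simp
      then show ?case using min by blast
    next
      case (left w k)
      then obtain a g where ag: "a \<in> block_perms r f P" "g \<in> sym r" "asc r f P (pinv g)" "w = a \<circ> g" by blast
      have "simple_refl k \<circ> a \<in> block_perms r f P" using ag(1) left(2) by blast
      moreover have "simple_refl k \<circ> w = (simple_refl k \<circ> a) \<circ> g" using ag(4) by (simp add: comp_assoc)
      ultimately show ?case using ag by blast
    next
      case (right w k)
      then show ?case by (simp add: gens_def)
    qed
    then show "w \<in> (\<lambda>(a, g). a \<circ> g) ` (block_perms r f P \<times> {g \<in> sym r. asc r f P (pinv g)})" by force
  qed
qed

lemma bij_pinv: "bij_betw pinv (sym r) (sym r)"
  by (rule bij_betw_byWitness[where f' = pinv]) auto

lemma block_factor_right: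
  assumes f: "mono_on {1..r} f"
  shows "bij_betw (\<lambda>(a, g). g \<circ> a) (block_perms r f P \<times> {g \<in> sym r. asc r f P g}) (sym r)"
proof -
  have 1: "bij_betw (map_prod pinv pinv) (block_perms r f P \<times> {g \<in> sym r. asc r f P g})
      (block_perms r f P \<times> {g \<in> sym r. asc r f P (pinv g)})"
  proof (rule bij_betw_byWitness[where f' = "map_prod pinv pinv"])
  qed (auto simp: sym_pinv_pinv[OF block_perms_sym])
  have 2: "bij_betw (pinv \<circ> ((\<lambda>(a, g). a \<circ> g) \<circ> map_prod pinv pinv)) (block_perms r f P \<times> {g \<in> sym r. asc r f P g}) (sym r)"
    by (rule bij_betw_trans[OF bij_betw_trans[OF 1 block_factor[OF f]] bij_pinv])
  have 3: "(pinv \<circ> ((\<lambda>(a, g). a \<circ> g) \<circ> map_prod pinv pinv)) x = (\<lambda>(a, g). g \<circ> a) x"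
    if x: "x \<in> block_perms r f P \<times> {g \<in> sym r. asc r f P g}" for x
  proof -
    obtain a g where ag: "x = (a, g)" "a \<in> block_perms r f P" "g \<in> sym r" using x by auto
    note as = block_perms_sym[OF ag(2)]
    have "pinv (pinv a \<circ> pinv g) = g \<circ> a"
      using sym_comp_pinv[OF sym_pinv[OF as] sym_pinv[OF ag(3)]] as ag(3) by simp
    then show ?thesis using ag(1) by simp
  qed
  show ?thesis by (rule bij_betw_cong[THEN iffD1, OF 3 2])
qed

context hecke_algebra
begin

section \<open>Divisibility by sums over parabolic subgroups\<close>

definition block_sum :: "(nat \<Rightarrow> nat) \<Rightarrow> (nat \<Rightarrow> bool) \<Rightarrow> bool \<Rightarrow> 'h" where
  "block_sum f P e = (\<Sum>a\<in>block_perms r f P. scl (kappa e ^ len r a) (T a))"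

lemma T_coeff_restrict:
  assumes "A \<subseteq> sym r"
  shows "T_coeff (\<Sum>w\<in>A. scl (c w) (T w)) w = (if w \<in> A then c w else 0)"
proof -
  have "(\<Sum>w\<in>A. scl (c w) (T w)) = (\<Sum>w\<in>sym r. scl (if w \<in> A then c w else 0) (T w))"
    using assms by (intro sum.mono_neutral_cong_left) auto
  then show ?thesis using T_coeff_sum_T[of "\<lambda>w. if w \<in> A then c w else 0" w] assms by auto
qed

text \<open>The sum is sorted by cosets W g with g minimal: \<open>T (a \<circ> g)\<close> is
  \<open>T a * T g\<close>, and the coefficient at a g is that at g times a power of
  \<open>kappa e\<close>. So the sum over W splits off; it is x for the even type with
  \<open>kappa True\<close>, and y for the odd type with \<open>kappa False\<close>.\<close>

lemma block_sum_factor: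
  assumes f: "mono_on {1..r} f"
    and c: "\<And>w k. w \<in> sym r \<Longrightarrow> k \<in> gens r f P \<Longrightarrow> pinv w k < pinv w (Suc k) \<Longrightarrow> c (simple_refl k \<circ> w) = kappa e * c w"
  shows "(\<Sum>w\<in>sym r. scl (c w) (T w)) = block_sum f P e * (\<Sum>g\<in>{g \<in> sym r. asc r f P (pinv g)}. scl (c g) (T g))"
proof -
  let ?L = "{g \<in> sym r. asc r f P (pinv g)}"
  have "(\<Sum>w\<in>sym r. scl (c w) (T w)) = (\<Sum>(a, g)\<in>block_perms r f P \<times> ?L. scl (c (a \<circ> g)) (T (a \<circ> g)))"
    by (subst sum.reindex_bij_betw[OF block_factor[OF f], symmetric]) (simp add: case_prod_unfold)
  also have "\<dots> = (\<Sum>(a, g)\<in>block_perms r f P \<times> ?L. scl (kappa e ^ len r a) (T a) * scl (c g) (T g))"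
  proof (rule sum.cong[OF refl], clarify)
    fix a g assume a: "a \<in> block_perms r f P" and g: "g \<in> sym r" "asc r f P (pinv g)"
    have "c (a \<circ> g) = kappa e ^ len r a * c g" by (rule block_covariant[OF f g c a])
    moreover have "T a * T g = T (a \<circ> g)" by (rule T_mult[OF block_perms_sym[OF a] g(1) len_block_comp[OF f a g]])
    ultimately show "scl (c (a \<circ> g)) (T (a \<circ> g)) = scl (kappa e ^ len r a) (T a) * scl (c g) (T g)"
      by (simp add: scl_mult_left[symmetric] scl_mult_right[symmetric] mult.commute)
  qed
  also have "\<dots> = block_sum f P e * (\<Sum>g\<in>?L. scl (c g) (T g))"
    unfolding block_sum_def sum_product by (simp add: sum.cartesian_product)
  finally show ?thesis .
qed

lemma block_sum_factor_right:
  assumes f: "mono_on {1..r} f"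
    and c: "\<And>w k. w \<in> sym r \<Longrightarrow> k \<in> gens r f P \<Longrightarrow> w k < w (Suc k) \<Longrightarrow> c (w \<circ> simple_refl k) = kappa e * c w"
  shows "(\<Sum>w\<in>sym r. scl (c w) (T w)) = (\<Sum>g\<in>{g \<in> sym r. asc r f P g}. scl (c g) (T g)) * block_sum f P e"
proof -
  let ?L = "{g \<in> sym r. asc r f P g}"
  have "(\<Sum>w\<in>sym r. scl (c w) (T w)) = (\<Sum>(a, g)\<in>block_perms r f P \<times> ?L. scl (c (g \<circ> a)) (T (g \<circ> a)))"
    by (subst sum.reindex_bij_betw[OF block_factor_right[OF f], symmetric]) (simp add: case_prod_unfold)
  also have "\<dots> = (\<Sum>(a, g)\<in>block_perms r f P \<times> ?L. scl (c g) (T g) * scl (kappa e ^ len r a) (T a))"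
  proof (rule sum.cong[OF refl], clarify)
    fix a g assume a: "a \<in> block_perms r f P" and g: "g \<in> sym r" "asc r f P g"
    note as = block_perms_sym[OF a]
    \<comment> \<open>Covariance on the right becomes covariance on the left for the coefficients
      read at inverses.\<close>
    have cp: "c (pinv (simple_refl k \<circ> w)) = kappa e * c (pinv w)"
      if w: "w \<in> sym r" and k: "k \<in> gens r f P" and up: "pinv w k < pinv w (Suc k)" for w k
      using c[OF sym_pinv[OF w] k up] pinv_simple_left[OF w gensD(1)[OF k]] by simp
    have "c (pinv (pinv a \<circ> pinv g)) = kappa e ^ len r (pinv a) * c (pinv (pinv g))"
      using block_covariant[where c = "\<lambda>w. c (pinv w)" and \<kappa> = "kappa e", OF f sym_pinv[OF g(1)] _ cp block_perms_pinv[OF a]] g by simp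
    then have "c (g \<circ> a) = kappa e ^ len r a * c g"
      using sym_comp_pinv[OF sym_pinv[OF as] sym_pinv[OF g(1)]] as g(1) len_pinv[OF as] by simp
    moreover have "T g * T a = T (g \<circ> a)" by (rule T_mult[OF g(1) as len_comp_block[OF f a g]])
    ultimately show "scl (c (g \<circ> a)) (T (g \<circ> a)) = scl (c g) (T g) * scl (kappa e ^ len r a) (T a)"
      by (simp add: scl_mult_left[symmetric] scl_mult_right[symmetric] mult.commute)
  qed
  also have "\<dots> = (\<Sum>a\<in>block_perms r f P. \<Sum>g\<in>?L. scl (c g) (T g) * scl (kappa e ^ len r a) (T a))"
    by (simp add: sum.cartesian_product)
  also have "\<dots> = (\<Sum>g\<in>?L. scl (c g) (T g)) * block_sum f P e"
    unfolding block_sum_def sum_product by (rule sum.swap)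
  finally show ?thesis .
qed

lemma T_coeff_block_sum: "T_coeff (block_sum f P e) w = (if w \<in> block_perms r f P then kappa e ^ len r w else 0)"
  unfolding block_sum_def by (rule T_coeff_restrict) (use block_perms_sym in blast)

lemma block_perms_simple_left_iff:
  assumes "k \<in> gens r f P" shows "simple_refl k \<circ> w \<in> block_perms r f P \<longleftrightarrow> w \<in> block_perms r f P"
  using block_perms_comp[OF block_perms_simple[OF assms], of w] 
    block_perms_comp[OF block_perms_simple[OF assms], of "simple_refl k \<circ> w"] by auto

lemma block_perms_simple_right_iff:
  assumes "k \<in> gens r f P" shows "w \<circ> simple_refl k \<in> block_perms r f P \<longleftrightarrow> w \<in> block_perms r f P"
  using block_perms_comp[OF _ block_perms_simple[OF assms], of w] 
    block_perms_comp[OF _ block_perms_simple[OF assms], of "w \<circ> simple_refl k"] by auto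

lemma block_sum_left_eigen:
  assumes k: "k \<in> gens r f P" shows "T (simple_refl k) * block_sum f P e = scl (q_param * kappa e) (block_sum f P e)"
  unfolding left_eigen_iff[OF gensD(1)[OF k]] T_coeff_block_sum block_perms_simple_left_iff[OF k]
  using len_simple_left[OF _ gensD(1)[OF k]] by simp

lemma block_sum_right_eigen:
  assumes k: "k \<in> gens r f P" shows "block_sum f P e * T (simple_refl k) = scl (q_param * kappa e) (block_sum f P e)"
  unfolding right_eigen_iff[OF gensD(1)[OF k]] T_coeff_block_sum block_perms_simple_right_iff[OF k]
  using len_simple_right[OF _ gensD(1)[OF k]] by simp

text \<open>The reflection and each a move disjoint sets of points, so they commute, and lengths add
  in either order.\<close>

lemma block_sum_commute:
  assumes k: "k \<in> gens r f (parity_type m (\<not> e))"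
  shows "T (simple_refl k) * block_sum f (parity_type m e) e' = block_sum f (parity_type m e) e' * T (simple_refl k)"
proof -
  have "T (simple_refl k) * T a = T a * T (simple_refl k)" if a: "a \<in> block_perms r f (parity_type m e)" for a
  proof -
    note as = block_perms_sym[OF a]
    have kr: "k \<in> {1..r}" "Suc k \<in> {1..r}" using gensD(1)[OF k] by auto
    have nt: "\<not> parity_type m e (f k)" "\<not> parity_type m e (f (Suc k))"
      using gensD(2,3)[OF k] by (auto simp: parity_type_def)
    have fix1: "a k = k" "a (Suc k) = Suc k" "pinv a k = k" "pinv a (Suc k) = Suc k"
      using block_permsD(2)[OF a kr(1) nt(1)] block_permsD(2)[OF a kr(2) nt(2)]
       block_permsD(2)[OF block_perms_pinv[OF a] kr(1) nt(1)] block_permsD(2)[OF block_perms_pinv[OF a] kr(2) nt(2)] by auto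
    have "T (simple_refl k) * T a = T (simple_refl k \<circ> a)"
      by (rule T_mult_simple_left_up[OF as gensD(1)[OF k]]) (simp add: fix1)
    moreover have "T a * T (simple_refl k) = T (a \<circ> simple_refl k)"
      by (rule T_mult_simple_right_up[OF as gensD(1)[OF k]]) (simp add: fix1)
    moreover have "a \<circ> simple_refl k = simple_refl k \<circ> a" by (rule block_perms_commute[OF a block_perms_simple[OF k]])
    ultimately show ?thesis by simp
  qed
  then show ?thesis unfolding block_sum_def sum_distrib_left sum_distrib_right
    by (intro sum.cong refl) (simp add: scl_mult_left[symmetric] scl_mult_right[symmetric])
qed

section \<open>Eigenspaces and their generators\<close>

definition left_space :: "nat \<Rightarrow> (nat \<Rightarrow> nat) \<Rightarrow> 'h set" where
  "left_space m f = {z. \<forall>k\<in>gens r f any_type. T (simple_refl k) * z = scl (q_param * kappa (f k < m)) z}"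

definition right_space :: "nat \<Rightarrow> (nat \<Rightarrow> nat) \<Rightarrow> 'h set" where
  "right_space m f = {z. \<forall>k\<in>gens r f any_type. z * T (simple_refl k) = scl (q_param * kappa (f k < m)) z}"

definition xy :: "nat \<Rightarrow> (nat \<Rightarrow> nat) \<Rightarrow> 'h" where
  "xy m f = block_sum f (parity_type m True) True * block_sum f (parity_type m False) False"

lemma left_spaceD: "z \<in> left_space m f \<Longrightarrow> w \<in> sym r \<Longrightarrow> k \<in> gens r f any_type \<Longrightarrow> pinv w k < pinv w (Suc k) \<Longrightarrow>
    T_coeff z (simple_refl k \<circ> w) = kappa (f k < m) * T_coeff z w"
  using left_eigen_iff[OF gensD(1)] unfolding left_space_def by blast

lemma right_spaceD: "z \<in> right_space m f \<Longrightarrow> w \<in> sym r \<Longrightarrow> k \<in> gens r f any_type \<Longrightarrow> w k < w (Suc k) \<Longrightarrow>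
    T_coeff z (w \<circ> simple_refl k) = kappa (f k < m) * T_coeff z w"
  using right_eigen_iff[OF gensD(1)] unfolding right_space_def by blast

lemma left_space_mult: "z \<in> left_space m f \<Longrightarrow> z * h \<in> left_space m f"
  unfolding left_space_def by (auto simp: scl_mult_left mult.assoc[symmetric])

lemma right_space_mult: "z \<in> right_space m f \<Longrightarrow> h * z \<in> right_space m f"
  unfolding right_space_def by (auto simp: scl_mult_right mult.assoc)

lemma left_space_scl: "z \<in> left_space m f \<Longrightarrow> scl c z \<in> left_space m f"
  unfolding left_space_def by (auto simp: scl_mult_right[symmetric] mult.commute)

lemma right_space_scl: "z \<in> right_space m f \<Longrightarrow> scl c z \<in> right_space m f"
  unfolding right_space_def by (auto simp: scl_mult_left[symmetric] mult.commute)

lemma gens_parity: "k \<in> gens r f any_type \<longleftrightarrow> k \<in> gens r f (parity_type m (f k < m))"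
  by (auto simp: gens_def parity_type_def)

lemma xy_left: "xy m f \<in> left_space m f"
  unfolding left_space_def
proof (intro CollectI ballI)
  let ?x = "block_sum f (parity_type m True) True" and ?y = "block_sum f (parity_type m False) False"
  fix k assume k: "k \<in> gens r f any_type"
  then have k': "k \<in> gens r f (parity_type m (f k < m))" using gens_parity by blast
  show "T (simple_refl k) * xy m f = scl (q_param * kappa (f k < m)) (xy m f)"
  proof (cases "f k < m")
    case True
    then show ?thesis using block_sum_left_eigen[of k f "parity_type m True" True] k'
      by (simp add: xy_def mult.assoc[symmetric] scl_mult_left)
  next
    case False
    then have ko: "k \<in> gens r f (parity_type m (\<not> True))" using k' by simp
    have "T (simple_refl k) * (?x * ?y) = ?x * (T (simple_refl k) * ?y)"
      using block_sum_commute[OF ko] by (metis mult.assoc)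
    also have "\<dots> = scl (q_param * kappa False) (?x * ?y)"
      using block_sum_left_eigen[of k f "parity_type m False" False] k' False by (simp add: scl_mult_right)
    finally show ?thesis using False by (simp add: xy_def)
  qed
qed

lemma xy_right: "xy m f \<in> right_space m f"
  unfolding right_space_def
proof (intro CollectI ballI)
  let ?x = "block_sum f (parity_type m True) True" and ?y = "block_sum f (parity_type m False) False"
  fix k assume k: "k \<in> gens r f any_type"
  then have k': "k \<in> gens r f (parity_type m (f k < m))" using gens_parity by blast
  show "xy m f * T (simple_refl k) = scl (q_param * kappa (f k < m)) (xy m f)"
  proof (cases "f k < m")
    case True
    then have ke: "k \<in> gens r f (parity_type m (\<not> False))" using k' by simp
    have "?x * ?y * T (simple_refl k) = ?x * T (simple_refl k) * ?y"
      using block_sum_commute[OF ke] by (metis mult.assoc)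
    also have "\<dots> = scl (q_param * kappa True) (?x * ?y)"
      using block_sum_right_eigen[of k f "parity_type m True" True] k' True by (simp add: scl_mult_left)
    finally show ?thesis using True by (simp add: xy_def)
  next
    case False
    then show ?thesis using block_sum_right_eigen[of k f "parity_type m False" False] k'
      by (simp add: xy_def mult.assoc scl_mult_right)
  qed
qed

lemma asc_parity: "asc r f any_type v \<longleftrightarrow> asc r f (parity_type m True) v \<and> asc r f (parity_type m False) v"
  by (auto simp: asc_def gens_def parity_type_def)

lemma asc_other_parity:
  assumes k: "k \<in> gens r f (parity_type m (\<not> e))"
  shows "asc r f (parity_type m e) (v \<circ> simple_refl k) \<longleftrightarrow> asc r f (parity_type m e) v"
proof -
  have "simple_refl k j = j \<and> simple_refl k (Suc j) = Suc j" if j: "j \<in> gens r f (parity_type m e)" for j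
  proof -
    have "f j \<noteq> f k" "f (Suc j) \<noteq> f k" "f (Suc k) = f k"
      using gensD(2,3)[OF k] gensD(2,3)[OF j] by (auto simp: parity_type_def)
    then have "j \<noteq> k" "j \<noteq> Suc k" "Suc j \<noteq> k" "Suc j \<noteq> Suc k" by auto
    then show ?thesis by simp
  qed
  then show ?thesis by (auto simp: asc_def)
qed

text \<open>The sum x is split off first, then y from the remaining sum over elements that are
  minimal for the even subgroup. For this the truncated coefficients \<open>c\<close> must still be
  covariant for odd reflections, which holds because these do not touch even ascents.\<close>

lemma left_space_factor:
  assumes f: "mono_on {1..r} f" and z: "z \<in> left_space m f"
  shows "z = xy m f * (\<Sum>g\<in>{g \<in> sym r. asc r f any_type (pinv g)}. scl (T_coeff z g) (T g))"
proof -
  let ?P = "parity_type m"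
  let ?E = "\<lambda>e. {g \<in> sym r. asc r f (?P e) (pinv g)}"
  define c where "c = (\<lambda>w. if asc r f (?P True) (pinv w) then T_coeff z w else 0)"
  have cov: "T_coeff z (simple_refl k \<circ> w) = kappa e * T_coeff z w"
    if "w \<in> sym r" "k \<in> gens r f (?P e)" "pinv w k < pinv w (Suc k)" for w k e
    using left_spaceD[OF z that(1) gens_any[OF that(2)] that(3)] gensD(3)[OF that(2)] by (simp add: parity_type_def)
  have "z = block_sum f (?P True) True * (\<Sum>g\<in>?E True. scl (T_coeff z g) (T g))"
    using block_sum_factor[where P = "?P True" and c = "T_coeff z" and e = True, OF f cov] T_expand[of z] by simp
  also have "(\<Sum>g\<in>?E True. scl (T_coeff z g) (T g)) = (\<Sum>g\<in>sym r. scl (c g) (T g))"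
    by (intro sum.mono_neutral_cong_left) (auto simp: c_def)
  also have "\<dots> = block_sum f (?P False) False * (\<Sum>g\<in>?E False. scl (c g) (T g))"
  proof (rule block_sum_factor[OF f])
    fix w k assume w: "w \<in> sym r" and k: "k \<in> gens r f (?P False)" and up: "pinv w k < pinv w (Suc k)"
    have "asc r f (?P True) (pinv (simple_refl k \<circ> w)) \<longleftrightarrow> asc r f (?P True) (pinv w)"
      unfolding pinv_simple_left[OF w gensD(1)[OF k]] by (rule asc_other_parity) (use k in simp)
    then show "c (simple_refl k \<circ> w) = kappa False * c w" using cov[OF w k up] by (simp add: c_def)
  qed
  also have "(\<Sum>g\<in>?E False. scl (c g) (T g)) = (\<Sum>g\<in>{g \<in> sym r. asc r f any_type (pinv g)}. scl (T_coeff z g) (T g))"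
    by (rule sum.mono_neutral_cong_right) (auto simp: c_def asc_parity[of f _ m])
  finally show ?thesis unfolding xy_def by (simp only: mult.assoc)
qed

lemma right_space_factor:
  assumes f: "mono_on {1..r} f" and z: "z \<in> right_space m f"
  shows "\<exists>h. z = h * xy m f"
proof -
  let ?P = "parity_type m"
  let ?E = "\<lambda>e. {g \<in> sym r. asc r f (?P e) g}"
  \<comment> \<open>In \<open>xy\<close> the odd sum stands on the right, so here it is split off
    first.\<close>
  define c where "c = (\<lambda>w. if asc r f (?P False) w then T_coeff z w else 0)"
  have cov: "T_coeff z (w \<circ> simple_refl k) = kappa e * T_coeff z w"
    if "w \<in> sym r" "k \<in> gens r f (?P e)" "w k < w (Suc k)" for w k e
    using right_spaceD[OF z that(1) gens_any[OF that(2)] that(3)] gensD(3)[OF that(2)] by (simp add: parity_type_def)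
  have "z = (\<Sum>g\<in>?E False. scl (T_coeff z g) (T g)) * block_sum f (?P False) False"
    using block_sum_factor_right[where P = "?P False" and c = "T_coeff z" and e = False, OF f cov] T_expand[of z] by simp
  also have "(\<Sum>g\<in>?E False. scl (T_coeff z g) (T g)) = (\<Sum>g\<in>sym r. scl (c g) (T g))"
    by (intro sum.mono_neutral_cong_left) (auto simp: c_def)
  also have "\<dots> = (\<Sum>g\<in>?E True. scl (c g) (T g)) * block_sum f (?P True) True"
  proof (rule block_sum_factor_right[OF f])
    fix w k assume w: "w \<in> sym r" and k: "k \<in> gens r f (?P True)" and up: "w k < w (Suc k)"
    have "asc r f (?P False) (w \<circ> simple_refl k) \<longleftrightarrow> asc r f (?P False) w"
      by (rule asc_other_parity) (use k in simp)
    then show "c (w \<circ> simple_refl k) = kappa True * c w" using cov[OF w k up] by (simp add: c_def)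
  qed
  finally show ?thesis unfolding xy_def by (metis mult.assoc)
qed

text \<open>Bar makes \<open>hecke_bar z\<close> an eigenvector of the inverse generator with the
  inverse eigenvalue, which is the original condition again.\<close>

lemma left_space_bar:
  assumes "z \<in> left_space m f" shows "hecke_bar z \<in> left_space m f"
  unfolding left_space_def
proof (intro CollectI ballI)
  fix k assume k: "k \<in> gens r f any_type"
  let ?c = "q_param * kappa (f k < m)"
  note s = T_simple_inv[OF gensD(1)[OF k]]
  have "T (simple_refl k) * z = scl ?c z" using assms k by (simp add: left_space_def)
  then have "T_simple_inv k * hecke_bar z = scl (laurent_bar ?c) (hecke_bar z)"
    by (metis hecke_bar_simple_mult[OF gensD(1)[OF k]] hecke_bar_scl)
  then have "T (simple_refl k) * (T_simple_inv k * hecke_bar z) = scl (laurent_bar ?c) (T (simple_refl k) * hecke_bar z)"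
    by (simp add: scl_mult_right)
  then have "hecke_bar z = scl (laurent_bar ?c) (T (simple_refl k) * hecke_bar z)"
    using s by (simp add: mult.assoc[symmetric])
  then have "scl ?c (hecke_bar z) = scl (laurent_bar ?c * ?c) (T (simple_refl k) * hecke_bar z)"
    by (metis scale_scale mult.commute)
  then show "T (simple_refl k) * hecke_bar z = scl ?c (hecke_bar z)" unfolding kappa_bar_q by simp
qed

lemma right_space_bar:
  assumes "z \<in> right_space m f" shows "hecke_bar z \<in> right_space m f"
  unfolding right_space_def
proof (intro CollectI ballI)
  fix k assume k: "k \<in> gens r f any_type"
  let ?c = "q_param * kappa (f k < m)"
  note s = T_simple_inv[OF gensD(1)[OF k]]
  have "z * T (simple_refl k) = scl ?c z" using assms k by (simp add: right_space_def)
  then have "hecke_bar z * T_simple_inv k = scl (laurent_bar ?c) (hecke_bar z)"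
    by (metis hecke_bar_T_simple[OF gensD(1)[OF k]] hecke_bar_mult hecke_bar_scl)
  then have "hecke_bar z * T_simple_inv k * T (simple_refl k) = scl (laurent_bar ?c) (hecke_bar z * T (simple_refl k))"
    by (simp add: scl_mult_left)
  then have "hecke_bar z = scl (laurent_bar ?c) (hecke_bar z * T (simple_refl k))"
    using s by (simp add: mult.assoc)
  then have "scl ?c (hecke_bar z) = scl (laurent_bar ?c * ?c) (hecke_bar z * T (simple_refl k))"
    by (metis scale_scale mult.commute)
  then show "hecke_bar z * T (simple_refl k) = scl ?c (hecke_bar z)" unfolding kappa_bar_q by simp
qed

section \<open>The basis elements of the eigenspaces\<close>

text \<open>The closed form of \<open>T_mat\<close>: one sum over the double coset replaces the
  nested sums of its definition.\<close>

definition coset_sum :: "nat \<Rightarrow> (nat \<Rightarrow> nat) \<Rightarrow> (nat \<Rightarrow> nat) \<Rightarrow> nmat \<Rightarrow> 'h" where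
  "coset_sum m f g A = (\<Sum>w\<in>mat_perms r f g A. scl (kappa False ^ bindex r f g (parity_type m False) w) (T w))"

lemma T_coeff_coset_sum:
  "T_coeff (coset_sum m f g A) w = (if w \<in> mat_perms r f g A then kappa False ^ bindex r f g (parity_type m False) w else 0)"
  unfolding coset_sum_def by (rule T_coeff_restrict[OF mat_perms_sub])

text \<open>Lengthening by an even generator keeps the odd index and lengthening by an odd one
  raises it by one, which is the covariance required of the coefficients.\<close>

lemma coset_sum_spaces:
  assumes ok: "\<And>w. w \<in> mat_perms r f g A \<Longrightarrow> parity_ok r m f g w"
  shows "coset_sum m f g A \<in> left_space m f" "coset_sum m f g A \<in> right_space m g"
proof -
  show "coset_sum m f g A \<in> left_space m f" unfolding left_space_def
  proof (intro CollectI ballI)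
    fix k assume k: "k \<in> gens r f any_type"
    show "T (simple_refl k) * coset_sum m f g A = scl (q_param * kappa (f k < m)) (coset_sum m f g A)"
      unfolding left_eigen_iff[OF gensD(1)[OF k]]
    proof (intro ballI impI)
      fix w assume w: "w \<in> sym r" "pinv w k < pinv w (Suc k)"
      have "simple_refl k \<circ> w \<in> mat_perms r f g A \<longleftrightarrow> w \<in> mat_perms r f g A"
        using mat_of_simple_left[OF w(1) k, of g] simple_left_sym[OF w(1) gensD(1)[OF k]] w(1) by (simp add: mat_perms_def)
      moreover have "bindex r f g (parity_type m False) (simple_refl k \<circ> w) =
          bindex r f g (parity_type m False) w + (if f k < m then 0 else 1)" if "w \<in> mat_perms r f g A"
        using bindex_simple_left[OF w(1) k w(2) ok[OF that], of False] by (simp add: parity_type_def[of _ _ "f k"])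
      ultimately show "T_coeff (coset_sum m f g A) (simple_refl k \<circ> w) = kappa (f k < m) * T_coeff (coset_sum m f g A) w"
        unfolding T_coeff_coset_sum by (cases "f k < m") simp_all
    qed
  qed
  show "coset_sum m f g A \<in> right_space m g" unfolding right_space_def
  proof (intro CollectI ballI)
    fix k assume k: "k \<in> gens r g any_type"
    show "coset_sum m f g A * T (simple_refl k) = scl (q_param * kappa (g k < m)) (coset_sum m f g A)"
      unfolding right_eigen_iff[OF gensD(1)[OF k]]
    proof (intro ballI impI)
      fix w assume w: "w \<in> sym r" "w k < w (Suc k)"
      have "w \<circ> simple_refl k \<in> mat_perms r f g A \<longleftrightarrow> w \<in> mat_perms r f g A"
        using mat_of_simple_right[OF w(1) k, of f] simple_right_sym[OF w(1) gensD(1)[OF k]] w(1) by (simp add: mat_perms_def)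
      moreover have "bindex r f g (parity_type m False) (w \<circ> simple_refl k) =
          bindex r f g (parity_type m False) w + (if g k < m then 0 else 1)" if "w \<in> mat_perms r f g A"
        using bindex_simple_right[OF w(1) k w(2) ok[OF that], of False] by (simp add: parity_type_def[of _ _ "g k"])
      ultimately show "T_coeff (coset_sum m f g A) (w \<circ> simple_refl k) = kappa (g k < m) * T_coeff (coset_sum m f g A) w"
        unfolding T_coeff_coset_sum by (cases "g k < m") simp_all
    qed
  qed
qed

text \<open>At the minimal element, \<open>mixed_cell\<close> provides a left and a right reflection
  with the same product but different factors; from there the vanishing spreads over the double
  coset by covariance.\<close>

lemma bispace_coeff_0:
  assumes f: "mono_on {1..r} f" and g: "mono_on {1..r} g" and z: "z \<in> left_space m f" "z \<in> right_space m g"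
    and w: "w \<in> sym r" "\<not> parity_ok r m f g w"
  shows "T_coeff z w = 0"
  using w
proof (induction rule: double_coset_induct[where f = f and g = g and P = any_type and P' = any_type])
  case (min d)
  obtain k l where kl: "k \<in> gens r g any_type" "l \<in> gens r f any_type" "pinv d l < pinv d (Suc l)" "d k < d (Suc k)"
    "d \<circ> simple_refl k = simple_refl l \<circ> d" "(f l < m) \<noteq> (g k < m)"
    using mixed_cell[OF f g min] by blast
  have "kappa (f l < m) * T_coeff z d = kappa (g k < m) * T_coeff z d"
    using left_spaceD[OF z(1) min(1) kl(2,3)] right_spaceD[OF z(2) min(1) kl(1,4)] kl(5) by metis
  then have "(kappa (f l < m) - kappa (g k < m)) * T_coeff z d = 0" by (simp add: algebra_simps)
  moreover have "kappa (f l < m) \<noteq> kappa (g k < m)" using kl(6) kappa_neq by (cases "f l < m") auto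
  ultimately show ?case by simp
next
  case (left w k)
  have "T_coeff z w = 0" using left(4) parity_ok_cong[OF mat_of_simple_left[OF left(1,2)]] left(5) by blast
  then have "T_coeff z (simple_refl k \<circ> w) = 0" using left_spaceD[OF z(1) left(1-3)] by simp
  then show ?case by (simp add: comp_def)
next
  case (right w k)
  have "T_coeff z w = 0" using right(4) parity_ok_cong[OF mat_of_simple_right[OF right(1,2)]] right(5) by blast
  then have "T_coeff z (w \<circ> simple_refl k) = 0" using right_spaceD[OF z(2) right(1-3)] by simp
  then show ?case by (simp add: comp_def)
qed

text \<open>Each lengthening step multiplies the coefficient by 1 or by \<open>kappa False\<close>,
  and \<open>bindex\<close> counts the latter.\<close>

lemma bispace_coeff:
  assumes f: "mono_on {1..r} f" and g: "mono_on {1..r} g" and z: "z \<in> left_space m f" "z \<in> right_space m g"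
    and d: "d \<in> sym r" "asc r f any_type (pinv d)" "asc r g any_type d" "parity_ok r m f g d"
    and w: "w \<in> sym r" "mat_of r f g w = mat_of r f g d"
  shows "T_coeff z w = kappa False ^ bindex r f g (parity_type m False) w * T_coeff z d"
  using w
proof (induction rule: double_coset_induct[where f = f and g = g and P = any_type and P' = any_type])
  case (min w)
  then have "w = d" using bimin_unique f g d by blast
  then show ?case using bindex_min[OF f g d(1-3)] by simp
next
  case (left w k)
  have m: "mat_of r f g w = mat_of r f g d" using left mat_of_simple_left by metis
  then have ok: "parity_ok r m f g w" using d(4) parity_ok_cong by blast
  have "T_coeff z (simple_refl k \<circ> w) = kappa (f k < m) * (kappa False ^ bindex r f g (parity_type m False) w * T_coeff z d)"
    using left_spaceD[OF z(1) left(1-3)] left(4)[OF m] by simp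
  also have "\<dots> = kappa False ^ bindex r f g (parity_type m False) (simple_refl k \<circ> w) * T_coeff z d"
    unfolding bindex_simple_left[OF left(1-3) ok] by (cases "f k < m") (simp_all add: parity_type_def[of _ _ "f k"])
  finally show ?case by (simp add: comp_def)
next
  case (right w k)
  have m: "mat_of r f g w = mat_of r f g d" using right mat_of_simple_right by metis
  then have ok: "parity_ok r m f g w" using d(4) parity_ok_cong by blast
  have "T_coeff z (w \<circ> simple_refl k) = kappa (g k < m) * (kappa False ^ bindex r f g (parity_type m False) w * T_coeff z d)"
    using right_spaceD[OF z(2) right(1-3)] right(4)[OF m] by simp
  also have "\<dots> = kappa False ^ bindex r f g (parity_type m False) (w \<circ> simple_refl k) * T_coeff z d"
    unfolding bindex_simple_right[OF right(1-3) ok] by (cases "g k < m") (simp_all add: parity_type_def[of _ _ "g k"])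
  finally show ?case by (simp add: comp_def)
qed

end

text \<open>The place of the leading coefficient: the matrices are ordered by their pivots, and the
  coefficient of \<open>T_cal\<close> at its pivot is a unit.\<close>

definition pivot :: "nat \<Rightarrow> nat \<Rightarrow> nat \<Rightarrow> nmat \<Rightarrow> perm" where
  "pivot m n r D = longest r (dcoset m n r D)"

definition mats_between :: "nat \<Rightarrow> nat \<Rightarrow> nat \<Rightarrow> nat list \<Rightarrow> nat list \<Rightarrow> nmat set" where
  "mats_between m n r \<nu> \<xi> = {C \<in> mats m n r. row_sums m n C = \<nu> \<and> col_sums m n C = \<xi>}"

lemma blk_mono_r: "\<nu> \<in> bicomps m n r \<Longrightarrow> mono_on {1..r} (blk \<nu>)"
  using blk_mono[of \<nu>] by (simp add: bicomps_def)

lemma finite_mats_between [simp, intro]: "finite (mats_between m n r \<nu> \<xi>)"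
  by (simp add: mats_between_def)

lemma pivot:
  assumes "D \<in> mats m n r"
  shows "pivot m n r D \<in> dcoset m n r D" "w \<in> dcoset m n r D \<Longrightarrow> bruhat_le r w (pivot m n r D)"
proof -
  have "dcoset m n r D \<subseteq> sym r" by (auto simp: dcoset_def)
  then show "pivot m n r D \<in> dcoset m n r D"
    unfolding pivot_def by (rule longest(1)[OF _ dcoset_nonempty[OF assms]])
  show "w \<in> dcoset m n r D \<Longrightarrow> bruhat_le r w (pivot m n r D)"
    unfolding pivot_def dcoset_eq[OF assms]
    by (rule bruhat_longest[OF blk_mono_r[OF row_sums_bicomps[OF assms]] blk_mono_r[OF col_sums_bicomps[OF assms]]])
qed

lemma mat_le_iff: "mat_le m n r C D \<longleftrightarrow> row_sums m n C = row_sums m n D \<and> col_sums m n C = col_sums m n D \<and>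
    bruhat_le r (pivot m n r C) (pivot m n r D)"
  by (simp add: mat_le_def pivot_def)

lemma dcoset_disjoint:
  assumes "C \<in> mats m n r" "D \<in> mats m n r" "row_sums m n C = row_sums m n D" "col_sums m n C = col_sums m n D"
    "w \<in> dcoset m n r C" "w \<in> dcoset m n r D"
  shows "C = D"
  using mats_parity_ok(2)[OF assms(1,5), unfolded assms(3,4)] mats_parity_ok(2)[OF assms(2,6)]
  by (rule trans[OF HOL.sym])

lemma mat_le_refl [simp]: "mat_le m n r D D"
  by (simp add: mat_le_iff)

lemma mat_le_trans: "mat_le m n r B C \<Longrightarrow> mat_le m n r C D \<Longrightarrow> mat_le m n r B D"
  using bruhat_trans unfolding mat_le_iff by metis

lemma dmin:
  assumes D: "D \<in> mats m n r"
  shows "dmin m n r D \<in> sym r" "mat_of r (blk (row_sums m n D)) (blk (col_sums m n D)) (dmin m n r D) = D"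
    "asc r (blk (row_sums m n D)) any_type (pinv (dmin m n r D))" "asc r (blk (col_sums m n D)) any_type (dmin m n r D)"
    "parity_ok r m (blk (row_sums m n D)) (blk (col_sums m n D)) (dmin m n r D)"
proof -
  note s = shortest_asc[OF dcoset_nonempty[OF D, unfolded dcoset_eq[OF D]]]
  show 1: "dmin m n r D \<in> sym r" "mat_of r (blk (row_sums m n D)) (blk (col_sums m n D)) (dmin m n r D) = D"
    "asc r (blk (row_sums m n D)) any_type (pinv (dmin m n r D))" "asc r (blk (col_sums m n D)) any_type (dmin m n r D)"
    using s unfolding dmin_def dcoset_eq[OF D] by auto
  then have "dmin m n r D \<in> dcoset m n r D" unfolding dcoset_eq[OF D] by (simp add: mat_perms_def)
  then show "parity_ok r m (blk (row_sums m n D)) (blk (col_sums m n D)) (dmin m n r D)" by (rule mats_parity_ok(3)[OF D])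
qed

lemma bicompsD: "\<nu> \<in> bicomps m n r \<Longrightarrow> sum_list \<nu> = r" "\<nu> \<in> bicomps m n r \<Longrightarrow> m \<le> length \<nu>"
  by (auto simp: bicomps_def)

section \<open>Closed form of T_D\<close>

lemma reps_eq_cell_reps:
  assumes D: "D \<in> mats m n r"
  shows "even_reps m n r D = cell_reps r m (blk (row_sums m n D)) (blk (col_sums m n D)) (dmin m n r D) True"
    "odd_reps m n r D = cell_reps r m (blk (row_sums m n D)) (blk (col_sums m n D)) (dmin m n r D) False"
proof -
  note R = row_sums_bicomps[OF D] and C = col_sums_bicomps[OF D]
  note eq = min_right_reps_eq[OF blk_mono_r[OF R] blk_mono_r[OF C] dmin(1,4,5)[OF D]]
  show "even_reps m n r D = cell_reps r m (blk (row_sums m n D)) (blk (col_sums m n D)) (dmin m n r D) True"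
    unfolding even_reps_def even_young_eq[OF bicompsD[OF R]] even_young_eq[OF bicompsD[OF C]] eq ..
  show "odd_reps m n r D = cell_reps r m (blk (row_sums m n D)) (blk (col_sums m n D)) (dmin m n r D) False"
    unfolding odd_reps_def odd_young_eq[OF bicompsD[OF R]] odd_young_eq[OF bicompsD[OF C]] eq ..
qed

abbreviation pivot_index :: "nat \<Rightarrow> nat \<Rightarrow> nat \<Rightarrow> nmat \<Rightarrow> nat" where
  "pivot_index m n r D \<equiv> bindex r (blk (row_sums m n D)) (blk (col_sums m n D)) (parity_type m False) (pivot m n r D)"

text \<open>Let d be the length of the shortest element, and e and o the even and the odd index of
  the pivot. Then \<open>even_dmax\<close> has length d + e, \<open>odd_dmax\<close> has length d +
  o, and the pivot has length d + e + o; so the exponent -(d + e) + (d + o) - d equals 2 o - (d + e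
  + o).\<close>

lemma T_cal_exponent:
  assumes D: "D \<in> mats m n r"
  shows "vpow (- int (len r (even_dmax m n r D))) * vpow (int (len r (odd_dmax m n r D)) - int (len r (dmin m n r D)))
    = vpow (2 * int (pivot_index m n r D) - int (len r (pivot m n r D)))"
proof -
  let ?f = "blk (row_sums m n D)" and ?g = "blk (col_sums m n D)"
  note R = row_sums_bicomps[OF D] and C = col_sums_bicomps[OF D]
  note d = dmin(1,3,4,5)[OF D]
  have p: "longest r (mat_perms r ?f ?g (mat_of r ?f ?g (dmin m n r D))) = pivot m n r D"
    unfolding dmin(2)[OF D] pivot_def dcoset_eq[OF D] ..
  note L = len_longest_part[OF blk_mono_r[OF R] blk_mono_r[OF C] d, unfolded p]
  have "even_dmax m n r D = longest r (part_coset r m ?f ?g (dmin m n r D) True)"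
    unfolding even_dmax_def part_coset_def even_young_eq[OF bicompsD[OF R]] even_young_eq[OF bicompsD[OF C]] ..
  moreover have "odd_dmax m n r D = longest r (part_coset r m ?f ?g (dmin m n r D) False)"
    unfolding odd_dmax_def part_coset_def odd_young_eq[OF bicompsD[OF R]] odd_young_eq[OF bicompsD[OF C]] ..
  moreover have "len r (pivot m n r D) = len r (dmin m n r D) + bindex r ?f ?g (parity_type m True) (pivot m n r D)
      + pivot_index m n r D"
    using mats_parity_ok(1,2)[OF D pivot(1)[OF D]] dmin(2)[OF D]
    by (intro len_bindex[OF blk_mono_r[OF R] blk_mono_r[OF C] d]) simp_all
  ultimately show ?thesis unfolding vpow_add by (intro arg_cong[of _ _ vpow]) (simp add: L)
qed

context hecke_algebra
begin

lemma x_elt_y_elt: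
  assumes "\<nu> \<in> bicomps m n r" shows "x_elt m \<nu> * y_elt m \<nu> = xy m (blk \<nu>)"
  unfolding x_elt_def y_elt_def xy_def block_sum_def even_young_eq[OF bicompsD[OF assms]] odd_young_eq[OF bicompsD[OF assms]]
  by (simp add: neg_q_inv_pow_eq)

text \<open>The closed form lies in the left eigenspace, so x y can be split off. What remains is a
  sum over the elements of the double coset that are minimal for the row subgroup; these are the
  products d u v of coset representatives, and their odd index is the length of v.\<close>

lemma T_mat_eq:
  assumes D: "D \<in> mats m n r"
  shows "T_mat m n D = coset_sum m (blk (row_sums m n D)) (blk (col_sums m n D)) D"
proof -
  define f g d where "f = blk (row_sums m n D)" and "g = blk (col_sums m n D)" and "d = dmin m n r D"
  note R = row_sums_bicomps[OF D] and C = col_sums_bicomps[OF D]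
  note fm = blk_mono_r[OF R, folded f_def] and gm = blk_mono_r[OF C, folded g_def]
  note d = dmin(1,3,4)[OF D, folded f_def g_def d_def] and ok = dmin(5)[OF D, folded f_def g_def d_def]
    and dD = dmin(2)[OF D, folded f_def g_def d_def]
  let ?L = "{w \<in> mat_perms r f g D. asc r f any_type (pinv w)}"
  let ?E = "cell_reps r m f g d True" and ?O = "cell_reps r m f g d False"
  let ?b = "\<lambda>w. kappa False ^ bindex r f g (parity_type m False) w"
  have okD: "parity_ok r m f g w" if "w \<in> mat_perms r f g D" for w
    using mats_parity_ok(3)[OF D, of w, folded f_def g_def] that dcoset_eq[OF D, folded f_def g_def] by blast
  have "coset_sum m f g D = xy m f * (\<Sum>w\<in>{w \<in> sym r. asc r f any_type (pinv w)}. scl (T_coeff (coset_sum m f g D) w) (T w))"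
    by (rule left_space_factor[OF fm coset_sum_spaces(1)[OF okD]])
  also have "(\<Sum>w\<in>{w \<in> sym r. asc r f any_type (pinv w)}. scl (T_coeff (coset_sum m f g D) w) (T w)) = (\<Sum>w\<in>?L. scl (?b w) (T w))"
    by (rule sum.mono_neutral_cong_right) (auto simp: T_coeff_coset_sum mat_perms_def)
  also have "\<dots> = (\<Sum>(u, v)\<in>?E \<times> ?O. scl (?b (d \<circ> u \<circ> v)) (T (d \<circ> u \<circ> v)))"
    using left_min_decomp[OF fm gm d, of m, unfolded dD]
    by (subst sum.reindex_bij_betw[symmetric]) (auto simp: case_prod_unfold)
  also have "\<dots> = (\<Sum>(u, v)\<in>?E \<times> ?O. scl (neg_q_inv_pow (len r v)) (T d * T u * T v))"
  proof (rule sum.cong[OF refl], clarify)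
    fix u v assume u: "u \<in> ?E" and v: "v \<in> ?O"
    note L = cell_reps_len[OF fm gm d ok u v]
    have us: "u \<in> sym r" and vs: "v \<in> sym r" using u v block_perms_sym by (auto simp: cell_reps_def)
    have "T d * T u = T (d \<circ> u)" by (rule T_mult[OF d(1) us L(1)])
    moreover have "T (d \<circ> u) * T v = T (d \<circ> u \<circ> v)" by (rule T_mult[OF _ vs]) (use d(1) us L in auto)
    ultimately show "scl (?b (d \<circ> u \<circ> v)) (T (d \<circ> u \<circ> v)) = scl (neg_q_inv_pow (len r v)) (T d * T u * T v)"
      unfolding L(3) neg_q_inv_pow_eq by simp
  qed
  also have "xy m f * \<dots> = (\<Sum>(u, v)\<in>?E \<times> ?O. scl (neg_q_inv_pow (len r v)) (xy m f * T d * T u * T v))"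
    unfolding sum_distrib_left by (intro sum.cong refl) (auto simp: scl_mult_right mult.assoc)
  also have "\<dots> = T_mat m n D"
    unfolding T_mat_def reps_eq_cell_reps[OF D] x_elt_y_elt[OF R] f_def g_def d_def by (simp add: sum.cartesian_product)
  finally show ?thesis by (simp add: f_def g_def)
qed

lemma T_cal_eq:
  assumes D: "D \<in> mats m n r"
  shows "T_cal m n D = scl (vpow (2 * int (pivot_index m n r D) - int (len r (pivot m n r D))))
     (coset_sum m (blk (row_sums m n D)) (blk (col_sums m n D)) D)"
  unfolding T_cal_def T_cal_exponent[OF D] T_mat_eq[OF D] ..

definition bispace :: "nat \<Rightarrow> nat list \<Rightarrow> nat list \<Rightarrow> 'h set" where
  "bispace m \<nu> \<xi> = left_space m (blk \<nu>) \<inter> right_space m (blk \<xi>)"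

lemma T_cal_bispace:
  assumes D: "D \<in> mats m n r" shows "T_cal m n D \<in> bispace m (row_sums m n D) (col_sums m n D)"
proof -
  have ok: "parity_ok r m (blk (row_sums m n D)) (blk (col_sums m n D)) w"
    if "w \<in> mat_perms r (blk (row_sums m n D)) (blk (col_sums m n D)) D" for w
    using mats_parity_ok(3)[OF D, of w] that dcoset_eq[OF D] by blast
  show ?thesis unfolding bispace_def T_cal_eq[OF D]
    using coset_sum_spaces[OF ok] left_space_scl right_space_scl by blast
qed

lemma T_coeff_T_cal_outside:
  assumes D: "D \<in> mats m n r" and "w \<notin> dcoset m n r D" shows "T_coeff (T_cal m n D) w = 0"
  unfolding T_cal_eq[OF D] T_coeff_scl T_coeff_coset_sum using assms(2) dcoset_eq[OF D] by simp

text \<open>With o the odd index of the pivot, the exponent -2 o of the factor (-1/q)^o cancels the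
  2 o of the normalisation.\<close>

lemma T_coeff_T_cal_pivot:
  assumes D: "D \<in> mats m n r" 
  shows "T_coeff (T_cal m n D) (pivot m n r D) = (- 1) ^ pivot_index m n r D * vpow (- int (len r (pivot m n r D)))"
proof -
  have "pivot m n r D \<in> mat_perms r (blk (row_sums m n D)) (blk (col_sums m n D)) D"
    using pivot(1)[OF D] dcoset_eq[OF D] by simp
  then have "T_coeff (T_cal m n D) (pivot m n r D) =
      vpow (2 * int (pivot_index m n r D) - int (len r (pivot m n r D))) * neg_q_inv_pow (pivot_index m n r D)"
    unfolding T_cal_eq[OF D] T_coeff_scl T_coeff_coset_sum by (simp add: neg_q_inv_pow_eq)
  also have "\<dots> = (- 1) ^ pivot_index m n r D * (vpow (2 * int (pivot_index m n r D) - int (len r (pivot m n r D)))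
      * vpow (- 2 * int (pivot_index m n r D)))"
    unfolding neg_q_inv_pow_def by (simp only: mult.left_commute)
  finally show ?thesis unfolding vpow_add by simp
qed

definition pivot_unit_inv :: "nat \<Rightarrow> nat \<Rightarrow> nmat \<Rightarrow> laurent" where
  "pivot_unit_inv m n D = (- 1) ^ pivot_index m n r D * vpow (int (len r (pivot m n r D)))"

lemma pivot_unit_inv:
  assumes "D \<in> mats m n r"
  shows "T_coeff (T_cal m n D) (pivot m n r D) * pivot_unit_inv m n D = 1"
proof -
  have *: "(- 1) ^ k * a * ((- 1) ^ k * b) = a * (b :: laurent)" for k :: nat and a b
  proof -
    have "(- 1) ^ k * a * ((- 1) ^ k * b) = ((- 1) ^ k * (- 1) ^ k) * (a * b)" by (simp only: mult.assoc mult.left_commute)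
    then show ?thesis by (simp flip: power_mult_distrib)
  qed
  show ?thesis unfolding T_coeff_T_cal_pivot[OF assms] pivot_unit_inv_def * vpow_add by simp
qed

section \<open>Expansion in the normalised T_D\<close>

lemma T_coeff_T_cal_sum:
  assumes X: "X \<subseteq> mats_between m n r \<nu> \<xi>" "B \<in> mats_between m n r \<nu> \<xi>" and w: "w \<in> dcoset m n r B"
  shows "T_coeff (\<Sum>C\<in>X. scl (c C) (T_cal m n C)) w = (if B \<in> X then c B * T_coeff (T_cal m n B) w else 0)"
proof -
  have "T_coeff (\<Sum>C\<in>X. scl (c C) (T_cal m n C)) w = (\<Sum>C\<in>X. c C * T_coeff (T_cal m n C) w)"
    by (simp add: T_coeff_sum T_coeff_scl)
  also have "\<dots> = (\<Sum>C\<in>X. if C = B then c B * T_coeff (T_cal m n B) w else 0)"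
  proof (rule sum.cong[OF refl])
    fix C assume "C \<in> X"
    then have C: "C \<in> mats m n r" "row_sums m n C = \<nu>" "col_sums m n C = \<xi>" using X by (auto simp: mats_between_def)
    have B: "B \<in> mats m n r" "row_sums m n B = \<nu>" "col_sums m n B = \<xi>" using X by (auto simp: mats_between_def)
    have "C = B" if "w \<in> dcoset m n r C" using dcoset_disjoint[OF C(1) B(1) _ _ that w] C B by simp
    then show "c C * T_coeff (T_cal m n C) w = (if C = B then c B * T_coeff (T_cal m n B) w else 0)"
      using T_coeff_T_cal_outside[OF C(1), of w] by auto
  qed
  also have "\<dots> = (if B \<in> X then c B * T_coeff (T_cal m n B) w else 0)"
    using finite_subset[OF X(1)] by (simp add: sum.delta)
  finally show ?thesis .
qed

text \<open>Double cosets of distinct matrices are disjoint, so the coefficient at the pivot of B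
  isolates the term of B.\<close>

lemma T_cal_independent:
  assumes X: "X \<subseteq> mats_between m n r \<nu> \<xi>"
    and eq: "(\<Sum>C\<in>X. scl (c C) (T_cal m n C)) = (\<Sum>C\<in>X. scl (c' C) (T_cal m n C))" and B: "B \<in> X"
  shows "c B = c' B"
proof -
  have B': "B \<in> mats_between m n r \<nu> \<xi>" "B \<in> mats m n r" using X B by (auto simp: mats_between_def)
  have "c B * T_coeff (T_cal m n B) (pivot m n r B) = c' B * T_coeff (T_cal m n B) (pivot m n r B)"
    using T_coeff_T_cal_sum[OF X B'(1) pivot(1)[OF B'(2)], of c] T_coeff_T_cal_sum[OF X B'(1) pivot(1)[OF B'(2)], of c'] eq B by auto
  moreover have "T_coeff (T_cal m n B) (pivot m n r B) \<noteq> 0" using pivot_unit_inv[OF B'(2)] by auto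
  ultimately show ?thesis by simp
qed

text \<open>Covariance fixes all coefficients on a double coset up to one scalar, the coefficient at
  the minimal element. Comparing z with \<open>T_cal\<close> at the pivot, where the latter has a
  unit, determines this scalar within the Laurent polynomials.\<close>

lemma T_cal_expand:
  assumes \<nu>: "\<nu> \<in> bicomps m n r" "\<xi> \<in> bicomps m n r" and z: "z \<in> bispace m \<nu> \<xi>"
  shows "z = (\<Sum>C\<in>mats_between m n r \<nu> \<xi>. scl (T_coeff z (pivot m n r C) * pivot_unit_inv m n C) (T_cal m n C))"
proof (rule T_coeff_eqI)
  let ?f = "blk \<nu>" and ?g = "blk \<xi>"
  let ?c = "\<lambda>C. T_coeff z (pivot m n r C) * pivot_unit_inv m n C"
  note fm = blk_mono_r[OF \<nu>(1)] and gm = blk_mono_r[OF \<nu>(2)]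
  have z': "z \<in> left_space m ?f" "z \<in> right_space m ?g" using z by (auto simp: bispace_def)
  fix w assume w: "w \<in> sym r"
  show "T_coeff z w = T_coeff (\<Sum>C\<in>mats_between m n r \<nu> \<xi>. scl (?c C) (T_cal m n C)) w"
  proof (cases "parity_ok r m ?f ?g w")
    case False
    have "T_coeff (T_cal m n C) w = 0" if "C \<in> mats_between m n r \<nu> \<xi>" for C
      using that T_cal_bispace[of C m n] bispace_coeff_0[OF fm gm _ _ w False] by (auto simp: mats_between_def bispace_def)
    then show ?thesis using bispace_coeff_0[OF fm gm z' w False] by (simp add: T_coeff_sum T_coeff_scl)
  next
    case True
    define B where "B = mat_of r ?f ?g w"
    have B: "B \<in> mats m n r" "row_sums m n B = \<nu>" "col_sums m n B = \<xi>"
      using mat_of_mats[OF \<nu> w] True unfolding B_def by auto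
    have BB: "B \<in> mats_between m n r \<nu> \<xi>" using B by (simp add: mats_between_def)
    have wB: "w \<in> dcoset m n r B" unfolding dcoset_eq[OF B(1)] B(2,3) using w by (simp add: mat_perms_def B_def)
    note d = dmin[OF B(1), unfolded B(2,3)]
    note P = mats_parity_ok[OF B(1) pivot(1)[OF B(1)], unfolded B(2,3)]
    define b where "b = (\<lambda>w. kappa False ^ bindex r ?f ?g (parity_type m False) w)"
    \<comment> \<open>Proportionality in cross-multiplied form, so that no coefficient has to be
      divided out; the unit at the pivot enters afterwards.\<close>
    have key: "T_coeff y w * T_coeff y' (pivot m n r B) = T_coeff y (pivot m n r B) * T_coeff y' w"
      if "y \<in> bispace m \<nu> \<xi>" "y' \<in> bispace m \<nu> \<xi>" for y y'
    proof -
      have "T_coeff x v = b v * T_coeff x (dmin m n r B)"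
        if "x \<in> bispace m \<nu> \<xi>" "v \<in> sym r" "mat_of r ?f ?g v = B" for x v
        using bispace_coeff[OF fm gm _ _ d(1,3,4,5) that(2)] that d(2) by (auto simp: b_def bispace_def)
      then have "T_coeff x w = b w * T_coeff x (dmin m n r B)" "T_coeff x (pivot m n r B) = b (pivot m n r B) * T_coeff x (dmin m n r B)"
        if "x \<in> bispace m \<nu> \<xi>" for x using that w P(1,2) by (simp_all add: B_def[symmetric])
      then show ?thesis using that by (simp add: mult.assoc mult.left_commute)
    qed
    have tB: "T_cal m n B \<in> bispace m \<nu> \<xi>" using T_cal_bispace[OF B(1)] B by simp
    have "T_coeff z w = T_coeff z w * (T_coeff (T_cal m n B) (pivot m n r B) * pivot_unit_inv m n B)"
      using pivot_unit_inv[OF B(1)] by simp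
    also have "\<dots> = (T_coeff z w * T_coeff (T_cal m n B) (pivot m n r B)) * pivot_unit_inv m n B"
      by (simp only: mult.assoc)
    also have "\<dots> = ?c B * T_coeff (T_cal m n B) w" unfolding key[OF z tB] by (simp only: mult.assoc mult.commute mult.left_commute)
    finally show ?thesis using T_coeff_T_cal_sum[OF order_refl BB wB] BB by simp
  qed
qed

text \<open>Connects the eigenvector conditions with the intersection of a right and a left ideal.
  The second factorisation is what later allows \<open>phi\<close> to be realised by a left
  multiplication.\<close>

lemma bispace_eq:
  assumes \<nu>: "\<nu> \<in> bicomps m n r" "\<xi> \<in> bicomps m n r"
  shows "z \<in> bispace m \<nu> \<xi> \<longleftrightarrow> (\<exists>h. z = xy m (blk \<nu>) * h) \<and> (\<exists>h. z = h * xy m (blk \<xi>))"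
proof
  assume "z \<in> bispace m \<nu> \<xi>"
  then show "(\<exists>h. z = xy m (blk \<nu>) * h) \<and> (\<exists>h. z = h * xy m (blk \<xi>))"
    using left_space_factor[OF blk_mono_r[OF \<nu>(1)]] right_space_factor[OF blk_mono_r[OF \<nu>(2)]] unfolding bispace_def by blast
next
  assume "(\<exists>h. z = xy m (blk \<nu>) * h) \<and> (\<exists>h. z = h * xy m (blk \<xi>))"
  then obtain h h' where h: "z = xy m (blk \<nu>) * h" "z = h' * xy m (blk \<xi>)" by blast
  have "z \<in> left_space m (blk \<nu>)" unfolding h(1) by (rule left_space_mult[OF xy_left])
  moreover have "z \<in> right_space m (blk \<xi>)" unfolding h(2) by (rule right_space_mult[OF xy_right])
  ultimately show "z \<in> bispace m \<nu> \<xi>" by (simp add: bispace_def)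
qed

section \<open>The bar involution on the normalised T_D\<close>

lemma bispace_bar: "z \<in> bispace m \<nu> \<xi> \<Longrightarrow> hecke_bar z \<in> bispace m \<nu> \<xi>"
  by (simp add: bispace_def left_space_bar right_space_bar)

lemma T_coeff_bar: "T_coeff (hecke_bar z) y = (\<Sum>w\<in>sym r. laurent_bar (T_coeff z w) * T_coeff (T_bar w) y)"
  by (simp add: hecke_bar_eq T_coeff_sum T_coeff_scl)

lemma T_coeff_bar_T_cal:
  assumes D: "D \<in> mats m n r" and nz: "T_coeff (hecke_bar (T_cal m n D)) y \<noteq> 0"
  shows "bruhat_le r y (pivot m n r D)"
proof -
  obtain w where "laurent_bar (T_coeff (T_cal m n D) w) * T_coeff (T_bar w) y \<noteq> 0" "w \<in> sym r"
    using nz unfolding T_coeff_bar by (meson sum.not_neutral_contains_not_neutral)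
  then have "w \<in> dcoset m n r D" "bruhat_le r y w"
    using T_coeff_T_cal_outside[OF D, of w] T_coeff_T_bar[of w] by force+
  then show ?thesis using pivot(2)[OF D] bruhat_trans by blast
qed

text \<open>A contribution of w needs w in the double coset, hence below the pivot, and the pivot in
  the support of \<open>T_bar w\<close>, hence below w. Only the pivot itself remains; with l its
  length, bar turns the exponent -l into l, and the leading coefficient v^(-2 l) of
  \<open>T_bar\<close> turns it back.\<close>

lemma T_coeff_bar_T_cal_pivot:
  assumes D: "D \<in> mats m n r"
  shows "T_coeff (hecke_bar (T_cal m n D)) (pivot m n r D) = T_coeff (T_cal m n D) (pivot m n r D)"
proof -
  let ?p = "pivot m n r D"
  have p: "?p \<in> sym r" by (rule mats_parity_ok(1)[OF D pivot(1)[OF D]])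
  have "T_coeff (hecke_bar (T_cal m n D)) ?p =
     (\<Sum>w\<in>sym r. if w = ?p then laurent_bar (T_coeff (T_cal m n D) ?p) * T_coeff (T_bar ?p) ?p else 0)"
    unfolding T_coeff_bar
  proof (rule sum.cong[OF refl])
    fix w assume w: "w \<in> sym r"
    show "laurent_bar (T_coeff (T_cal m n D) w) * T_coeff (T_bar w) ?p =
        (if w = ?p then laurent_bar (T_coeff (T_cal m n D) ?p) * T_coeff (T_bar ?p) ?p else 0)"
    proof (cases "w \<in> dcoset m n r D \<and> T_coeff (T_bar w) ?p \<noteq> 0")
      case True
      then have "bruhat_le r ?p w" "bruhat_le r w ?p" using T_coeff_T_bar[OF w] pivot(2)[OF D] by blast+
      then have "w = ?p" using bruhat_antisym by blast
      then show ?thesis by simp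
    next
      case False
      then show ?thesis using T_coeff_T_cal_outside[OF D, of w] by auto
    qed
  qed
  also have "\<dots> = laurent_bar (T_coeff (T_cal m n D) ?p) * vpow (- 2 * int (len r ?p))"
    using p T_coeff_T_bar[OF p] by (simp add: sum.delta)
  also have "\<dots> = T_coeff (T_cal m n D) ?p"
    unfolding T_coeff_T_cal_pivot[OF D] by (simp add: vpow_add mult.assoc)
  finally show ?thesis .
qed

text \<open>The bar of \<open>T_cal\<close> stays in the same eigenspaces and can be expanded there.
  The coordinate at C is read at the pivot of C, hence vanishes unless this pivot is below that of
  D; independence makes the description in \<open>bar_row\<close> unique.\<close>

lemma bar_row_spec:
  assumes D: "D \<in> mats m n r"
  shows "(\<forall>C. \<not> (C \<in> mats m n r \<and> mat_le m n r C D) \<longrightarrow> bar_coeff m n C D = 0) \<and>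
     hecke_bar (T_cal m n D) = (\<Sum>C | C \<in> mats m n r \<and> mat_le m n r C D. scl (bar_coeff m n C D) (T_cal m n C))"
    "bar_coeff m n D D = 1"
proof -
  let ?\<nu> = "row_sums m n D" and ?\<xi> = "col_sums m n D"
  let ?X = "{C. C \<in> mats m n r \<and> mat_le m n r C D}"
  let ?z = "hecke_bar (T_cal m n D)"
  note R = row_sums_bicomps[OF D] and Cb = col_sums_bicomps[OF D]
  have X: "?X \<subseteq> mats_between m n r ?\<nu> ?\<xi>" by (auto simp: mats_between_def mat_le_iff)
  have z: "?z \<in> bispace m ?\<nu> ?\<xi>" by (rule bispace_bar[OF T_cal_bispace[OF D]])
  define c where "c = (\<lambda>C. if C \<in> ?X then T_coeff ?z (pivot m n r C) * pivot_unit_inv m n C else 0)"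
  have c0: "T_coeff ?z (pivot m n r C) = 0" if "C \<in> mats_between m n r ?\<nu> ?\<xi> - ?X" for C
    using T_coeff_bar_T_cal[OF D, of "pivot m n r C"] that by (auto simp: mats_between_def mat_le_iff)
  have "?z = (\<Sum>C\<in>mats_between m n r ?\<nu> ?\<xi>. scl (T_coeff ?z (pivot m n r C) * pivot_unit_inv m n C) (T_cal m n C))"
    by (rule T_cal_expand[OF R Cb z])
  also have "\<dots> = (\<Sum>C\<in>?X. scl (c C) (T_cal m n C))"
    by (rule sum.mono_neutral_cong_right) (use X c0 in \<open>auto simp: c_def\<close>)
  finally have zc: "?z = (\<Sum>C\<in>?X. scl (c C) (T_cal m n C))" .
  have row: "bar_row m n D = c" unfolding bar_row_def
  proof (rule the_equality)
    show "(\<forall>C. \<not> (C \<in> mats m n r \<and> mat_le m n r C D) \<longrightarrow> c C = 0) \<and> ?z = (\<Sum>C\<in>?X. scl (c C) (T_cal m n C))"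
      using zc by (simp add: c_def)
    fix c' assume c': "(\<forall>C. \<not> (C \<in> mats m n r \<and> mat_le m n r C D) \<longrightarrow> c' C = 0) \<and> ?z = (\<Sum>C\<in>?X. scl (c' C) (T_cal m n C))"
    show "c' = c"
    proof
      fix C show "c' C = c C"
      proof (cases "C \<in> ?X")
        case True
        have "(\<Sum>C\<in>?X. scl (c' C) (T_cal m n C)) = (\<Sum>C\<in>?X. scl (c C) (T_cal m n C))" using c' zc by metis
        then show ?thesis by (rule T_cal_independent[OF X _ True])
      qed (use c' in \<open>auto simp: c_def\<close>)
    qed
  qed
  then have bc: "bar_coeff m n C D = c C" for C by (simp add: bar_coeff_def)
  show "(\<forall>C. \<not> (C \<in> mats m n r \<and> mat_le m n r C D) \<longrightarrow> bar_coeff m n C D = 0) \<and>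
     ?z = (\<Sum>C\<in>?X. scl (bar_coeff m n C D) (T_cal m n C))"
    unfolding bc using zc by (simp add: c_def)
  show "bar_coeff m n D D = 1"
    unfolding bc using D by (simp add: c_def T_coeff_bar_T_cal_pivot[OF D] pivot_unit_inv[OF D])
qed

text \<open>A Young subgroup is closed under going down in the Bruhat order, so no other matrix lies
  below the diagonal one, and the only bar coefficient is 1. For the second claim, the identity is
  the only minimal representative within the subgroup.\<close>

lemma T_cal_diag:
  assumes \<nu>: "\<nu> \<in> bicomps m n r"
  shows "hecke_bar (T_cal m n (diag_mat \<nu>)) = T_cal m n (diag_mat \<nu>)"
    "\<exists>k. T_cal m n (diag_mat \<nu>) = scl (vpow k) (xy m (blk \<nu>))"
proof -
  note D = diag_mat(1)[OF \<nu>] and RC = diag_mat(2,3)[OF \<nu>]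
  note f = blk_mono_r[OF \<nu>]
  have dc: "w \<in> dcoset m n r (diag_mat \<nu>) \<longleftrightarrow> w \<in> block_perms r (blk \<nu>) any_type" for w
    unfolding dcoset_eq[OF D] RC mat_perms_def using mat_of_diag_iff[OF \<nu>, of w] block_perms_sym by blast
  have down: "y \<in> block_perms r (blk \<nu>) any_type" if "bruhat_le r y w" "w \<in> block_perms r (blk \<nu>) any_type" for y w
    using that
  proof (induction rule: bruhat_induct)
    case (step y i j)
    define t where "t = Transposition.transpose i j"
    define z where "z = y \<circ> t"
    have z: "z \<in> block_perms r (blk \<nu>) any_type" using step by (simp add: z_def t_def comp_def)
    note zs = block_perms_sym[OF z]
    have ij: "i \<in> {1..r}" "j \<in> {1..r}" using step by auto
    have "z j < z i" using step by (simp add: z_def t_def)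
    then have "blk \<nu> (z j) \<le> blk \<nu> (z i)" by (intro mono_onD[OF f] sym_range[OF zs] ij) simp
    moreover have "blk \<nu> i \<le> blk \<nu> j" using step by (intro mono_onD[OF f] ij) simp
    \<comment> \<open>\<open>z j < z i\<close> with blocks preserved gives one inequality,
      \<open>i < j\<close> the other; so the transposition stays inside one block.\<close>
    ultimately have eq: "blk \<nu> i = blk \<nu> j" using block_permsD(1)[OF z ij(1)] block_permsD(1)[OF z ij(2)] by simp
    have "blk \<nu> (t p) = blk \<nu> p" for p using eq by (auto simp: t_def Transposition.transpose_def)
    moreover have "t \<in> sym r" unfolding t_def using ij by blast
    ultimately have "t \<in> block_perms r (blk \<nu>) any_type" by (simp add: block_perms_def)
    then have "z \<circ> t \<in> block_perms r (blk \<nu>) any_type" using z by blast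
    moreover have "z \<circ> t = y" by (simp add: z_def t_def transpose_involutory)
    ultimately show ?case by simp
  qed
  have only: "C = diag_mat \<nu>" if C: "C \<in> mats m n r" "mat_le m n r C (diag_mat \<nu>)" for C
  proof -
    have "pivot m n r C \<in> dcoset m n r (diag_mat \<nu>)"
      using down[of "pivot m n r C" "pivot m n r (diag_mat \<nu>)"] C(2) pivot(1)[OF D] unfolding dc mat_le_iff by blast
    then show ?thesis using dcoset_disjoint[OF C(1) D _ _ pivot(1)[OF C(1)]] C(2) unfolding mat_le_iff by blast
  qed
  have X: "{C. C \<in> mats m n r \<and> mat_le m n r C (diag_mat \<nu>)} = {diag_mat \<nu>}" using only D by auto
  show "hecke_bar (T_cal m n (diag_mat \<nu>)) = T_cal m n (diag_mat \<nu>)"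
    using conjunct2[OF bar_row_spec(1)[OF D]] bar_row_spec(2)[OF D] unfolding X by simp
  have ok: "parity_ok r m (blk \<nu>) (blk \<nu>) w" if "w \<in> mat_perms r (blk \<nu>) (blk \<nu>) (diag_mat \<nu>)" for w
    using mats_parity_ok(3)[OF D, of w, unfolded RC] that dcoset_eq[OF D, unfolded RC] by blast
  define e where "e = coset_sum m (blk \<nu>) (blk \<nu>) (diag_mat \<nu>)"
  have "e = xy m (blk \<nu>) * (\<Sum>g\<in>{g \<in> sym r. asc r (blk \<nu>) any_type (pinv g)}. scl (T_coeff e g) (T g))"
    unfolding e_def by (rule left_space_factor[OF f coset_sum_spaces(1)[OF ok]])
  also have "(\<Sum>g\<in>{g \<in> sym r. asc r (blk \<nu>) any_type (pinv g)}. scl (T_coeff e g) (T g)) = (\<Sum>g\<in>{id}. scl (T_coeff e g) (T g))"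
  proof (rule sum.mono_neutral_right)
    show "\<forall>g\<in>{g \<in> sym r. asc r (blk \<nu>) any_type (pinv g)} - {id}. scl (T_coeff e g) (T g) = 0"
    proof
      fix g assume g: "g \<in> {g \<in> sym r. asc r (blk \<nu>) any_type (pinv g)} - {id}"
      then have "g \<notin> block_perms r (blk \<nu>) any_type" using block_perms_asc_pinv_id[OF f] by blast
      then have "g \<notin> mat_perms r (blk \<nu>) (blk \<nu>) (diag_mat \<nu>)" using dc dcoset_eq[OF D, unfolded RC] by blast
      then show "scl (T_coeff e g) (T g) = 0" by (simp add: e_def T_coeff_coset_sum)
    qed
    have "asc r (blk \<nu>) any_type (pinv id)" unfolding pinv_id by (simp add: asc_def)
    then show "{id} \<subseteq> {g \<in> sym r. asc r (blk \<nu>) any_type (pinv g)}" by simp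
  qed auto
  also have "\<dots> = 1"
  proof -
    have "id \<in> mat_perms r (blk \<nu>) (blk \<nu>) (diag_mat \<nu>)" using mat_of_id[OF \<nu>] by (simp add: mat_perms_def)
    moreover have "bindex r (blk \<nu>) (blk \<nu>) (parity_type m False) id = 0" by (simp add: bindex_def)
    ultimately have 1: "T_coeff e id = 1" unfolding e_def T_coeff_coset_sum by (simp only: power_0 if_True)
    have "(\<Sum>g\<in>{id}. scl (T_coeff e g) (T g)) = scl (T_coeff e id) (T id)" by simp
    then show ?thesis unfolding 1 T_id by simp
  qed
  finally have "e = xy m (blk \<nu>)" by simp
  then show "\<exists>k. T_cal m n (diag_mat \<nu>) = scl (vpow k) (xy m (blk \<nu>))"
    unfolding T_cal_eq[OF D] RC e_def[symmetric] by blast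
qed

end

section \<open>The quantum Schur superalgebra\<close>

context hecke_algebra
begin

text \<open>For a bicomposition \<nu> this is a bar invariant multiple of x y by a power of v; it
  generates the same summand and is the element on which \<open>phi\<close> is prescribed.\<close>

abbreviation gen :: "nat \<Rightarrow> nat \<Rightarrow> nat list \<Rightarrow> 'h" where
  "gen m n \<nu> \<equiv> T_cal m n (diag_mat \<nu>)"

lemma scl_1_mult: "scl c 1 * z = scl c z" "z * scl c 1 = scl c z"
  using scl_mult_left[of c 1 z] scl_mult_right[of c z 1] by simp_all

lemma gen_xy:
  assumes "\<nu> \<in> bicomps m n r"
  obtains c d where "gen m n \<nu> = scl c (xy m (blk \<nu>))" "xy m (blk \<nu>) = scl d (gen m n \<nu>)"
proof -
  obtain k where k: "gen m n \<nu> = scl (vpow k) (xy m (blk \<nu>))" using T_cal_diag(2)[OF assms] by blast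
  then have "scl (vpow (- k)) (gen m n \<nu>) = xy m (blk \<nu>)" by (simp add: vpow_add)
  then show ?thesis using that k by metis
qed

lemma dsum_iff: "f \<in> dsum m n \<longleftrightarrow> (\<forall>\<nu>\<in>bicomps m n r. \<exists>h. f \<nu> = gen m n \<nu> * h) \<and> (\<forall>\<nu>. \<nu> \<notin> bicomps m n r \<longrightarrow> f \<nu> = 0)"
proof -
  have "(\<exists>h. z = x_elt m \<nu> * y_elt m \<nu> * h) \<longleftrightarrow> (\<exists>h. z = gen m n \<nu> * h)" if \<nu>: "\<nu> \<in> bicomps m n r" for \<nu> z
  proof -
    obtain c d where cd: "gen m n \<nu> = scl c (xy m (blk \<nu>))" "xy m (blk \<nu>) = scl d (gen m n \<nu>)" using gen_xy[OF \<nu>] by blast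
    have "gen m n \<nu> * h = xy m (blk \<nu>) * scl c h" "xy m (blk \<nu>) * h = gen m n \<nu> * scl d h" for h
      using arg_cong[OF cd(1), of "\<lambda>x. x * h"] arg_cong[OF cd(2), of "\<lambda>x. x * h"]
      by (simp_all only: scl_mult_left[symmetric] scl_mult_right[symmetric])
    then show ?thesis unfolding x_elt_y_elt[OF \<nu>] by metis
  qed
  then show ?thesis unfolding dsum_def by auto
qed

lemma dsum_outside: "f \<in> dsum m n \<Longrightarrow> \<nu> \<notin> bicomps m n r \<Longrightarrow> f \<nu> = 0"
  by (simp add: dsum_iff)

lemma dsum_gen: "f \<in> dsum m n \<Longrightarrow> \<nu> \<in> bicomps m n r \<Longrightarrow> \<exists>h. f \<nu> = gen m n \<nu> * h"
  by (simp add: dsum_iff)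

lemma dsum_0 [simp, intro]: "(\<lambda>\<nu>. 0) \<in> dsum m n"
  unfolding dsum_iff by (metis mult_zero_right)

lemma dsum_add [intro]: 
  assumes "f \<in> dsum m n" "g \<in> dsum m n" shows "(\<lambda>\<nu>. f \<nu> + g \<nu>) \<in> dsum m n"
  unfolding dsum_iff
proof (intro conjI ballI allI impI)
  fix \<nu> assume \<nu>: "\<nu> \<in> bicomps m n r"
  obtain h h' where "f \<nu> = gen m n \<nu> * h" "g \<nu> = gen m n \<nu> * h'" using dsum_gen \<nu> assms by metis
  then have "f \<nu> + g \<nu> = gen m n \<nu> * (h + h')" by (simp add: distrib_left)
  then show "\<exists>h. f \<nu> + g \<nu> = gen m n \<nu> * h" by blast
qed (simp add: dsum_outside[OF assms(1)] dsum_outside[OF assms(2)])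

lemma dsum_mult [intro]: 
  assumes "f \<in> dsum m n" shows "(\<lambda>\<nu>. f \<nu> * h) \<in> dsum m n"
  unfolding dsum_iff
proof (intro conjI ballI allI impI)
  fix \<nu> assume \<nu>: "\<nu> \<in> bicomps m n r"
  obtain h' where "f \<nu> = gen m n \<nu> * h'" using dsum_gen \<nu> assms by metis
  then have "f \<nu> * h = gen m n \<nu> * (h' * h)" by (simp add: mult.assoc)
  then show "\<exists>h'. f \<nu> * h = gen m n \<nu> * h'" by blast
qed (simp add: dsum_outside[OF assms])

lemma dsum_scl [intro]: "f \<in> dsum m n \<Longrightarrow> (\<lambda>\<nu>. scl c (f \<nu>)) \<in> dsum m n"
  using dsum_mult[of f m n "scl c 1"] by (simp add: scl_1_mult)

lemma dsum_uminus [intro]: "f \<in> dsum m n \<Longrightarrow> (\<lambda>\<nu>. - f \<nu>) \<in> dsum m n"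
  using dsum_mult[of f m n "- 1"] by simp

lemma dsum_if [intro]: "f \<in> dsum m n \<Longrightarrow> (\<lambda>\<nu>. if Q \<nu> then f \<nu> else 0) \<in> dsum m n"
  unfolding dsum_iff by (auto intro: exI[of _ 0])

lemma dsum_incl [intro]: "\<nu> \<in> bicomps m n r \<Longrightarrow> z = gen m n \<nu> * h \<Longrightarrow> incl \<nu> z \<in> dsum m n"
  unfolding dsum_iff incl_def by (auto intro: exI[of _ 0])

lemma dsum_incl_gen [simp, intro]: "\<nu> \<in> bicomps m n r \<Longrightarrow> incl \<nu> (gen m n \<nu>) \<in> dsum m n"
  by (rule dsum_incl[of _ _ _ _ 1]) simp_all

lemma dsum_bar [intro]:
  assumes "f \<in> dsum m n" shows "(\<lambda>\<nu>. hecke_bar (f \<nu>)) \<in> dsum m n"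
  unfolding dsum_iff
proof (intro conjI ballI allI impI)
  fix \<nu> assume \<nu>: "\<nu> \<in> bicomps m n r"
  obtain h where "f \<nu> = gen m n \<nu> * h" using dsum_gen \<nu> assms by metis
  then have "hecke_bar (f \<nu>) = gen m n \<nu> * hecke_bar h" using T_cal_diag(1)[OF \<nu>] by (simp add: hecke_bar_mult)
  then show "\<exists>h. hecke_bar (f \<nu>) = gen m n \<nu> * h" by blast
qed (simp add: dsum_outside[OF assms])

lemma endosD:
  assumes "\<phi> \<in> endos m n"
  shows "f \<in> dsum m n \<Longrightarrow> \<phi> f \<in> dsum m n" "f \<notin> dsum m n \<Longrightarrow> \<phi> f = undefined"
    "f \<in> dsum m n \<Longrightarrow> g \<in> dsum m n \<Longrightarrow> \<phi> (\<lambda>\<nu>. f \<nu> + g \<nu>) = (\<lambda>\<nu>. \<phi> f \<nu> + \<phi> g \<nu>)"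
    "f \<in> dsum m n \<Longrightarrow> \<phi> (\<lambda>\<nu>. f \<nu> * h) = (\<lambda>\<nu>. \<phi> f \<nu> * h)"
  using assms unfolding endos_def by (auto dest: PiE_mem PiE_arb)

lemma endosI:
  assumes "\<And>f. f \<in> dsum m n \<Longrightarrow> F f \<in> dsum m n"
    "\<And>f g \<nu>. f \<in> dsum m n \<Longrightarrow> g \<in> dsum m n \<Longrightarrow> F (\<lambda>\<nu>. f \<nu> + g \<nu>) \<nu> = F f \<nu> + F g \<nu>"
    "\<And>f h \<nu>. f \<in> dsum m n \<Longrightarrow> F (\<lambda>\<nu>. f \<nu> * h) \<nu> = F f \<nu> * h"
  shows "restrict F (dsum m n) \<in> endos m n"
proof -
  have "restrict F (dsum m n) \<in> dsum m n \<rightarrow>\<^sub>E dsum m n" using assms(1) by auto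
  moreover have "restrict F (dsum m n) (\<lambda>\<nu>. f \<nu> + g \<nu>) = (\<lambda>\<nu>. restrict F (dsum m n) f \<nu> + restrict F (dsum m n) g \<nu>)"
    if "f \<in> dsum m n" "g \<in> dsum m n" for f g
    using that dsum_add[OF that] assms(2)[OF that] by (simp add: fun_eq_iff)
  moreover have "restrict F (dsum m n) (\<lambda>\<nu>. f \<nu> * h) = (\<lambda>\<nu>. restrict F (dsum m n) f \<nu> * h)"
    if "f \<in> dsum m n" for f h
    using that dsum_mult[OF that] assms(3)[OF that] by (simp add: fun_eq_iff)
  ultimately show ?thesis unfolding endos_def by blast
qed

lemma endos_ext:
  assumes "\<phi> \<in> endos m n" "\<psi> \<in> endos m n" "\<And>f \<nu>. f \<in> dsum m n \<Longrightarrow> \<phi> f \<nu> = \<psi> f \<nu>"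
  shows "\<phi> = \<psi>"
proof
  fix f show "\<phi> f = \<psi> f" 
    using assms(3) endosD(2)[OF assms(1)] endosD(2)[OF assms(2)] by (cases "f \<in> dsum m n") auto
qed

lemma endos_0: "\<phi> \<in> endos m n \<Longrightarrow> \<phi> (\<lambda>\<nu>. 0) = (\<lambda>\<nu>. 0)"
  using endosD(4)[of \<phi> m n "\<lambda>\<nu>. 0" 0] by simp

lemma incl_mult: "incl \<nu> (a * h) = (\<lambda>\<xi>. incl \<nu> a \<xi> * h)"
  by (auto simp: incl_def)

text \<open>The summands are cyclic modules.\<close>
lemma endos_eqI:
  assumes "\<phi> \<in> endos m n" "\<psi> \<in> endos m n"
    "\<And>\<nu>. \<nu> \<in> bicomps m n r \<Longrightarrow> \<phi> (incl \<nu> (gen m n \<nu>)) = \<psi> (incl \<nu> (gen m n \<nu>))"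
  shows "\<phi> = \<psi>"
proof (rule endos_ext[OF assms(1,2)])
  fix f \<nu> assume f: "f \<in> dsum m n"
  have part: "\<phi> (\<lambda>\<xi>. if \<xi> \<in> A then f \<xi> else 0) = \<psi> (\<lambda>\<xi>. if \<xi> \<in> A then f \<xi> else 0)"
    if "finite A" "A \<subseteq> bicomps m n r" for A
    using that
  proof (induction A rule: finite_induct)
    case empty
    then show ?case using endos_0[OF assms(1)] endos_0[OF assms(2)] by simp
  next
    case (insert \<nu> A)
    obtain h where h: "f \<nu> = gen m n \<nu> * h" using dsum_gen[OF f] insert by blast
    have eq: "(\<lambda>\<xi>. if \<xi> \<in> insert \<nu> A then f \<xi> else 0) = (\<lambda>\<xi>. (if \<xi> \<in> A then f \<xi> else 0) + incl \<nu> (gen m n \<nu> * h) \<xi>)"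
      using insert(2) h by (auto simp: incl_def)
    have i: "incl \<nu> (gen m n \<nu>) \<in> dsum m n" "incl \<nu> (gen m n \<nu> * h) \<in> dsum m n" using insert by auto
    have "\<chi> (\<lambda>\<xi>. if \<xi> \<in> insert \<nu> A then f \<xi> else 0) =
        (\<lambda>\<xi>. \<chi> (\<lambda>\<xi>. if \<xi> \<in> A then f \<xi> else 0) \<xi> + \<chi> (incl \<nu> (gen m n \<nu>)) \<xi> * h)" if "\<chi> \<in> endos m n" for \<chi>
      unfolding eq endosD(3)[OF that dsum_if[OF f] i(2)] unfolding incl_mult endosD(4)[OF that i(1)] ..
    then show ?case using assms insert by auto
  qed
  have "(\<lambda>\<xi>. if \<xi> \<in> bicomps m n r then f \<xi> else 0) = f" using dsum_outside[OF f] by auto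
  then show "\<phi> f \<nu> = \<psi> f \<nu>" using part[of "bicomps m n r"] by simp
qed

subsection \<open>The module structure\<close>

lemma S_simps:
  "carrier (schur_superalgebra m n) = endos m n"
  "\<one>\<^bsub>schur_superalgebra m n\<^esub> = (\<lambda>f\<in>dsum m n. f)"
  "\<zero>\<^bsub>schur_superalgebra m n\<^esub> = (\<lambda>f\<in>dsum m n. \<lambda>\<nu>. 0)"
  "\<phi> \<oplus>\<^bsub>schur_superalgebra m n\<^esub> \<psi> = (\<lambda>f\<in>dsum m n. \<lambda>\<nu>. \<phi> f \<nu> + \<psi> f \<nu>)"
  "c \<odot>\<^bsub>schur_superalgebra m n\<^esub> \<phi> = (\<lambda>f\<in>dsum m n. \<lambda>\<nu>. scl c (\<phi> f \<nu>))"
  "\<phi> \<otimes>\<^bsub>schur_superalgebra m n\<^esub> \<psi> = (\<lambda>f\<in>dsum m n. \<lambda>\<nu>.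
       \<Sum>a<2. \<Sum>b<2. (- 1) ^ (a * b) * hom_part m n a \<phi> (hom_part m n b \<psi> f) \<nu>)"
  by (simp_all add: schur_superalgebra_def)

lemma S_zero_closed: "(\<lambda>f\<in>dsum m n. \<lambda>\<nu>. 0) \<in> endos m n"
  by (rule endosI) auto

lemma S_add_closed:
  assumes "\<phi> \<in> endos m n" "\<psi> \<in> endos m n" shows "(\<lambda>f\<in>dsum m n. \<lambda>\<nu>. \<phi> f \<nu> + \<psi> f \<nu>) \<in> endos m n"
  by (rule endosI) (use endosD[OF assms(1)] endosD[OF assms(2)] in \<open>auto simp: distrib_right\<close>)

lemma S_smult_closed:
  assumes "\<phi> \<in> endos m n" shows "(\<lambda>f\<in>dsum m n. \<lambda>\<nu>. scl c (\<phi> f \<nu>)) \<in> endos m n"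
  by (rule endosI) (use endosD[OF assms] in \<open>auto simp: scale_right_distrib scl_mult_left\<close>)

lemma S_uminus_closed:
  assumes "\<phi> \<in> endos m n" shows "(\<lambda>f\<in>dsum m n. \<lambda>\<nu>. - \<phi> f \<nu>) \<in> endos m n"
  by (rule endosI) (use endosD[OF assms] in auto)

lemma S_abelian_group: "abelian_group (schur_superalgebra m n)"
proof (rule abelian_groupI)
  fix \<phi> assume \<phi>: "\<phi> \<in> carrier (schur_superalgebra m n)"
  show "\<zero>\<^bsub>schur_superalgebra m n\<^esub> \<oplus>\<^bsub>schur_superalgebra m n\<^esub> \<phi> = \<phi>"
    using \<phi> unfolding S_simps by (intro endos_ext[OF S_add_closed[OF S_zero_closed]]) auto
  show "\<exists>\<psi>\<in>carrier (schur_superalgebra m n). \<psi> \<oplus>\<^bsub>schur_superalgebra m n\<^esub> \<phi> = \<zero>\<^bsub>schur_superalgebra m n\<^esub>"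
  proof
    show "(\<lambda>f\<in>dsum m n. \<lambda>\<nu>. - \<phi> f \<nu>) \<oplus>\<^bsub>schur_superalgebra m n\<^esub> \<phi> = \<zero>\<^bsub>schur_superalgebra m n\<^esub>"
      unfolding S_simps by (rule restrict_ext) auto
  qed (use \<phi> S_uminus_closed in \<open>simp add: S_simps\<close>)
qed (auto simp: S_simps S_add_closed S_zero_closed add.assoc add.commute intro!: restrict_ext)

text \<open>Reduces sums in the record structure to sums in H, where the computations take
  place.\<close>

lemma finsum_eval:
  assumes "finite A" "\<And>x. x \<in> A \<Longrightarrow> g x \<in> endos m n"
  shows "finsum (schur_superalgebra m n) g A \<in> endos m n"
    "f \<in> dsum m n \<Longrightarrow> finsum (schur_superalgebra m n) g A f \<nu> = (\<Sum>x\<in>A. g x f \<nu>)"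
proof -
  interpret S: abelian_group "schur_superalgebra m n" by (rule S_abelian_group)
  have "finsum (schur_superalgebra m n) g A \<in> endos m n \<and>
    (f \<in> dsum m n \<longrightarrow> finsum (schur_superalgebra m n) g A f \<nu> = (\<Sum>x\<in>A. g x f \<nu>))"
    using assms
  proof (induction A rule: finite_induct)
    case empty
    have "finsum (schur_superalgebra m n) g {} = (\<lambda>f\<in>dsum m n. \<lambda>\<nu>. 0)" by (simp add: S_simps(3))
    then have "finsum (schur_superalgebra m n) g {} \<in> endos m n \<and>
      (f \<in> dsum m n \<longrightarrow> finsum (schur_superalgebra m n) g {} f \<nu> = (\<Sum>x\<in>{}. g x f \<nu>))"
      using S_zero_closed[of m n] by (simp only: restrict_apply') simp
    then show ?case .
  next
    case (insert x A)
    have "finsum (schur_superalgebra m n) g (insert x A) = g x \<oplus>\<^bsub>schur_superalgebra m n\<^esub> finsum (schur_superalgebra m n) g A"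
      by (rule S.finsum_insert) (use insert in \<open>auto simp: S_simps\<close>)
    then have fi: "finsum (schur_superalgebra m n) g (insert x A) =
        (\<lambda>f\<in>dsum m n. \<lambda>\<nu>. g x f \<nu> + finsum (schur_superalgebra m n) g A f \<nu>)" by (simp only: S_simps)
    have "finsum (schur_superalgebra m n) g (insert x A) \<in> endos m n"
      unfolding fi using S_add_closed[of "g x" m n "finsum (schur_superalgebra m n) g A"] insert by blast
    moreover have "finsum (schur_superalgebra m n) g (insert x A) f \<nu> = (\<Sum>y\<in>insert x A. g y f \<nu>)" if "f \<in> dsum m n"
      unfolding fi using insert that by simp
    ultimately show ?case by blast
  qed
  then show "finsum (schur_superalgebra m n) g A \<in> endos m n"
    "f \<in> dsum m n \<Longrightarrow> finsum (schur_superalgebra m n) g A f \<nu> = (\<Sum>x\<in>A. g x f \<nu>)" by auto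
qed

subsection \<open>The basis\<close>

text \<open>Let \<xi> be the column sums and \<nu> the row sums of D. Writing
  \<open>T_cal m n D\<close> as \<open>h2 * gen m n \<xi>\<close>, left multiplication by h2 is
  right H-linear and takes the prescribed value; writing it as \<open>gen m n \<nu> * h3\<close>
  shows that the image stays inside the summand \<nu>. Uniqueness holds since the summands are
  cyclic.\<close>

lemma phi_spec:
  assumes D: "D \<in> mats m n r"
  shows "phi m n D \<in> endos m n \<and> (\<forall>\<nu>\<in>bicomps m n r. phi m n D (incl \<nu> (gen m n \<nu>)) =
       (if col_sums m n D = \<nu> then incl (row_sums m n D) (T_cal m n D) else (\<lambda>_. 0)))"
proof -
  let ?\<nu> = "row_sums m n D" and ?\<xi> = "col_sums m n D"
  note R = row_sums_bicomps[OF D] and C = col_sums_bicomps[OF D]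
  obtain h0 h1 where h: "T_cal m n D = xy m (blk ?\<nu>) * h1" "T_cal m n D = h0 * xy m (blk ?\<xi>)"
    using T_cal_bispace[OF D] unfolding bispace_eq[OF R C] by blast
  obtain c d where c: "gen m n ?\<xi> = scl c (xy m (blk ?\<xi>))" "xy m (blk ?\<xi>) = scl d (gen m n ?\<xi>)" using gen_xy[OF C] by blast
  obtain c' d' where c': "gen m n ?\<nu> = scl c' (xy m (blk ?\<nu>))" "xy m (blk ?\<nu>) = scl d' (gen m n ?\<nu>)" using gen_xy[OF R] by blast
  define h2 where "h2 = scl d h0"
  define h3 where "h3 = scl d' h1"
  have g: "h2 * gen m n ?\<xi> = T_cal m n D"
    unfolding h2_def scl_mult_left[symmetric] scl_mult_right h(2) using c(2) by simp
  have g': "gen m n ?\<nu> * h3 = T_cal m n D"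
    unfolding h3_def scl_mult_right[symmetric] scl_mult_left h(1) using c'(2) by simp
  define F where "F = (\<lambda>f. incl ?\<nu> (h2 * f ?\<xi>))"
  have F: "restrict F (dsum m n) \<in> endos m n"
  proof (rule endosI)
    fix f assume f: "f \<in> dsum m n"
    obtain h where "f ?\<xi> = gen m n ?\<xi> * h" using dsum_gen[OF f C] by blast
    then have "h2 * f ?\<xi> = T_cal m n D * h" using g by (simp add: mult.assoc[symmetric])
    also have "\<dots> = gen m n ?\<nu> * (h3 * h)" using g' by (simp add: mult.assoc[symmetric])
    finally show "F f \<in> dsum m n" unfolding F_def by (rule dsum_incl[OF R])
  qed (auto simp: F_def incl_def distrib_left mult.assoc)
  have Fg: "restrict F (dsum m n) (incl \<nu> (gen m n \<nu>)) = (if ?\<xi> = \<nu> then incl ?\<nu> (T_cal m n D) else (\<lambda>_. 0))"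
    if "\<nu> \<in> bicomps m n r" for \<nu>
  proof -
    have "restrict F (dsum m n) (incl \<nu> (gen m n \<nu>)) = F (incl \<nu> (gen m n \<nu>))"
      by (rule restrict_apply'[OF dsum_incl_gen[OF that]])
    also have "\<dots> = (if ?\<xi> = \<nu> then incl ?\<nu> (T_cal m n D) else (\<lambda>_. 0))"
      using g by (auto simp: F_def incl_def)
    finally show ?thesis .
  qed
  have "phi m n D = restrict F (dsum m n)"
    unfolding phi_def S_simps
  proof (rule the_equality)
    fix \<phi> assume \<phi>: "\<phi> \<in> endos m n \<and> (\<forall>\<nu>\<in>bicomps m n r. \<phi> (incl \<nu> (gen m n \<nu>)) =
       (if ?\<xi> = \<nu> then incl ?\<nu> (T_cal m n D) else (\<lambda>_. 0)))"
    show "\<phi> = restrict F (dsum m n)"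
      by (rule endos_eqI[OF _ F]) (use \<phi> Fg in simp_all)
  qed (use F Fg in simp)
  then show ?thesis using F Fg by simp
qed

lemma phi_closed: "D \<in> mats m n r \<Longrightarrow> phi m n D \<in> endos m n"
  using phi_spec by blast

lemma phi_gen: "D \<in> mats m n r \<Longrightarrow> \<xi> \<in> bicomps m n r \<Longrightarrow> phi m n D (incl \<xi> (gen m n \<xi>)) \<nu> =
    (if D \<in> mats_between m n r \<nu> \<xi> then T_cal m n D else 0)"
  using phi_spec[of D m n] by (auto simp: incl_def mats_between_def)

text \<open>The element with coordinates c in the \<open>phi\<close>; through it, questions on the
  superalgebra become questions on coefficient functions.\<close>

definition comb :: "nat \<Rightarrow> nat \<Rightarrow> (nmat \<Rightarrow> laurent) \<Rightarrow> (nat list \<Rightarrow> 'h) \<Rightarrow> (nat list \<Rightarrow> 'h)" where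
  "comb m n c = (\<Oplus>\<^bsub>schur_superalgebra m n\<^esub>D\<in>mats m n r. c D \<odot>\<^bsub>schur_superalgebra m n\<^esub> phi m n D)"

lemma smult_phi_closed: "D \<in> mats m n r \<Longrightarrow> c \<odot>\<^bsub>schur_superalgebra m n\<^esub> phi m n D \<in> endos m n"
  unfolding S_simps by (rule S_smult_closed[OF phi_closed])

lemma comb_closed: "comb m n c \<in> endos m n"
  unfolding comb_def by (rule finsum_eval(1)) (auto simp: smult_phi_closed)

lemma comb_eval: "f \<in> dsum m n \<Longrightarrow> comb m n c f \<nu> = (\<Sum>D\<in>mats m n r. scl (c D) (phi m n D f \<nu>))"
proof -
  assume f: "f \<in> dsum m n"
  have "comb m n c f \<nu> = (\<Sum>D\<in>mats m n r. (c D \<odot>\<^bsub>schur_superalgebra m n\<^esub> phi m n D) f \<nu>)"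
    unfolding comb_def by (rule finsum_eval(2)[OF finite_mats smult_phi_closed f])
  then show ?thesis using f by (simp add: S_simps(5))
qed

lemma comb_cong: "(\<And>D. D \<in> mats m n r \<Longrightarrow> c D = c' D) \<Longrightarrow> comb m n c = comb m n c'"
  by (rule endos_ext[OF comb_closed comb_closed]) (simp add: comb_eval)

lemma comb_subset:
  assumes "Z \<subseteq> mats m n r"
  shows "(\<Oplus>\<^bsub>schur_superalgebra m n\<^esub>D\<in>Z. c D \<odot>\<^bsub>schur_superalgebra m n\<^esub> phi m n D) = comb m n (\<lambda>D. if D \<in> Z then c D else 0)"
proof (rule endos_ext[OF _ comb_closed])
  have fin: "finite Z" by (rule finite_subset[OF assms]) simp
  have cl: "D \<in> Z \<Longrightarrow> c D \<odot>\<^bsub>schur_superalgebra m n\<^esub> phi m n D \<in> endos m n" for D using assms smult_phi_closed by blast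
  show "(\<Oplus>\<^bsub>schur_superalgebra m n\<^esub>D\<in>Z. c D \<odot>\<^bsub>schur_superalgebra m n\<^esub> phi m n D) \<in> endos m n"
    by (rule finsum_eval(1)[OF fin cl])
  fix f \<nu> assume f: "f \<in> dsum m n"
  have "(\<Oplus>\<^bsub>schur_superalgebra m n\<^esub>D\<in>Z. c D \<odot>\<^bsub>schur_superalgebra m n\<^esub> phi m n D) f \<nu> = (\<Sum>D\<in>Z. scl (c D) (phi m n D f \<nu>))"
    by (subst finsum_eval(2)[OF fin cl f]) (simp_all add: S_simps(5) f)
  also have "\<dots> = comb m n (\<lambda>D. if D \<in> Z then c D else 0) f \<nu>"
    unfolding comb_eval[OF f] using assms by (intro sum.mono_neutral_cong_left) auto
  finally show "(\<Oplus>\<^bsub>schur_superalgebra m n\<^esub>D\<in>Z. c D \<odot>\<^bsub>schur_superalgebra m n\<^esub> phi m n D) f \<nu> = comb m n (\<lambda>D. if D \<in> Z then c D else 0) f \<nu>" .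
qed

lemma comb_add: "comb m n c \<oplus>\<^bsub>schur_superalgebra m n\<^esub> comb m n c' = comb m n (\<lambda>D. c D + c' D)"
  unfolding S_simps by (rule endos_ext[OF S_add_closed[OF comb_closed comb_closed] comb_closed])
    (simp add: comb_eval scale_left_distrib sum.distrib)

lemma comb_delta: "D \<in> mats m n r \<Longrightarrow> comb m n (\<lambda>C. if C = D then 1 else 0) = phi m n D"
proof (rule endos_ext[OF comb_closed phi_closed])
  assume D: "D \<in> mats m n r"
  fix f \<nu> assume f: "f \<in> dsum m n"
  have "comb m n (\<lambda>C. if C = D then 1 else 0) f \<nu> = (\<Sum>C\<in>mats m n r. if C = D then phi m n D f \<nu> else 0)"
    unfolding comb_eval[OF f] by (intro sum.cong) auto
  then show "comb m n (\<lambda>C. if C = D then 1 else 0) f \<nu> = phi m n D f \<nu>" using D by simp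
qed

lemma comb_gen:
  assumes "\<xi> \<in> bicomps m n r"
  shows "comb m n c (incl \<xi> (gen m n \<xi>)) \<nu> = (\<Sum>D\<in>mats_between m n r \<nu> \<xi>. scl (c D) (T_cal m n D))"
proof -
  have "comb m n c (incl \<xi> (gen m n \<xi>)) \<nu> =
      (\<Sum>D\<in>mats m n r. if D \<in> mats_between m n r \<nu> \<xi> then scl (c D) (T_cal m n D) else 0)"
    unfolding comb_eval[OF dsum_incl_gen[OF assms]] using phi_gen[OF _ assms] by (intro sum.cong) auto
  also have "\<dots> = (\<Sum>D\<in>mats_between m n r \<nu> \<xi>. scl (c D) (T_cal m n D))"
    by (rule sum.mono_neutral_cong_right) (auto simp: mats_between_def)
  finally show ?thesis .
qed

lemma comb_inj:
  assumes eq: "comb m n c = comb m n c'" and D: "D \<in> mats m n r"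
  shows "c D = c' D"
proof (rule T_cal_independent[where c = c and c' = c', OF order_refl])
  show "(\<Sum>C\<in>mats_between m n r (row_sums m n D) (col_sums m n D). scl (c C) (T_cal m n C)) =
    (\<Sum>C\<in>mats_between m n r (row_sums m n D) (col_sums m n D). scl (c' C) (T_cal m n C))"
    using comb_gen[OF col_sums_bicomps[OF D]] eq by metis
  show "D \<in> mats_between m n r (row_sums m n D) (col_sums m n D)" using D by (simp add: mats_between_def)
qed

text \<open>The image of a generator has components that are right multiples of generators, hence
  left eigenvectors. Since \<phi> commutes with right multiplication, the right eigenvector property
  of the generator passes to its image as well. The components can thus be expanded in the
  \<open>T_cal\<close>.\<close>

lemma comb_surj:
  assumes \<phi>: "\<phi> \<in> endos m n" shows "\<exists>c. (\<forall>D. D \<notin> mats m n r \<longrightarrow> c D = 0) \<and> \<phi> = comb m n c"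
proof -
  define z where "z = (\<lambda>\<xi> \<nu>. \<phi> (incl \<xi> (gen m n \<xi>)) \<nu>)"
  define c where "c = (\<lambda>D. if D \<in> mats m n r then T_coeff (z (col_sums m n D) (row_sums m n D)) (pivot m n r D) * pivot_unit_inv m n D else 0)"
  have zb: "z \<xi> \<nu> \<in> bispace m \<nu> \<xi>" if \<nu>: "\<nu> \<in> bicomps m n r" and \<xi>: "\<xi> \<in> bicomps m n r" for \<nu> \<xi>
  proof -
    have i: "incl \<xi> (gen m n \<xi>) \<in> dsum m n" using \<xi> by blast
    have D: "gen m n \<tau> \<in> bispace m \<tau> \<tau>" if "\<tau> \<in> bicomps m n r" for \<tau>
      using T_cal_bispace[OF diag_mat(1)[OF that]] diag_mat(2,3)[OF that] by simp
    obtain h where "z \<xi> \<nu> = gen m n \<nu> * h" using dsum_gen[OF endosD(1)[OF \<phi> i] \<nu>] by (auto simp: z_def)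
    then have "z \<xi> \<nu> \<in> left_space m (blk \<nu>)" using left_space_mult D[OF \<nu>] by (simp add: bispace_def)
    moreover have "z \<xi> \<nu> \<in> right_space m (blk \<xi>)" unfolding right_space_def
    proof (intro CollectI ballI)
      fix k assume k: "k \<in> gens r (blk \<xi>) any_type"
      let ?c = "q_param * kappa (blk \<xi> k < m)"
      have "gen m n \<xi> * T (simple_refl k) = gen m n \<xi> * scl ?c 1"
        using D[OF \<xi>] k by (simp add: bispace_def right_space_def scl_1_mult)
      then have "(\<lambda>\<nu>. incl \<xi> (gen m n \<xi>) \<nu> * T (simple_refl k)) = (\<lambda>\<nu>. incl \<xi> (gen m n \<xi>) \<nu> * scl ?c 1)"
        by (auto simp: incl_def)
      then have "\<phi> (incl \<xi> (gen m n \<xi>)) \<nu> * T (simple_refl k) = \<phi> (incl \<xi> (gen m n \<xi>)) \<nu> * scl ?c 1"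
        using endosD(4)[OF \<phi> i, of "T (simple_refl k)"] endosD(4)[OF \<phi> i, of "scl ?c 1"] by metis
      then show "z \<xi> \<nu> * T (simple_refl k) = scl ?c (z \<xi> \<nu>)" by (simp add: z_def scl_1_mult)
    qed
    ultimately show ?thesis by (simp add: bispace_def)
  qed
  have "\<phi> = comb m n c"
  proof (rule endos_eqI[OF \<phi> comb_closed], rule ext)
    fix \<xi> \<nu> assume \<xi>: "\<xi> \<in> bicomps m n r"
    show "\<phi> (incl \<xi> (gen m n \<xi>)) \<nu> = comb m n c (incl \<xi> (gen m n \<xi>)) \<nu>"
    proof (cases "\<nu> \<in> bicomps m n r")
      case True
      have "z \<xi> \<nu> = (\<Sum>C\<in>mats_between m n r \<nu> \<xi>. scl (c C) (T_cal m n C))"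
        by (subst T_cal_expand[OF True \<xi> zb[OF True \<xi>]]) (intro sum.cong, auto simp: c_def mats_between_def)
      then show ?thesis unfolding comb_gen[OF \<xi>] by (simp add: z_def)
    next
      case False
      then show ?thesis using dsum_outside[OF endosD(1)[OF \<phi> dsum_incl_gen[OF \<xi>]] False]
        dsum_outside[OF endosD(1)[OF comb_closed dsum_incl_gen[OF \<xi>]] False] by simp
    qed
  qed
  moreover have "\<forall>D. D \<notin> mats m n r \<longrightarrow> c D = 0" by (simp add: c_def)
  ultimately show ?thesis by blast
qed

subsection \<open>The bar involution\<close>

definition S_bar :: "nat \<Rightarrow> nat \<Rightarrow> ((nat list \<Rightarrow> 'h) \<Rightarrow> (nat list \<Rightarrow> 'h)) \<Rightarrow> (nat list \<Rightarrow> 'h) \<Rightarrow> (nat list \<Rightarrow> 'h)" where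
  "S_bar m n \<phi> = (\<lambda>f\<in>dsum m n. \<lambda>\<nu>. hecke_bar (\<phi> (\<lambda>\<xi>. hecke_bar (f \<xi>)) \<nu>))"

lemma S_bar_eval: "f \<in> dsum m n \<Longrightarrow> S_bar m n \<phi> f \<nu> = hecke_bar (\<phi> (\<lambda>\<xi>. hecke_bar (f \<xi>)) \<nu>)"
  by (simp add: S_bar_def)

lemma S_bar_closed: assumes \<phi>: "\<phi> \<in> endos m n" shows "S_bar m n \<phi> \<in> endos m n"
  unfolding S_bar_def
proof (rule endosI)
  fix f assume f: "f \<in> dsum m n"
  show "(\<lambda>\<nu>. hecke_bar (\<phi> (\<lambda>\<xi>. hecke_bar (f \<xi>)) \<nu>)) \<in> dsum m n"
    by (intro dsum_bar endosD(1)[OF \<phi>] f)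
next
  fix f g \<nu> assume f: "f \<in> dsum m n" "g \<in> dsum m n"
  show "hecke_bar (\<phi> (\<lambda>\<xi>. hecke_bar (f \<xi> + g \<xi>)) \<nu>) =
       hecke_bar (\<phi> (\<lambda>\<xi>. hecke_bar (f \<xi>)) \<nu>) + hecke_bar (\<phi> (\<lambda>\<xi>. hecke_bar (g \<xi>)) \<nu>)"
    unfolding hecke_bar_add endosD(3)[OF \<phi> dsum_bar[OF f(1)] dsum_bar[OF f(2)]] ..
next
  fix f h \<nu> assume f: "f \<in> dsum m n"
  show "hecke_bar (\<phi> (\<lambda>\<xi>. hecke_bar (f \<xi> * h)) \<nu>) = hecke_bar (\<phi> (\<lambda>\<xi>. hecke_bar (f \<xi>)) \<nu>) * h"
    unfolding hecke_bar_mult endosD(4)[OF \<phi> dsum_bar[OF f]] by simp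
qed

lemma S_bar_bar: "\<phi> \<in> endos m n \<Longrightarrow> S_bar m n (S_bar m n \<phi>) = \<phi>"
  by (rule endos_ext[OF S_bar_closed[OF S_bar_closed]]) (auto simp: S_bar_eval dsum_bar)

lemma hom_part_eval: "f \<in> dsum m n \<Longrightarrow> hom_part m n a \<phi> f \<nu> =
    \<phi> (\<lambda>\<xi>. if (odd_size m \<nu> + odd_size m \<xi>) mod 2 = a then f \<xi> else 0) \<nu>"
  by (simp add: hom_part_def)

lemma hom_part_dsum:
  assumes \<phi>: "\<phi> \<in> endos m n" and f: "f \<in> dsum m n"
  shows "hom_part m n a \<phi> f \<in> dsum m n"
proof -
  have "(\<lambda>\<xi>. if (odd_size m \<nu> + odd_size m \<xi>) mod 2 = a then f \<xi> else 0) \<in> dsum m n" for \<nu>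
    by (rule dsum_if[OF f])
  note d = endosD(1)[OF \<phi> this]
  have "hom_part m n a \<phi> f \<nu> = 0" if "\<nu> \<notin> bicomps m n r" for \<nu>
    unfolding hom_part_eval[OF f] by (rule dsum_outside[OF d that])
  moreover have "\<exists>h. hom_part m n a \<phi> f \<nu> = gen m n \<nu> * h" if "\<nu> \<in> bicomps m n r" for \<nu>
    unfolding hom_part_eval[OF f] by (rule dsum_gen[OF d that])
  ultimately show ?thesis unfolding dsum_iff by blast
qed

text \<open>The degree depends only on the indices of the summands, which bar leaves alone; hence
  the signs of the supermultiplication are respected.\<close>

lemma hom_part_bar:
  assumes f: "f \<in> dsum m n"
  shows "hom_part m n a (S_bar m n \<phi>) f = (\<lambda>\<nu>. hecke_bar (hom_part m n a \<phi> (\<lambda>\<xi>. hecke_bar (f \<xi>)) \<nu>))"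
proof
  fix \<nu>
  have "(\<lambda>\<xi>. hecke_bar (if Q \<xi> then f \<xi> else 0)) = (\<lambda>\<xi>. if Q \<xi> then hecke_bar (f \<xi>) else 0)" for Q by auto
  then show "hom_part m n a (S_bar m n \<phi>) f \<nu> = hecke_bar (hom_part m n a \<phi> (\<lambda>\<xi>. hecke_bar (f \<xi>)) \<nu>)"
    using f by (simp add: hom_part_eval dsum_bar S_bar_eval dsum_if)
qed

lemma hecke_bar_sign: "hecke_bar ((- 1) ^ k * z) = (- 1) ^ k * hecke_bar z"
proof (cases "even k")
  case False
  have "hecke_bar (- z) = - hecke_bar z" using hecke_bar_add[of z "- z"] by (simp add: eq_neg_iff_add_eq_0 add.commute)
  then show ?thesis using False by simp
qed simp

lemma S_bar_ring_hom: "S_bar m n \<in> ring_hom (schur_superalgebra m n) (schur_superalgebra m n)"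
proof (rule ring_hom_memI)
  fix \<phi> assume "\<phi> \<in> carrier (schur_superalgebra m n)"
  then show "S_bar m n \<phi> \<in> carrier (schur_superalgebra m n)" unfolding S_simps by (rule S_bar_closed)
next
  fix \<phi> \<psi> assume \<phi>: "\<phi> \<in> carrier (schur_superalgebra m n)" and \<psi>: "\<psi> \<in> carrier (schur_superalgebra m n)"
  show "S_bar m n (\<phi> \<otimes>\<^bsub>schur_superalgebra m n\<^esub> \<psi>) = S_bar m n \<phi> \<otimes>\<^bsub>schur_superalgebra m n\<^esub> S_bar m n \<psi>"
    unfolding S_simps S_bar_def[of m n "restrict _ _"]
  proof (rule restrict_ext)
    fix f assume f: "f \<in> dsum m n"
    have h: "hom_part m n b (S_bar m n \<psi>) f \<in> dsum m n" for b
      using hom_part_dsum[OF S_bar_closed f] \<psi> unfolding S_simps by blast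
    \<comment> \<open>The outer bar of the inner map cancels the inner bar of the outer one.\<close>
    have "hom_part m n a (S_bar m n \<phi>) (hom_part m n b (S_bar m n \<psi>) f) \<nu> =
        hecke_bar (hom_part m n a \<phi> (hom_part m n b \<psi> (\<lambda>\<xi>. hecke_bar (f \<xi>))) \<nu>)" for a b \<nu>
      unfolding hom_part_bar[OF h] unfolding hom_part_bar[OF f] by simp
    then show "(\<lambda>\<nu>. hecke_bar ((\<lambda>f\<in>dsum m n. \<lambda>\<nu>.
          \<Sum>a<2. \<Sum>b<2. (- 1) ^ (a * b) * hom_part m n a \<phi> (hom_part m n b \<psi> f) \<nu>) (\<lambda>\<xi>. hecke_bar (f \<xi>)) \<nu>)) =
        (\<lambda>\<nu>. \<Sum>a<2. \<Sum>b<2. (- 1) ^ (a * b) * hom_part m n a (S_bar m n \<phi>) (hom_part m n b (S_bar m n \<psi>) f) \<nu>)"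
      using dsum_bar[OF f] by (simp add: hecke_bar_sum hecke_bar_sign)
  qed
  show "S_bar m n (\<phi> \<oplus>\<^bsub>schur_superalgebra m n\<^esub> \<psi>) = S_bar m n \<phi> \<oplus>\<^bsub>schur_superalgebra m n\<^esub> S_bar m n \<psi>"
    unfolding S_simps S_bar_def by (rule restrict_ext) (simp add: dsum_bar hecke_bar_add)
next
  show "S_bar m n \<one>\<^bsub>schur_superalgebra m n\<^esub> = \<one>\<^bsub>schur_superalgebra m n\<^esub>"
    unfolding S_simps S_bar_def by (rule restrict_ext) (simp add: dsum_bar)
qed

lemma S_bar_smult: "S_bar m n (c \<odot>\<^bsub>schur_superalgebra m n\<^esub> \<phi>) = laurent_bar c \<odot>\<^bsub>schur_superalgebra m n\<^esub> S_bar m n \<phi>"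
  unfolding S_simps S_bar_def by (rule restrict_ext) (simp add: dsum_bar hecke_bar_scl)

text \<open>The semilinear map that describes \<open>S_bar\<close> in coordinates. The order of
  matrices enters only through vanishing coefficients, so the sum can run over all of them.\<close>

definition bar_coords :: "nat \<Rightarrow> nat \<Rightarrow> (nmat \<Rightarrow> laurent) \<Rightarrow> nmat \<Rightarrow> laurent" where
  "bar_coords m n c B = (\<Sum>C\<in>mats m n r. bar_coeff m n B C * laurent_bar (c C))"

lemma bar_coeff_outside: "D \<in> mats m n r \<Longrightarrow> \<not> (C \<in> mats m n r \<and> mat_le m n r C D) \<Longrightarrow> bar_coeff m n C D = 0"
  using bar_row_spec(1) by blast

text \<open>Compared on the generators, which bar fixes; there \<open>S_bar\<close> reduces to the
  bar of H on a combination of the \<open>T_cal\<close>.\<close>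

lemma S_bar_comb: "S_bar m n (comb m n c) = comb m n (bar_coords m n c)"
proof (rule endos_eqI[OF S_bar_closed[OF comb_closed] comb_closed], rule ext)
  fix \<xi> \<nu> assume \<xi>: "\<xi> \<in> bicomps m n r"
  let ?X = "mats_between m n r \<nu> \<xi>"
  have bT: "hecke_bar (T_cal m n D) = (\<Sum>C\<in>?X. scl (bar_coeff m n C D) (T_cal m n C))" if D: "D \<in> ?X" for D
  proof -
    have Dm: "D \<in> mats m n r" using D by (simp add: mats_between_def)
    have "hecke_bar (T_cal m n D) = (\<Sum>C | C \<in> mats m n r \<and> mat_le m n r C D. scl (bar_coeff m n C D) (T_cal m n C))"
      using bar_row_spec(1)[OF Dm] by blast
    also have "\<dots> = (\<Sum>C\<in>?X. scl (bar_coeff m n C D) (T_cal m n C))"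
      by (rule sum.mono_neutral_left) (use D bar_coeff_outside[OF Dm] in \<open>auto simp: mats_between_def mat_le_iff\<close>)
    finally show ?thesis .
  qed
  have bc: "bar_coords m n c C = (\<Sum>D\<in>?X. bar_coeff m n C D * laurent_bar (c D))" if C: "C \<in> ?X" for C
    unfolding bar_coords_def
  proof (rule sum.mono_neutral_right)
    show "\<forall>D\<in>mats m n r - ?X. bar_coeff m n C D * laurent_bar (c D) = 0"
    proof
      fix D assume D: "D \<in> mats m n r - ?X"
      then have "\<not> mat_le m n r C D" using C by (auto simp: mats_between_def mat_le_iff)
      then show "bar_coeff m n C D * laurent_bar (c D) = 0" using bar_coeff_outside[of D m n C] D by simp
    qed
  qed (auto simp: mats_between_def)
  have bi: "(\<lambda>\<tau>. hecke_bar (incl \<xi> (gen m n \<xi>) \<tau>)) = incl \<xi> (gen m n \<xi>)"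
    using T_cal_diag(1)[OF \<xi>] by (auto simp: incl_def)
  have "S_bar m n (comb m n c) (incl \<xi> (gen m n \<xi>)) \<nu> = hecke_bar (\<Sum>D\<in>?X. scl (c D) (T_cal m n D))"
    unfolding S_bar_eval[OF dsum_incl_gen[OF \<xi>]] bi comb_gen[OF \<xi>] ..
  also have "\<dots> = (\<Sum>D\<in>?X. \<Sum>C\<in>?X. scl (bar_coeff m n C D * laurent_bar (c D)) (T_cal m n C))"
    unfolding hecke_bar_sum hecke_bar_scl by (intro sum.cong refl) (simp add: bT scale_sum_right mult.commute)
  also have "\<dots> = (\<Sum>C\<in>?X. scl (bar_coords m n c C) (T_cal m n C))"
    by (subst sum.swap) (intro sum.cong refl, simp add: bc scale_sum_left)
  finally show "S_bar m n (comb m n c) (incl \<xi> (gen m n \<xi>)) \<nu> = comb m n (bar_coords m n c) (incl \<xi> (gen m n \<xi>)) \<nu>"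
    unfolding comb_gen[OF \<xi>] .
qed

lemma S_bar_phi:
  assumes D: "D \<in> mats m n r"
  shows "S_bar m n (phi m n D) = comb m n (\<lambda>C. bar_coeff m n C D)"
proof -
  have "bar_coords m n (\<lambda>C. if C = D then 1 else 0) = (\<lambda>B. bar_coeff m n B D)"
  proof
    fix B
    have "bar_coords m n (\<lambda>C. if C = D then 1 else 0) B = (\<Sum>C\<in>mats m n r. if C = D then bar_coeff m n B D else 0)"
      unfolding bar_coords_def by (intro sum.cong) auto
    then show "bar_coords m n (\<lambda>C. if C = D then 1 else 0) B = bar_coeff m n B D" using D by simp
  qed
  then show ?thesis using S_bar_comb[of m n "\<lambda>C. if C = D then 1 else 0"] comb_delta[OF D] by simp
qed

lemma bar_coords_bar_coords:
  assumes "D \<in> mats m n r" shows "bar_coords m n (bar_coords m n c) D = c D"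
proof (rule comb_inj[OF _ assms])
  show "comb m n (bar_coords m n (bar_coords m n c)) = comb m n c"
    unfolding S_bar_comb[symmetric] by (rule S_bar_bar[OF comb_closed])
qed

text \<open>An additive semilinear map is determined by its values on the \<open>phi\<close>; this
  gives the uniqueness of the bar involution.\<close>

lemma semilinear_comb:
  assumes \<beta>: "\<beta> \<in> endos m n \<rightarrow> endos m n"
    "\<And>f g. f \<in> endos m n \<Longrightarrow> g \<in> endos m n \<Longrightarrow> \<beta> (f \<oplus>\<^bsub>schur_superalgebra m n\<^esub> g) = \<beta> f \<oplus>\<^bsub>schur_superalgebra m n\<^esub> \<beta> g"
    "\<And>z f. f \<in> endos m n \<Longrightarrow> \<beta> (z \<odot>\<^bsub>schur_superalgebra m n\<^esub> f) = laurent_bar z \<odot>\<^bsub>schur_superalgebra m n\<^esub> \<beta> f"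
  shows "\<beta> (comb m n c) = (\<Oplus>\<^bsub>schur_superalgebra m n\<^esub>D\<in>mats m n r. laurent_bar (c D) \<odot>\<^bsub>schur_superalgebra m n\<^esub> \<beta> (phi m n D))"
proof -
  let ?S = "schur_superalgebra m n"
  interpret S: abelian_group ?S by (rule S_abelian_group)
  have z0: "0 \<odot>\<^bsub>?S\<^esub> \<phi> = \<zero>\<^bsub>?S\<^esub>" for \<phi> unfolding S_simps by simp
  have zc: "\<zero>\<^bsub>?S\<^esub> \<in> endos m n" using S_zero_closed by (simp add: S_simps)
  have "\<beta> (0 \<odot>\<^bsub>?S\<^esub> \<zero>\<^bsub>?S\<^esub>) = laurent_bar 0 \<odot>\<^bsub>?S\<^esub> \<beta> \<zero>\<^bsub>?S\<^esub>" by (rule \<beta>(3)[OF zc])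
  then have \<beta>0: "\<beta> \<zero>\<^bsub>?S\<^esub> = \<zero>\<^bsub>?S\<^esub>" unfolding z0 laurent_bar_0 .
  have sc: "a \<odot>\<^bsub>?S\<^esub> \<phi> \<in> endos m n" if "\<phi> \<in> endos m n" for a \<phi> using S_smult_closed[OF that] by (simp add: S_simps)
  have "\<beta> (\<Oplus>\<^bsub>?S\<^esub>D\<in>A. c D \<odot>\<^bsub>?S\<^esub> phi m n D) = (\<Oplus>\<^bsub>?S\<^esub>D\<in>A. laurent_bar (c D) \<odot>\<^bsub>?S\<^esub> \<beta> (phi m n D))"
    if "finite A" "A \<subseteq> mats m n r" for A
    using that
  proof (induction A rule: finite_induct)
    case empty
    then show ?case by (simp add: \<beta>0)
  next
    case (insert D A)
    have p: "phi m n C \<in> endos m n" "\<beta> (phi m n C) \<in> endos m n" if "C \<in> insert D A" for C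
      using that insert phi_closed \<beta>(1) by blast+
    have "(\<Oplus>\<^bsub>?S\<^esub>C\<in>insert D A. c C \<odot>\<^bsub>?S\<^esub> phi m n C) = c D \<odot>\<^bsub>?S\<^esub> phi m n D \<oplus>\<^bsub>?S\<^esub> (\<Oplus>\<^bsub>?S\<^esub>C\<in>A. c C \<odot>\<^bsub>?S\<^esub> phi m n C)"
      by (rule S.finsum_insert) (use insert p sc in \<open>auto simp: S_simps(1)\<close>)
    moreover have "(\<Oplus>\<^bsub>?S\<^esub>C\<in>insert D A. laurent_bar (c C) \<odot>\<^bsub>?S\<^esub> \<beta> (phi m n C)) =
        laurent_bar (c D) \<odot>\<^bsub>?S\<^esub> \<beta> (phi m n D) \<oplus>\<^bsub>?S\<^esub> (\<Oplus>\<^bsub>?S\<^esub>C\<in>A. laurent_bar (c C) \<odot>\<^bsub>?S\<^esub> \<beta> (phi m n C))"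
      by (rule S.finsum_insert) (use insert p sc in \<open>auto simp: S_simps(1)\<close>)
    moreover have "(\<Oplus>\<^bsub>?S\<^esub>C\<in>A. c C \<odot>\<^bsub>?S\<^esub> phi m n C) \<in> endos m n"
      by (rule finsum_eval(1)) (use insert p sc in auto)
    ultimately show ?case using \<beta>(2)[OF sc[OF p(1)]] \<beta>(3)[OF p(1)] insert by simp
  qed
  then show ?thesis unfolding comb_def by simp
qed

end

section \<open>Unitriangular matrices and canonical bases\<close>

text \<open>The strictly increasing rank excludes cycles and supplies maximal elements; for matrices
  it is the length of the pivot.\<close>

locale ranked_poset =
  fixes M :: "'i set" and le :: "'i \<Rightarrow> 'i \<Rightarrow> bool" and rank :: "'i \<Rightarrow> nat"
  assumes finite_M: "finite M"
    and rank_less: "B \<in> M \<Longrightarrow> C \<in> M \<Longrightarrow> le B C \<Longrightarrow> B \<noteq> C \<Longrightarrow> rank B < rank C"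
    and le_trans: "B \<in> M \<Longrightarrow> C \<in> M \<Longrightarrow> D \<in> M \<Longrightarrow> le B C \<Longrightarrow> le C D \<Longrightarrow> le B D"
begin

definition unitriangular :: "('i \<Rightarrow> 'i \<Rightarrow> laurent) \<Rightarrow> bool" where
  "unitriangular P \<longleftrightarrow> (\<forall>D\<in>M. P D D = 1) \<and> (\<forall>B\<in>M. \<forall>D\<in>M. B \<noteq> D \<longrightarrow> \<not> le B D \<longrightarrow> P B D = 0)"

definition down_closed :: "'i set \<Rightarrow> bool" where
  "down_closed X \<longleftrightarrow> X \<subseteq> M \<and> (\<forall>C\<in>X. \<forall>B\<in>M. le B C \<longrightarrow> B \<in> X)"

lemma exists_maximal:
  assumes "X \<subseteq> M" "X \<noteq> {}"
  obtains C where "C \<in> X" "\<And>D. D \<in> X \<Longrightarrow> le C D \<Longrightarrow> D = C"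
proof -
  have fin: "finite (rank ` X)" using assms(1) finite_M finite_subset by blast
  then have "Max (rank ` X) \<in> rank ` X" using assms(2) by (intro Max_in) auto
  then obtain C where C: "C \<in> X" "rank C = Max (rank ` X)" by auto
  have "D = C" if "D \<in> X" "le C D" for D
  proof (rule ccontr)
    assume "D \<noteq> C"
    then have "rank C < rank D" using rank_less[of C D] that C assms(1) by blast
    moreover have "rank D \<le> rank C" unfolding C(2) using fin that by simp
    ultimately show False by simp
  qed
  then show ?thesis using that C(1) by blast
qed

lemma down_closed_remove:
  assumes "down_closed X" "C \<in> X" "\<And>D. D \<in> X \<Longrightarrow> le C D \<Longrightarrow> D = C"
  shows "down_closed (X - {C})"
  using assms unfolding down_closed_def by blast

lemma sum_delta_right: "C \<in> M \<Longrightarrow> (\<Sum>D\<in>M. P D * (if D = C then b else 0)) = P C * (b :: laurent)"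
proof -
  assume C: "C \<in> M"
  have "(\<Sum>D\<in>M. P D * (if D = C then b else 0)) = (\<Sum>D\<in>M. if D = C then P C * b else 0)"
    by (intro sum.cong) auto
  then show ?thesis using C finite_M by simp
qed

lemma unitriangular_row:
  assumes P: "unitriangular P" and C: "C \<in> M" and e: "\<And>D. D \<in> M \<Longrightarrow> D \<noteq> C \<Longrightarrow> le C D \<Longrightarrow> e D = 0"
  shows "(\<Sum>D\<in>M. P C D * e D) = e C"
proof -
  have "(\<Sum>D\<in>M. P C D * e D) = (\<Sum>D\<in>M. if D = C then e C else 0)"
  proof (rule sum.cong[OF refl])
    fix D assume D: "D \<in> M"
    show "P C D * e D = (if D = C then e C else 0)"
    proof (cases "D = C \<or> le C D")
      case True
      then show ?thesis using P C e D by (auto simp: unitriangular_def)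
    next
      case False
      then have "P C D = 0" using P C D unfolding unitriangular_def by metis
      then show ?thesis using False by simp
    qed
  qed
  then show ?thesis using C finite_M by simp
qed

text \<open>Elimination from the top: for a maximal C in X, subtracting \<open>a C\<close> times the
  column of C clears the entry at C and, as this column is supported at and below C, changes nothing
  outside X.\<close>

lemma unitriangular_solve:
  assumes P: "unitriangular P" and X: "down_closed X" and a: "\<And>B. B \<in> M - X \<Longrightarrow> a B = 0"
  shows "\<exists>c. (\<forall>D. D \<notin> X \<longrightarrow> c D = 0) \<and> (\<forall>B\<in>M. a B = (\<Sum>D\<in>M. P B D * c D))"
  using X a
proof (induction "card X" arbitrary: X a)
  case 0
  have "finite X" using 0(2) finite_M finite_subset by (auto simp: down_closed_def)
  then have "X = {}" using 0(1) by simp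
  then show ?case using 0(3) by (intro exI[of _ "\<lambda>_. 0"]) simp
next
  case (Suc l)
  have XM: "X \<subseteq> M" and "X \<noteq> {}" using Suc by (auto simp: down_closed_def)
  have fin: "finite X" using XM finite_M finite_subset by blast
  obtain C where C: "C \<in> X" "\<And>D. D \<in> X \<Longrightarrow> le C D \<Longrightarrow> D = C" using exists_maximal[OF XM \<open>X \<noteq> {}\<close>] by blast
  have CM: "C \<in> M" using C XM by blast
  define a' where "a' = (\<lambda>B. a B - P B C * a C)"
  have "a' B = 0" if B: "B \<in> M - (X - {C})" for B
  proof (cases "B = C")
    case True
    then show ?thesis using P CM by (simp add: a'_def unitriangular_def)
  next
    case False
    then have "B \<notin> X" "\<not> le B C" using B C(1) Suc(3) by (auto simp: down_closed_def)
    then have "P B C = 0" using P B CM False unfolding unitriangular_def by blast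
    then show ?thesis using Suc(4)[of B] B \<open>B \<notin> X\<close> by (simp add: a'_def)
  qed
  moreover have "l = card (X - {C})" using Suc(2) C(1) fin by simp
  ultimately obtain c where c: "\<And>D. D \<notin> X - {C} \<Longrightarrow> c D = 0" "\<And>B. B \<in> M \<Longrightarrow> a' B = (\<Sum>D\<in>M. P B D * c D)"
    using Suc(1)[of "X - {C}" a'] down_closed_remove[OF Suc(3) C] by blast
  define c' where "c' = (\<lambda>D. c D + (if D = C then a C else 0))"
  have "a B = (\<Sum>D\<in>M. P B D * c' D)" if "B \<in> M" for B
    using c(2)[OF that] sum_delta_right[OF CM, of "P B" "a C"]
    by (simp add: c'_def distrib_left sum.distrib a'_def algebra_simps)
  moreover have "c' D = 0" if "D \<notin> X" for D using c(1)[of D] that C(1) by (auto simp: c'_def)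
  ultimately show ?case by blast
qed

text \<open>At a maximal index C of the support of e, row C of the product returns
  \<open>e C\<close> itself.\<close>

lemma unitriangular_kernel:
  assumes P: "unitriangular P" and e: "\<And>B. B \<in> M \<Longrightarrow> (\<Sum>D\<in>M. P B D * e D) = 0" and D: "D \<in> M"
  shows "e D = 0"
proof (rule ccontr)
  let ?X = "{D \<in> M. e D \<noteq> 0}"
  assume "e D \<noteq> 0"
  then have "?X \<noteq> {}" using D by blast
  then obtain C where C: "C \<in> ?X" "\<And>D. D \<in> ?X \<Longrightarrow> le C D \<Longrightarrow> D = C"
    using exists_maximal[of ?X] by blast
  have "(\<Sum>D\<in>M. P C D * e D) = e C" by (rule unitriangular_row[OF P]) (use C in auto)
  then show False using e[of C] C(1) by simp
qed

lemma unitriangular_ex1: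
  assumes P: "unitriangular P"
  shows "\<exists>!c. (\<forall>D. D \<notin> M \<longrightarrow> c D = 0) \<and> (\<forall>B\<in>M. a B = (\<Sum>D\<in>M. P B D * c D))"
proof (rule ex_ex1I)
  show "\<exists>c. (\<forall>D. D \<notin> M \<longrightarrow> c D = 0) \<and> (\<forall>B\<in>M. a B = (\<Sum>D\<in>M. P B D * c D))"
    by (rule unitriangular_solve[OF P]) (auto simp: down_closed_def)
next
  fix c c' assume c: "(\<forall>D. D \<notin> M \<longrightarrow> c D = 0) \<and> (\<forall>B\<in>M. a B = (\<Sum>D\<in>M. P B D * c D))"
    and c': "(\<forall>D. D \<notin> M \<longrightarrow> c' D = 0) \<and> (\<forall>B\<in>M. a B = (\<Sum>D\<in>M. P B D * c' D))"
  have "c D - c' D = 0" if "D \<in> M" for D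
  proof (rule unitriangular_kernel[OF P _ that])
    fix B assume B: "B \<in> M"
    have "a B = (\<Sum>D\<in>M. P B D * c D)" "a B = (\<Sum>D\<in>M. P B D * c' D)" using c c' B by blast+
    then have "(\<Sum>D\<in>M. P B D * c D) = (\<Sum>D\<in>M. P B D * c' D)" by (rule trans[OF HOL.sym])
    then show "(\<Sum>D\<in>M. P B D * (c D - c' D)) = 0"
      by (simp add: right_diff_distrib sum_subtractf)
  qed
  then have "c D = c' D" for D using c c' by (cases "D \<in> M") auto
  then show "c = c'" by blast
qed

end

text \<open>J is asked to be involutive on M only, because its result depends only on the values
  there.\<close>

locale bar_matrix = ranked_poset +
  fixes R :: "'a \<Rightarrow> 'a \<Rightarrow> laurent" and J :: "('a \<Rightarrow> laurent) \<Rightarrow> 'a \<Rightarrow> laurent"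
  assumes R: "unitriangular R"
    and J: "\<And>x B. J x B = (\<Sum>C\<in>M. R B C * laurent_bar (x C))"
    and J_J: "\<And>x B. B \<in> M \<Longrightarrow> J (J x) B = x B"
begin

lemma J_add: "J (\<lambda>C. x C + y C) B = J x B + J y B"
  by (simp add: J distrib_left sum.distrib)

lemma J_diff: "J (\<lambda>C. x C - y C) B = J x B - J y B"
  by (simp add: J right_diff_distrib sum_subtractf)

lemma J_delta: "C \<in> M \<Longrightarrow> J (\<lambda>D. if D = C then b else 0) B = R B C * laurent_bar b"
  using sum_delta_right[of C "R B" "laurent_bar b"] by (simp add: J if_distrib[of laurent_bar] cong: if_cong)

text \<open>At a maximal C the value of J x is the bar of \<open>x C\<close>, so \<open>x C\<close>
  is antisymmetric and equals b - bar(b) with b negative. Subtracting \<delta> - J \<delta>, for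
  \<delta> equal to b at C and 0 elsewhere, keeps x antisymmetric and removes C from X.\<close>

lemma J_antisymmetric_solve:
  assumes X: "down_closed X" and x: "\<And>B. B \<in> M - X \<Longrightarrow> x B = 0" and anti: "\<And>B. B \<in> M \<Longrightarrow> J x B = - x B"
  shows "\<exists>y. (\<forall>B. y B \<in> neg_laurent) \<and> (\<forall>B. B \<notin> X \<longrightarrow> y B = 0) \<and> (\<forall>B\<in>M. x B = y B - J y B)"
  using X x anti
proof (induction "card X" arbitrary: X x)
  case 0
  have "finite X" using 0(2) finite_M finite_subset by (auto simp: down_closed_def)
  then have "X = {}" using 0(1) by simp
  then show ?case using 0(3) by (intro exI[of _ "\<lambda>_. 0"]) (simp add: J)
next
  case (Suc l)
  have XM: "X \<subseteq> M" and "X \<noteq> {}" using Suc by (auto simp: down_closed_def)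
  have fin: "finite X" using XM finite_M finite_subset by blast
  obtain C where C: "C \<in> X" "\<And>D. D \<in> X \<Longrightarrow> le C D \<Longrightarrow> D = C" using exists_maximal[OF XM \<open>X \<noteq> {}\<close>] by blast
  have CM: "C \<in> M" using C XM by blast
  have "J x C = laurent_bar (x C)"
    unfolding J by (rule unitriangular_row[OF R CM]) (use Suc(4) C in auto)
  then have "laurent_bar (x C) = - x C" using Suc(5)[OF CM] by simp
  then obtain b where b: "b \<in> neg_laurent" "x C = b - laurent_bar b" using antisymmetric_laurent by blast
  define \<delta> where "\<delta> = (\<lambda>D. if D = C then b else 0)"
  define x' where "x' = (\<lambda>B. x B - \<delta> B + J \<delta> B)"
  have J\<delta>: "J \<delta> B = R B C * laurent_bar b" for B unfolding \<delta>_def by (rule J_delta[OF CM])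
  have 0: "x' B = 0" if B: "B \<in> M - (X - {C})" for B
  proof (cases "B = C")
    case True
    then show ?thesis using R CM b by (simp add: x'_def \<delta>_def[symmetric] J\<delta> unitriangular_def) (simp add: \<delta>_def)
  next
    case False
    then have "B \<notin> X" "\<not> le B C" using B C(1) Suc(3) by (auto simp: down_closed_def)
    then have "R B C = 0" using R B CM False unfolding unitriangular_def by blast
    then show ?thesis using Suc(4)[of B] B \<open>B \<notin> X\<close> False by (simp add: x'_def J\<delta>) (simp add: \<delta>_def)
  qed
  have anti': "J x' B = - x' B" if "B \<in> M" for B
    using Suc(5)[OF that] J_J[OF that, of \<delta>] J_add[of "\<lambda>B. x B - \<delta> B" "J \<delta>" B] J_diff[of x \<delta> B] by (simp add: x'_def)
  have l: "l = card (X - {C})" using Suc(2) C(1) fin by simp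
  have "\<exists>y. (\<forall>B. y B \<in> neg_laurent) \<and> (\<forall>B. B \<notin> X - {C} \<longrightarrow> y B = 0) \<and> (\<forall>B\<in>M. x' B = y B - J y B)"
    by (rule Suc(1)[OF l down_closed_remove[OF Suc(3) C] 0 anti'])
  then obtain y where y: "\<And>B. y B \<in> neg_laurent" "\<And>B. B \<notin> X - {C} \<Longrightarrow> y B = 0" "\<And>B. B \<in> M \<Longrightarrow> x' B = y B - J y B"
    by blast
  define y' where "y' = (\<lambda>B. y B + \<delta> B)"
  have "y' B \<in> neg_laurent" for B
    using y(1)[of B] y(2)[of C] b(1) by (auto simp: y'_def \<delta>_def)
  moreover have "y' B = 0" if "B \<notin> X" for B using that y(2)[of B] C(1) by (auto simp: y'_def \<delta>_def)
  moreover have "x B = y' B - J y' B" if "B \<in> M" for B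
    using y(3)[OF that] J_add[of y \<delta> B] by (simp add: y'_def x'_def algebra_simps)
  ultimately show ?case by blast
qed

text \<open>At a maximal index of the support, x would have a bar invariant value with negative
  exponents only, which is 0.\<close>

lemma J_fixed_neg:
  assumes x: "\<And>B. B \<in> M \<Longrightarrow> x B \<in> neg_laurent" "\<And>B. B \<in> M \<Longrightarrow> J x B = x B" and D: "D \<in> M"
  shows "x D = 0"
proof (rule ccontr)
  let ?X = "{D \<in> M. x D \<noteq> 0}"
  assume "x D \<noteq> 0"
  then have "?X \<noteq> {}" using D by blast
  then obtain C where C: "C \<in> ?X" "\<And>D. D \<in> ?X \<Longrightarrow> le C D \<Longrightarrow> D = C"
    using exists_maximal[of ?X] by blast
  have "J x C = laurent_bar (x C)" unfolding J by (rule unitriangular_row[OF R]) (use C in auto)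
  then show False using x[of C] neg_laurent_bar_eq_0[of "x C"] C(1) by simp
qed

text \<open>With \<delta> the unit vector at D, the vector J \<delta> - \<delta> is antisymmetric
  and supported strictly below D. If it equals y - J y, then \<delta> + y is fixed by J.\<close>

lemma canonical_vector:
  assumes D: "D \<in> M"
  shows "\<exists>y. (\<forall>B. y B \<in> neg_laurent) \<and> (\<forall>B. \<not> (B \<in> M \<and> le B D \<and> B \<noteq> D) \<longrightarrow> y B = 0) \<and>
    (\<forall>B\<in>M. J (\<lambda>C. (if C = D then 1 else 0) + y C) B = (if B = D then 1 else 0) + y B)"
proof -
  let ?X = "{B \<in> M. le B D \<and> B \<noteq> D}"
  define \<delta> where "\<delta> = (\<lambda>C. if C = D then 1 else 0 :: laurent)"
  have X: "down_closed ?X" unfolding down_closed_def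
  proof (intro conjI ballI impI)
    fix C B assume C: "C \<in> ?X" and B: "B \<in> M" "le B C"
    have "le B D" using le_trans[OF B(1) _ D B(2)] C by blast
    \<comment> \<open>Otherwise C and D would lie below each other, against the strict growth of the
      rank.\<close>
    moreover have "B \<noteq> D" using rank_less[of C D] rank_less[of D C] C B D by fastforce
    ultimately show "B \<in> ?X" using B by blast
  qed auto
  define x where "x = (\<lambda>B. J \<delta> B - \<delta> B)"
  have J\<delta>: "J \<delta> B = R B D" for B using J_delta[OF D, of 1] by (simp add: \<delta>_def)
  have "x B = 0" if B: "B \<in> M - ?X" for B
    using R B D by (cases "B = D") (auto simp: x_def J\<delta>, auto simp: \<delta>_def unitriangular_def)
  moreover have "J x B = - x B" if "B \<in> M" for B
    using J_diff[of "J \<delta>" \<delta> B] J_J[OF that, of \<delta>] by (simp add: x_def)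
  ultimately obtain y where y: "\<forall>B. y B \<in> neg_laurent" "\<forall>B. B \<notin> ?X \<longrightarrow> y B = 0" "\<forall>B\<in>M. x B = y B - J y B"
    using J_antisymmetric_solve[OF X, of x] by blast
  have "J (\<lambda>C. \<delta> C + y C) B = \<delta> B + y B" if B: "B \<in> M" for B
  proof -
    have "J \<delta> B - \<delta> B = y B - J y B" using y(3) B unfolding x_def by blast
    then show ?thesis unfolding J_add by (simp add: algebra_simps)
  qed
  then show ?thesis using y(1,2) unfolding \<delta>_def by blast
qed

end

context hecke_algebra
begin

text \<open>Distinct matrices with the same row and column sums have disjoint double cosets, hence
  distinct pivots; so a strict relation of matrices strictly increases the length of the
  pivot.\<close>

lemma bar_matrix_mats: "bar_matrix (mats m n r) (mat_le m n r) (\<lambda>D. len r (pivot m n r D)) (bar_coeff m n) (bar_coords m n)"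
proof -
  interpret ranked_poset "mats m n r" "mat_le m n r" "\<lambda>D. len r (pivot m n r D)"
  proof
    fix B C assume B: "B \<in> mats m n r" "C \<in> mats m n r" "mat_le m n r B C" "B \<noteq> C"
    have "pivot m n r B \<noteq> pivot m n r C"
      using dcoset_disjoint[OF B(1,2) _ _ pivot(1)[OF B(1)]] pivot(1)[OF B(2)] B(3,4) unfolding mat_le_iff by metis
    then show "len r (pivot m n r B) < len r (pivot m n r C)" using bruhat_len B(3) unfolding mat_le_iff by blast
  qed (auto intro: mat_le_trans)
  show ?thesis
  proof
    show "unitriangular (bar_coeff m n)"
      unfolding unitriangular_def using bar_row_spec(2) bar_coeff_outside by blast
  qed (rule bar_coords_def, rule bar_coords_bar_coords)
qed

text \<open>The coordinates of the \<Theta> form a unitriangular matrix, which makes them a basis.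
  Two candidates for the same D differ by a vector with negative coefficients that is fixed by bar,
  hence by 0. \<open>extensional\<close> makes the family unique as a function.\<close>

lemma canonical_basis:
  fixes m n
  defines "S \<equiv> schur_superalgebra m n"
  shows "\<exists>!\<Theta>. \<Theta> \<in> extensional (mats m n r) \<and> is_basis S (mats m n r) \<Theta> \<and>
    (\<forall>D\<in>mats m n r. S_bar m n (\<Theta> D) = \<Theta> D \<and>
      (\<exists>p. (\<forall>C. p C \<in> neg_laurent) \<and> \<Theta> D \<ominus>\<^bsub>S\<^esub> phi m n D =
        (\<Oplus>\<^bsub>S\<^esub>C\<in>{C\<in>mats m n r. mat_le m n r C D \<and> C \<noteq> D}. p C \<odot>\<^bsub>S\<^esub> phi m n C)))"
proof -
  let ?M = "mats m n r" and ?Z = "\<lambda>D. {C\<in>mats m n r. mat_le m n r C D \<and> C \<noteq> D}"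
  define \<delta> :: "nmat \<Rightarrow> nmat \<Rightarrow> laurent" where "\<delta> = (\<lambda>D C. if C = D then 1 else 0)"
  interpret S: abelian_group S unfolding S_def by (rule S_abelian_group)
  interpret bar_matrix ?M "mat_le m n r" "\<lambda>D. len r (pivot m n r D)" "bar_coeff m n" "bar_coords m n"
    by (rule bar_matrix_mats)
  have minus: "x \<ominus>\<^bsub>S\<^esub> phi m n D = comb m n c \<longleftrightarrow> x = comb m n (\<lambda>C. \<delta> D C + c C)"
    if x: "x \<in> endos m n" and D: "D \<in> ?M" for x D c
  proof -
    have cl: "x \<in> carrier S" "phi m n D \<in> carrier S" "comb m n c \<in> carrier S"
      using x phi_closed[OF D] comb_closed by (simp_all add: S_def S_simps(1))
    have "x \<ominus>\<^bsub>S\<^esub> phi m n D = comb m n c \<longleftrightarrow> x = comb m n c \<oplus>\<^bsub>S\<^esub> phi m n D"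
      using S.add.inv_solve_right[OF cl(3,1,2)] unfolding a_minus_def by auto
    also have "comb m n c \<oplus>\<^bsub>S\<^esub> phi m n D = comb m n (\<lambda>C. \<delta> D C + c C)"
      unfolding comb_delta[OF D, symmetric] S_def comb_add by (simp add: \<delta>_def add.commute)
    finally show ?thesis .
  qed
  have sub: "(\<Oplus>\<^bsub>S\<^esub>C\<in>?Z D. p C \<odot>\<^bsub>S\<^esub> phi m n C) = comb m n (\<lambda>C. if C \<in> ?Z D then p C else 0)" for p D
    unfolding S_def by (rule comb_subset) auto
  have "\<forall>D\<in>?M. \<exists>y. (\<forall>B. y B \<in> neg_laurent) \<and> (\<forall>B. B \<notin> ?Z D \<longrightarrow> y B = 0) \<and>
    (\<forall>B\<in>?M. bar_coords m n (\<lambda>C. \<delta> D C + y C) B = \<delta> D B + y B)"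
    using canonical_vector unfolding \<delta>_def by simp
  from bchoice[OF this] obtain y where Y: "\<forall>D\<in>?M. (\<forall>B. y D B \<in> neg_laurent) \<and> (\<forall>B. B \<notin> ?Z D \<longrightarrow> y D B = 0) \<and>
    (\<forall>B\<in>?M. bar_coords m n (\<lambda>C. \<delta> D C + y D C) B = \<delta> D B + y D B)" by (rule exE)
  then have y: "\<And>D B. D \<in> ?M \<Longrightarrow> y D B \<in> neg_laurent" "\<And>D B. D \<in> ?M \<Longrightarrow> B \<notin> ?Z D \<Longrightarrow> y D B = 0"
    "\<And>D B. D \<in> ?M \<Longrightarrow> B \<in> ?M \<Longrightarrow> bar_coords m n (\<lambda>C. \<delta> D C + y D C) B = \<delta> D B + y D B"
    by blast+
  define P where "P = (\<lambda>B D. \<delta> D B + y D B)"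
  define \<Theta> where "\<Theta> = (\<lambda>D\<in>?M. comb m n (\<lambda>B. P B D))"
  have P: "unitriangular P" unfolding unitriangular_def P_def using y(2) by (auto simp: \<delta>_def)
  have \<Theta>: "\<Theta> D = comb m n (\<lambda>C. \<delta> D C + y D C)" if "D \<in> ?M" for D using that by (simp add: \<Theta>_def P_def)
  show ?thesis
  proof (rule ex1I[of _ \<Theta>])
    have basis: "is_basis S ?M \<Theta>"
      unfolding is_basis_def
    proof (intro conjI ballI)
      show "\<Theta> D \<in> carrier S" if "D \<in> ?M" for D using \<Theta>[OF that] comb_closed by (simp add: S_def S_simps(1))
      fix x assume "x \<in> carrier S"
      then obtain a where a: "x = comb m n a" using comb_surj[of x m n] unfolding S_def S_simps(1) by blast
      \<comment> \<open>A combination of the \<Theta> has as coordinates the product of P with the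
        coefficients, so the basis property becomes the unique solvability of a unitriangular
        system.\<close>
      have lin: "(\<Oplus>\<^bsub>S\<^esub>D\<in>?M. c D \<odot>\<^bsub>S\<^esub> \<Theta> D) = comb m n (\<lambda>B. \<Sum>D\<in>?M. P B D * c D)" for c
      proof (rule endos_ext[OF _ comb_closed])
        have cl: "c D \<odot>\<^bsub>S\<^esub> \<Theta> D \<in> endos m n" if "D \<in> ?M" for D
          unfolding S_def S_simps \<Theta>[OF that] by (rule S_smult_closed[OF comb_closed])
        show "(\<Oplus>\<^bsub>S\<^esub>D\<in>?M. c D \<odot>\<^bsub>S\<^esub> \<Theta> D) \<in> endos m n"
          unfolding S_def by (rule finsum_eval(1)) (use cl in \<open>auto simp: S_def\<close>)
        fix f \<nu> assume f: "f \<in> dsum m n"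
        have "(\<Oplus>\<^bsub>S\<^esub>D\<in>?M. c D \<odot>\<^bsub>S\<^esub> \<Theta> D) f \<nu> = (\<Sum>D\<in>?M. (c D \<odot>\<^bsub>S\<^esub> \<Theta> D) f \<nu>)"
          using cl f unfolding S_def by (intro finsum_eval(2)) auto
        also have "\<dots> = (\<Sum>D\<in>?M. \<Sum>B\<in>?M. scl (P B D * c D) (phi m n B f \<nu>))"
        proof (rule sum.cong[OF refl])
          fix D assume D: "D \<in> ?M"
          have "(c D \<odot>\<^bsub>S\<^esub> \<Theta> D) f \<nu> = scl (c D) (comb m n (\<lambda>B. P B D) f \<nu>)"
            using D f by (simp add: S_def S_simps(5) \<Theta>_def)
          then show "(c D \<odot>\<^bsub>S\<^esub> \<Theta> D) f \<nu> = (\<Sum>B\<in>?M. scl (P B D * c D) (phi m n B f \<nu>))"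
            unfolding comb_eval[OF f] by (simp add: scale_sum_right mult.commute)
        qed
        also have "\<dots> = comb m n (\<lambda>B. \<Sum>D\<in>?M. P B D * c D) f \<nu>"
          unfolding comb_eval[OF f] by (subst sum.swap) (simp add: scale_sum_left)
        finally show "(\<Oplus>\<^bsub>S\<^esub>D\<in>?M. c D \<odot>\<^bsub>S\<^esub> \<Theta> D) f \<nu> = comb m n (\<lambda>B. \<Sum>D\<in>?M. P B D * c D) f \<nu>" .
      qed
      have "x = (\<Oplus>\<^bsub>S\<^esub>D\<in>?M. c D \<odot>\<^bsub>S\<^esub> \<Theta> D) \<longleftrightarrow> (\<forall>B\<in>?M. a B = (\<Sum>D\<in>?M. P B D * c D))" for c
        unfolding lin a
      proof
        show "comb m n a = comb m n (\<lambda>B. \<Sum>D\<in>?M. P B D * c D) \<Longrightarrow> \<forall>B\<in>?M. a B = (\<Sum>D\<in>?M. P B D * c D)"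
          using comb_inj[of m n a "\<lambda>B. \<Sum>D\<in>?M. P B D * c D"] by simp
        show "\<forall>B\<in>?M. a B = (\<Sum>D\<in>?M. P B D * c D) \<Longrightarrow> comb m n a = comb m n (\<lambda>B. \<Sum>D\<in>?M. P B D * c D)"
          by (rule comb_cong) simp
      qed
      then show "\<exists>!c. (\<forall>D. D \<notin> ?M \<longrightarrow> c D = 0) \<and> x = (\<Oplus>\<^bsub>S\<^esub>D\<in>?M. c D \<odot>\<^bsub>S\<^esub> \<Theta> D)"
        using unitriangular_ex1[OF P, of a] by simp
    qed
    have "S_bar m n (\<Theta> D) = \<Theta> D \<and> (\<exists>p. (\<forall>C. p C \<in> neg_laurent) \<and> \<Theta> D \<ominus>\<^bsub>S\<^esub> phi m n D =
        (\<Oplus>\<^bsub>S\<^esub>C\<in>?Z D. p C \<odot>\<^bsub>S\<^esub> phi m n C))" if D: "D \<in> ?M" for D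
    proof
      show "S_bar m n (\<Theta> D) = \<Theta> D" unfolding \<Theta>[OF D] S_bar_comb by (rule comb_cong[OF y(3)[OF D]])
      have "(\<lambda>C. if C \<in> ?Z D then y D C else 0) = y D" using y(2)[OF D] by auto
      then have "\<Theta> D \<ominus>\<^bsub>S\<^esub> phi m n D = (\<Oplus>\<^bsub>S\<^esub>C\<in>?Z D. y D C \<odot>\<^bsub>S\<^esub> phi m n C)"
        unfolding sub using minus[OF _ D, of "\<Theta> D"] \<Theta>[OF D] comb_closed by simp
      then show "\<exists>p. (\<forall>C. p C \<in> neg_laurent) \<and> \<Theta> D \<ominus>\<^bsub>S\<^esub> phi m n D =
        (\<Oplus>\<^bsub>S\<^esub>C\<in>?Z D. p C \<odot>\<^bsub>S\<^esub> phi m n C)" using y(1)[OF D] by blast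
    qed
    then show "\<Theta> \<in> extensional ?M \<and> is_basis S ?M \<Theta> \<and> (\<forall>D\<in>?M. S_bar m n (\<Theta> D) = \<Theta> D \<and>
      (\<exists>p. (\<forall>C. p C \<in> neg_laurent) \<and> \<Theta> D \<ominus>\<^bsub>S\<^esub> phi m n D = (\<Oplus>\<^bsub>S\<^esub>C\<in>?Z D. p C \<odot>\<^bsub>S\<^esub> phi m n C)))"
      using basis by (simp add: \<Theta>_def)
  next
    fix \<Theta>' assume \<Theta>': "\<Theta>' \<in> extensional ?M \<and> is_basis S ?M \<Theta>' \<and> (\<forall>D\<in>?M. S_bar m n (\<Theta>' D) = \<Theta>' D \<and>
      (\<exists>p. (\<forall>C. p C \<in> neg_laurent) \<and> \<Theta>' D \<ominus>\<^bsub>S\<^esub> phi m n D = (\<Oplus>\<^bsub>S\<^esub>C\<in>?Z D. p C \<odot>\<^bsub>S\<^esub> phi m n C)))"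
    show "\<Theta>' = \<Theta>"
    proof (rule extensionalityI)
      show "\<Theta>' \<in> extensional ?M" "\<Theta> \<in> extensional ?M" using \<Theta>' by (simp_all add: \<Theta>_def)
      fix D assume D: "D \<in> ?M"
      have cl: "\<Theta>' D \<in> endos m n" using \<Theta>' D by (simp add: is_basis_def S_def S_simps(1))
      obtain p where p: "\<And>C. p C \<in> neg_laurent" "\<Theta>' D \<ominus>\<^bsub>S\<^esub> phi m n D = (\<Oplus>\<^bsub>S\<^esub>C\<in>?Z D. p C \<odot>\<^bsub>S\<^esub> phi m n C)"
        using \<Theta>' D by blast
      define q where "q = (\<lambda>C. if C \<in> ?Z D then p C else 0)"
      have \<Theta>'D: "\<Theta>' D = comb m n (\<lambda>C. \<delta> D C + q C)" using p(2) unfolding sub q_def[symmetric] minus[OF cl D] .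
      have "S_bar m n (\<Theta>' D) = \<Theta>' D" using \<Theta>' D by blast
      then have fix1: "bar_coords m n (\<lambda>C. \<delta> D C + q C) B = \<delta> D B + q B" if "B \<in> ?M" for B
        unfolding \<Theta>'D S_bar_comb
        using comb_inj[where c = "bar_coords m n (\<lambda>C. \<delta> D C + q C)" and c' = "\<lambda>C. \<delta> D C + q C", OF _ that] by simp
      have qy: "q B - y D B = 0" if B: "B \<in> ?M" for B
      proof (rule J_fixed_neg[OF _ _ B])
        fix B assume B: "B \<in> ?M"
        show "q B - y D B \<in> neg_laurent" using p(1) y(1)[OF D] by (intro neg_laurent_diff) (auto simp: q_def)
        \<comment> \<open>Both \<delta> + q and \<delta> + y are fixed; additivity passes this on to
          their difference, in which \<delta> cancels.\<close>
        have "bar_coords m n (\<lambda>B. (\<delta> D B + q B) - (\<delta> D B + y D B)) B = (\<delta> D B + q B) - (\<delta> D B + y D B)"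
          unfolding J_diff fix1[OF B] y(3)[OF D B] ..
        then show "bar_coords m n (\<lambda>B. q B - y D B) B = q B - y D B" by simp
      qed
      show "\<Theta>' D = \<Theta> D" unfolding \<Theta>'D \<Theta>[OF D] by (rule comb_cong) (use qy in simp)
    qed
  qed
qed

end

theorem theorem6p3:
  fixes m n r :: nat
    and scl :: "laurent \<Rightarrow> 'h::ring_1 \<Rightarrow> 'h"
    and T :: "perm \<Rightarrow> 'h"
  assumes "m \<noteq> 0 \<or> n \<noteq> 0"
    and "r \<ge> 1"
    and "hecke_algebra scl r T"
  shows "let S = hecke_algebra.schur_superalgebra scl r T m n;
             M = mats m n r;
             \<phi> = hecke_algebra.phi scl r T m n;
             rc = hecke_algebra.bar_coeff scl r T m n
         in \<exists>\<beta>.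
           \<beta> \<in> ring_hom S S \<and>
           (\<forall>z. \<beta> (z \<odot>\<^bsub>S\<^esub> \<one>\<^bsub>S\<^esub>) = laurent_bar z \<odot>\<^bsub>S\<^esub> \<one>\<^bsub>S\<^esub>) \<and>
           (\<forall>z. \<forall>f\<in>carrier S. \<beta> (z \<odot>\<^bsub>S\<^esub> f) = laurent_bar z \<odot>\<^bsub>S\<^esub> \<beta> f) \<and>
           (\<forall>D\<in>M. \<beta> (\<phi> D) = (\<Oplus>\<^bsub>S\<^esub>C\<in>M. rc C D \<odot>\<^bsub>S\<^esub> \<phi> C)) \<and>
           (\<forall>\<beta>'. \<beta>' \<in> carrier S \<rightarrow> carrier S \<and>
                 (\<forall>f\<in>carrier S. \<forall>g\<in>carrier S. \<beta>' (f \<oplus>\<^bsub>S\<^esub> g) = \<beta>' f \<oplus>\<^bsub>S\<^esub> \<beta>' g) \<and>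
                 (\<forall>z. \<forall>f\<in>carrier S. \<beta>' (z \<odot>\<^bsub>S\<^esub> f) = laurent_bar z \<odot>\<^bsub>S\<^esub> \<beta>' f) \<and>
                 (\<forall>D\<in>M. \<beta>' (\<phi> D) = (\<Oplus>\<^bsub>S\<^esub>C\<in>M. rc C D \<odot>\<^bsub>S\<^esub> \<phi> C))
               \<longrightarrow> (\<forall>f\<in>carrier S. \<beta>' f = \<beta> f)) \<and>
           (\<exists>!\<Theta>. \<Theta> \<in> extensional M \<and> is_basis S M \<Theta> \<and>
              (\<forall>D\<in>M. \<beta> (\<Theta> D) = \<Theta> D \<and>
                 (\<exists>p. (\<forall>C. p C \<in> neg_laurent) \<and>
                      \<Theta> D \<ominus>\<^bsub>S\<^esub> \<phi> D =
                        (\<Oplus>\<^bsub>S\<^esub>C\<in>{C\<in>M. mat_le m n r C D \<and> C \<noteq> D}. p C \<odot>\<^bsub>S\<^esub> \<phi> C))))"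
proof -
  interpret hecke_algebra scl r T by (rule assms(3))
  let ?S = "schur_superalgebra m n" and ?M = "mats m n r" and ?\<phi> = "phi m n" and ?rc = "bar_coeff m n"
  let ?\<beta> = "S_bar m n"
  have hom: "?\<beta> \<in> ring_hom ?S ?S" by (rule S_bar_ring_hom)
  have one: "\<forall>z. ?\<beta> (z \<odot>\<^bsub>?S\<^esub> \<one>\<^bsub>?S\<^esub>) = laurent_bar z \<odot>\<^bsub>?S\<^esub> \<one>\<^bsub>?S\<^esub>"
    using S_bar_smult ring_hom_one[OF hom] by simp
  have smult: "\<forall>z. \<forall>f\<in>carrier ?S. ?\<beta> (z \<odot>\<^bsub>?S\<^esub> f) = laurent_bar z \<odot>\<^bsub>?S\<^esub> ?\<beta> f"
    using S_bar_smult by blast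
  have phi: "\<forall>D\<in>?M. ?\<beta> (?\<phi> D) = (\<Oplus>\<^bsub>?S\<^esub>C\<in>?M. ?rc C D \<odot>\<^bsub>?S\<^esub> ?\<phi> C)"
    using S_bar_phi unfolding comb_def by blast
  \<comment> \<open>A competing \<beta>' agrees with the bar involution on the \<open>phi\<close>,
    and semilinearity extends this to all combinations.\<close>
  have uniq: "\<forall>f\<in>carrier ?S. \<beta>' f = ?\<beta> f"
    if \<beta>': "\<beta>' \<in> carrier ?S \<rightarrow> carrier ?S \<and>
       (\<forall>f\<in>carrier ?S. \<forall>g\<in>carrier ?S. \<beta>' (f \<oplus>\<^bsub>?S\<^esub> g) = \<beta>' f \<oplus>\<^bsub>?S\<^esub> \<beta>' g) \<and>
       (\<forall>z. \<forall>f\<in>carrier ?S. \<beta>' (z \<odot>\<^bsub>?S\<^esub> f) = laurent_bar z \<odot>\<^bsub>?S\<^esub> \<beta>' f) \<and>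
       (\<forall>D\<in>?M. \<beta>' (?\<phi> D) = (\<Oplus>\<^bsub>?S\<^esub>C\<in>?M. ?rc C D \<odot>\<^bsub>?S\<^esub> ?\<phi> C))" for \<beta>'
  proof
    fix f assume "f \<in> carrier ?S"
    then obtain c where f: "f = comb m n c" using comb_surj[of f m n] unfolding S_simps(1) by blast
    note cs = S_simps(1)[of m n]
    interpret S: abelian_group ?S by (rule S_abelian_group)
    have eq: "\<beta>' (?\<phi> D) = ?\<beta> (?\<phi> D)" if "D \<in> ?M" for D
    proof -
      have "\<beta>' (?\<phi> D) = (\<Oplus>\<^bsub>?S\<^esub>C\<in>?M. ?rc C D \<odot>\<^bsub>?S\<^esub> ?\<phi> C)" using \<beta>' that by blast
      also have "\<dots> = ?\<beta> (?\<phi> D)" by (rule bspec[OF phi that, symmetric])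
      finally show ?thesis .
    qed
    have b: "?\<beta> (?\<phi> D) \<in> endos m n" if "D \<in> ?M" for D by (rule S_bar_closed[OF phi_closed[OF that]])
    have "\<beta>' f = (\<Oplus>\<^bsub>?S\<^esub>D\<in>?M. laurent_bar (c D) \<odot>\<^bsub>?S\<^esub> \<beta>' (?\<phi> D))"
      unfolding f by (rule semilinear_comb) (use \<beta>' in \<open>unfold cs, blast+\<close>)
    also have "\<dots> = (\<Oplus>\<^bsub>?S\<^esub>D\<in>?M. laurent_bar (c D) \<odot>\<^bsub>?S\<^esub> ?\<beta> (?\<phi> D))"
      by (rule S.finsum_cong') (use eq S_smult_closed[OF b] in \<open>auto simp: S_simps\<close>)
    also have "\<dots> = ?\<beta> f"
      unfolding f
    proof (rule semilinear_comb[symmetric])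
      show "?\<beta> \<in> endos m n \<rightarrow> endos m n" using S_bar_closed by blast
      show "?\<beta> (f \<oplus>\<^bsub>?S\<^esub> g) = ?\<beta> f \<oplus>\<^bsub>?S\<^esub> ?\<beta> g" if "f \<in> endos m n" "g \<in> endos m n" for f g
        using ring_hom_add[OF hom] that unfolding cs by blast
    qed (rule S_bar_smult)
    finally show "\<beta>' f = ?\<beta> f" .
  qed
  show ?thesis unfolding Let_def
    by (rule exI[of _ ?\<beta>])
       (rule conjI[OF hom conjI[OF one conjI[OF smult conjI[OF phi conjI[OF allI[OF impI[OF uniq]] canonical_basis]]]]])
qed

end
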